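(* Let $E$ be a countable, measure-preserving, ergodic equivalence relation on the standard probability space $(X,\mu)$. (1) If the cost of $E$ is less than $n$ for some $n\in\mathbb{N}$, then $t([E])\leq 2n$. (2) If $E$ is induced by a free action of the free group $\mathbb{F}_n$, then $n+1\leq t([E])\leq 2(n+1)$.
   Context: $X$ is a standard Borel space and $\mu$ is a non-atomic Borel probability measure on $X$. $\operatorname{Aut}(X,\mu)$ is the group of all measure-preserving automorphisms of $(X,\mu)$, modulo null sets, equipped with the uniform topology, i.e. the topology induced by the metric $d(f,g)=\mu(\{x\in X\mid f(x)\neq g(x)\})$. $E$ is a Borel equivalence relation on $X$. It is countable if every equivalence class is countable; measure-preserving if every Borel automorphism of $X$ whose graph is contained in $E$ preserves $\mu$; ergodic if every $E$-invariant Borel set has measure $0$ or $1$. The measurable full group of $E$ is $[E]=\{f\in\operatorname{Aut}(X,\mu)\mid (x,f(x))\in E\text{ for almost every }x\in X\}$, a closed subgroup of $\operatorname{Aut}(X,\mu)$ in the uniform topology. $t([E])$ denotes the minimum number of topological generators of $[E]$, i.e. the minimum number of elements which generate a dense subgroup of $[E]$. Cost: the cost of $E$ is the infimum of $\sum_i\mu(A_i)$ over all countable families $(\theta_i:A_i\to B_i)_i$ of Borel isomorphisms between Borel subsets $A_i,B_i\subset X$ with $(x,\theta_i(x))\in E$ for all $x\in A_i$, such that (up to a null set) $E$ is the smallest equivalence relation containing the graphs of all the $\theta_i$. In (2), $\mathbb{F}_n$ is the free group on $n\geq1$ generators; the action is a measure-preserving Borel action on $(X,\mu)$, free means that almost every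 point has trivial stabilizer, and $E$ is induced by the action if $E$ is its orbit equivalence relation. *)

theory Defs
  imports
    "HOL-Analysis.Analysis"
    "HOL-Probability.Probability_Measure"
    "HOL-Algebra.Group_Action"
    "HOL-Algebra.Generated_Groups"
begin

section \<open>Standard Borel spaces and Borel isomorphisms\<close>

definition standard_borel :: "'a measure \<Rightarrow> bool" where
  "standard_borel M \<longleftrightarrow>
     (\<exists>T. completely_metrizable_space T \<and> second_countable T \<and> topspace T = space M \<and>
          sets M = sigma_sets (space M) {U. openin T U})"

definition non_atomic :: "'a measure \<Rightarrow> bool" where
  "non_atomic M \<longleftrightarrow>
     (\<forall>A\<in>sets M. 0 < emeasure M A \<longrightarrow>
        (\<exists>B\<in>sets M. B \<subseteq> A \<and> 0 < emeasure M B \<and> emeasure M B < emeasure M A))"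

definition borel_iso :: "'a measure \<Rightarrow> 'b measure \<Rightarrow> ('a \<Rightarrow> 'b) \<Rightarrow> bool" where
  "borel_iso M N f \<longleftrightarrow>
     f \<in> measurable M N \<and> bij_betw f (space M) (space N) \<and>
     inv_into (space M) f \<in> measurable N M"

section \<open>The group of measure-preserving automorphisms and its uniform topology\<close>

definition mp_aut :: "'a measure \<Rightarrow> ('a \<Rightarrow> 'a) monoid" where
  "mp_aut M = (BijGroup (space M))
     \<lparr>carrier := {f \<in> Bij (space M). borel_iso M M f \<and> distr M M f = M}\<rparr>"

definition null_aut :: "'a measure \<Rightarrow> ('a \<Rightarrow> 'a) set" where
  "null_aut M = {f \<in> carrier (mp_aut M). AE x in M. f x = x}"

text \<open>\<open>Aut(X, \<mu>)\<close>: its elements are the cosets of \<^const>\<open>null_aut\<close>, that is, the classes of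
  almost everywhere equal automorphisms (lemma \<open>mem_Aut_class_iff\<close> below).\<close>

definition Aut :: "'a measure \<Rightarrow> ('a \<Rightarrow> 'a) set monoid" where
  "Aut M = mp_aut M Mod null_aut M"

text \<open>The value does not depend on the representatives chosen (lemma \<open>Aut_dist_eq\<close> below).\<close>

definition Aut_dist :: "'a measure \<Rightarrow> ('a \<Rightarrow> 'a) set \<Rightarrow> ('a \<Rightarrow> 'a) set \<Rightarrow> real" where
  "Aut_dist M a b = measure M {x \<in> space M. (SOME f. f \<in> a) x \<noteq> (SOME g. g \<in> b) x}"

definition uniform_topology :: "'a measure \<Rightarrow> ('a \<Rightarrow> 'a) set topology" where
  "uniform_topology M = Metric_space.mtopology (carrier (Aut M)) (Aut_dist M)"

section \<open>Equivalence relations, full groups and cost\<close>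

definition borel_equiv :: "'a measure \<Rightarrow> ('a \<times> 'a) set \<Rightarrow> bool" where
  "borel_equiv M E \<longleftrightarrow> equiv (space M) E \<and> E \<in> sets (M \<Otimes>\<^sub>M M)"

definition countable_rel :: "'a measure \<Rightarrow> ('a \<times> 'a) set \<Rightarrow> bool" where
  "countable_rel M E \<longleftrightarrow> (\<forall>x\<in>space M. countable (E `` {x}))"

definition measure_preserving_rel :: "'a measure \<Rightarrow> ('a \<times> 'a) set \<Rightarrow> bool" where
  "measure_preserving_rel M E \<longleftrightarrow>
     (\<forall>f. borel_iso M M f \<and> (\<forall>x\<in>space M. (x, f x) \<in> E) \<longrightarrow> distr M M f = M)"

definition ergodic_rel :: "'a measure \<Rightarrow> ('a \<times> 'a) set \<Rightarrow> bool" where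
  "ergodic_rel M E \<longleftrightarrow>
     (\<forall>A\<in>sets M. E `` A \<subseteq> A \<longrightarrow> emeasure M A = 0 \<or> emeasure M A = 1)"

definition full_group :: "'a measure \<Rightarrow> ('a \<times> 'a) set \<Rightarrow> ('a \<Rightarrow> 'a) set set" where
  "full_group M E = {a \<in> carrier (Aut M). \<exists>f\<in>a. AE x in M. (x, f x) \<in> E}"

text \<open>The minimum number of topological generators of a group \<open>G\<close> with topology \<open>T\<close>; it is
  \<open>\<infinity>\<close> if no finite set generates a dense subgroup.\<close>

definition top_gen_number :: "('g, 'b) monoid_scheme \<Rightarrow> 'g topology \<Rightarrow> enat" where
  "top_gen_number G T =
     Inf {enat (card S) | S. finite S \<and> S \<subseteq> carrier G \<and> T closure_of (generate G S) = topspace T}"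

definition t_full_group :: "'a measure \<Rightarrow> ('a \<times> 'a) set \<Rightarrow> enat" where
  "t_full_group M E =
     top_gen_number ((Aut M)\<lparr>carrier := full_group M E\<rparr>)
       (subtopology (uniform_topology M) (full_group M E))"

definition smallest_equiv :: "'a set \<Rightarrow> ('a \<times> 'a) set \<Rightarrow> ('a \<times> 'a) set" where
  "smallest_equiv X G = \<Inter>{R. equiv X R \<and> G \<subseteq> R}"

text \<open>Countable families of partial isomorphisms are indexed by all of \<open>\<nat>\<close>; finite ones are
  padded with the isomorphism between empty sets.  Generating \<open>E\<close> up to a null set means that
  almost every point has the same class for \<open>E\<close> and for the relation generated by the family.\<close>

definition generating_family ::
    "'a measure \<Rightarrow> ('a \<times> 'a) set \<Rightarrow> (nat \<Rightarrow> 'a set) \<Rightarrow> (nat \<Rightarrow> 'a \<Rightarrow> 'a) \<Rightarrow> bool" where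
  "generating_family M E A \<theta> \<longleftrightarrow>
     (\<forall>i. A i \<in> sets M \<and> \<theta> i ` A i \<in> sets M \<and>
          borel_iso (restrict_space M (A i)) (restrict_space M (\<theta> i ` A i)) (\<theta> i) \<and>
          (\<forall>x\<in>A i. (x, \<theta> i x) \<in> E)) \<and>
     (AE x in M. E `` {x} = smallest_equiv (space M) (\<Union>i. {(y, \<theta> i y) | y. y \<in> A i}) `` {x})"

definition cost :: "'a measure \<Rightarrow> ('a \<times> 'a) set \<Rightarrow> ennreal" where
  "cost M E = Inf {\<Sum>i. emeasure M (A i) | A \<theta>. generating_family M E A \<theta>}"

section \<open>Free groups and their actions\<close>

text \<open>The letter \<open>(i, True)\<close> stands for the \<open>i\<close>-th generator and \<open>(i, False)\<close> for its
  inverse.\<close>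

type_synonym letter = "nat \<times> bool"

definition inv_letter :: "letter \<Rightarrow> letter" where
  "inv_letter a = (fst a, \<not> snd a)"

definition reduced_word :: "letter list \<Rightarrow> bool" where
  "reduced_word w \<longleftrightarrow> successively (\<lambda>a b. b \<noteq> inv_letter a) w"

definition cancel_cons :: "letter \<Rightarrow> letter list \<Rightarrow> letter list" where
  "cancel_cons a w = (if w \<noteq> [] \<and> hd w = inv_letter a then tl w else a # w)"

definition free_group :: "nat \<Rightarrow> letter list monoid" where
  "free_group n =
     \<lparr>carrier = {w. reduced_word w \<and> fst ` set w \<subseteq> {..<n}},
      mult = foldr cancel_cons,
      one = []\<rparr>"

definition mp_action :: "('g, 'b) monoid_scheme \<Rightarrow> 'a measure \<Rightarrow> ('g \<Rightarrow> 'a \<Rightarrow> 'a) \<Rightarrow> bool" where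
  "mp_action G M \<phi> \<longleftrightarrow>
     group_action G (space M) \<phi> \<and>
     (\<forall>g\<in>carrier G. \<phi> g \<in> measurable M M \<and> distr M M (\<phi> g) = M)"

definition free_action :: "('g, 'b) monoid_scheme \<Rightarrow> 'a measure \<Rightarrow> ('g \<Rightarrow> 'a \<Rightarrow> 'a) \<Rightarrow> bool" where
  "free_action G M \<phi> \<longleftrightarrow> (AE x in M. stabilizer G \<phi> x = {\<one>\<^bsub>G\<^esub>})"

definition orbit_relation :: "('g, 'b) monoid_scheme \<Rightarrow> 'a measure \<Rightarrow> ('g \<Rightarrow> 'a \<Rightarrow> 'a) \<Rightarrow> ('a \<times> 'a) set" where
  "orbit_relation G M \<phi> = {(x, y). x \<in> space M \<and> y \<in> orbit G \<phi> x}"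

section \<open>Well-definedness\<close>

lemma inv_letter_inv [simp]: "inv_letter (inv_letter a) = a"
  by (simp add: inv_letter_def)

lemma fst_inv_letter [simp]: "fst (inv_letter a) = fst a"
  by (simp add: inv_letter_def)

lemma inv_letter_neq: "inv_letter a \<noteq> a" "a \<noteq> inv_letter a"
  by (auto simp: inv_letter_def prod_eq_iff)

lemma reduced_Nil [simp]: "reduced_word []"
  by (simp add: reduced_word_def)

lemma reduced_Cons:
  "reduced_word (a # w) \<longleftrightarrow> reduced_word w \<and> (w \<noteq> [] \<longrightarrow> hd w \<noteq> inv_letter a)"
  by (cases w) (auto simp: reduced_word_def)

lemma reduced_cancel_cons: "reduced_word w \<Longrightarrow> reduced_word (cancel_cons a w)"
  by (cases w) (auto simp: cancel_cons_def reduced_Cons)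

lemma reduced_foldr: "reduced_word w \<Longrightarrow> reduced_word (foldr cancel_cons u w)"
  by (induction u) (auto simp: reduced_cancel_cons)

lemma cancel_cons_inv:
  "reduced_word w \<Longrightarrow> cancel_cons a (cancel_cons (inv_letter a) w) = w"
  by (cases w) (auto simp: cancel_cons_def reduced_Cons)

lemma foldr_cancel_cons:
  assumes "reduced_word w"
  shows "foldr cancel_cons (cancel_cons a u) w = cancel_cons a (foldr cancel_cons u w)"
proof (cases "u \<noteq> [] \<and> hd u = inv_letter a")
  case True
  then obtain v where "u = inv_letter a # v" by (cases u) auto
  then show ?thesis
    using assms by (simp add: cancel_cons_def[of a "_ # _"] cancel_cons_inv reduced_foldr)
qed (auto simp: cancel_cons_def)

lemma foldr_cancel_assoc:
  "reduced_word w \<Longrightarrow>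
   foldr cancel_cons (foldr cancel_cons u v) w = foldr cancel_cons u (foldr cancel_cons v w)"
  by (induction u) (auto simp: foldr_cancel_cons)

lemma foldr_cancel_Nil: "reduced_word u \<Longrightarrow> foldr cancel_cons u [] = u"
  by (induction u) (auto simp: reduced_Cons cancel_cons_def)

lemma set_cancel_cons: "set (cancel_cons a w) \<subseteq> insert a (set w)"
  by (cases w) (auto simp: cancel_cons_def)

lemma set_foldr_cancel: "set (foldr cancel_cons u w) \<subseteq> set u \<union> set w"
proof (induction u)
  case (Cons a u)
  then show ?case using set_cancel_cons[of a "foldr cancel_cons u w"] by auto
qed simp

lemma foldr_cancel_inverse:
  "foldr cancel_cons (rev (map inv_letter u)) u = []"
  by (induction u) (auto simp: cancel_cons_def)

lemma reduced_inverse: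
  assumes "reduced_word u"
  shows "reduced_word (rev (map inv_letter u))"
proof -
  have "reduced_word (rev (map inv_letter u)) \<longleftrightarrow>
      successively (\<lambda>a b. inv_letter a \<noteq> inv_letter (inv_letter b)) u"
    by (simp only: reduced_word_def successively_rev successively_map)
  also have "(\<lambda>a b. inv_letter a \<noteq> inv_letter (inv_letter b)) = (\<lambda>a b. b \<noteq> inv_letter a)"
    by (intro ext) auto
  finally show ?thesis using assms by (simp only: reduced_word_def)
qed

lemma group_free_group: "group (free_group n)"
proof (rule groupI)
  fix u v w
  assume u: "u \<in> carrier (free_group n)" and v: "v \<in> carrier (free_group n)"
    and w: "w \<in> carrier (free_group n)"
  show "u \<otimes>\<^bsub>free_group n\<^esub> v \<in> carrier (free_group n)"
  proof -
    have "fst ` set (foldr cancel_cons u v) \<subseteq> fst ` set u \<union> fst ` set v"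
      using image_mono[OF set_foldr_cancel[of u v], of fst] by (simp only: image_Un)
    then show ?thesis using u v by (simp add: free_group_def reduced_foldr) blast
  qed
  show "u \<otimes>\<^bsub>free_group n\<^esub> v \<otimes>\<^bsub>free_group n\<^esub> w = u \<otimes>\<^bsub>free_group n\<^esub> (v \<otimes>\<^bsub>free_group n\<^esub> w)"
    using w by (simp add: free_group_def foldr_cancel_assoc)
next
  fix u assume u: "u \<in> carrier (free_group n)"
  have "rev (map inv_letter u) \<in> carrier (free_group n)"
    using u by (auto simp: free_group_def reduced_inverse)
  moreover have "rev (map inv_letter u) \<otimes>\<^bsub>free_group n\<^esub> u = \<one>\<^bsub>free_group n\<^esub>"
    using foldr_cancel_inverse by (simp add: free_group_def)
  ultimately show "\<exists>v\<in>carrier (free_group n). v \<otimes>\<^bsub>free_group n\<^esub> u = \<one>\<^bsub>free_group n\<^esub>"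
    by blast
qed (auto simp: free_group_def)

lemma carrier_mp_aut:
  "carrier (mp_aut M) = {f \<in> Bij (space M). borel_iso M M f \<and> distr M M f = M}"
  by (simp add: mp_aut_def)

lemma mp_autD:
  assumes "f \<in> carrier (mp_aut M)"
  shows "f \<in> Bij (space M)" "f \<in> measurable M M" "bij_betw f (space M) (space M)"
    "inv_into (space M) f \<in> measurable M M" "distr M M f = M" "f \<in> extensional (space M)"
  using assms by (auto simp: carrier_mp_aut borel_iso_def Bij_def)

lemma mult_mp_aut:
  assumes "f \<in> carrier (mp_aut M)" "g \<in> carrier (mp_aut M)"
  shows "f \<otimes>\<^bsub>mp_aut M\<^esub> g = compose (space M) f g"
  using assms by (simp add: mp_aut_def BijGroup_def)

lemma subgroup_mp_aut: "subgroup (carrier (mp_aut M)) (BijGroup (space M))"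
proof -
  interpret B: group "BijGroup (space M)" by (rule group_BijGroup)
  show ?thesis
  proof (rule B.subgroupI)
    show "carrier (mp_aut M) \<subseteq> carrier (BijGroup (space M))"
      by (auto simp: carrier_mp_aut BijGroup_def)
    have "borel_iso M M (\<lambda>x\<in>space M. x)"
    proof -
      have 1: "(\<lambda>x\<in>space M. x) \<in> measurable M M"
        by (rule measurable_cong[THEN iffD1, OF _ measurable_ident]) auto
      have "inv_into (space M) (\<lambda>x\<in>space M. x) x = x" if "x \<in> space M" for x
        by (rule inv_into_f_eq) (auto simp: that inj_on_def)
      then have 2: "inv_into (space M) (\<lambda>x\<in>space M. x) \<in> measurable M M"
        by (intro measurable_cong[THEN iffD1, OF _ measurable_ident]) auto
      show ?thesis
        using 1 2 id_Bij[of "space M"] by (auto simp: borel_iso_def Bij_def)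
    qed
    moreover have "distr M M (\<lambda>x\<in>space M. x) = M"
      by (rule trans[OF distr_cong distr_id]) auto
    ultimately have "(\<lambda>x\<in>space M. x) \<in> carrier (mp_aut M)"
      using id_Bij[of "space M"] by (simp add: carrier_mp_aut)
    then show "carrier (mp_aut M) \<noteq> {}" by blast
  next
    fix f assume f: "f \<in> carrier (mp_aut M)"
    let ?g = "\<lambda>x\<in>space M. inv_into (space M) f x"
    note fD = mp_autD[OF f]
    have gB: "?g \<in> Bij (space M)" by (rule restrict_inv_into_Bij[OF fD(1)])
    have gm: "?g \<in> measurable M M"
      by (rule measurable_cong[THEN iffD1, OF _ fD(4)]) auto
    have gf: "?g (f x) = x" if "x \<in> space M" for x
      using that fD(3) by (auto simp: bij_betw_def)
    have "inv_into (space M) ?g x = f x" if "x \<in> space M" for x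
      using that gB fD(3) gf[OF that]
      by (intro inv_into_f_eq) (auto simp: Bij_def bij_betw_def)
    then have igm: "inv_into (space M) ?g \<in> measurable M M"
      by (intro measurable_cong[THEN iffD1, OF _ fD(2)]) auto
    have "distr M M ?g = distr (distr M M f) M ?g" by (simp add: fD(5))
    also have "\<dots> = distr M M (?g \<circ> f)" by (rule distr_distr[OF gm fD(2)])
    also have "\<dots> = distr M M (\<lambda>x. x)"
    proof (rule distr_cong)
      fix x assume "x \<in> space M"
      then show "(?g \<circ> f) x = x" using gf by simp
    qed simp_all
    finally have "distr M M ?g = M" by (simp add: distr_id)
    then have g: "?g \<in> carrier (mp_aut M)"
      using gB gm igm by (auto simp: carrier_mp_aut borel_iso_def Bij_def)
    have "inv\<^bsub>BijGroup (space M)\<^esub> f = ?g"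
    proof (rule B.inv_equality)
      show "?g \<otimes>\<^bsub>BijGroup (space M)\<^esub> f = \<one>\<^bsub>BijGroup (space M)\<^esub>"
        using fD(1) gB Bij_compose_restrict_eq[OF fD(1)] by (simp add: BijGroup_def)
    qed (use fD(1) gB in \<open>simp_all add: BijGroup_def\<close>)
    then show "inv\<^bsub>BijGroup (space M)\<^esub> f \<in> carrier (mp_aut M)" using g by simp
  next
    fix f g assume f: "f \<in> carrier (mp_aut M)" and g: "g \<in> carrier (mp_aut M)"
    note fD = mp_autD[OF f] and gD = mp_autD[OF g]
    let ?h = "compose (space M) f g"
    have hB: "?h \<in> Bij (space M)" by (rule compose_Bij[OF fD(1) gD(1)])
    have gs: "g x \<in> space M" if "x \<in> space M" for x
      using that gD(3) by (auto simp: bij_betw_def)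
    have hm: "?h \<in> measurable M M"
      by (rule measurable_cong[THEN iffD1, OF _ measurable_comp[OF gD(2) fD(2)]])
         (auto simp: compose_def)
    have "inv_into (space M) ?h x = (inv_into (space M) g \<circ> inv_into (space M) f) x"
      if x: "x \<in> space M" for x
    proof (rule inv_into_f_eq)
      show "inj_on ?h (space M)" using hB by (auto simp: Bij_def bij_betw_def)
      have 1: "inv_into (space M) f x \<in> space M" "f (inv_into (space M) f x) = x"
        using x fD(3) by (auto simp: bij_betw_def f_inv_into_f inv_into_into)
      then have 2: "inv_into (space M) g (inv_into (space M) f x) \<in> space M"
        "g (inv_into (space M) g (inv_into (space M) f x)) = inv_into (space M) f x"
        using gD(3) by (metis bij_betw_def inv_into_into, metis bij_betw_def f_inv_into_f)
      show "(inv_into (space M) g \<circ> inv_into (space M) f) x \<in> space M" using 2 by simp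
      show "?h ((inv_into (space M) g \<circ> inv_into (space M) f) x) = x"
        using 1 2 by (simp add: compose_def)
    qed
    then have ihm: "inv_into (space M) ?h \<in> measurable M M"
      by (intro measurable_cong[THEN iffD1, OF _ measurable_comp[OF fD(4) gD(4)]]) simp
    have "distr M M ?h = distr M M (f \<circ> g)"
      by (rule distr_cong) (auto simp: compose_def)
    also have "\<dots> = distr (distr M M g) M f" by (rule distr_distr[OF fD(2) gD(2), symmetric])
    finally have "distr M M ?h = M" by (simp add: fD(5) gD(5))
    then have "?h \<in> carrier (mp_aut M)"
      using hB hm ihm by (auto simp: carrier_mp_aut borel_iso_def Bij_def)
    then show "f \<otimes>\<^bsub>BijGroup (space M)\<^esub> g \<in> carrier (mp_aut M)"
      using fD(1) gD(1) by (simp add: BijGroup_def)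
  qed
qed

lemma group_mp_aut: "group (mp_aut M)"
proof -
  have "mp_aut M = (BijGroup (space M))\<lparr>carrier := carrier (mp_aut M)\<rparr>"
    by (simp add: mp_aut_def)
  then show ?thesis
    using subgroup.subgroup_is_group[OF subgroup_mp_aut group_BijGroup] by metis
qed

lemma one_mp_aut: "\<one>\<^bsub>mp_aut M\<^esub> = (\<lambda>x\<in>space M. x)"
  by (simp add: mp_aut_def BijGroup_def)

lemma AE_mp_aut:
  assumes "f \<in> carrier (mp_aut M)" "AE x in M. P x"
  shows "AE x in M. P (f x)"
proof -
  have "AE x in distr M M f. P x" by (subst mp_autD(5)[OF assms(1)]) (rule assms(2))
  then show ?thesis using AE_distrD[OF mp_autD(2)[OF assms(1)]] by blast
qed

lemma mp_aut_space: "f \<in> carrier (mp_aut M) \<Longrightarrow> x \<in> space M \<Longrightarrow> f x \<in> space M"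
  using mp_autD(3) by (metis bij_betw_apply)

lemma mult_mp_aut_apply:
  assumes "f \<in> carrier (mp_aut M)" "g \<in> carrier (mp_aut M)" "x \<in> space M"
  shows "(f \<otimes>\<^bsub>mp_aut M\<^esub> g) x = f (g x)"
  using assms by (simp add: mult_mp_aut compose_def)

lemma inv_mp_aut_apply:
  assumes "f \<in> carrier (mp_aut M)" "x \<in> space M"
  shows "(inv\<^bsub>mp_aut M\<^esub> f) (f x) = x" "f ((inv\<^bsub>mp_aut M\<^esub> f) x) = x"
proof -
  interpret group "mp_aut M" by (rule group_mp_aut)
  have *: "(inv\<^bsub>mp_aut M\<^esub> f \<otimes>\<^bsub>mp_aut M\<^esub> f) x = x"
    "(f \<otimes>\<^bsub>mp_aut M\<^esub> inv\<^bsub>mp_aut M\<^esub> f) x = x"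
    using assms by (simp_all add: one_mp_aut)
  from *[unfolded
      mult_mp_aut_apply[OF inv_closed[OF assms(1)] assms(1) assms(2)]
      mult_mp_aut_apply[OF assms(1) inv_closed[OF assms(1)] assms(2)]]
  show "(inv\<^bsub>mp_aut M\<^esub> f) (f x) = x" "f ((inv\<^bsub>mp_aut M\<^esub> f) x) = x"
    by simp_all
qed

lemma normal_null_aut: "null_aut M \<lhd> mp_aut M"
proof -
  interpret group "mp_aut M" by (rule group_mp_aut)
  have sub: "subgroup (null_aut M) (mp_aut M)"
  proof (rule subgroupI)
    have "\<one>\<^bsub>mp_aut M\<^esub> \<in> null_aut M" by (auto simp: null_aut_def one_mp_aut[symmetric] intro!: AE_I2)
       (simp add: one_mp_aut)
    then show "null_aut M \<noteq> {}" by blast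
  next
    fix f assume f: "f \<in> null_aut M"
    then have fc: "f \<in> carrier (mp_aut M)" and ae: "AE x in M. f x = x"
      by (auto simp: null_aut_def)
    have "AE x in M. (inv\<^bsub>mp_aut M\<^esub> f) x = x"
      using ae AE_space by eventually_elim (metis inv_mp_aut_apply(1) fc)
    then show "(inv\<^bsub>mp_aut M\<^esub> f) \<in> null_aut M" using fc by (auto simp: null_aut_def)
  next
    fix f g assume "f \<in> null_aut M" "g \<in> null_aut M"
    then have fc: "f \<in> carrier (mp_aut M)" "g \<in> carrier (mp_aut M)"
      and ae: "AE x in M. f x = x" "AE x in M. g x = x"
      by (auto simp: null_aut_def)
    have "AE x in M. (f \<otimes>\<^bsub>mp_aut M\<^esub> g) x = x"
      using ae AE_space by eventually_elim (simp add: mult_mp_aut_apply fc)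
    then show "f \<otimes>\<^bsub>mp_aut M\<^esub> g \<in> null_aut M" using fc by (auto simp: null_aut_def)
  qed (auto simp: null_aut_def)
  show ?thesis
  proof (subst normal_inv_iff, intro conjI ballI sub)
    fix f n assume f: "f \<in> carrier (mp_aut M)" and n: "n \<in> null_aut M"
    then have nc: "n \<in> carrier (mp_aut M)" and ae: "AE x in M. n x = x"
      by (auto simp: null_aut_def)
    have "AE x in M. n ((inv\<^bsub>mp_aut M\<^esub> f) x) = (inv\<^bsub>mp_aut M\<^esub> f) x"
      using AE_mp_aut[OF _ ae] f by auto
    then have "AE x in M. (f \<otimes>\<^bsub>mp_aut M\<^esub> n \<otimes>\<^bsub>mp_aut M\<^esub> (inv\<^bsub>mp_aut M\<^esub> f)) x = x"
      using AE_space
    proof eventually_elim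
      case (elim x)
      then show ?case
        using f nc by (simp add: mult_mp_aut_apply mp_aut_space inv_mp_aut_apply)
    qed
    then show "f \<otimes>\<^bsub>mp_aut M\<^esub> n \<otimes>\<^bsub>mp_aut M\<^esub> (inv\<^bsub>mp_aut M\<^esub> f) \<in> null_aut M" using f nc by (auto simp: null_aut_def)
  qed
qed

lemma group_Aut: "group (Aut M)"
  unfolding Aut_def by (rule normal.factorgroup_is_group[OF normal_null_aut])

lemma mem_Aut_class_iff:
  assumes f: "f \<in> carrier (mp_aut M)"
  shows "g \<in> null_aut M #>\<^bsub>mp_aut M\<^esub> f \<longleftrightarrow>
         g \<in> carrier (mp_aut M) \<and> (AE x in M. g x = f x)"
proof -
  interpret group "mp_aut M" by (rule group_mp_aut)
  show ?thesis
  proof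
    assume "g \<in> null_aut M #>\<^bsub>mp_aut M\<^esub> f"
    then obtain n where n: "n \<in> null_aut M" "g = n \<otimes>\<^bsub>mp_aut M\<^esub> f" by (auto simp: r_coset_def)
    then have nc: "n \<in> carrier (mp_aut M)" and ae: "AE x in M. n x = x"
      by (auto simp: null_aut_def)
    have "AE x in M. g x = f x"
      using AE_mp_aut[OF f ae] AE_space
      by eventually_elim (simp add: n mult_mp_aut_apply f nc)
    then show "g \<in> carrier (mp_aut M) \<and> (AE x in M. g x = f x)"
      using n nc f by auto
  next
    assume A: "g \<in> carrier (mp_aut M) \<and> (AE x in M. g x = f x)"
    then have "AE x in M. g ((inv\<^bsub>mp_aut M\<^esub> f) x) = f ((inv\<^bsub>mp_aut M\<^esub> f) x)"
      using AE_mp_aut[of "inv\<^bsub>mp_aut M\<^esub> f" M "\<lambda>x. g x = f x"] f by blast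
    then have "AE x in M. (g \<otimes>\<^bsub>mp_aut M\<^esub> (inv\<^bsub>mp_aut M\<^esub> f)) x = x"
      using AE_space
      by eventually_elim (use A f in \<open>simp add: mult_mp_aut_apply inv_mp_aut_apply\<close>)
    then have "g \<otimes>\<^bsub>mp_aut M\<^esub> (inv\<^bsub>mp_aut M\<^esub> f) \<in> null_aut M" using A f by (auto simp: null_aut_def)
    moreover have "g = g \<otimes>\<^bsub>mp_aut M\<^esub> (inv\<^bsub>mp_aut M\<^esub> f) \<otimes>\<^bsub>mp_aut M\<^esub> f" using A f by (simp add: m_assoc)
    ultimately show "g \<in> null_aut M #>\<^bsub>mp_aut M\<^esub> f" by (auto simp: r_coset_def)
  qed
qed

lemma carrier_Aut:
  "carrier (Aut M) = {null_aut M #>\<^bsub>mp_aut M\<^esub> f | f. f \<in> carrier (mp_aut M)}"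
  by (auto simp: Aut_def FactGroup_def RCOSETS_def)

lemma Aut_class_eq:
  assumes "a \<in> carrier (Aut M)" "f \<in> a"
  shows "f \<in> carrier (mp_aut M)"
    "a = {g \<in> carrier (mp_aut M). AE x in M. g x = f x}"
proof -
  obtain h where h: "h \<in> carrier (mp_aut M)" "a = null_aut M #>\<^bsub>mp_aut M\<^esub> h"
    using assms by (auto simp: carrier_Aut)
  have f: "f \<in> carrier (mp_aut M)" "AE x in M. f x = h x"
    using assms(2) mem_Aut_class_iff[OF h(1)] h(2) by auto
  show "f \<in> carrier (mp_aut M)" by (rule f)
  have "(AE x in M. g x = h x) \<longleftrightarrow> (AE x in M. g x = f x)" for g
    using f(2) by auto
  then show "a = {g \<in> carrier (mp_aut M). AE x in M. g x = f x}"
    using mem_Aut_class_iff[OF h(1)] h(2) by auto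
qed

lemma Aut_class_nonempty: "a \<in> carrier (Aut M) \<Longrightarrow> \<exists>f. f \<in> a"
proof -
  assume "a \<in> carrier (Aut M)"
  then obtain f where "f \<in> carrier (mp_aut M)" "a = null_aut M #>\<^bsub>mp_aut M\<^esub> f"
    unfolding carrier_Aut by blast
  then have "f \<in> a" by (simp add: mem_Aut_class_iff)
  then show "\<exists>f. f \<in> a" by blast
qed

lemma full_group_any_representative:
  assumes "a \<in> carrier (Aut M)" "f \<in> a"
  shows "a \<in> full_group M E \<longleftrightarrow> (AE x in M. (x, f x) \<in> E)"
proof
  assume "a \<in> full_group M E"
  then obtain g where g: "g \<in> a" "AE x in M. (x, g x) \<in> E" by (auto simp: full_group_def)
  then have "AE x in M. g x = f x" using Aut_class_eq[OF assms] by auto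
  with g(2) show "AE x in M. (x, f x) \<in> E" by eventually_elim simp
qed (use assms in \<open>auto simp: full_group_def\<close>)

lemma subgroup_full_group:
  assumes E: "equiv (space M) E"
  shows "subgroup (full_group M E) (Aut M)"
proof -
  interpret A: group "mp_aut M" by (rule group_mp_aut)
  interpret N: normal "null_aut M" "mp_aut M" by (rule normal_null_aut)
  let ?c = "\<lambda>f. null_aut M #>\<^bsub>mp_aut M\<^esub> f"
  have cl: "?c f \<in> carrier (Aut M)" "f \<in> ?c f" if "f \<in> carrier (mp_aut M)" for f
    using that by (auto simp: carrier_Aut mem_Aut_class_iff)
  have full: "?c f \<in> full_group M E \<longleftrightarrow> (AE x in M. (x, f x) \<in> E)"
    if "f \<in> carrier (mp_aut M)" for f
    using full_group_any_representative[OF cl[OF that]] .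
  have rep: "\<exists>f\<in>carrier (mp_aut M). a = ?c f \<and> (AE x in M. (x, f x) \<in> E)"
    if a: "a \<in> full_group M E" for a
  proof -
    obtain f where "f \<in> carrier (mp_aut M)" "a = ?c f"
      using a by (auto simp: full_group_def carrier_Aut)
    with full a show ?thesis by blast
  qed
  show ?thesis
  proof (rule group.subgroupI[OF group_Aut])
    show "full_group M E \<subseteq> carrier (Aut M)" by (auto simp: full_group_def)
    have "AE x in M. (x, \<one>\<^bsub>mp_aut M\<^esub> x) \<in> E"
    proof (rule AE_I2)
      fix x assume "x \<in> space M"
      then show "(x, \<one>\<^bsub>mp_aut M\<^esub> x) \<in> E"
        using equiv_class_self[OF E] by (simp add: one_mp_aut)
    qed
    then show "full_group M E \<noteq> {}" using full[OF A.one_closed] by blast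
  next
    fix a assume "a \<in> full_group M E"
    then obtain f where f: "f \<in> carrier (mp_aut M)" "a = ?c f" "AE x in M. (x, f x) \<in> E"
      using rep by blast
    let ?g = "inv\<^bsub>mp_aut M\<^esub> f"
    have g: "?g \<in> carrier (mp_aut M)" using f by simp
    have "AE x in M. (x, ?g x) \<in> E"
      using AE_mp_aut[OF g f(3)] AE_space
    proof eventually_elim
      case (elim x)
      then have "(?g x, x) \<in> E" using inv_mp_aut_apply(2)[OF f(1)] by simp
      then show ?case using E unfolding equiv_def by (blast dest: symD)
    qed
    moreover have "inv\<^bsub>Aut M\<^esub> a = ?c ?g"
      using N.inv_FactGroup[of a] cl(1)[OF f(1)] N.rcos_inv[OF f(1)] f(2)
      by (simp add: Aut_def)
    ultimately show "inv\<^bsub>Aut M\<^esub> a \<in> full_group M E" using full[OF g] by simp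
  next
    fix a b assume "a \<in> full_group M E" "b \<in> full_group M E"
    then obtain f g where f: "f \<in> carrier (mp_aut M)" "a = ?c f" "AE x in M. (x, f x) \<in> E"
      and g: "g \<in> carrier (mp_aut M)" "b = ?c g" "AE x in M. (x, g x) \<in> E"
      using rep[of a] rep[of b] by blast
    have "AE x in M. (x, (f \<otimes>\<^bsub>mp_aut M\<^esub> g) x) \<in> E"
      using AE_mp_aut[OF g(1) f(3)] g(3) AE_space
    proof eventually_elim
      case (elim x)
      then have "(x, f (g x)) \<in> E" using E unfolding equiv_def by (blast dest: transD)
      then show ?case using elim f g by (simp add: mult_mp_aut_apply)
    qed
    moreover have "a \<otimes>\<^bsub>Aut M\<^esub> b = ?c (f \<otimes>\<^bsub>mp_aut M\<^esub> g)"
      using N.rcos_sum[OF f(1) g(1)] f(2) g(2) by (simp add: Aut_def FactGroup_def)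
    ultimately show "a \<otimes>\<^bsub>Aut M\<^esub> b \<in> full_group M E"
      using full[OF A.m_closed[OF f(1) g(1)]] by simp
  qed
qed

lemma neq_set_measurable:
  assumes sb: "standard_borel M" and f: "f \<in> measurable M M" and g: "g \<in> measurable M M"
  shows "{x \<in> space M. f x \<noteq> g x} \<in> sets M"
proof -
  obtain T where T: "completely_metrizable_space T" "second_countable T" "topspace T = space M"
    "sets M = sigma_sets (space M) {U. openin T U}"
    using sb by (auto simp: standard_borel_def)
  have met: "metrizable_space T"
    using T(1) by (rule completely_metrizable_imp_metrizable_space)
  obtain B where B: "countable B" "\<And>V. V \<in> B \<Longrightarrow> openin T V"
    "\<And>U x. openin T U \<Longrightarrow> x \<in> U \<Longrightarrow> \<exists>V\<in>B. x \<in> V \<and> V \<subseteq> U"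
    using T(2) unfolding second_countable_def by metis
  have BM: "V \<in> sets M" if "V \<in> B" for V using B(2)[OF that] T(4) by auto
  have H: "Hausdorff_space T" using met by (rule metrizable_imp_Hausdorff_space)
  define P where "P = {(U, V) \<in> B \<times> B. disjnt U V}"
  have "{x \<in> space M. f x \<noteq> g x} =
      (\<Union>(U, V)\<in>P. (f -` U \<inter> space M) \<inter> (g -` V \<inter> space M))" (is "?L = ?R")
  proof
    show "?L \<subseteq> ?R"
    proof
      fix x assume x: "x \<in> ?L"
      then have "f x \<in> topspace T" "g x \<in> topspace T" "f x \<noteq> g x"
        using f g T(3) by (auto dest: measurable_space)
      then obtain U V where UV: "openin T U" "openin T V" "f x \<in> U" "g x \<in> V" "disjnt U V"
        using H unfolding Hausdorff_space_def by blast
      obtain U' where U': "U' \<in> B" "f x \<in> U'" "U' \<subseteq> U" using B(3) UV by metis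
      obtain V' where V': "V' \<in> B" "g x \<in> V'" "V' \<subseteq> V" using B(3) UV by metis
      have "(U', V') \<in> P" using U' V' UV by (auto simp: P_def disjnt_def)
      then show "x \<in> ?R" using U' V' x by auto
    qed
    show "?R \<subseteq> ?L" by (auto simp: P_def disjnt_def)
  qed
  also have "\<dots> \<in> sets M"
  proof (rule sets.countable_UN')
    show "countable P" using B(1) by (auto simp: P_def intro: countable_subset[of _ "B \<times> B"])
  qed (use BM f g in \<open>auto simp: P_def intro!: sets.Int measurable_sets[of _ M M]\<close>)
  finally show ?thesis .
qed

lemma Aut_dist_eq:
  assumes sb: "standard_borel M"
    and a: "a \<in> carrier (Aut M)" "f \<in> a" and b: "b \<in> carrier (Aut M)" "g \<in> b"
  shows "Aut_dist M a b = measure M {x \<in> space M. f x \<noteq> g x}"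
proof -
  define f' where "f' = (SOME f. f \<in> a)"
  define g' where "g' = (SOME g. g \<in> b)"
  have f': "f' \<in> a" using a(2) unfolding f'_def by (rule someI[of "\<lambda>f. f \<in> a"])
  have g': "g' \<in> b" using b(2) unfolding g'_def by (rule someI[of "\<lambda>g. g \<in> b"])
  have 1: "AE x in M. f' x = f x" using Aut_class_eq[OF a] f' by auto
  have 2: "AE x in M. g' x = g x" using Aut_class_eq[OF b] g' by auto
  note m = mp_autD(2)[OF Aut_class_eq(1)]
  have "measure M {x \<in> space M. f' x \<noteq> g' x} = measure M {x \<in> space M. f x \<noteq> g x}"
  proof (rule measure_eq_AE)
    show "AE x in M. (x \<in> {x \<in> space M. f' x \<noteq> g' x}) = (x \<in> {x \<in> space M. f x \<noteq> g x})"
      using 1 2 by eventually_elim auto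
  qed (auto intro!: neq_set_measurable[OF sb] m[OF a] m[OF b] m[OF a(1) f'] m[OF b(1) g'])
  then show ?thesis by (simp add: Aut_dist_def f'_def g'_def)
qed

lemma Metric_space_Aut:
  assumes sb: "standard_borel M" and P: "prob_space M"
  shows "Metric_space (carrier (Aut M)) (Aut_dist M)"
proof -
  interpret prob_space M by (rule P)
  note m = mp_autD(2)[OF Aut_class_eq(1)]
  show ?thesis
  proof
    show "0 \<le> Aut_dist M a b" for a b by (simp add: Aut_dist_def)
    show "Aut_dist M a b = Aut_dist M b a" for a b
      unfolding Aut_dist_def by (rule arg_cong[where f = "measure M"]) auto
  next
    fix a b assume a: "a \<in> carrier (Aut M)" and b: "b \<in> carrier (Aut M)"
    obtain f g where f: "f \<in> a" and g: "g \<in> b" using Aut_class_nonempty a b by metis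
    have s: "{x \<in> space M. f x \<noteq> g x} \<in> sets M"
      by (intro neq_set_measurable[OF sb] m[OF a f] m[OF b g])
    have "Aut_dist M a b = 0 \<longleftrightarrow> (AE x in M. f x = g x)"
      using Aut_dist_eq[OF sb a f b g] prob_eq_0[OF s] by simp
    also have "\<dots> \<longleftrightarrow> a = b"
    proof
      assume "AE x in M. f x = g x"
      then have "(AE x in M. h x = f x) \<longleftrightarrow> (AE x in M. h x = g x)" for h by auto
      then show "a = b" using Aut_class_eq[OF a f] Aut_class_eq[OF b g] by auto
    next
      assume "a = b"
      then show "AE x in M. f x = g x" using Aut_class_eq[OF b g] f by auto
    qed
    finally show "Aut_dist M a b = 0 \<longleftrightarrow> a = b" .
  next
    fix a b c
    assume a: "a \<in> carrier (Aut M)" and b: "b \<in> carrier (Aut M)" and c: "c \<in> carrier (Aut M)"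
    obtain f g h where f: "f \<in> a" and g: "g \<in> b" and h: "h \<in> c"
      using Aut_class_nonempty a b c by metis
    have s: "{x \<in> space M. f x \<noteq> g x} \<in> sets M" "{x \<in> space M. g x \<noteq> h x} \<in> sets M"
      by (intro neq_set_measurable[OF sb] m[OF a f] m[OF b g] m[OF c h])+
    have "measure M {x \<in> space M. f x \<noteq> h x} \<le>
        measure M ({x \<in> space M. f x \<noteq> g x} \<union> {x \<in> space M. g x \<noteq> h x})"
      using s by (intro finite_measure_mono) auto
    also have "\<dots> \<le> measure M {x \<in> space M. f x \<noteq> g x} + measure M {x \<in> space M. g x \<noteq> h x}"
      using s by (rule measure_Un_le)
    finally show "Aut_dist M a c \<le> Aut_dist M a b + Aut_dist M b c"
      using Aut_dist_eq[OF sb] a b c f g h by simp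
  qed
qed

end

theory Submission
 imports
  Defs
  "HOL-Combinatorics.Permutations"
  "HOL-Number_Theory.Cong"
begin

text \<open>Upper bound. Inside the full group build an odometer \<open>\<sigma>\<close> as a limit of towers, and let \<open>v\<close> be a
 product of disjointly supported cycles along its levels, of distinct prime lengths. Powers of \<open>v\<close>
 isolate each cycle; a cycle and a translate of it share one point, so their commutator is a 3-cycle, and
 translating by \<open>\<sigma>\<close> yields all local permutations along \<open>\<sigma>\<close>-orbits. Contract a generating family of
 total measure less than \<open>n\<close> along paths to a small base of the odometer: this uses up almost measure 1, so
 edges of total measure less than \<open>n - 1\<close> remain, and they are encoded by \<open>2n - 2\<close> involutions, each with
 room outside its support. Being good for a closed subgroup then propagates along orbits.

 Lower bound. If partial maps \<open>f\<^sub>j\<close> generate the orbits of a free action of the free group, let \<open>C\<close> express tree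
 edges as chains of \<open>f\<close>-edges. Geodesics give a bounded left inverse of \<open>C\<close>, so \<open>C\<^sup>T C\<close> is bounded below, and
 \<open>C (C\<^sup>T C)\<^sup>-\<^sup>1 C\<^sup>T\<close>, truncated to a finite Neumann series, has diagonal at most 1 and trace about \<open>n\<close>. So the
 domains have total measure at least \<open>n\<close>. If \<open>n\<close> elements were topological generators, an approximation of an
 involution with small support would be a word with fixed points, whose cycles allow one to drop edges of
 positive measure.\<close>

section \<open>Measure-preserving bijections\<close>

unbundle no m_inv_syntax

text \<open>The count \<open>2 * n\<close> comes from measure. An involution that encodes a family
  of partial maps holds a copy of every domain and a copy of every range, so it occupies twice their
  total measure; a total below \<open>n - 1\<close>, divided into \<open>2 * n - 2\<close> equal
  shares, makes each share less than \<open>1 / 2\<close> and each support smaller than the space.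
  The two further generators are \<open>\<sigma>\<close> and \<open>v\<close>. The obstacle is that
  a closed subgroup is given only by density. It is met by asking which swaps over small sets it
  contains: this property survives products, inverses, subsets, countable unions and limits, so maps
  may be realised piece by piece and modulo null sets. In the lower bound the operator
  \<open>C\<close> acts on the edges of an infinite tree and depends on the point \<open>x\<close>.
  Truncation makes it banded and bounded, uniformly in \<open>x\<close>, so that finitely supported
  vectors suffice; the trace of an infinite matrix is replaced by an integral over \<open>x\<close>,
  where the invariance of the measure turns column sums into row sums.\<close>

definition swp :: "'a set => ('a => 'a) => 'a => 'a" where
 "swp A g x = (if x \<in> A then g x else if x \<in> g ` A then inv g x else x)"

lemma swp_in: "x \<in> A ==> swp A g x = g x"
 by (simp add: swp_def)

lemma swp_image: "inj g ==> A \<inter> g ` A = {} ==> x \<in> A ==> swp A g (g x) = x"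
 by (auto simp: swp_def)

lemma swp_out: "x \<notin> A ==> x \<notin> g ` A ==> swp A g x = x"
 by (simp add: swp_def)

lemma swp_swp: "inj g ==> A \<inter> g ` A = {} ==> swp A g (swp A g x) = x"
 by (cases "x \<in> A"; cases "x \<in> g ` A") (auto simp: swp_in swp_image swp_out)

lemma bij_swp: "inj g ==> A \<inter> g ` A = {} ==> bij (swp A g)"
 by (rule o_bij[of "swp A g"]) (auto simp: swp_swp)

lemma swp_cong:
 assumes "inj g" "inj h" "\<And>x. x \<in> A ==> g x = h x"
 shows "swp A g = swp A h"
proof
 have "g ` A = h ` A" using assms(3) by (rule image_cong[OF refl])
 moreover have "inv g x = inv h x" if "x \<in> g ` A" for x
  using that assms(3) inv_f_f[OF assms(1)] inv_f_f[OF assms(2)] by (metis imageE)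
 ultimately show "swp A g x = swp A h x" for x
  using assms(3) by (simp add: swp_def)
qed

text \<open>The sequence \<open>U\<close> stands for a countable base of a Polish topology.
  Separation of points makes the set where two measurable maps differ measurable; generation lets
  the levels of the odometer approximate every measurable set.\<close>

locale std_prob = prob_space M for M :: "'a measure" +
 fixes U :: "nat => 'a set"
 assumes sets_eq: "sets M = sigma_sets (space M) (range U)"
  and sep: "\<And>x y. x \<in> space M ==> y \<in> space M ==> x ~= y ==> \<exists>k. x \<in> U k \<and> y \<notin> U k"
begin

lemma U_sets [measurable, simp]: "U k \<in> sets M"
 unfolding sets_eq by (rule sigma_sets.Basic) simp

text \<open>Bijections of the whole type, fixed off \<open>space M\<close>, so that
  \<open>o\<close>, \<open>inv\<close> and \<open>^^\<close> apply directly. Passing to classes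
  modulo null sets is postponed to the map \<open>cl\<close>.\<close>

definition mpa :: "('a => 'a) set" where
 "mpa = {f. bij f \<and> (\<forall>x. x \<notin> space M --> f x = x) \<and> f \<in> measurable M M \<and>
       inv f \<in> measurable M M \<and> distr M M f = M}"

lemma mpaD:
 assumes "f \<in> mpa"
 shows "bij f" "inj f" "surj f" "\<And>x. x \<notin> space M ==> f x = x" "f \<in> measurable M M"
  "inv f \<in> measurable M M" "distr M M f = M"
 using assms by (auto simp: mpa_def bij_def)

lemma mpa_space: "f \<in> mpa ==> f x \<in> space M \<longleftrightarrow> x \<in> space M"
 using mpaD(4)[of f x] measurable_space[OF mpaD(5)[of f], of x] by metis

lemma mpa_inv_apply [simp]: "f \<in> mpa ==> f (inv f x) = x" "f \<in> mpa ==> inv f (f x) = x"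
 using mpaD(2,3) by (auto simp: surj_f_inv_f)

lemma vimage_eq: "f \<in> mpa ==> A \<in> sets M ==> f -` A = f -` A \<inter> space M"
 using mpa_space sets.sets_into_space by blast

lemma vimage_sets: "f \<in> mpa ==> A \<in> sets M ==> f -` A \<in> sets M"
 using vimage_eq[of f A] mpaD(5)[of f] measurable_sets by metis

lemma image_eq: "f \<in> mpa ==> f ` A = inv f -` A"
proof -
 assume f: "f \<in> mpa"
 hence i: "\<And>x. f (inv f x) = x" "\<And>x. inv f (f x) = x" by simp_all
 have "x \<in> f ` A \<longleftrightarrow> inv f x \<in> A" for x
  using i by (metis image_iff)
 thus ?thesis by auto
qed

lemma emeasure_vimage: "f \<in> mpa ==> A \<in> sets M ==> emeasure M (f -` A) = emeasure M A"
 using emeasure_distr[of f M M A] mpaD(5,7)[of f] vimage_eq[of f A] by metis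

lemma prob_vimage: "f \<in> mpa ==> A \<in> sets M ==> prob (f -` A) = prob A"
 by (simp add: measure_def emeasure_vimage)

lemma mpaI:
 assumes "bij f" "\<And>x. x \<notin> space M ==> f x = x" "f \<in> measurable M M" "inv f \<in> measurable M M"
  "\<And>A. A \<in> sets M ==> prob (f -` A) = prob A"
 shows "f \<in> mpa"
proof -
 have sp: "f x \<in> space M \<longleftrightarrow> x \<in> space M" for x
  using assms(2)[of x] measurable_space[OF assms(3), of x] by metis
 have "distr M M f = M"
 proof (rule measure_eqI)
  fix A assume A: "A \<in> sets (distr M M f)"
  hence "f -` A \<inter> space M = f -` A"
   using sp sets.sets_into_space[of A M] by auto
  thus "emeasure (distr M M f) A = emeasure M A"
   using A assms(3,5) by (simp add: emeasure_distr emeasure_eq_measure)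
 qed simp
 thus ?thesis using assms by (auto simp: mpa_def)
qed

lemma id_mpa [simp]: "id \<in> mpa" "(\<lambda>x. x) \<in> mpa"
proof -
 show *: "id \<in> mpa" by (rule mpaI) (auto simp: inv_id)
 thus "(\<lambda>x. x) \<in> mpa" by (simp add: id_def)
qed

lemma inv_mpa:
 assumes f: "f \<in> mpa" shows "inv f \<in> mpa"
proof (rule mpaI)
 show "inv f x = x" if "x \<notin> space M" for x
  using mpaD(4)[OF f that] mpa_inv_apply(2)[OF f, of x] by simp
 show "inv (inv f) \<in> M \<rightarrow>\<^sub>M M" using f mpaD(1,5) by (simp add: inv_inv_eq)
 show "prob (inv f -` A) = prob A" if A: "A \<in> sets M" for A
 proof -
  have "inv f -` A \<subseteq> space M"
  proof
   fix x assume "x \<in> inv f -` A"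
   hence "inv f x \<in> space M" using sets.sets_into_space[OF A] by auto
   thus "x \<in> space M" using mpa_space[OF f, of "inv f x"] f by simp
  qed
  hence "inv f -` A \<in> sets M"
   using measurable_sets[OF mpaD(6)[OF f] A] by (simp add: Int_absorb2)
  hence "prob (f -` (inv f -` A)) = prob (inv f -` A)" by (rule prob_vimage[OF f])
  moreover have "f -` (inv f -` A) = A" using f by auto
  ultimately show ?thesis by simp
 qed
qed (use mpaD[OF f] bij_imp_bij_inv in auto)

lemma image_sets: "f \<in> mpa ==> A \<in> sets M ==> f ` A \<in> sets M"
 by (simp add: image_eq vimage_sets inv_mpa)

lemma prob_image: "f \<in> mpa ==> A \<in> sets M ==> prob (f ` A) = prob A"
 by (simp add: image_eq prob_vimage inv_mpa)

lemma comp_mpa: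
 assumes f: "f \<in> mpa" and g: "g \<in> mpa" shows "f o g \<in> mpa"
proof (rule mpaI)
 show "bij (f o g)" using f g by (simp add: bij_comp mpaD(1))
 show "inv (f o g) \<in> M \<rightarrow>\<^sub>M M"
  using measurable_comp[OF mpaD(6)[OF f] mpaD(6)[OF g]] mpaD(1)[OF f] mpaD(1)[OF g]
  by (simp add: o_inv_distrib bij_is_inj bij_is_surj)
 show "prob ((f o g) -` A) = prob A" if A: "A \<in> sets M" for A
  using f g A by (simp add: vimage_comp[symmetric] prob_vimage vimage_sets)
qed (use mpaD[OF f] mpaD[OF g] in auto)

lemma funpow_mpa: "f \<in> mpa ==> f ^^ n \<in> mpa"
 by (induction n) (auto intro: comp_mpa)

lemma AE_mpa:
 assumes f: "f \<in> mpa" and P: "AE x in M. P x" shows "AE x in M. P (f x)"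
proof -
 have "AE x in distr M M f. P x" by (subst mpaD(7)[OF f]) (rule P)
 thus ?thesis using AE_distrD[OF mpaD(5)[OF f]] by blast
qed

lemma neq_sets:
 assumes f: "f \<in> measurable M M" and g: "g \<in> measurable M M"
 shows "{x \<in> space M. f x ~= g x} \<in> sets M"
proof -
 have "{x \<in> space M. f x ~= g x} = (\<Union>k. (f -` U k \<inter> space M) - (g -` U k \<inter> space M))" (is "?L = ?R")
 proof
  show "?L \<subseteq> ?R" using sep measurable_space[OF f] measurable_space[OF g] by fastforce
 qed auto
 also have "... \<in> sets M" using f g by (auto intro!: sets.countable_UN sets.Diff measurable_sets)
 finally show ?thesis .
qed

lemma eq_sets:
 assumes "f \<in> measurable M M" "g \<in> measurable M M"
 shows "{x \<in> space M. f x = g x} \<in> sets M"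
proof -
 have "{x \<in> space M. f x = g x} = space M - {x \<in> space M. f x ~= g x}" by auto
 thus ?thesis using neq_sets[OF assms] by simp
qed

lemma neq_mpa:
 assumes "f \<in> mpa" "g \<in> mpa" shows "{x. f x ~= g x} \<in> sets M"
proof -
 have "{x. f x ~= g x} = {x \<in> space M. f x ~= g x}"
  using mpaD(4)[OF assms(1)] mpaD(4)[OF assms(2)] by force
 thus ?thesis using neq_sets[OF mpaD(5)[OF assms(1)] mpaD(5)[OF assms(2)]] by simp
qed

text \<open>On disjoint pieces \<open>F\<close> acts like the measure-preserving \<open>g i\<close>,
  and the images of the pieces stay disjoint because \<open>F\<close> is injective; the measure of a
  preimage is summed over the pieces.\<close>

lemma mpa_piecewise_nat:
 fixes C :: "nat => 'a set"
 assumes F: "bij F" "\<And>x. x \<notin> space M ==> F x = x"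
  and C: "\<And>i. C i \<in> sets M" "space M \<subseteq> (\<Union>i. C i)"
  and g: "\<And>i. g i \<in> mpa" and eq: "\<And>i x. x \<in> C i ==> F x = g i x"
 shows "F \<in> mpa"
proof -
 have sp: "F x \<in> space M \<longleftrightarrow> x \<in> space M" for x
  using F(2) C(2) eq mpa_space[OF g] by (metis UN_E subsetD)
 have vF: "F -` A = (\<Union>i. C i \<inter> g i -` A)" if A: "A \<in> sets M" for A
 proof -
  have "F -` A \<subseteq> space M" using sp sets.sets_into_space[OF A] by auto
  have "x \<in> F -` A \<longleftrightarrow> x \<in> (\<Union>i. C i \<inter> g i -` A)" for x
  proof
   assume x: "x \<in> F -` A"
   then obtain i where "x \<in> C i" using C(2) \<open>F -` A \<subseteq> space M\<close> by blast
   thus "x \<in> (\<Union>i. C i \<inter> g i -` A)" using x eq[of x i] by auto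
  next
   assume "x \<in> (\<Union>i. C i \<inter> g i -` A)"
   then obtain i where "x \<in> C i" "g i x \<in> A" by auto
   thus "x \<in> F -` A" using eq[of x i] by simp
  qed
  thus ?thesis by blast
 qed
 have m: "F -` A \<in> sets M" if A: "A \<in> sets M" for A
  unfolding vF[OF A] using C(1) vimage_sets[OF g A] by auto
 have Fm: "F \<in> measurable M M"
 proof (rule measurableI)
  fix A assume A: "A \<in> sets M"
  have "F -` A \<inter> space M = F -` A" using sp sets.sets_into_space[OF A] by auto
  thus "F -` A \<inter> space M \<in> sets M" using m[OF A] by simp
 qed (simp add: sp)
 have injF: "inj F" and surjF: "surj F" using F(1) by (auto simp: bij_def)
 have imF: "F ` A = (\<Union>i. g i ` (C i \<inter> A))" if A: "A \<in> sets M" for A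
 proof -
  have "F x \<in> (\<Union>i. g i ` (C i \<inter> A))" if x: "x \<in> A" for x
  proof -
   obtain i where "x \<in> C i" using x sets.sets_into_space[OF A] C(2) by blast
   thus ?thesis using x eq[of x i] by auto
  qed
  moreover have "g i x \<in> F ` A" if "x \<in> C i \<inter> A" for i x
   using that eq[of x i] by (metis IntE imageI)
  ultimately show ?thesis by auto
 qed
 have iF: "inv F -` A = F ` A" for A
  using bij_vimage_eq_inv_image[of "inv F"] F(1) by (simp add: bij_imp_bij_inv inv_inv_eq)
 have im: "F ` A \<in> sets M" if A: "A \<in> sets M" for A
  unfolding imF[OF A] using C(1) A by (auto intro!: image_sets[OF g])
 have Fi: "inv F \<in> measurable M M"
 proof (rule measurableI)
  show "inv F x \<in> space M" if "x \<in> space M" for x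
   using that sp[of "inv F x"] surjF by (simp add: surj_f_inv_f)
  fix A assume A: "A \<in> sets M"
  have "F ` A \<subseteq> space M" using im[OF A] sets.sets_into_space by blast
  hence "inv F -` A \<inter> space M = F ` A" using iF by auto
  thus "inv F -` A \<inter> space M \<in> sets M" using im[OF A] by simp
 qed
 have "prob (F -` A) = prob A" if A: "A \<in> sets M" for A
 proof -
  define D where "D = disjointed C"
  have D: "D i \<in> sets M" "D i \<subseteq> C i" "disjoint_family D" "(\<Union>i. D i) = (\<Union>i. C i)" for i
   using C(1) sets.range_disjointed_sets[of C M] disjointed_subset[of C]
   by (auto simp: D_def disjoint_family_disjointed UN_disjointed_eq)
  have "disjoint_family (\<lambda>i. D i \<inter> F -` A)" using D(3) unfolding disjoint_family_on_def by blast
  hence 1: "(\<lambda>i. prob (D i \<inter> F -` A)) sums prob (\<Union>i. D i \<inter> F -` A)"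
   using D(1) m[OF A] by (intro finite_measure_UNION) auto
  have "F -` A \<subseteq> (\<Union>i. D i)"
   using sets.sets_into_space[OF m[OF A]] C(2) unfolding D(4) by (rule subset_trans)
  hence "(\<Union>i. D i \<inter> F -` A) = F -` A" by blast
  with 1 have 1: "(\<lambda>i. prob (D i \<inter> F -` A)) sums prob (F -` A)" by simp
  have eqi: "F ` D i = g i ` D i" for i using D(2) eq by (auto intro!: image_cong)
  have 2: "(\<lambda>i. prob (F ` D i \<inter> A)) sums prob (\<Union>i. F ` D i \<inter> A)"
  proof (intro finite_measure_UNION)
   have "F ` D i \<inter> F ` D j = {}" if "i ~= j" for i j
    using D(3) that injF by (simp add: image_Int[symmetric] disjoint_family_on_def)
   thus "disjoint_family (\<lambda>i. F ` D i \<inter> A)" by (auto simp: disjoint_family_on_def)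
  qed (use D(1) im A in auto)
  have "(\<Union>i. F ` D i \<inter> A) = F ` (\<Union>i. D i) \<inter> A" by auto
  also have "... = A"
  proof -
   have "A \<subseteq> F ` space M"
   proof
    fix y assume "y \<in> A"
    hence "F (inv F y) = y" "y \<in> space M"
     using surjF sets.sets_into_space[OF A] by (auto simp: surj_f_inv_f)
    thus "y \<in> F ` space M" using sp[of "inv F y"] by (metis image_eqI)
   qed
   also have "... \<subseteq> F ` (\<Union>i. D i)" unfolding D(4) using C(2) by (rule image_mono)
   finally show ?thesis by (simp add: Int_absorb1)
  qed
  finally have 2: "(\<lambda>i. prob (F ` D i \<inter> A)) sums prob A" using 2 by simp
  have "prob (F ` D i \<inter> A) = prob (D i \<inter> F -` A)" for i
  proof -
   have "F ` D i \<inter> A = g i ` (D i \<inter> F -` A)"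
    using D(2) eq by (force simp: eqi)
   thus ?thesis using prob_image[OF g, of "D i \<inter> F -` A" i] D(1) m[OF A] by auto
  qed
  thus ?thesis using sums_unique2[OF 1] 2 by simp
 qed
 thus ?thesis using mpaI F Fm Fi by blast
qed

lemma mpa_piecewise:
 fixes C :: "'i::countable => 'a set"
 assumes F: "bij F" "\<And>x. x \<notin> space M ==> F x = x"
  and C: "\<And>i. C i \<in> sets M" "space M \<subseteq> (\<Union>i. C i)"
  and g: "\<And>i. g i \<in> mpa" and eq: "\<And>i x. x \<in> C i ==> F x = g i x"
 shows "F \<in> mpa"
proof (rule mpa_piecewise_nat[OF F])
 let ?C = "\<lambda>n. if n \<in> range (to_nat :: 'i => nat) then C (from_nat n) else {}"
 show "?C n \<in> sets M" for n using C by simp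
 show "space M \<subseteq> (\<Union>n. ?C n)"
 proof
  fix x assume "x \<in> space M"
  then obtain i where "x \<in> C i" using C by auto
  hence "x \<in> ?C (to_nat i)" by simp
  thus "x \<in> (\<Union>n. ?C n)" by blast
 qed
 show "g (from_nat n) \<in> mpa" for n by (rule g)
 show "F x = g (from_nat n) x" if "x \<in> ?C n" for n x using that eq by (auto split: if_splits)
qed

lemma swp_mpa:
 assumes A: "A \<in> sets M" and g: "g \<in> mpa" and d: "A \<inter> g ` A = {}"
 shows "swp A g \<in> mpa"
proof (rule mpa_piecewise_nat)
 let ?C = "\<lambda>i::nat. if i = 0 then A else if i = 1 then g ` A else space M - A - g ` A"
 let ?g = "\<lambda>i::nat. if i = 0 then g else if i = 1 then inv g else id"
 show "bij (swp A g)" using bij_swp[OF mpaD(2)[OF g] d] .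
 have "A \<subseteq> space M" "g ` A \<subseteq> space M"
  using A image_sets[OF g A] sets.sets_into_space by blast+
 thus "swp A g x = x" if "x \<notin> space M" for x
  using that by (intro swp_out) auto
 show "?C i \<in> sets M" for i using A image_sets[OF g A] by auto
 show "space M \<subseteq> (\<Union>i. ?C i)"
 proof
  fix x assume "x \<in> space M"
  hence "x \<in> ?C 0 \<or> x \<in> ?C 1 \<or> x \<in> ?C 2" by auto
  thus "x \<in> (\<Union>i. ?C i)" by blast
 qed
 show "?g i \<in> mpa" for i using g inv_mpa by auto
 show "swp A g x = ?g i x" if "x \<in> ?C i" for i x
  using that d g by (auto simp: swp_def split: if_splits)
qed

text \<open>A moved point and its image are separated by some \<open>U i\<close>, and
  \<open>f\<close> sends the points that leave \<open>U i\<close> outside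
  \<open>U i\<close>.\<close>

lemma separate:
 assumes f: "f \<in> mpa"
 shows "\<exists>Q :: nat => 'a set. (\<forall>i. Q i \<in> sets M \<and> Q i \<inter> f ` Q i = {}) \<and> {x. f x ~= x} \<subseteq> (\<Union>i. Q i)"
proof (intro exI conjI allI)
 let ?Q = "\<lambda>i. U i - f -` U i"
 show "?Q i \<in> sets M" for i using f vimage_sets by auto
 show "?Q i \<inter> f ` ?Q i = {}" for i by auto
 show "{x. f x ~= x} \<subseteq> (\<Union>i. ?Q i)"
 proof
  fix x assume "x \<in> {x. f x ~= x}"
  hence "x \<in> space M" "f x ~= x" using f mpaD(4) by auto
  thus "x \<in> (\<Union>i. ?Q i)" using sep[of x "f x"] f mpa_space by auto
 qed
qed

section \<open>Closed groups and local membership\<close>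

definition clgrp :: "('a => 'a) set => bool" where
 "clgrp G \<longleftrightarrow> G \<subseteq> mpa \<and> id \<in> G \<and> (\<forall>f\<in>G. \<forall>g\<in>G. f o g \<in> G) \<and> (\<forall>f\<in>G. inv f \<in> G) \<and>
   (\<forall>f\<in>mpa. (\<forall>e>0. \<exists>g\<in>G. prob {x. f x ~= g x} < e) --> f \<in> G)"

text \<open>Membership of \<open>g\<close> in a closed group \<open>G\<close>, localised to \<open>A\<close>: unlike membership it passes to subsets and
 countable unions.\<close>

definition good :: "('a => 'a) set => 'a set => ('a => 'a) => bool" where
 "good G A g \<longleftrightarrow> (\<forall>A'\<in>sets M. A' \<subseteq> A \<and> A' \<inter> g ` A' = {} --> swp A' g \<in> G)"

lemma clgrpD:
 assumes "clgrp G"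
 shows "\<And>f. f \<in> G ==> f \<in> mpa" "id \<in> G" "\<And>f g. f \<in> G ==> g \<in> G ==> f o g \<in> G"
  "\<And>f. f \<in> G ==> inv f \<in> G"
  "\<And>f. f \<in> mpa ==> (\<And>e. e > 0 ==> \<exists>g\<in>G. prob {x. f x ~= g x} < e) ==> f \<in> G"
 using assms by (auto simp: clgrp_def)

lemma clgrp_AE:
 assumes "clgrp G" "f \<in> mpa" "g \<in> G" "AE x in M. f x = g x"
 shows "f \<in> G"
proof (rule clgrpD(5)[OF assms(1,2)])
 fix e :: real assume "e > 0"
 have g: "g \<in> mpa" using clgrpD(1) assms by auto
 have "{x. f x ~= g x} \<in> sets M" using neq_mpa assms(2) g by auto
 moreover have "AE x in M. x \<notin> {x. f x ~= g x}" using assms(4) by auto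
 ultimately have "prob {x. f x ~= g x} = 0" using prob_eq_0 by blast
 thus "\<exists>g\<in>G. prob {x. f x ~= g x} < e"
  using assms(3) \<open>e > 0\<close> by (intro bexI[of _ g]) auto
qed

lemma good_subset: "good G A g ==> B \<subseteq> A ==> good G B g"
 by (auto simp: good_def)

lemma goodD: "good G A g ==> A' \<in> sets M ==> A' \<subseteq> A ==> A' \<inter> g ` A' = {} ==> swp A' g \<in> G"
 by (auto simp: good_def)

lemma good_cong:
 assumes "good G A g" "g \<in> mpa" "h \<in> mpa" "\<And>x. x \<in> A ==> g x = h x"
 shows "good G A h"
 unfolding good_def
proof (intro ballI impI)
 fix A' assume A': "A' \<in> sets M" "A' \<subseteq> A \<and> A' \<inter> h ` A' = {}"
 have "swp A' g = swp A' h"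
  using assms A' by (intro swp_cong) (auto simp: mpaD)
 moreover have "g ` A' = h ` A'" using A' assms(4) by (intro image_cong) auto
 ultimately show "swp A' h \<in> G" using goodD[OF assms(1) A'(1)] A' by auto
qed

lemma good_fix:
 assumes "clgrp G" "\<And>x. x \<in> A ==> g x = x" shows "good G A g"
 unfolding good_def
proof (intro ballI impI)
 fix A' assume A': "A' \<in> sets M" "A' \<subseteq> A \<and> A' \<inter> g ` A' = {}"
 hence "A' = {}" using assms(2) by force
 hence "swp A' g = id" by (auto simp: swp_def fun_eq_iff)
 thus "swp A' g \<in> G" using clgrpD(2)[OF assms(1)] by simp
qed

text \<open>The swap over \<open>C\<close> is the product of the swaps over
  \<open>C \<inter> A\<close> and \<open>C - A\<close>, whose supports are disjoint.\<close>

lemma good_Un: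
 assumes G: "clgrp G" and g: "g \<in> mpa" and A: "A \<in> sets M" "good G A g" and B: "good G B g"
 shows "good G (A \<union> B) g"
 unfolding good_def
proof (intro ballI impI)
 fix C assume C: "C \<in> sets M" "C \<subseteq> A \<union> B \<and> C \<inter> g ` C = {}"
 have inj: "inj g" by (rule mpaD(2)[OF g])
 have d: "y \<in> C ==> g y \<notin> C" for y using C by auto
 have "swp C g = swp (C \<inter> A) g o swp (C - A) g"
 proof
  fix x
  consider "x \<in> C \<inter> A" | "x \<in> C - A" | "x \<in> g ` (C \<inter> A)" | "x \<in> g ` (C - A)" | "x \<notin> C" "x \<notin> g ` C" by blast
  thus "swp C g x = (swp (C \<inter> A) g o swp (C - A) g) x"
   by cases (use d in \<open>auto simp: swp_def inj_image_mem_iff[OF inj] inv_f_f[OF inj] inj_eq[OF inj]\<close>)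
 qed
 moreover have "swp (C \<inter> A) g \<in> G" using C A by (intro goodD[OF A(2)]) auto
 moreover have "swp (C - A) g \<in> G" using C A by (intro goodD[OF B]) auto
 ultimately show "swp C g \<in> G" using clgrpD(3)[OF G] by auto
qed

text \<open>The swaps over \<open>C\<close> and over \<open>C \<inter> A n\<close> differ only on
  \<open>C - A n\<close> and its image, whose measure tends to 0; here the closedness of
  \<open>G\<close> enters.\<close>

lemma good_incseq:
 assumes G: "clgrp G" and g: "g \<in> mpa" and A: "\<And>n. A n \<in> sets M" "\<And>n::nat. good G (A n) g" "incseq A"
  and B: "B \<in> sets M" "prob (B - (\<Union>n. A n)) = 0"
 shows "good G B g"
 unfolding good_def
proof (intro ballI impI)
 fix C assume C: "C \<in> sets M" "C \<subseteq> B \<and> C \<inter> g ` C = {}"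
 have inj: "inj g" by (rule mpaD(2)[OF g])
 show "swp C g \<in> G"
 proof (rule clgrpD(5)[OF G])
  show "swp C g \<in> mpa" using swp_mpa C g by auto
  fix e :: real assume e: "e > 0"
  have "(\<lambda>n. prob (C - A n)) \<longlonglongrightarrow> prob (\<Inter>n. C - A n)"
   using A(1) C(1) incseqD[OF A(3)] by (intro finite_Lim_measure_decseq) (auto simp: decseq_def dest: subsetD)
  moreover have "prob (\<Inter>n. C - A n) = 0"
  proof -
   have "prob (\<Inter>n. C - A n) \<le> prob (B - (\<Union>n. A n))"
    using A B C by (intro finite_measure_mono) auto
   thus ?thesis using B measure_nonneg[of M] by (metis antisym)
  qed
  ultimately have "(\<lambda>n. prob (C - A n)) \<longlonglongrightarrow> 0" by simp
  hence "\<forall>\<^sub>F n in sequentially. prob (C - A n) < e / 2" using e by (intro order_tendstoD) auto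
  then obtain n where n: "prob (C - A n) < e / 2" by (auto simp: eventually_sequentially)
  let ?h = "swp (C \<inter> A n) g"
  have h: "?h \<in> G" using C A by (intro goodD[OF A(2)[of n]]) auto
  let ?R = "C - A n"
  have R: "?R \<in> sets M" using A C by auto
  have "{x. swp C g x ~= ?h x} \<subseteq> ?R \<union> g ` ?R"
   using C inj by (auto simp: swp_def split: if_splits)
  hence "prob {x. swp C g x ~= ?h x} \<le> prob (?R \<union> g ` ?R)"
   using R image_sets[OF g R] by (intro finite_measure_mono) auto
  also have "... \<le> prob ?R + prob (g ` ?R)" using R image_sets[OF g R] by (intro measure_Un_le)
  also have "... < e" using n prob_image[OF g R] by simp
  finally show "\<exists>h\<in>G. prob {x. swp C g x ~= h x} < e" using h by blast
 qed
qed

lemma good_UN_nat: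
 assumes G: "clgrp G" and g: "g \<in> mpa" and A: "\<And>n. A n \<in> sets M" "\<And>n::nat. good G (A n) g"
  and B: "B \<in> sets M" "prob (B - (\<Union>n. A n)) = 0"
 shows "good G B g"
proof (rule good_incseq[OF G g, where A = "\<lambda>n. \<Union>i<n. A i"])
 show "good G (\<Union>i<n. A i) g" for n
 proof (induction n)
  case 0 show ?case using good_fix[OF G, of "{}"] by auto
 next
  case (Suc n)
  have "(\<Union>i<Suc n. A i) = (\<Union>i<n. A i) \<union> A n" by (auto simp: less_Suc_eq)
  thus ?case using good_Un[OF G g _ Suc A(2)] A(1) by auto
 qed
 show "incseq (\<lambda>n. \<Union>i<n. A i)" by (force simp: incseq_def)
 have "(\<Union>n. \<Union>i<n. A i) = (\<Union>n. A n)" by auto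
 thus "prob (B - (\<Union>n. \<Union>i<n. A i)) = 0" using B by simp
qed (use A B in auto)

lemma good_UN:
 fixes A :: "'i::countable => 'a set"
 assumes G: "clgrp G" and g: "g \<in> mpa" and A: "\<And>n. A n \<in> sets M" "\<And>n. good G (A n) g"
  and B: "B \<in> sets M" "prob (B - (\<Union>n. A n)) = 0"
 shows "good G B g"
proof (rule good_UN_nat[OF G g])
 let ?C = "\<lambda>n. if n \<in> range (to_nat :: 'i => nat) then A (from_nat n) else {}"
 show "?C n \<in> sets M" "good G (?C n) g" for n using A good_fix[OF G, of "{}"] by auto
 have "(\<Union>n. ?C n) = (\<Union>n. A n)"
 proof
  show "(\<Union>n. A n) \<subseteq> (\<Union>n. ?C n)"
  proof
   fix x assume "x \<in> (\<Union>n. A n)"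
   then obtain i where "x \<in> A i" by auto
   hence "x \<in> ?C (to_nat i)" by simp
   thus "x \<in> (\<Union>n. ?C n)" by blast
  qed
 qed (auto split: if_splits)
 thus "prob (B - (\<Union>n. ?C n)) = 0" using B by simp
qed (rule B)

text \<open>Swapping a set with its image along \<open>g\<close> is the same map as swapping the
  image back along \<open>inv g\<close>.\<close>

lemma good_inv:
 assumes g: "g \<in> mpa" and A: "good G A g"
 shows "good G (g ` A) (inv g)"
 unfolding good_def
proof (intro ballI impI)
 have inj: "inj g" by (rule mpaD(2)[OF g])
 fix C assume C: "C \<in> sets M" "C \<subseteq> g ` A \<and> C \<inter> inv g ` C = {}"
 let ?D = "inv g ` C"
 have gD: "g ` ?D = C" using g by (auto simp: image_image)
 have "?D \<subseteq> A" using C g inj by auto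
 moreover have "?D \<in> sets M" using image_sets[OF inv_mpa[OF g]] C by auto
 ultimately have "swp ?D g \<in> G" using C gD by (intro goodD[OF A]) auto
 moreover have "swp ?D g = swp C (inv g)"
  using gD C g by (auto simp: swp_def fun_eq_iff inv_inv_eq mpaD)
 ultimately show "swp C (inv g) \<in> G" by simp
qed

text \<open>Where a set and its images under \<open>g\<close> and \<open>h o g\<close> are pairwise
  disjoint, the swap along \<open>h o g\<close> is a conjugate of a swap along \<open>h\<close> by a
  swap along \<open>g\<close>. Countably many such pieces cover \<open>A\<close>, apart from three
  degenerate sets.\<close>

lemma good_comp:
 assumes G: "clgrp G" and g: "g \<in> mpa" and h: "h \<in> mpa" and A: "A \<in> sets M" "good G A g"
  and B: "good G (g ` A) h"
 shows "good G A (h o g)"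
proof -
 note hg = comp_mpa[OF h g]
 have inj: "inj g" "inj h" using mpaD(2)[OF g] mpaD(2)[OF h] by auto
 obtain Q1 where Q1: "\<And>i::nat. Q1 i \<in> sets M" "\<And>i. Q1 i \<inter> g ` Q1 i = {}" "{x. g x ~= x} \<subseteq> (\<Union>i. Q1 i)"
  using separate[OF g] by blast
 obtain Q2 where Q2: "\<And>i::nat. Q2 i \<in> sets M" "\<And>i. Q2 i \<inter> h ` Q2 i = {}" "{x. h x ~= x} \<subseteq> (\<Union>i. Q2 i)"
  using separate[OF h] by blast
 obtain Q3 where Q3: "\<And>i::nat. Q3 i \<in> sets M" "\<And>i. Q3 i \<inter> (h o g) ` Q3 i = {}" "{x. (h o g) x ~= x} \<subseteq> (\<Union>i. Q3 i)"
  using separate[OF hg] by blast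
 define A0 where "A0 = {x \<in> A. (h o g) x = x}"
 define A1 where "A1 = {x \<in> A. g x = x}"
 define A2 where "A2 = {x \<in> A. (h o g) x = g x}"
 \<comment> \<open>On \<open>A0\<close>, \<open>A1\<close> and \<open>A2\<close> one of
   \<open>h o g\<close>, \<open>g\<close>, \<open>h\<close> does nothing, so one of the other maps
   decides. On the pieces \<open>Q\<close> the three sets of the conjugation are disjoint.\<close>
 define Q where "Q = (\<lambda>(i,j,k). A \<inter> Q1 i \<inter> g -` Q2 j \<inter> Q3 k)"
 define P where "P = (\<lambda>t. case t of None => A0 | Some None => A1 | Some (Some None) => A2 | Some (Some (Some t)) => Q t)"
 have eqs: "{x \<in> A. f x = f' x} \<in> sets M" if "f \<in> mpa" "f' \<in> mpa" for f f'
 proof -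
  have "{x \<in> A. f x = f' x} = A - {x. f x ~= f' x}" by auto
  thus ?thesis using neq_mpa that A by auto
 qed
 have s: "A0 \<in> sets M" "A1 \<in> sets M" "A2 \<in> sets M"
  unfolding A0_def A1_def A2_def using eqs[OF hg id_mpa(2)] eqs[OF g id_mpa(2)] eqs[OF hg g] by auto
 have sQ: "Q t \<in> sets M" for t using Q1 Q2 Q3 A vimage_sets[OF g] by (auto simp: Q_def split: prod.splits)
 show ?thesis
 proof (rule good_UN[OF G hg, where A = P])
  show "P t \<in> sets M" for t using s sQ by (auto simp: P_def split: option.splits)
  have g0: "good G A0 (h o g)" by (rule good_fix[OF G]) (auto simp: A0_def)
  have g1: "good G A1 (h o g)"
  proof (rule good_cong[OF _ h hg])
   show "good G A1 h" by (rule good_subset[OF B]) (force simp: A1_def)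
  qed (auto simp: A1_def)
  have g2: "good G A2 (h o g)"
  proof (rule good_cong[OF _ g hg])
   show "good G A2 g" by (rule good_subset[OF A(2)]) (force simp: A2_def)
  qed (auto simp: A2_def)
  have g3: "good G (Q t) (h o g)" for t
   unfolding good_def
  proof (intro ballI impI)
   fix C assume C: "C \<in> sets M" "C \<subseteq> Q t \<and> C \<inter> (h o g) ` C = {}"
   obtain i j k where t: "t = (i,j,k)" by (cases t)
   have CA: "C \<subseteq> A" "C \<subseteq> Q1 i" "g ` C \<subseteq> Q2 j" "C \<subseteq> Q3 k" using C by (auto simp: Q_def t)
   have d1: "C \<inter> g ` C = {}" using CA Q1(2)[of i] by blast
   have d2: "g ` C \<inter> h ` g ` C = {}" using CA Q2(2)[of j] by blast
   have d3: "C \<inter> h ` g ` C = {}" using C by (auto simp: image_comp)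
   \<comment> \<open>The identity \<open>(1 3) = (1 2) (2 3) (1 2)\<close> for three disjoint
     sets.\<close>
   have "swp C (h o g) = swp C g o swp (g ` C) h o swp C g"
   proof
    fix x
    consider "x \<in> C" | y where "y \<in> C" "x = g y" | y where "y \<in> C" "x = h (g y)" | "x \<notin> C" "x \<notin> g ` C" "x \<notin> h ` g ` C" by blast
    thus "swp C (h o g) x = (swp C g o swp (g ` C) h o swp C g) x"
    proof cases
     case 1
     hence "swp C g x = g x" "swp (g ` C) h (g x) = h (g x)" by (auto simp: swp_in)
     moreover have "swp C g (h (g x)) = h (g x)" using 1 d2 d3 by (intro swp_out) auto
     ultimately show ?thesis using 1 by (simp add: swp_in)
    next
     case 2
     hence "swp C g x = y" using swp_image[OF inj(1) d1] by auto
     moreover have "swp (g ` C) h y = y" using 2 d1 d3 by (intro swp_out) auto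
     moreover have "swp C (h o g) x = x" using 2 d1 d2 by (intro swp_out) (auto simp: image_comp[symmetric])
     ultimately show ?thesis using 2 by (simp add: swp_in)
    next
     case 3
     have "swp C g x = x" using 3 d2 d3 by (intro swp_out) auto
     moreover have "swp (g ` C) h x = g y" using 3 swp_image[OF inj(2) d2] by auto
     moreover have "swp C g (g y) = y" using 3 swp_image[OF inj(1) d1] by auto
     moreover have "swp C (h o g) ((h o g) y) = y"
      using 3 d3 inj by (intro swp_image) (auto simp: image_comp intro: inj_compose)
     ultimately show ?thesis using 3 by simp
    next
     case 4
     hence "x \<notin> (h o g) ` C" by auto
     thus ?thesis using 4 by (simp add: swp_out)
    qed
   qed
   moreover have "swp C g \<in> G" using C CA d1 by (intro goodD[OF A(2)]) auto
   moreover have "swp (g ` C) h \<in> G" using C CA d2 image_sets[OF g] by (intro goodD[OF B]) auto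
   ultimately show "swp C (h o g) \<in> G" using clgrpD(3)[OF G] by auto
  qed
  show "good G (P t) (h o g)" for t using g0 g1 g2 g3 by (auto simp: P_def split: option.splits)
  have "A \<subseteq> (\<Union>t. P t)"
  proof
   fix x assume x: "x \<in> A"
   show "x \<in> (\<Union>t. P t)"
   proof (cases "x \<in> A0 \<or> x \<in> A1 \<or> x \<in> A2")
    case True
    hence "x \<in> P None \<or> x \<in> P (Some None) \<or> x \<in> P (Some (Some None))" by (simp add: P_def)
    thus ?thesis by blast
   next
    case False
    hence "g x ~= x" "h (g x) ~= g x" "(h o g) x ~= x" using x by (auto simp: A0_def A1_def A2_def)
    then obtain i j k where "x \<in> Q1 i" "g x \<in> Q2 j" "x \<in> Q3 k" using Q1(3) Q2(3) Q3(3) by blast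
    hence "x \<in> P (Some (Some (Some (i,j,k))))" using x by (simp add: P_def Q_def)
    thus ?thesis by blast
   qed
  qed
  hence "A - (\<Union>t. P t) = {}" by blast
  thus "prob (A - (\<Union>t. P t)) = 0" by (metis measure_empty)
 qed (rule A)
qed

end

section \<open>Products of maps with disjoint supports\<close>

definition dsup :: "('i => 'a => 'a) => bool" where
 "dsup w \<longleftrightarrow> (\<forall>i j x. w i x ~= x --> w j x ~= x --> i = j)"

text \<open>Under \<open>dsup\<close> at most one index moves \<open>x\<close>, so the infinite
  product is defined point by point, without a limit, and the choice is unambiguous.\<close>

definition dprod :: "('i => 'a => 'a) => 'a => 'a" where
 "dprod w x = (if \<exists>i. w i x ~= x then w (SOME i. w i x ~= x) x else x)"

lemma dsupD: "dsup w ==> w i x ~= x ==> w j x ~= x ==> i = j"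
 unfolding dsup_def by blast

lemma dprod_eq:
 assumes d: "dsup w" and x: "w i x ~= x"
 shows "dprod w x = w i x"
proof -
 have "w (SOME i. w i x ~= x) x ~= x" using x by (rule someI[of "\<lambda>i. w i x ~= x"])
 hence "(SOME i. w i x ~= x) = i" using dsupD[OF d _ x] by blast
 thus ?thesis using x by (auto simp: dprod_def)
qed

lemma dprod_id: "(\<And>i. w i x = x) ==> dprod w x = x"
 by (simp add: dprod_def)

lemma supp_invariant: "inj (f :: 'b => 'b) ==> f (f x) ~= f x \<longleftrightarrow> f x ~= x"
 by (simp add: inj_eq)

lemma dprod_supp:
 assumes d: "dsup w" and inj: "\<And>i. inj (w i)"
 shows "w i (dprod w x) ~= dprod w x \<longleftrightarrow> w i x ~= x"
proof (cases "\<exists>j. w j x ~= x")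
 case True
 then obtain j where j: "w j x ~= x" by blast
 have e: "dprod w x = w j x" by (rule dprod_eq[OF d j])
 have j': "w j (dprod w x) ~= dprod w x" using j supp_invariant[OF inj] by (simp add: e)
 show ?thesis using dsupD[OF d j] dsupD[OF d j'] j j' by blast
next
 case False
 thus ?thesis using dprod_id[of w x] by auto
qed

lemma dprod_funpow:
 assumes d: "dsup w" and inj: "\<And>i. inj (w i)" and x: "w i x ~= x"
 shows "(dprod w ^^ k) x = (w i ^^ k) x \<and> w i ((w i ^^ k) x) ~= (w i ^^ k) x"
proof (induction k)
 case (Suc k)
 thus ?case using dprod_eq[OF d, of i "(w i ^^ k) x"] supp_invariant[OF inj] by simp
qed (simp add: x)

lemma bij_dprod:
 assumes d: "dsup w" and bij: "\<And>i. bij (w i)"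
 shows "bij (dprod w)"
proof (rule bijI)
 have inj: "inj (w i)" for i using bij bij_is_inj by blast
 note sup = dprod_supp[OF d inj]
 show "inj (dprod w)"
 proof (rule injI)
  fix x y assume eq: "dprod w x = dprod w y"
  show "x = y"
  proof (cases "\<exists>i. w i x ~= x")
   case True
   then obtain i where i: "w i x ~= x" by blast
   hence i': "w i y ~= y" using sup[of i x] sup[of i y] eq by simp
   hence "w i x = w i y" using eq dprod_eq[OF d i] dprod_eq[OF d i'] by simp
   thus ?thesis by (rule injD[OF inj])
  next
   case False
   hence "w i y = y" for i using sup[of i x] sup[of i y] eq by auto
   thus ?thesis using False eq dprod_id[of w x] dprod_id[of w y] by auto
  qed
 qed
 have "y \<in> range (dprod w)" for y
 proof (cases "\<exists>i. w i y ~= y")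
  case True
  then obtain i where i: "w i y ~= y" by blast
  have y: "w i (inv (w i) y) = y" using bij by (simp add: bij_is_surj surj_f_inv_f)
  hence "w i (inv (w i) y) ~= inv (w i) y" using i by auto
  hence "dprod w (inv (w i) y) = y" using dprod_eq[OF d] y by metis
  thus ?thesis by (metis rangeI)
 next
  case False
  hence "dprod w y = y" using dprod_id[of w y] by blast
  thus ?thesis by (metis rangeI)
 qed
 thus "surj (dprod w)" by blast
qed

context std_prob
begin

lemma supp_sets: "f \<in> mpa ==> {x. f x ~= x} \<in> sets M"
 using neq_mpa[of f id] by simp

lemma good_inv_swp:
 assumes G: "clgrp G" and g: "g \<in> mpa" and A: "A \<in> sets M" "A \<inter> g ` A = {}" "good G A g"
 shows "good G (space M) (swp A g)"
proof (rule good_UN_nat[OF G swp_mpa[OF A(1) g A(2)]])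
 let ?C = "\<lambda>i::nat. if i = 0 then A else if i = 1 then g ` A else space M - A - g ` A"
 note gA = image_sets[OF g A(1)]
 show "?C i \<in> sets M" for i using A gA by auto
 have inj: "inj g" by (rule mpaD(2)[OF g])
 have "good G A (swp A g)"
  by (rule good_cong[OF A(3) g swp_mpa[OF A(1) g A(2)]]) (simp add: swp_in)
 moreover have "good G (g ` A) (swp A g)"
  by (rule good_cong[OF good_inv[OF g A(3)] inv_mpa[OF g] swp_mpa[OF A(1) g A(2)]])
    (auto simp: swp_image[OF inj A(2)] inv_f_f[OF inj])
 moreover have "good G (space M - A - g ` A) (swp A g)"
  by (rule good_fix[OF G]) (simp add: swp_out)
 ultimately show "good G (?C i) (swp A g)" for i by simp
 have "space M - (\<Union>i. ?C i) = {}"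
 proof -
  have "x \<in> ?C 0 \<or> x \<in> ?C 1 \<or> x \<in> ?C 2" if "x \<in> space M" for x using that by auto
  thus ?thesis by blast
 qed
 thus "prob (space M - (\<Union>i. ?C i)) = 0" by (metis measure_empty)
qed simp

lemma good_AE_subset:
 assumes G: "clgrp G" and g: "g \<in> mpa" and A: "A \<in> sets M" "good G A g"
  and B: "B \<in> sets M" "prob (B - A) = 0"
 shows "good G B g"
 by (rule good_UN_nat[OF G g, where A = "\<lambda>_. A"]) (use assms in auto)

text \<open>Running greedily through the pieces of \<open>separate\<close>, every moved point is
  either put into \<open>B\<close> or rejected because it lies in \<open>B\<close>, in its image or
  in its preimage. The three sets have the same measure, hence the factor 3.\<close>

lemma maximal_disjoint:
 assumes f: "f \<in> mpa"
 shows "\<exists>B\<in>sets M. B \<inter> f ` B = {} \<and> prob {x. f x ~= x} \<le> 3 * prob B"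
proof -
 obtain Q where Q: "\<And>i::nat. Q i \<in> sets M" "\<And>i. Q i \<inter> f ` Q i = {}" "{x. f x ~= x} \<subseteq> (\<Union>i. Q i)"
  using separate[OF f] by blast
 define BB where "BB = rec_nat {} (\<lambda>i B. B \<union> (Q i - (B \<union> f ` B \<union> f -` B)))"
 have BB: "BB 0 = {}" "BB (Suc i) = BB i \<union> (Q i - (BB i \<union> f ` BB i \<union> f -` BB i))" for i
  by (simp_all add: BB_def)
 have s: "BB i \<in> sets M" for i
 proof (induction i)
  case (Suc i) thus ?case
   using Q(1)[of i] image_sets[OF f Suc] vimage_sets[OF f Suc] by (auto simp: BB)
 qed (simp add: BB)
 have inc: "incseq BB" by (rule incseq_SucI) (auto simp: BB)
 have d: "BB i \<inter> f ` BB i = {}" for i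
 proof (induction i)
  case (Suc i)
  have "x \<notin> f ` BB (Suc i)" if x: "x \<in> BB (Suc i)" for x
  proof
   assume "x \<in> f ` BB (Suc i)"
   then obtain y where y: "y \<in> BB (Suc i)" "x = f y" by auto
   consider "x \<in> BB i" "y \<in> BB i" | "x \<in> BB i" "y \<notin> BB i" "y \<in> BB (Suc i)"
    | "x \<notin> BB i" "x \<in> BB (Suc i)" "y \<in> BB i" | "x \<notin> BB i" "y \<notin> BB i" using x y by blast
   thus False
   proof cases
    case 1 thus ?thesis using Suc y by auto
   next
    case 2 thus ?thesis using y by (simp add: BB)
   next
    case 3 thus ?thesis using y by (simp add: BB)
   next
    case 4
    hence "x \<in> Q i" "y \<in> Q i" using x y by (auto simp: BB)
    thus ?thesis using Q(2)[of i] y by auto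
   qed
  qed
  thus ?case by blast
 qed (simp add: BB)
 define B where "B = (\<Union>i. BB i)"
 have Bs: "B \<in> sets M" using s by (auto simp: B_def)
 have dB: "B \<inter> f ` B = {}"
 proof -
  have False if xy: "x \<in> BB i" "y \<in> BB j" "x = f y" for x y i j
  proof -
   have "x \<in> BB (max i j)" "y \<in> BB (max i j)"
    using xy incseqD[OF inc, of i "max i j"] incseqD[OF inc, of j "max i j"] by auto
   thus False using d[of "max i j"] xy(3) by blast
  qed
  thus ?thesis unfolding B_def by blast
 qed
 have "{x. f x ~= x} \<subseteq> (B \<union> f ` B) \<union> f -` B"
 proof
  fix x assume "x \<in> {x. f x ~= x}"
  then obtain i where "x \<in> Q i" using Q by blast
  hence "x \<in> BB (Suc i) \<or> x \<in> f ` BB i \<or> f x \<in> BB i" by (auto simp: BB)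
  thus "x \<in> (B \<union> f ` B) \<union> f -` B" by (auto simp: B_def)
 qed
 hence "prob {x. f x ~= x} \<le> prob ((B \<union> f ` B) \<union> f -` B)"
  using Bs image_sets[OF f Bs] vimage_sets[OF f Bs] by (intro finite_measure_mono) auto
 also have "... \<le> prob (B \<union> f ` B) + prob (f -` B)"
  using Bs image_sets[OF f Bs] vimage_sets[OF f Bs] by (intro measure_Un_le) auto
 also have "... \<le> (prob B + prob (f ` B)) + prob (f -` B)"
  using Bs image_sets[OF f Bs] measure_Un_le[of B M "f ` B"] by auto
 also have "... = 3 * prob B" by (simp add: prob_image[OF f Bs] prob_vimage[OF f Bs])
 finally show ?thesis using Bs dB by blast
qed

text \<open>The way back from local to actual membership: a swap taken from \<open>G\<close> undoes
  \<open>f\<close> on at least a third of its support, so repeated swaps bring \<open>s o f\<close>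
  arbitrarily close to the identity, and \<open>inv s\<close> close to \<open>f\<close>.\<close>

lemma good_imp_mem:
 assumes G: "clgrp G" and f: "f \<in> mpa" and gd: "good G (space M) f"
 shows "f \<in> G"
proof -
 have step: "\<exists>s\<in>G. good G (space M) (s o f) \<and> prob {x. (s o f) x ~= x} \<le> (2/3) ^ k" for k
 proof (induction k)
  case 0
  show ?case using clgrpD(2)[OF G] gd prob_le_1 by (intro bexI[of _ id]) auto
 next
  case (Suc k)
  then obtain s where s: "s \<in> G" "good G (space M) (s o f)" "prob {x. (s o f) x ~= x} \<le> (2/3)^k" by blast
  define g where "g = s o f"
  have g: "g \<in> mpa" using comp_mpa[OF clgrpD(1)[OF G s(1)] f] by (simp add: g_def)
  have inj: "inj g" by (rule mpaD(2)[OF g])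
  obtain B where B: "B \<in> sets M" "B \<inter> g ` B = {}" "prob {x. g x ~= x} \<le> 3 * prob B"
   using maximal_disjoint[OF g] by blast
  have Bs: "B \<subseteq> space M" using B sets.sets_into_space by blast
  let ?t = "swp B g"
  have gB: "good G B g" using s(2) Bs good_subset by (auto simp: g_def)
  have t: "?t \<in> G" using goodD[OF gB B(1) _ B(2)] by simp
  have tm: "?t \<in> mpa" using clgrpD(1)[OF G t] .
  have "good G (space M) (?t o g)"
  proof (rule good_comp[OF G g tm])
   show "good G (space M) g" using s(2) by (simp add: g_def)
   have "g ` space M \<subseteq> space M" using mpa_space[OF g] by auto
   thus "good G (g ` space M) ?t" using good_inv_swp[OF G g B(1,2) gB] good_subset by blast
  qed simp
  moreover have "prob {x. (?t o g) x ~= x} \<le> (2/3) ^ Suc k"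
  proof -
   \<comment> \<open>The swap undoes \<open>g\<close> on \<open>B\<close>, and a fixed point of
     \<open>g\<close> outside \<open>B\<close> cannot lie in the image of \<open>B\<close>.\<close>
   have sub: "{x. (?t o g) x ~= x} \<subseteq> {x. g x ~= x} - B"
   proof
    fix x assume x: "x \<in> {x. (?t o g) x ~= x}"
    have "x \<notin> B" using x swp_image[OF inj B(2)] by auto
    moreover have "g x ~= x"
    proof
     assume eq: "g x = x"
     hence "swp B g x ~= x" using x by simp
     hence "x \<in> g ` B" using \<open>x \<notin> B\<close> swp_out by metis
     hence "x \<in> B" using eq inj by (metis imageE injD)
     thus False using \<open>x \<notin> B\<close> by simp
    qed
    ultimately show "x \<in> {x. g x ~= x} - B" by simp
   qed
   have BS: "B \<subseteq> {x. g x ~= x}" using B(2) by force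
   have "prob {x. (?t o g) x ~= x} \<le> prob ({x. g x ~= x} - B)"
    using sub supp_sets[OF g] B(1) by (intro finite_measure_mono) auto
   also have "... = prob {x. g x ~= x} - prob B"
    using supp_sets[OF g] B(1) BS by (simp add: finite_measure_Diff)
   also have "... \<le> 2/3 * prob {x. g x ~= x}" using B(3) by linarith
   also have "... \<le> 2/3 * (2/3)^k" using s(3) by (simp add: g_def)
   finally show ?thesis by simp
  qed
  moreover have "(?t o s) o f = ?t o g" by (simp add: g_def comp_assoc)
  ultimately show ?case
   using clgrpD(3)[OF G t s(1)] by (intro bexI[of _ "?t o s"]) (simp_all only:)
 qed
 show ?thesis
 proof (rule clgrpD(5)[OF G f])
  fix e :: real assume "e > 0"
  then obtain k where k: "(2/3::real)^k < e" using real_arch_pow_inv[of e "2/3"] by auto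
  obtain s where s: "s \<in> G" "prob {x. (s o f) x ~= x} \<le> (2/3) ^ k" using step by blast
  have sm: "s \<in> mpa" using clgrpD(1)[OF G s(1)] .
  have "{x. f x ~= inv s x} = {x. (s o f) x ~= x}"
   using sm by (auto simp: mpa_inv_apply) (metis mpa_inv_apply(2))
  thus "\<exists>g\<in>G. prob {x. f x ~= g x} < e"
   using s k clgrpD(4)[OF G s(1)] by (intro bexI[of _ "inv s"]) auto
 qed
qed

lemma dprod_mpa:
 fixes w :: "'i::countable => 'a => 'a"
 assumes d: "dsup w" and w: "\<And>i. w i \<in> mpa"
 shows "dprod w \<in> mpa"
proof (rule mpa_piecewise)
 have inj: "inj (w i)" for i by (rule mpaD(2)[OF w])
 let ?C = "\<lambda>o'. case o' of None => space M - (\<Union>i. {x. w i x ~= x}) | Some i => {x. w i x ~= x}"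
 let ?g = "\<lambda>o'. case o' of None => id | Some i => w i"
 show "?C i \<in> sets M" for i using supp_sets[OF w] by (auto split: option.split)
 show "space M \<subseteq> (\<Union>i. ?C i)"
 proof
  fix x assume x: "x \<in> space M"
  show "x \<in> (\<Union>i. ?C i)"
  proof (cases "\<exists>i. w i x ~= x")
   case True
   then obtain i where "x \<in> ?C (Some i)" by auto
   thus ?thesis by blast
  next
   case False
   hence "x \<in> ?C None" using x by auto
   thus ?thesis by blast
  qed
 qed
 show "?g i \<in> mpa" for i using w by (auto split: option.split)
 show "dprod w x = ?g i x" if "x \<in> ?C i" for i x
  using that dprod_eq[OF d] dprod_id[of w x] by (auto split: option.splits)
 show "dprod w x = x" if "x \<notin> space M" for x
  using mpaD(4)[OF w that] by (intro dprod_id)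
 show "bij (dprod w)" by (rule bij_dprod[OF d mpaD(1)[OF w]])
qed

text \<open>Removing from the space all translates of one null set under the countable group
  generated by the \<open>f k\<close> leaves an invariant conull set, on which the property may be
  used at every point of an orbit.\<close>

lemma saturate:
 fixes f :: "nat => 'a => 'a"
 assumes f: "\<And>k. f k \<in> mpa" and Y: "AE x in M. P x"
 shows "\<exists>Z\<in>sets M. prob Z = 1 \<and> (\<forall>x\<in>Z. P x) \<and> (\<forall>k x. f k x \<in> Z \<longleftrightarrow> x \<in> Z)"
proof -
 obtain N where N: "{x \<in> space M. \<not> P x} \<subseteq> N" "N \<in> sets M" "emeasure M N = 0"
  using AE_E[OF Y] by metis
 \<comment> \<open>Even indices give the maps and odd ones their inverses, so that lists of numbers
   run through the whole group.\<close>
 define F where "F k = (if even k then f (k div 2) else inv (f (k div 2)))" for k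
 have F: "F k \<in> mpa" for k using f inv_mpa by (auto simp: F_def)
 define W where "W w = foldr (\<lambda>k g. F k o g) w id" for w
 have W_simps: "W [] = id" "W (k # w) = F k o W w" for k w by (simp_all add: W_def)
 have W: "W w \<in> mpa" for w by (induction w) (simp_all only: W_simps id_mpa comp_mpa F)
 have W_app: "W (v @ [k]) x = W v (F k x)" for v k x by (induction v) (auto simp: W_def)
 define Z where "Z = (\<Inter>w. W w -` (space M - N))"
 have Zs: "Z \<in> sets M" unfolding Z_def using N vimage_sets[OF W] by (intro sets.countable_INT) auto
 have FZ: "F k x \<in> Z" if "x \<in> Z" for k x
  unfolding Z_def
 proof
  fix w :: "nat list"
  have "W (w @ [k]) x \<in> space M - N" using that unfolding Z_def by blast
  thus "F k x \<in> W w -` (space M - N)" unfolding W_app by simp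
 qed
 show ?thesis
 proof (intro bexI conjI ballI allI)
  show "Z \<in> sets M" by fact
  have nullN: "prob N = 0" using N by (simp add: measure_def)
  have "AE x in M. x \<in> W w -` (space M - N)" for w
  proof -
   have "AE x in M. x \<notin> N" using N by (intro AE_not_in) (auto simp: null_sets_def)
   hence "AE x in M. W w x \<notin> N" by (rule AE_mpa[OF W])
   thus ?thesis using AE_space by eventually_elim (simp add: mpa_space[OF W])
  qed
  hence "AE x in M. x \<in> Z" unfolding Z_def by (simp add: AE_all_countable)
  thus "prob Z = 1" using prob_eq_1[OF Zs] by simp
  show "P x" if "x \<in> Z" for x
  proof -
   have "x \<in> W [] -` (space M - N)" using that unfolding Z_def by blast
   thus ?thesis using N(1) by (auto simp: W_def)
  qed
  fix k x
  show "f k x \<in> Z \<longleftrightarrow> x \<in> Z"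
  proof
   assume "x \<in> Z"
   thus "f k x \<in> Z" using FZ[of x "2 * k"] by (simp add: F_def)
  next
   assume "f k x \<in> Z"
   hence "inv (f k) (f k x) \<in> Z" using FZ[of "f k x" "2 * k + 1"] by (simp add: F_def)
   thus "x \<in> Z" using f by simp
  qed
 qed
qed

end

text \<open>Sierpinski's theorem by exhaustion: halving gives subsets of arbitrarily small positive
  measure, and a greedy union of admissible sets cannot stop below \<open>t\<close>.\<close>

lemma nonatomic_split:
 assumes P: "prob_space M" and na: "non_atomic M"
  and A: "A \<in> sets M" and t: "0 \<le> t" "t \<le> measure M A"
 shows "\<exists>B\<in>sets M. B \<subseteq> A \<and> measure M B = t"
proof -
 interpret prob_space M by (rule P)
 have half: "\<exists>B\<in>sets M. B \<subseteq> A \<and> 0 < prob B \<and> prob B \<le> prob A / 2" if A: "A \<in> sets M" "0 < prob A" for A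
 proof -
  have "\<forall>A\<in>sets M. 0 < prob A --> (\<exists>B\<in>sets M. B \<subseteq> A \<and> 0 < prob B \<and> prob B < prob A)"
   using na unfolding non_atomic_def by (simp add: emeasure_eq_measure ennreal_less_iff)
  from this[THEN bspec, OF A(1)] A(2)
  obtain B where B: "B \<in> sets M" "B \<subseteq> A" "0 < prob B" "prob B < prob A"
   by blast
  show ?thesis
  proof (cases "prob B \<le> prob A / 2")
   case False
   have "prob (A - B) = prob A - prob B" using B that by (simp add: finite_measure_Diff)
   thus ?thesis using B False that by (intro bexI[of _ "A - B"]) auto
  qed (use B in blast)
 qed
 have small: "\<exists>B\<in>sets M. B \<subseteq> A \<and> 0 < prob B \<and> prob B < e" if A: "A \<in> sets M" "0 < prob A" and e: "e > 0" for A e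
 proof -
  have "\<exists>B\<in>sets M. B \<subseteq> A \<and> 0 < prob B \<and> prob B \<le> (1/2)^k" for k
  proof (induction k)
   case 0 thus ?case using A prob_le_1 by (intro bexI[of _ A]) auto
  next
   case (Suc k)
   then obtain B where B: "B \<in> sets M" "B \<subseteq> A" "0 < prob B" "prob B \<le> (1/2)^k" by blast
   obtain C where "C \<in> sets M" "C \<subseteq> B" "0 < prob C" "prob C \<le> prob B / 2" using half B by blast
   thus ?case using B by (intro bexI[of _ C]) auto
  qed
  moreover obtain k where "(1/2::real)^k < e" using real_arch_pow_inv[of e "1/2"] e by auto
  ultimately show ?thesis by (meson order_le_less_trans)
 qed
 \<comment> \<open>The measures by which \<open>B\<close> may still grow without exceeding
   \<open>t\<close>; each stage will take at least half of their supremum.\<close>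
 define S where "S B = {prob C |C. C \<in> sets M \<and> C \<subseteq> A - B \<and> prob B + prob C \<le> t}" for B
 have Sb: "bdd_above (S B)" for B unfolding S_def by (rule bdd_aboveI[of _ 1]) auto
 have ex: "\<exists>C. C \<in> sets M \<and> C \<subseteq> A - B \<and> prob B + prob C \<le> t \<and> Sup (S B) / 2 \<le> prob C"
  if B: "prob B \<le> t" for B
 proof (cases "Sup (S B) > 0")
  case True
  have "S B ~= {}" unfolding S_def using B by (auto intro!: exI[of _ "{}"])
  moreover have "Sup (S B) / 2 < Sup (S B)" using True by simp
  ultimately obtain x where "x \<in> S B" "Sup (S B) / 2 < x" using less_cSup_iff[OF _ Sb] by blast
  thus ?thesis unfolding S_def by auto
 next
  case False
  thus ?thesis using B by (intro exI[of _ "{}"]) auto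
 qed
 define nxt where "nxt B = (SOME C. C \<in> sets M \<and> C \<subseteq> A - B \<and> prob B + prob C \<le> t \<and> Sup (S B) / 2 \<le> prob C)" for B
 have nxt: "nxt B \<in> sets M" "nxt B \<subseteq> A - B" "prob B + prob (nxt B) \<le> t" "Sup (S B) / 2 \<le> prob (nxt B)"
  if "prob B \<le> t" for B
  using someI_ex[OF ex[OF that]] unfolding nxt_def by blast+
 define BB where "BB = rec_nat {} (\<lambda>_ B. B \<union> nxt B)"
 have BB: "BB 0 = {}" "BB (Suc k) = BB k \<union> nxt (BB k)" for k by (simp_all add: BB_def)
 have inv: "BB k \<in> sets M \<and> BB k \<subseteq> A \<and> prob (BB k) \<le> t" for k
 proof (induction k)
  case (Suc k)
  hence "prob (BB k \<union> nxt (BB k)) = prob (BB k) + prob (nxt (BB k))"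
   using nxt[of "BB k"] by (intro finite_measure_Union) auto
  thus ?case using nxt[of "BB k"] Suc by (auto simp: BB)
 qed (use t in \<open>auto simp: BB\<close>)
 have add: "prob (BB (Suc k)) = prob (BB k) + prob (nxt (BB k))" for k
  using inv[of k] nxt[of "BB k"] unfolding BB by (intro finite_measure_Union) auto
 have inc: "incseq BB" by (rule incseq_SucI) (auto simp: BB)
 let ?B = "\<Union>k. BB k"
 have Bs: "?B \<in> sets M" "?B \<subseteq> A" using inv by auto
 have lim: "(\<lambda>k. prob (BB k)) \<longlonglongrightarrow> prob ?B"
  using inv inc by (intro finite_Lim_measure_incseq) auto
 hence le: "prob ?B \<le> t" using inv by (intro LIMSEQ_le_const2[OF lim]) auto
 have "prob ?B = t"
 proof (rule ccontr)
  assume "prob ?B ~= t"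
  hence lt: "prob ?B < t" using le by simp
  hence "0 < prob (A - ?B)" using t A Bs by (simp add: finite_measure_Diff)
  then obtain C where C: "C \<in> sets M" "C \<subseteq> A - ?B" "0 < prob C" "prob C < t - prob ?B"
   using small[of "A - ?B" "t - prob ?B"] A Bs lt by auto
  \<comment> \<open>The set \<open>C\<close> was admissible at every stage, so every stage gained at
    least half of its measure, which is impossible in a probability space.\<close>
  have "prob C / 2 \<le> prob (nxt (BB k))" for k
  proof -
   have "prob (BB k) \<le> prob ?B" using Bs inv by (intro finite_measure_mono) auto
   hence "prob C \<in> S (BB k)" using C unfolding S_def by (intro CollectI exI[of _ C]) auto
   hence "prob C \<le> Sup (S (BB k))" by (intro cSup_upper Sb)
   thus ?thesis using nxt(4)[of "BB k"] inv[of k] by simp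
  qed
  hence ge: "prob (BB (Suc k)) \<ge> prob (BB k) + prob C / 2" for k using add[of k] by simp
  have "prob (BB k) \<ge> k * (prob C / 2)" for k
  proof (induction k)
   case (Suc k) thus ?case using ge[of k] by (simp add: algebra_simps)
  qed simp
  moreover obtain k :: nat where "k * (prob C / 2) > 1" using C(3) reals_Archimedean3[of "prob C / 2"] by (metis half_gt_zero)
  ultimately show False using prob_le_1 by (meson less_le_not_le order_trans)
 qed
 thus ?thesis using Bs by blast
qed

section \<open>Full groups generated by involutions\<close>

context std_prob
begin

text \<open>Greedy matching of \<open>A - B\<close> with \<open>B - A\<close> along the maps
  \<open>h k\<close>. The part \<open>A \<inter> B\<close> is left alone, which is why the
  involution is supported in the symmetric difference.\<close>

lemma exchange:
 fixes h :: "nat => 'a => 'a"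
 assumes h: "\<And>k. h k \<in> mpa"
  and erg: "\<And>A B. A \<in> sets M ==> B \<in> sets M ==> prob A > 0 ==> prob B > 0 ==> \<exists>k. prob (A \<inter> h k -` B) > 0"
  and A: "A \<in> sets M" and B: "B \<in> sets M" and eq: "prob A = prob B"
 shows "\<exists>f\<in>mpa. (\<forall>x. f (f x) = x) \<and> (\<forall>x. f x ~= x --> x \<in> (A - B) \<union> (B - A)) \<and>
  (\<exists>A0\<in>sets M. A0 \<subseteq> A \<and> prob (A - A0) = 0 \<and> f ` A0 \<subseteq> B) \<and>
  (\<forall>x. f x = x \<or> (\<exists>k. f x = h k x \<or> h k (f x) = x))"
proof -
 define A' where "A' = A - B"
 define B' where "B' = B - A"
 have AB: "A' \<in> sets M" "B' \<in> sets M" "A' \<inter> B' = {}" using A B by (auto simp: A'_def B'_def)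
 have "prob A' = prob A - prob (A \<inter> B)" "prob B' = prob B - prob (A \<inter> B)"
  using A B by (auto simp: A'_def B'_def finite_measure_Diff' Int_commute)
 hence eq': "prob A' = prob B'" using eq by simp
 define UV where "UV = rec_nat ({}, {}) (\<lambda>k (U, V). (U \<union> (A' - U) \<inter> h k -` (B' - V), V \<union> h k ` ((A' - U) \<inter> h k -` (B' - V))))"
 define UU where "UU k = fst (UV k)" for k
 define VV where "VV k = snd (UV k)" for k
 define P where "P k = (A' - UU k) \<inter> h k -` (B' - VV k)" for k
 have rec: "UU 0 = {}" "VV 0 = {}" "UU (Suc k) = UU k \<union> P k" "VV (Suc k) = VV k \<union> h k ` P k" for k
  by (auto simp: UU_def VV_def P_def UV_def split: prod.splits)
 have UVs: "UU k \<in> sets M \<and> VV k \<in> sets M" for k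
 proof (induction k)
  case (Suc k)
  hence "P k \<in> sets M" unfolding P_def using AB vimage_sets[OF h] by auto
  thus ?case using Suc image_sets[OF h] by (auto simp: rec)
 qed (simp add: rec)
 have Ps: "P k \<in> sets M" for k
  unfolding P_def using UVs[of k] AB(1,2) vimage_sets[OF h, of "B' - VV k"] by auto
 have PA: "P k \<subseteq> A'" "h k ` P k \<subseteq> B'" "P k \<inter> UU k = {}" "h k ` P k \<inter> VV k = {}" for k
  by (auto simp: P_def)
 have mono: "UU i \<subseteq> UU j \<and> VV i \<subseteq> VV j" if "i \<le> j" for i j
  using that by (induction j rule: dec_induct) (auto simp: rec)
 have PUU: "P i \<subseteq> UU j \<and> h i ` P i \<subseteq> VV j" if "i < j" for i j
  using mono[of "Suc i" j] that by (auto simp: rec)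
 define w where "w k = swp (P k) (h k)" for k
 have dk: "P k \<inter> h k ` P k = {}" for k using PA(1,2)[of k] AB(3) by blast
 have inj: "inj (h k)" for k by (rule mpaD(2)[OF h])
 have wx: "x \<in> P k \<union> h k ` P k" if "w k x ~= x" for k x using that swp_out unfolding w_def by (metis UnI1 UnI2)
 have dlt: "(P i \<union> h i ` P i) \<inter> (P j \<union> h j ` P j) = {}" if "i < j" for i j
 proof -
  have "P i \<inter> P j = {}" using PUU[OF that] PA(3)[of j] by blast
  moreover have "h i ` P i \<inter> h j ` P j = {}" using PUU[OF that] PA(4)[of j] by blast
  moreover have "P i \<inter> h j ` P j = {}" "h i ` P i \<inter> P j = {}"
   using PA(1,2)[of i] PA(1,2)[of j] AB(3) by blast+
  ultimately show ?thesis by blast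
 qed
 have ds: "dsup w" unfolding dsup_def
 proof (intro allI impI)
  fix i j x assume ij: "w i x ~= x" "w j x ~= x"
  show "i = j"
  proof (rule linorder_cases[of i j])
   assume "i < j" thus ?thesis using wx[OF ij(1)] wx[OF ij(2)] dlt[of i j] by blast
  next
   assume "j < i" thus ?thesis using wx[OF ij(1)] wx[OF ij(2)] dlt[of j i] by blast
  qed
 qed
 have wm: "w k \<in> mpa" for k unfolding w_def by (rule swp_mpa[OF Ps h dk])
 have ww: "w k (w k x) = x" for k x unfolding w_def by (rule swp_swp[OF inj dk])
 define f where "f = dprod w"
 have fm: "f \<in> mpa" unfolding f_def by (rule dprod_mpa[OF ds wm])
 have cases: "(\<exists>k. w k x ~= x \<and> f x = w k x) \<or> f x = x" for x
  unfolding f_def using dprod_eq[OF ds] dprod_id[of w x] by metis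
 have fw: "f x = w k x" if "w k x ~= x" for x k unfolding f_def by (rule dprod_eq[OF ds that])
 have fP: "f x = h k x" if "x \<in> P k" for x k
 proof -
  have "w k x = h k x" using that by (simp add: w_def swp_in)
  moreover have "h k x ~= x" using dk[of k] that by (metis IntI empty_iff imageI)
  ultimately show ?thesis using fw[of k x] by simp
 qed
 show ?thesis
 proof (intro bexI[OF _ fm] conjI allI impI)
  fix x
  show "f (f x) = x"
  proof (cases "f x = x")
   case False
   then obtain k where k: "w k x ~= x" "f x = w k x" using cases[of x] by blast
   have "w k (w k x) ~= w k x" using k ww[of k x] by simp
   thus ?thesis using fw[of k "w k x"] k ww[of k x] by simp
  qed simp
  show "x \<in> (A - B) \<union> (B - A)" if neq: "f x ~= x"
  proof -
   obtain k where k: "w k x ~= x" using cases[of x] neq by blast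
   show ?thesis using wx[OF k] PA(1,2)[of k] by (auto simp: A'_def B'_def)
  qed
  show "f x = x \<or> (\<exists>k. f x = h k x \<or> h k (f x) = x)"
  proof (cases "f x = x")
   case False
   then obtain k where k: "w k x ~= x" "f x = w k x" using cases[of x] by blast
   from wx[OF k(1)] show ?thesis
   proof
    assume "x \<in> P k" thus ?thesis using fP by blast
   next
    assume "x \<in> h k ` P k"
    then obtain y where y: "y \<in> P k" "x = h k y" by blast
    hence "w k x = y" unfolding w_def using swp_image[OF inj dk] by simp
    thus ?thesis using k y by auto
   qed
  qed simp
 next
  let ?U = "\<Union>k. P k" and ?V = "\<Union>k. h k ` P k"
  let ?A0 = "(A \<inter> B) \<union> ?U"
  have Us: "?U \<in> sets M" "?V \<in> sets M" using Ps image_sets[OF h Ps] by auto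
  have UU: "x \<in> UU k ==> x \<in> ?U" "x \<in> VV k ==> x \<in> ?V" for x k
   by (induction k) (auto simp: rec)
  have "prob ?U = prob ?V"
  proof -
   have "disjoint_family P" "disjoint_family (\<lambda>k. h k ` P k)"
    unfolding disjoint_family_on_def using dlt by (metis (no_types, lifting) Int_Un_distrib Int_Un_distrib2 Un_empty inf_commute nat_neq_iff)+
   hence "(\<lambda>k. prob (P k)) sums prob ?U" "(\<lambda>k. prob (h k ` P k)) sums prob ?V"
    using Ps image_sets[OF h Ps] by (auto intro!: finite_measure_UNION)
   moreover have "prob (h k ` P k) = prob (P k)" for k by (rule prob_image[OF h Ps])
   ultimately show ?thesis using sums_unique2 by fastforce
  qed
  moreover have UA: "?U \<subseteq> A'" "?V \<subseteq> B'" using PA(1) PA(2) by blast+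
  ultimately have e: "prob (A' - ?U) = prob (B' - ?V)"
   using eq' AB Us by (simp add: finite_measure_Diff)
  \<comment> \<open>The leftovers on both sides have equal measure. If it were positive, some
    \<open>h k\<close> would carry a non-null part of one into the other, but stage \<open>k\<close>
    has already taken all such points.\<close>
  have "prob (A' - ?U) = 0"
  proof (rule ccontr)
   assume "prob (A' - ?U) ~= 0"
   hence "prob (A' - ?U) > 0" "prob (B' - ?V) > 0" using e by (auto simp: zero_less_measure_iff)
   then obtain k where "prob ((A' - ?U) \<inter> h k -` (B' - ?V)) > 0"
    using erg[OF sets.Diff[OF AB(1) Us(1)] sets.Diff[OF AB(2) Us(2)]] by blast
   moreover have "(A' - ?U) \<inter> h k -` (B' - ?V) = {}"
   proof -
    have False if x: "x \<in> A'" "x \<notin> ?U" "h k x \<in> B'" "h k x \<notin> ?V" for x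
    proof -
     have "x \<notin> UU k" "h k x \<notin> VV k" using UU(1)[of x k] UU(2)[of "h k x" k] x by auto
     hence "x \<in> P k" using x by (simp add: P_def)
     thus False using x(2) by blast
    qed
    thus ?thesis by blast
   qed
   ultimately show False by simp
  qed
  moreover have "A - ?A0 = A' - ?U" by (auto simp: A'_def)
  ultimately have "prob (A - ?A0) = 0" by simp
  moreover have "f x \<in> B" if "x \<in> ?A0" for x
  proof (cases "x \<in> ?U")
   case True
   then obtain k where "x \<in> P k" by blast
   thus ?thesis using fP PA(2)[of k] by (auto simp: B'_def)
  next
   case False
   hence x: "x \<in> A \<inter> B" using that by blast
   have "f x = x"
   proof (rule ccontr)
    assume "f x ~= x"
    then obtain k where k: "w k x ~= x" using cases[of x] by blast
    show False using wx[OF k] PA(1,2)[of k] x by (auto simp: A'_def B'_def)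
   qed
   thus ?thesis using x by simp
  qed
  ultimately show "\<exists>A0\<in>sets M. A0 \<subseteq> A \<and> prob (A - A0) = 0 \<and> f ` A0 \<subseteq> B"
   using Us A B UA by (intro bexI[of _ ?A0]) (auto simp: A'_def)
 qed
qed

definition aeq :: "'a set => 'a set => bool" where
 "aeq A B \<longleftrightarrow> (AE x in M. x \<in> A \<longleftrightarrow> x \<in> B)"

lemma aeq_trans:
 assumes "aeq A B" "aeq B C" shows "aeq A C"
 using assms unfolding aeq_def by eventually_elim simp

lemma aeq_sym:
 assumes "aeq A B" shows "aeq B A"
 using assms unfolding aeq_def by eventually_elim simp

lemma aeq_image: "f \<in> mpa ==> aeq A B ==> aeq (f ` A) (f ` B)"
 unfolding aeq_def using AE_mpa[OF inv_mpa, of f] by (simp add: image_eq)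

lemma aeq_subset:
 assumes "A \<in> sets M" "B \<in> sets M" "A \<subseteq> B" "prob A = prob B"
 shows "aeq A B"
proof -
 have "prob (B - A) = 0" using assms by (simp add: finite_measure_Diff)
 hence "AE x in M. x \<notin> B - A" using assms prob_eq_0 by auto
 thus ?thesis unfolding aeq_def by eventually_elim (use assms(3) in auto)
qed

end

text \<open>The relation is presented by countably many involutions, to which partial isomorphisms
  with disjoint domain and range extend. The inverse of a word is then its reversal.\<close>

locale gam = std_prob M U for M :: "'a measure" and U +
 fixes gs :: "nat => 'a => 'a"
 assumes na: "non_atomic M"
  and gs_mpa: "\<And>i. gs i \<in> mpa" and gs_gs: "\<And>i x. gs i (gs i x) = x"
  and ergodic: "\<And>A. A \<in> sets M ==> (\<And>i x. x \<in> A ==> gs i x \<in> A) ==> prob A = 0 \<or> prob A = 1"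
begin

definition wd :: "nat list => 'a => 'a" where
 "wd w = foldr (\<lambda>i f. gs i o f) w id"

lemma wd_simps [simp]: "wd [] = id" "wd (i # w) = gs i o wd w"
 by (simp_all add: wd_def)

lemma wd_append: "wd (v @ w) = wd v o wd w"
 by (induction v) (auto simp: comp_assoc)

lemma wd_mpa: "wd w \<in> mpa"
 by (induction w) (simp_all only: wd_simps id_mpa comp_mpa gs_mpa)

lemma wd_rev: "wd (rev w) (wd w x) = x"
 by (induction w arbitrary: x) (auto simp: wd_append gs_gs)

definition orb :: "'a => 'a => bool" where
 "orb x y \<longleftrightarrow> (\<exists>w. y = wd w x)"

lemma orb_refl [simp]: "orb x x"
 unfolding orb_def by (rule exI[of _ "[]"]) simp

lemma orb_wd [simp]: "orb x (wd w x)"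
 unfolding orb_def by blast

lemma orb_gs [simp]: "orb x (gs i x)"
 using orb_wd[of x "[i]"] by simp

lemma orb_sym: "orb x y ==> orb y x"
 unfolding orb_def by (metis wd_rev)

lemma orb_trans: "orb x y ==> orb y z ==> orb x z"
 unfolding orb_def by (metis comp_apply wd_append)

definition fullg :: "('a => 'a) set" where
 "fullg = {f \<in> mpa. AE x in M. orb x (f x)}"

lemma fullgD: "f \<in> fullg ==> f \<in> mpa" "f \<in> fullg ==> AE x in M. orb x (f x)"
 by (auto simp: fullg_def)

lemma fullgI: "f \<in> mpa ==> (\<And>x. orb x (f x)) ==> f \<in> fullg"
 by (auto simp: fullg_def)

lemma fullg_id: "id \<in> fullg"
 by (rule fullgI) auto

lemma fullg_wd: "wd w \<in> fullg"
 by (rule fullgI) (auto simp: wd_mpa)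

lemma fullg_comp:
 assumes "f \<in> fullg" "g \<in> fullg" shows "f o g \<in> fullg"
proof -
 have "AE x in M. orb (g x) (f (g x))" using AE_mpa[OF fullgD(1)[OF assms(2)] fullgD(2)[OF assms(1)]] .
 with fullgD(2)[OF assms(2)] have "AE x in M. orb x ((f o g) x)"
  by eventually_elim (auto intro: orb_trans)
 thus ?thesis using comp_mpa assms by (auto simp: fullg_def)
qed

lemma fullg_inv:
 assumes "f \<in> fullg" shows "inv f \<in> fullg"
proof -
 have f: "f \<in> mpa" using assms fullgD by blast
 have "AE x in M. orb (inv f x) (f (inv f x))" using AE_mpa[OF inv_mpa[OF f] fullgD(2)[OF assms]] .
 hence "AE x in M. orb x (inv f x)" by eventually_elim (use f in \<open>auto intro: orb_sym\<close>)
 thus ?thesis using inv_mpa[OF f] by (auto simp: fullg_def)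
qed

lemma fullg_funpow: "f \<in> fullg ==> f ^^ n \<in> fullg"
 by (induction n) (auto intro: fullg_comp fullg_id)

lemma fullg_swp:
 assumes A: "A \<in> sets M" "A \<inter> g ` A = {}" and g: "g \<in> fullg"
 shows "swp A g \<in> fullg"
proof -
 have gm: "g \<in> mpa" using fullgD g by blast
 have "AE x in M. orb x (swp A g x)"
  using fullgD(2)[OF g] fullgD(2)[OF fullg_inv[OF g]]
  by eventually_elim (auto simp: swp_def)
 thus ?thesis using swp_mpa[OF A(1) gm A(2)] by (auto simp: fullg_def)
qed

lemma fullg_dprod:
 fixes w :: "'i::countable => 'a => 'a"
 assumes d: "dsup w" and w: "\<And>i. w i \<in> fullg"
 shows "dprod w \<in> fullg"
proof -
 have "AE x in M. \<forall>i. orb x (w i x)" using fullgD(2)[OF w] by (simp add: AE_all_countable)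
 hence "AE x in M. orb x (dprod w x)"
  by eventually_elim (metis dprod_eq[OF d] dprod_id orb_refl)
 thus ?thesis using dprod_mpa[OF d fullgD(1)[OF w]] by (auto simp: fullg_def)
qed

text \<open>The points whose orbit meets \<open>B\<close> form an invariant set that contains
  \<open>B\<close>.\<close>

lemma sweep:
 assumes B: "B \<in> sets M" "prob B > 0"
 shows "AE x in M. \<exists>w. wd w x \<in> B"
proof -
 let ?S = "\<Union>w. wd w -` B"
 have Ss: "?S \<in> sets M" using vimage_sets[OF wd_mpa B(1)] by (intro sets.countable_UN) auto
 have "prob ?S = 0 \<or> prob ?S = 1"
 proof (rule ergodic[OF Ss])
  fix i x assume "x \<in> ?S"
  then obtain w where "wd w x \<in> B" by auto
  hence "wd (w @ [i]) (gs i x) \<in> B" by (simp add: wd_append gs_gs)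
  thus "gs i x \<in> ?S" by blast
 qed
 moreover have "prob B \<le> prob ?S"
 proof (rule finite_measure_mono[OF _ Ss])
  have "B = wd [] -` B" by simp
  thus "B \<subseteq> ?S" by blast
 qed
 ultimately have "prob ?S = 1" using B(2) by linarith
 hence "AE x in M. x \<in> ?S" using prob_eq_1[OF Ss] by simp
 thus ?thesis by eventually_elim auto
qed

text \<open>The enumerated words satisfy the recurrence condition of \<open>exchange\<close>,
  because by \<open>sweep\<close> almost every orbit meets a set of positive measure.\<close>

lemma exchange_full:
 assumes A: "A \<in> sets M" and B: "B \<in> sets M" and eq: "prob A = prob B"
 shows "\<exists>f\<in>fullg. (\<forall>x. f (f x) = x) \<and> (\<forall>x. f x ~= x --> x \<in> (A - B) \<union> (B - A)) \<and>
  (\<exists>A0\<in>sets M. A0 \<subseteq> A \<and> prob (A - A0) = 0 \<and> f ` A0 \<subseteq> B)"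
proof -
 let ?h = "\<lambda>k. wd (from_nat k)"
 have "\<exists>f\<in>mpa. (\<forall>x. f (f x) = x) \<and> (\<forall>x. f x ~= x --> x \<in> (A - B) \<union> (B - A)) \<and>
  (\<exists>A0\<in>sets M. A0 \<subseteq> A \<and> prob (A - A0) = 0 \<and> f ` A0 \<subseteq> B) \<and>
  (\<forall>x. f x = x \<or> (\<exists>k. f x = ?h k x \<or> ?h k (f x) = x))"
 proof (rule exchange[OF wd_mpa _ A B eq])
  fix A B assume AB: "A \<in> sets M" "B \<in> sets M" "prob A > 0" "prob B > 0"
  show "\<exists>k. prob (A \<inter> ?h k -` B) > 0"
  proof (rule ccontr)
   assume "\<not> (\<exists>k. prob (A \<inter> ?h k -` B) > 0)"
   hence "prob (A \<inter> wd w -` B) = 0" for w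
    by (metis from_nat_to_nat zero_less_measure_iff)
   hence "AE x in M. x \<notin> A \<inter> wd w -` B" for w
    using prob_eq_0 AB(1) vimage_sets[OF wd_mpa AB(2)] by auto
   hence "AE x in M. \<forall>w. x \<notin> A \<inter> wd w -` B" unfolding AE_all_countable by blast
   with sweep[OF AB(2,4)] have "AE x in M. x \<notin> A" by eventually_elim auto
   thus False using prob_eq_0[OF AB(1)] AB(3) by simp
  qed
 qed
 then obtain f where f: "f \<in> mpa" "\<forall>x. f (f x) = x" "\<forall>x. f x ~= x --> x \<in> (A - B) \<union> (B - A)"
  "\<exists>A0\<in>sets M. A0 \<subseteq> A \<and> prob (A - A0) = 0 \<and> f ` A0 \<subseteq> B"
  "\<forall>x. f x = x \<or> (\<exists>k. f x = ?h k x \<or> ?h k (f x) = x)" by blast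
 have "orb x (f x)" for x using f(5) by (metis orb_refl orb_sym orb_wd)
 hence "f \<in> fullg" using f(1) by (intro fullgI)
 thus ?thesis using f by blast
qed

text \<open>A tower of height \<open>N\<close> over the base \<open>B\<close>, whose top level is mapped back to the base.\<close>

definition state :: "'a set => ('a => 'a) => nat => bool" where
 "state B s N \<longleftrightarrow> B \<in> sets M \<and> s \<in> fullg \<and> N > 0 \<and> prob B = 1 / N \<and>
   (\<forall>x\<in>B. \<forall>i. 0 < i \<and> i < N --> (s ^^ i) x \<notin> B) \<and> (\<forall>x\<in>B. (s ^^ N) x = x)"

text \<open>The map may change only where it returns to the old base. As the bases shrink to a null
  set, the maps of successive towers stabilise at almost every point.\<close>

definition ext :: "'a set => ('a => 'a) => 'a set => ('a => 'a) => bool" where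
 "ext B s B' s' \<longleftrightarrow> B' \<subseteq> B \<and> (\<forall>x. s x \<notin> B --> s' x = s x)"

lemma ext_refl: "ext B s B s"
 by (simp add: ext_def)

lemma ext_trans: "ext B s B' s' ==> ext B' s' B'' s'' ==> ext B s B'' s''"
 unfolding ext_def by (metis subset_iff)

text \<open>Cutting and stacking: from the top of the tower over \<open>H\<close> the composite goes
  on to the other half of the base instead of returning, climbs the tower again and only then closes
  up.\<close>

lemma halve:
 assumes S: "state B s N" and H: "H \<in> sets M" "H \<subseteq> B" "prob H = prob B / 2"
  and r: "r \<in> fullg" "\<And>x. r (r x) = x" "\<And>x. r x ~= x ==> x \<in> B" "r ` H \<inter> H = {}"
 shows "state H (r o s) (2 * N)" "ext B s H (r o s)"
  "\<And>x i. x \<in> H ==> i < N ==> ((r o s) ^^ i) x = (s ^^ i) x"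
  "\<And>x i. x \<in> H ==> i < N ==> ((r o s) ^^ (N + i)) x = (s ^^ i) (r x)"
proof -
 note Sd = S[unfolded state_def]
 have rB: "r x \<in> B" if "x \<in> B" for x using r(2)[of x] r(3)[of "r x"] that by metis
 have 1: "((r o s) ^^ i) x = (s ^^ i) x" if "x \<in> B" "i < N" for x i
  using that(2)
 proof (induction i)
  case (Suc i)
  hence "(s ^^ Suc i) x \<notin> B" using Sd that(1) by blast
  hence "r ((s ^^ Suc i) x) = (s ^^ Suc i) x" using r(3) by blast
  thus ?case using Suc by simp
 qed simp
 \<comment> \<open>At height \<open>N\<close> the map \<open>s\<close> has come back to its starting
   point, and \<open>r\<close> moves that point to the other half of the base.\<close>
 have 2: "((r o s) ^^ N) x = r x" if "x \<in> B" for x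
 proof -
  obtain n where n: "N = Suc n" using Sd by (cases N) auto
  have "((r o s) ^^ N) x = r (s ((s ^^ n) x))" using 1[OF that, of n] n by simp
  also have "s ((s ^^ n) x) = (s ^^ N) x" using n by simp
  also have "... = x" using Sd that by blast
  finally show ?thesis .
 qed
 have 3: "((r o s) ^^ (N + i)) x = (s ^^ i) (r x)" if "x \<in> B" "i < N" for x i
 proof -
  have "((r o s) ^^ (N + i)) x = ((r o s) ^^ i) (((r o s) ^^ N) x)"
   by (subst add.commute) (simp only: funpow_add comp_apply)
  thus ?thesis using 1[OF rB that(2)] 2 that by simp
 qed
 show "\<And>x i. x \<in> H ==> i < N ==> ((r o s) ^^ i) x = (s ^^ i) x" using 1 H by auto
 show "\<And>x i. x \<in> H ==> i < N ==> ((r o s) ^^ (N + i)) x = (s ^^ i) (r x)" using 3 H by auto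
 show "ext B s H (r o s)" unfolding ext_def using H r(3) by auto
 show "state H (r o s) (2 * N)" unfolding state_def
 proof (intro conjI ballI allI impI)
  show "r o s \<in> fullg" using fullg_comp r Sd by blast
  fix x assume x: "x \<in> H"
  hence xB: "x \<in> B" using H by auto
  show "((r o s) ^^ (2 * N)) x = x"
  proof -
   have "((r o s) ^^ (N + N)) x = ((r o s) ^^ N) (((r o s) ^^ N) x)" by (simp only: funpow_add comp_apply)
   thus ?thesis using 2[OF xB] 2[OF rB[OF xB]] r(2) by (simp add: mult_2)
  qed
  fix i assume i: "0 < i \<and> i < 2 * N"
  consider "i < N" | "i = N" | j where "i = N + j" "0 < j" "j < N"
  proof -
   have "i = N + (i - N) \<and> 0 < i - N \<and> i - N < N" if "\<not> i < N" "i ~= N" using that i by auto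
   thus ?thesis using that by blast
  qed
  thus "((r o s) ^^ i) x \<notin> H"
  proof cases
   case 1
   thus ?thesis using \<open>\<And>x i. x \<in> B ==> i < N ==> ((r o s) ^^ i) x = (s ^^ i) x\<close>[OF xB 1] Sd i xB H by auto
  next
   case 2
   thus ?thesis using \<open>\<And>x. x \<in> B ==> ((r o s) ^^ N) x = r x\<close>[OF xB] r(4) x by auto
  next
   case 3
   hence "(s ^^ j) (r x) \<notin> B" using Sd rB[OF xB] by blast
   thus ?thesis using \<open>\<And>x i. x \<in> B ==> i < N ==> ((r o s) ^^ (N + i)) x = (s ^^ i) (r x)\<close>[OF xB 3(3)] 3 H by auto
  qed
 qed (use Sd H in auto)
qed

end

section \<open>Approximation of sets by levels of towers\<close>

lemma equal_parts:
 assumes P: "prob_space M" and na: "non_atomic M"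
  and A: "A \<in> sets M" "measure M A = real k * t" "t \<ge> 0"
 shows "\<exists>Y. (\<forall>q<k. Y q \<in> sets M \<and> Y q \<subseteq> A \<and> measure M (Y q) = t) \<and> disjoint_family_on Y {..<k}"
 using A
proof (induction k arbitrary: A)
 case 0
 thus ?case by (auto simp: disjoint_family_on_def)
next
 case (Suc k)
 interpret prob_space M by (rule P)
 have "t \<le> prob A" using Suc.prems by (simp add: algebra_simps)
 then obtain Z where Z: "Z \<in> sets M" "Z \<subseteq> A" "prob Z = t"
  using nonatomic_split[OF P na Suc.prems(1,3)] by blast
 have "prob (A - Z) = real k * t" using Z Suc.prems by (simp add: finite_measure_Diff algebra_simps)
 then obtain Y where Y: "\<forall>q<k. Y q \<in> sets M \<and> Y q \<subseteq> A - Z \<and> measure M (Y q) = t" "disjoint_family_on Y {..<k}"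
  using Suc.IH[of "A - Z"] Z Suc.prems by blast
 define Y' where "Y' = Y(k := Z)"
 have "Y' q \<in> sets M \<and> Y' q \<subseteq> A \<and> measure M (Y' q) = t" if "q < Suc k" for q
  using Y(1)[THEN spec, of q] Z that by (cases "q = k") (auto simp: Y'_def)
 moreover have "disjoint_family_on Y' {..<Suc k}"
  unfolding disjoint_family_on_def
 proof (intro ballI impI)
  fix m n assume mn: "m \<in> {..<Suc k}" "n \<in> {..<Suc k}" "m ~= n"
  consider "m = k" "n < k" | "n = k" "m < k" | "m < k" "n < k" using mn by fastforce
  thus "Y' m \<inter> Y' n = {}"
  proof cases
   case 1 thus ?thesis using Y(1)[THEN spec, of n] by (auto simp: Y'_def)
  next
   case 2 thus ?thesis using Y(1)[THEN spec, of m] by (auto simp: Y'_def)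
  next
   case 3 thus ?thesis using Y(2) mn by (auto simp: Y'_def disjoint_family_on_def)
  qed
 qed
 ultimately show ?case by blast
qed

text \<open>Pieces are cut from single sets \<open>A i\<close> as long as one of these has measure
  at least \<open>t\<close>. Afterwards all of them are smaller than \<open>t\<close>, so at most
  \<open>card I\<close> pieces are left to be cut across several sets.\<close>

lemma equal_pieces:
 assumes P: "prob_space M" and na: "non_atomic M" and I: "finite I" and t: "t > 0"
  and A: "\<And>i. i \<in> I ==> A i \<in> sets M" "disjoint_family_on A I" "(\<Sum>i\<in>I. measure M (A i)) = real k * t"
 shows "\<exists>Y. (\<forall>q<k. Y q \<in> sets M \<and> Y q \<subseteq> (\<Union>i\<in>I. A i) \<and> measure M (Y q) = t) \<and>
  disjoint_family_on Y {..<k} \<and> card {q. q < k \<and> \<not> (\<exists>i\<in>I. Y q \<subseteq> A i)} \<le> card I"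
 using A
proof (induction k arbitrary: A)
 case 0
 thus ?case by (auto simp: disjoint_family_on_def)
next
 case (Suc k)
 interpret prob_space M by (rule P)
 show ?case
 proof (cases "\<exists>i\<in>I. t \<le> prob (A i)")
  case True
  then obtain j where j: "j \<in> I" "t \<le> prob (A j)" by blast
  then obtain Z where Z: "Z \<in> sets M" "Z \<subseteq> A j" "prob Z = t"
   using nonatomic_split[OF P na Suc.prems(1)[OF j(1)], of t] t by auto
  define A' where "A' = A(j := A j - Z)"
  have sub: "A' i \<subseteq> A i" for i by (auto simp: A'_def)
  have "(\<Sum>i\<in>I. prob (A' i)) = prob (A' j) + (\<Sum>i\<in>I-{j}. prob (A' i))" using I j by (simp add: sum.remove)
  also have "(\<Sum>i\<in>I-{j}. prob (A' i)) = (\<Sum>i\<in>I-{j}. prob (A i))" by (intro sum.cong) (auto simp: A'_def)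
  also have "prob (A' j) = prob (A j) - t" using Z Suc.prems(1)[OF j(1)] by (simp add: A'_def finite_measure_Diff)
  also have "prob (A j) - t + (\<Sum>i\<in>I-{j}. prob (A i)) = (\<Sum>i\<in>I. prob (A i)) - t"
   using I j by (simp add: sum.remove)
  finally have sum': "(\<Sum>i\<in>I. prob (A' i)) = real k * t" using Suc.prems(3) by (simp add: algebra_simps)
  have "A' i \<in> sets M" if "i \<in> I" for i using Suc.prems(1)[OF that] Z by (auto simp: A'_def)
  moreover have "disjoint_family_on A' I" using Suc.prems(2) sub unfolding disjoint_family_on_def by blast
  ultimately obtain Y where Y: "\<forall>q<k. Y q \<in> sets M \<and> Y q \<subseteq> (\<Union>i\<in>I. A' i) \<and> measure M (Y q) = t"
   "disjoint_family_on Y {..<k}" "card {q. q < k \<and> \<not> (\<exists>i\<in>I. Y q \<subseteq> A' i)} \<le> card I"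
   using Suc.IH[of A'] sum' by blast
  have ZA: "A' i \<inter> Z = {}" if "i \<in> I" for i
  proof (cases "i = j")
   case False
   hence "A i \<inter> A j = {}" using Suc.prems(2) that j(1) unfolding disjoint_family_on_def by blast
   thus ?thesis using Z(2) sub[of i] by blast
  qed (auto simp: A'_def)
  have YZ: "Y q \<inter> Z = {}" if "q < k" for q
  proof -
   have "Y q \<subseteq> (\<Union>i\<in>I. A' i)" using Y(1) that by blast
   thus ?thesis using ZA by blast
  qed
  define Y' where "Y' = Y(k := Z)"
  have "Y' q \<in> sets M \<and> Y' q \<subseteq> (\<Union>i\<in>I. A i) \<and> measure M (Y' q) = t" if q: "q < Suc k" for q
  proof (cases "q = k")
   case True
   thus ?thesis using Z j by (auto simp: Y'_def)
  next
   case False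
   hence "q < k" using q by simp
   hence "Y q \<in> sets M" "Y q \<subseteq> (\<Union>i\<in>I. A' i)" "prob (Y q) = t" using Y(1) by auto
   moreover have "(\<Union>i\<in>I. A' i) \<subseteq> (\<Union>i\<in>I. A i)" using sub by blast
   ultimately show ?thesis using False by (auto simp: Y'_def)
  qed
  moreover have "disjoint_family_on Y' {..<Suc k}"
   unfolding disjoint_family_on_def
  proof (intro ballI impI)
   fix m n assume mn: "m \<in> {..<Suc k}" "n \<in> {..<Suc k}" "m ~= n"
   consider "m = k" "n < k" | "n = k" "m < k" | "m < k" "n < k" using mn by fastforce
   thus "Y' m \<inter> Y' n = {}"
   proof cases
    case 1 thus ?thesis using YZ[of n] by (auto simp: Y'_def)
   next
    case 2 thus ?thesis using YZ[of m] by (auto simp: Y'_def)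
   next
    case 3 thus ?thesis using Y(2) mn by (auto simp: Y'_def disjoint_family_on_def)
   qed
  qed
  moreover have "card {q. q < Suc k \<and> \<not> (\<exists>i\<in>I. Y' q \<subseteq> A i)} \<le> card I"
  proof -
   have "{q. q < Suc k \<and> \<not> (\<exists>i\<in>I. Y' q \<subseteq> A i)} \<subseteq> {q. q < k \<and> \<not> (\<exists>i\<in>I. Y q \<subseteq> A' i)}"
   proof
    fix q assume q: "q \<in> {q. q < Suc k \<and> \<not> (\<exists>i\<in>I. Y' q \<subseteq> A i)}"
    have "q ~= k" using q j(1) Z(2) by (auto simp: Y'_def)
    hence "q < k" "\<not> (\<exists>i\<in>I. Y q \<subseteq> A i)" using q by (auto simp: Y'_def)
    moreover have "\<not> (\<exists>i\<in>I. Y q \<subseteq> A' i)" using calculation(2) sub by (meson subset_trans)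
    ultimately show "q \<in> {q. q < k \<and> \<not> (\<exists>i\<in>I. Y q \<subseteq> A' i)}" by blast
   qed
   hence "card {q. q < Suc k \<and> \<not> (\<exists>i\<in>I. Y' q \<subseteq> A i)} \<le> card {q. q < k \<and> \<not> (\<exists>i\<in>I. Y q \<subseteq> A' i)}"
    by (intro card_mono) auto
   thus ?thesis using Y(3) by linarith
  qed
  ultimately show ?thesis by blast
 next
  case False
  hence lt: "prob (A i) < t" if "i \<in> I" for i using that by auto
  have "prob (\<Union>i\<in>I. A i) = real (Suc k) * t"
   using finite_measure_finite_Union[OF I _ Suc.prems(2)] Suc.prems(1,3) by auto
  moreover have "(\<Union>i\<in>I. A i) \<in> sets M" using I Suc.prems(1) by auto
  ultimately obtain Y where Y: "\<forall>q<Suc k. Y q \<in> sets M \<and> Y q \<subseteq> (\<Union>i\<in>I. A i) \<and> measure M (Y q) = t"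
    "disjoint_family_on Y {..<Suc k}"
   using equal_parts[OF P na _ _ less_imp_le[OF t]] by blast
  have "real (Suc k) * t \<le> card I * t"
   using sum_bounded_above[of I "\<lambda>i. prob (A i)" t] lt Suc.prems(3) by (simp add: less_imp_le)
  hence "Suc k \<le> card I" using t by (simp del: of_nat_Suc)
  moreover have "card {q. q < Suc k \<and> \<not> (\<exists>i\<in>I. Y q \<subseteq> A i)} \<le> card {..<Suc k}" by (intro card_mono) auto
  ultimately have "card {q. q < Suc k \<and> \<not> (\<exists>i\<in>I. Y q \<subseteq> A i)} \<le> card I" by simp
  thus ?thesis using Y by blast
 qed
qed

context gam
begin

text \<open>A point on two levels would bring a base point back to the base before time
  \<open>N\<close>.\<close>

lemma state_inj:
 assumes S: "state B s N" and x: "x \<in> B" "y \<in> B" and ij: "i < N" "j < N" and eq: "(s ^^ i) x = (s ^^ j) y"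
 shows "i = j"
proof -
 note Sd = S[unfolded state_def]
 have inj: "inj (s ^^ n)" for n using mpaD(2)[OF funpow_mpa[OF fullgD(1)]] Sd by blast
 have *: False if "i < j" "x \<in> B" "y \<in> B" "j < N" "(s ^^ i) x = (s ^^ j) y" for i j x y
 proof -
  have "(s ^^ j) y = (s ^^ (i + (j - i))) y" using that by simp
  also have "... = (s ^^ i) ((s ^^ (j - i)) y)" by (simp only: funpow_add comp_apply)
  finally have "(s ^^ i) x = (s ^^ i) ((s ^^ (j - i)) y)" using that by simp
  hence "x = (s ^^ (j - i)) y" using inj by (metis injD)
  moreover have "0 < j - i" "j - i < N" using that by auto
  ultimately show False using Sd that by blast
 qed
 show ?thesis using *[of i j x y] *[of j i y x] x ij eq by (metis linorder_neqE_nat)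
qed

text \<open>After \<open>r\<close> halvings, chosen so as to respect the partition \<open>Y\<close>
  of the base, every piece of every old level is a whole level of the new tower, up to a null
  set.\<close>

lemma refine:
 fixes Y :: "nat => 'a set"
 assumes "state B s N"
  and "\<And>q. q < 2 ^ r ==> Y q \<in> sets M \<and> Y q \<subseteq> B \<and> prob (Y q) = 1 / (N * 2 ^ r)"
  and "disjoint_family_on Y {..<2 ^ r}"
 shows "\<exists>B' s'. state B' s' (N * 2 ^ r) \<and> ext B s B' s' \<and>
  (\<forall>q<2 ^ r. \<forall>i<N. \<exists>j<N * 2 ^ r. aeq ((s ^^ i) ` Y q) ((s' ^^ j) ` B'))"
 using assms
proof (induction r arbitrary: B s N Y)
 case 0
 note Sd = 0(1)[unfolded state_def]
 have sm: "s ^^ i \<in> mpa" for i using Sd fullgD(1) funpow_mpa by blast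
 have Y0: "Y 0 \<in> sets M" "Y 0 \<subseteq> B" "prob (Y 0) = 1 / N" using 0(2)[of 0] by auto
 have "aeq (Y 0) B" using Y0 Sd by (intro aeq_subset) auto
 hence "aeq ((s ^^ i) ` Y 0) ((s ^^ i) ` B)" for i using aeq_image sm by blast
 hence "\<forall>q<2 ^ 0. \<forall>i<N. \<exists>j<N * 2 ^ 0. aeq ((s ^^ i) ` Y q) ((s ^^ j) ` B)"
  by (metis less_one mult.right_neutral power_0)
 thus ?case using 0(1) ext_refl by (intro exI[of _ B] exI[of _ s]) simp
next
 case (Suc r)
 note Sd = Suc.prems(1)[unfolded state_def]
 let ?R = "2 ^ r :: nat"
 have Yq: "Y q \<in> sets M" "Y q \<subseteq> B" "prob (Y q) = 1 / (N * 2 ^ Suc r)" if "q < 2 * ?R" for q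
  using Suc.prems(2)[of q] that by auto
 have Yd: "Y q \<inter> Y q' = {}" if "q < 2 * ?R" "q' < 2 * ?R" "q ~= q'" for q q'
  using Suc.prems(3) that unfolding disjoint_family_on_def by auto
 \<comment> \<open>Piece \<open>q\<close> is exchanged with piece \<open>q + 2 ^ r\<close>: the
   lower pieces will form the new base, the upper ones its continuation at height
   \<open>N\<close>.\<close>
 define Q where "Q q = (\<lambda>(f, A0). f \<in> fullg \<and> (\<forall>x. f (f x) = x) \<and> (\<forall>x. f x ~= x --> x \<in> Y q \<union> Y (q + ?R)) \<and>
   A0 \<in> sets M \<and> A0 \<subseteq> Y q \<and> prob (Y q - A0) = 0 \<and> f ` A0 \<subseteq> Y (q + ?R))" for q
 have exQ: "\<exists>p. Q q p" if q: "q < ?R" for q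
 proof -
  have q2: "q < 2 * ?R" "q + ?R < 2 * ?R" using q by auto
  have e: "prob (Y q) = prob (Y (q + ?R))" using Yq(3)[OF q2(1)] Yq(3)[OF q2(2)] by simp
  obtain f A0 where "f \<in> fullg" "\<forall>x. f (f x) = x"
   "\<forall>x. f x ~= x --> x \<in> (Y q - Y (q + ?R)) \<union> (Y (q + ?R) - Y q)"
   "A0 \<in> sets M" "A0 \<subseteq> Y q" "prob (Y q - A0) = 0" "f ` A0 \<subseteq> Y (q + ?R)"
   using exchange_full[OF Yq(1)[OF q2(1)] Yq(1)[OF q2(2)] e] by blast
  hence "Q q (f, A0)" by (auto simp: Q_def)
  thus ?thesis by blast
 qed
 define f where "f q = fst (SOME p. Q q p)" for q
 define A0 where "A0 q = snd (SOME p. Q q p)" for q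
 have "Q q (f q, A0 q)" if "q < ?R" for q
  using someI_ex[OF exQ[OF that]] by (simp add: f_def A0_def)
 hence f: "\<And>q. q < ?R ==> f q \<in> fullg" "\<And>q x. q < ?R ==> f q (f q x) = x"
   "\<And>q x. q < ?R ==> f q x ~= x ==> x \<in> Y q \<union> Y (q + ?R)"
  and A0: "\<And>q. q < ?R ==> A0 q \<in> sets M" "\<And>q. q < ?R ==> A0 q \<subseteq> Y q"
   "\<And>q. q < ?R ==> prob (Y q - A0 q) = 0" "\<And>q. q < ?R ==> f q ` A0 q \<subseteq> Y (q + ?R)"
  unfolding Q_def by blast+
 define w where "w q = (if q < ?R then f q else id)" for q
 have wf: "w q \<in> fullg" for q using f(1) fullg_id by (simp add: w_def)
 have ww: "w q (w q x) = x" for q x using f(2) by (simp add: w_def)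
 have ws: "q < ?R \<and> x \<in> Y q \<union> Y (q + ?R)" if "w q x ~= x" for q x
  using that f(3)[of q x] by (auto simp: w_def split: if_splits)
 have ds: "dsup w" unfolding dsup_def
 proof (intro allI impI)
  fix q q' x assume "w q x ~= x" "w q' x ~= x"
  from ws[OF this(1)] ws[OF this(2)] show "q = q'"
   using Yd[of q q'] Yd[of q "q' + ?R"] Yd[of "q + ?R" q'] Yd[of "q + ?R" "q' + ?R"] by (auto simp: disjoint_iff)
 qed
 define \<rho> where "\<rho> = dprod w"
 have \<rho>w: "\<rho> x = w q x" if "w q x ~= x" for q x unfolding \<rho>_def by (rule dprod_eq[OF ds that])
 have \<rho>id: "\<exists>q. w q x ~= x" if "\<rho> x ~= x" for x using that dprod_id[of w x] unfolding \<rho>_def by blast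
 have \<rho>f: "\<rho> \<in> fullg" unfolding \<rho>_def by (rule fullg_dprod[OF ds wf])
 have \<rho>m: "\<rho> \<in> mpa" using \<rho>f fullgD by blast
 have \<rho>\<rho>: "\<rho> (\<rho> x) = x" for x
 proof (cases "\<rho> x = x")
  case False
  then obtain q where q: "w q x ~= x" using \<rho>id by blast
  have "w q (w q x) ~= w q x" using q ww[of q x] by simp
  thus ?thesis using \<rho>w[of q "w q x"] \<rho>w[OF q] ww[of q x] by simp
 qed simp
 have \<rho>A: "\<rho> x \<in> Y (q + ?R)" "\<rho> x = w q x" if "q < ?R" "x \<in> A0 q" for q x
 proof -
  have wx: "w q x \<in> Y (q + ?R)" using A0(4)[OF that(1)] that by (auto simp: w_def)
  moreover have "x \<in> Y q" using A0(2) that by blast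
  moreover have "Y q \<inter> Y (q + ?R) = {}" using that(1) by (intro Yd) auto
  ultimately have "w q x ~= x" by auto
  thus "\<rho> x \<in> Y (q + ?R)" "\<rho> x = w q x" using \<rho>w wx by auto
 qed
 define H where "H = (\<Union>q<?R. A0 q)"
 have A0B: "A0 q \<subseteq> B" if "q < ?R" for q using A0(2)[OF that] Yq(2)[of q] that by auto
 have Hs: "H \<in> sets M" "H \<subseteq> B" using A0(1) A0B unfolding H_def by auto
 have A0p: "prob (A0 q) = 1 / (N * 2 ^ Suc r)" if "q < ?R" for q
 proof -
  have q2: "q < 2 * ?R" using that by simp
  have "prob (Y q - A0 q) = prob (Y q) - prob (A0 q)"
   using A0(1,2)[OF that] Yq(1)[OF q2] by (simp add: finite_measure_Diff)
  thus ?thesis using A0(3)[OF that] Yq(3)[OF q2] by simp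
 qed
 have A0d: "disjoint_family_on A0 {..<?R}" unfolding disjoint_family_on_def
 proof (intro ballI impI)
  fix q q' assume "q \<in> {..<?R}" "q' \<in> {..<?R}" "q ~= q'"
  thus "A0 q \<inter> A0 q' = {}" using A0(2)[of q] A0(2)[of q'] Yd[of q q'] by auto
 qed
 have "prob H = (\<Sum>q<?R. prob (A0 q))"
  unfolding H_def using A0(1) A0d by (intro finite_measure_finite_Union) auto
 also have "... = (\<Sum>q<?R. 1 / (N * 2 ^ Suc r))" using A0p by (intro sum.cong) auto
 also have "... = prob B / 2" using Sd by simp
 finally have Hp: "prob H = prob B / 2" .
 have \<rho>B: "x \<in> B" if nx: "\<rho> x ~= x" for x
 proof -
  obtain q where "w q x ~= x" using \<rho>id[OF nx] by blast
  hence "q < ?R" "x \<in> Y q \<union> Y (q + ?R)" using ws by blast+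
  thus ?thesis using Yq(2)[of q] Yq(2)[of "q + ?R"] by auto
 qed
 have \<rho>H: "\<rho> ` H \<inter> H = {}"
 proof -
  have False if "q < ?R" "x \<in> A0 q" "q' < ?R" "\<rho> x \<in> A0 q'" for q q' x
  proof -
   have "\<rho> x \<in> Y (q + ?R)" "\<rho> x \<in> Y q'" using \<rho>A(1) A0(2) that by auto
   moreover have "Y (q + ?R) \<inter> Y q' = {}" using that by (intro Yd) auto
   ultimately show False by blast
  qed
  thus ?thesis unfolding H_def by auto
 qed
 note hv = halve[OF Suc.prems(1) Hs Hp \<rho>f \<rho>\<rho> \<rho>B \<rho>H]
 \<comment> \<open>In the doubled tower only the lower pieces \<open>A0 q\<close> lie in the base,
   so \<open>r\<close> halvings remain, for towers of height \<open>2 * N\<close>.\<close>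
 have "\<exists>B' s'. state B' s' (2 * N * 2 ^ r) \<and> ext H (\<rho> o s) B' s' \<and>
  (\<forall>q<2 ^ r. \<forall>i<2 * N. \<exists>j<2 * N * 2 ^ r. aeq (((\<rho> o s) ^^ i) ` A0 q) ((s' ^^ j) ` B'))"
 proof (rule Suc.IH[OF hv(1) _ A0d])
  fix q assume q: "q < ?R"
  thus "A0 q \<in> sets M \<and> A0 q \<subseteq> H \<and> prob (A0 q) = 1 / (real (2 * N) * 2 ^ r)"
   using A0(1) A0p[OF q] by (auto simp: H_def)
 qed
 then obtain B' s' where B': "state B' s' (2 * N * 2 ^ r)" "ext H (\<rho> o s) B' s'"
  "\<And>q i. q < ?R ==> i < 2 * N ==> \<exists>j<2 * N * 2 ^ r. aeq (((\<rho> o s) ^^ i) ` A0 q) ((s' ^^ j) ` B')" by blast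
 have sm: "s ^^ i \<in> mpa" for i using Sd fullgD(1) funpow_mpa by blast
 have "\<exists>j<N * 2 ^ Suc r. aeq ((s ^^ i) ` Y q) ((s' ^^ j) ` B')" if q: "q < 2 ^ Suc r" and i: "i < N" for q i
 proof (cases "q < ?R")
  case True
  have "((\<rho> o s) ^^ i) ` A0 q = (s ^^ i) ` A0 q"
   using hv(3) True i by (intro image_cong) (auto simp: H_def)
  moreover have "aeq (A0 q) (Y q)" using A0 A0p Yq True by (intro aeq_subset) auto
  ultimately have "aeq ((s ^^ i) ` Y q) (((\<rho> o s) ^^ i) ` A0 q)"
   using aeq_image[OF sm] aeq_sym by metis
  thus ?thesis using B'(3)[OF True, of i] i aeq_trans by (metis mult.assoc mult.commute mult_2 power_Suc trans_less_add1)
 next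
  case False
  \<comment> \<open>An upper piece is reached from its partner \<open>p\<close> after climbing the
    first copy of the tower, hence at height \<open>N + i\<close>.\<close>
  define p where "p = q - ?R"
  have p: "p < ?R" "q = p + ?R" using False q by (auto simp: p_def)
  have "((\<rho> o s) ^^ (N + i)) ` A0 p = (\<lambda>x. (s ^^ i) (\<rho> x)) ` A0 p"
   using hv(4) p i by (intro image_cong) (auto simp: H_def)
  hence e: "((\<rho> o s) ^^ (N + i)) ` A0 p = (s ^^ i) ` \<rho> ` A0 p" by (simp add: image_image)
  have "aeq (\<rho> ` A0 p) (Y q)"
  proof (rule aeq_subset)
   show "\<rho> ` A0 p \<in> sets M" using image_sets[OF \<rho>m A0(1)[OF p(1)]] .
   show "\<rho> ` A0 p \<subseteq> Y q" using \<rho>A(1) p by auto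
   show "prob (\<rho> ` A0 p) = prob (Y q)" using prob_image[OF \<rho>m A0(1)[OF p(1)]] A0p[OF p(1)] Yq(3)[of q] q by simp
   show "Y q \<in> sets M" using Yq(1) q by simp
  qed
  hence "aeq ((s ^^ i) ` Y q) (((\<rho> o s) ^^ (N + i)) ` A0 p)"
   using aeq_image[OF sm] aeq_sym e by metis
  moreover have "N + i < 2 * N" using i by simp
  ultimately show ?thesis using B'(3)[OF p(1), of "N + i"] aeq_trans by (metis mult.assoc mult.commute power_Suc)
 qed
 moreover have "ext B s B' s'" using ext_trans[OF hv(2) B'(2)] .
 moreover have "state B' s' (N * 2 ^ Suc r)" using B'(1) by (simp add: mult.assoc mult.left_commute)
 ultimately show ?case by blast
qed

end

context gam
begin

lemma state_cover:
 assumes S: "state B s N"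
 shows "AE x in M. \<exists>i<N. x \<in> (s ^^ i) ` B"
proof -
 note Sd = S[unfolded state_def]
 have sm: "s ^^ i \<in> mpa" for i using Sd fullgD(1) funpow_mpa by blast
 have Bs: "(s ^^ i) ` B \<in> sets M" for i using image_sets[OF sm] Sd by blast
 have "disjoint_family_on (\<lambda>i. (s ^^ i) ` B) {..<N}"
  unfolding disjoint_family_on_def using state_inj[OF S] by blast
 hence "prob (\<Union>i<N. (s ^^ i) ` B) = (\<Sum>i<N. prob ((s ^^ i) ` B))"
  using Bs by (intro finite_measure_finite_Union) auto
 also have "... = (\<Sum>i<N. 1 / N)" using prob_image[OF sm] Sd by (intro sum.cong) auto
 also have "... = 1" using Sd by simp
 finally have "AE x in M. x \<in> (\<Union>i<N. (s ^^ i) ` B)" using Bs by (subst prob_eq_1[symmetric]) auto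
 thus ?thesis by eventually_elim auto
qed

text \<open>Base points are sorted by the levels at which their column meets \<open>D\<close>. A
  column over a piece inside one class lies level by level inside or outside \<open>D\<close>, and
  \<open>refine\<close> turns these levels into levels of the new tower. The columns over mixed
  pieces make up the error \<open>Q\<close>.\<close>

lemma approx:
 assumes S: "state B s N" and D: "D \<in> sets M" and e: "e > 0"
 shows "\<exists>r\<ge>r0. \<exists>B' s'. state B' s' (N * 2 ^ r) \<and> ext B s B' s' \<and>
  (\<exists>I\<subseteq>{..<N * 2 ^ r}. \<exists>Q\<in>sets M. prob Q < e \<and>
    (AE x in M. x \<notin> Q --> (x \<in> D \<longleftrightarrow> (\<exists>j\<in>I. x \<in> (s' ^^ j) ` B'))))"
proof -
 note Sd = S[unfolded state_def]
 have sm: "s ^^ i \<in> mpa" for i using Sd fullgD(1) funpow_mpa by blast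
 have N0: "N > 0" using Sd by blast
 \<comment> \<open>At most \<open>2 ^ N\<close> pieces are mixed, one for each class, and a column
   has measure \<open>1 / 2 ^ r\<close>. The constant \<open>2 ^ (2 ^ N)\<close> is a generous bound
   for their number.\<close>
 obtain r1 where r1: "(1/2::real) ^ r1 < e / 2 ^ (2 ^ N)"
  using real_arch_pow_inv[of "e / 2 ^ (2 ^ N)" "1/2"] e by auto
 define r where "r = max r0 r1"
 have r: "r \<ge> r0" "2 ^ (2 ^ N) * (1/2::real) ^ r < e"
 proof -
  have "(1/2::real) ^ r \<le> (1/2) ^ r1" unfolding r_def by (intro power_decreasing) auto
  from this r1 have "(1/2::real) ^ r < e / 2 ^ (2 ^ N)" by (rule order_le_less_trans)
  thus "2 ^ (2 ^ N) * (1/2::real) ^ r < e" by (simp add: field_simps)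
 qed (simp add: r_def)
 define t where "t = 1 / (real N * 2 ^ r)"
 have t: "t > 0" using N0 by (simp add: t_def)
 \<comment> \<open>The class of the base points whose column meets \<open>D\<close> exactly at the
   levels in \<open>T\<close>.\<close>
 define A where "A T = {x \<in> B. {i. i < N \<and> (s ^^ i) x \<in> D} = T}" for T
 have As: "A T \<in> sets M" for T
 proof -
  define V where "V i = (if i \<in> T then (s ^^ i) -` D else space M - (s ^^ i) -` D)" for i
  have Vs: "V i \<in> sets M" for i using vimage_sets[OF sm D] by (simp add: V_def)
  have Bsp: "B \<subseteq> space M" using Sd sets.sets_into_space by blast
  have V: "x \<in> V i \<longleftrightarrow> ((s ^^ i) x \<in> D \<longleftrightarrow> i \<in> T)" if "x \<in> space M" for x i
   using that by (simp add: V_def)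
  have VT: "{i. i < N \<and> (s ^^ i) x \<in> D} = T \<longleftrightarrow> T \<subseteq> {..<N} \<and> (\<forall>i<N. x \<in> V i)"
   if "x \<in> space M" for x using V[OF that] by auto
  show ?thesis
  proof (cases "T \<subseteq> {..<N}")
   case True
   have "A T = B \<inter> (\<Inter>i\<in>{..<N}. V i)"
   proof (rule Set.set_eqI)
    fix x show "x \<in> A T \<longleftrightarrow> x \<in> B \<inter> (\<Inter>i\<in>{..<N}. V i)"
     using Bsp VT[of x] True by (cases "x \<in> B") (auto simp: A_def)
   qed
   also have "... \<in> sets M"
    using Sd Vs N0 by (intro sets.Int sets.finite_INT) auto
   finally show ?thesis .
  next
   case False
   hence "A T = {}" by (auto simp: A_def)
   thus ?thesis by simp
  qed
 qed
 have UA: "(\<Union>T\<in>Pow {..<N}. A T) = B"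
 proof
  show "B \<subseteq> (\<Union>T\<in>Pow {..<N}. A T)"
  proof
   fix x assume "x \<in> B"
   hence "x \<in> A {i. i < N \<and> (s ^^ i) x \<in> D}" by (simp add: A_def)
   thus "x \<in> (\<Union>T\<in>Pow {..<N}. A T)" by (rule UN_I[rotated]) auto
  qed
 qed (auto simp: A_def)
 have dA: "disjoint_family_on A (Pow {..<N})" by (auto simp: disjoint_family_on_def A_def)
 have "(\<Sum>T\<in>Pow {..<N}. prob (A T)) = prob (\<Union>T\<in>Pow {..<N}. A T)"
  using As dA by (intro finite_measure_finite_Union[symmetric]) auto
 also have "... = real (2 ^ r) * t" unfolding UA t_def using Sd by simp
 finally have sA: "(\<Sum>T\<in>Pow {..<N}. prob (A T)) = real (2 ^ r) * t" .
 obtain Y :: "nat => 'a set" where Y: "\<forall>q<2^r. Y q \<in> sets M \<and> Y q \<subseteq> (\<Union>T\<in>Pow {..<N}. A T) \<and> prob (Y q) = t"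
  "disjoint_family_on Y {..<2^r}" "card {q. q < 2^r \<and> \<not> (\<exists>T\<in>Pow {..<N}. Y q \<subseteq> A T)} \<le> card (Pow {..<N})"
  using equal_pieces[OF prob_space_axioms na _ t As dA sA] by auto
 have Yq: "Y q \<in> sets M" "Y q \<subseteq> B" "prob (Y q) = t" if "q < 2^r" for q
  using Y(1) that unfolding UA by auto
 obtain B' s' where B': "state B' s' (N * 2 ^ r)" "ext B s B' s'"
  "\<forall>q<2 ^ r. \<forall>i<N. \<exists>j<N * 2 ^ r. aeq ((s ^^ i) ` Y q) ((s' ^^ j) ` B')"
  using refine[OF S, of r Y] Yq Y(2) unfolding t_def by auto
 define jj where "jj q i = (SOME j. j < N * 2 ^ r \<and> aeq ((s ^^ i) ` Y q) ((s' ^^ j) ` B'))" for q i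
 have jj: "jj q i < N * 2 ^ r" "aeq ((s ^^ i) ` Y q) ((s' ^^ jj q i) ` B')" if "q < 2^r" "i < N" for q i
 proof -
  have "\<exists>j. j < N * 2 ^ r \<and> aeq ((s ^^ i) ` Y q) ((s' ^^ j) ` B')" using B'(3) that by blast
  from someI_ex[OF this] have "jj q i < N * 2 ^ r \<and> aeq ((s ^^ i) ` Y q) ((s' ^^ jj q i) ` B')"
   unfolding jj_def .
  thus "jj q i < N * 2 ^ r" "aeq ((s ^^ i) ` Y q) ((s' ^^ jj q i) ` B')" by auto
 qed
 define bad where "bad = {q. q < 2^r \<and> \<not> (\<exists>T\<in>Pow {..<N}. Y q \<subseteq> A T)}"
 define I where "I = {jj q i | q i. q < 2^r \<and> i < N \<and> (s ^^ i) ` Y q \<subseteq> D}"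
 define Q where "Q = (\<Union>q\<in>bad. \<Union>i<N. (s ^^ i) ` Y q)"
 have badf: "finite bad" "\<And>q. q \<in> bad ==> q < 2^r" by (auto simp: bad_def)
 have sYs: "(s ^^ i) ` Y q \<in> sets M" if "q < 2^r" for q i using image_sets[OF sm Yq(1)[OF that]] .
 have Qs: "Q \<in> sets M" unfolding Q_def using badf sYs by (intro sets.finite_UN) auto
 have "prob Q \<le> (\<Sum>q\<in>bad. prob (\<Union>i<N. (s ^^ i) ` Y q))"
  unfolding Q_def using badf sYs by (intro finite_measure_subadditive_finite) auto
 also have "... \<le> (\<Sum>q\<in>bad. \<Sum>i<N. prob ((s ^^ i) ` Y q))"
  using badf sYs by (intro sum_mono finite_measure_subadditive_finite) auto
 also have "... = (\<Sum>q\<in>bad. \<Sum>i<N. t)"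
  using badf Yq prob_image[OF sm Yq(1)] by (intro sum.cong) auto
 also have "... = card bad * (N * t)" by simp
 also have "... \<le> 2 ^ (2 ^ N) * (N * t)"
 proof (intro mult_right_mono)
  have "card bad \<le> 2 ^ N" using Y(3) by (simp add: bad_def card_Pow)
  also have "... \<le> 2 ^ (2 ^ N)" by (intro power_increasing) auto
  finally show "real (card bad) \<le> 2 ^ 2 ^ N" by (metis of_nat_le_iff of_nat_numeral of_nat_power)
 qed (use t in auto)
 also have "... = 2 ^ (2 ^ N) * (1/2) ^ r" using N0 by (simp add: t_def power_divide)
 also have "... < e" by (rule r(2))
 finally have Qe: "prob Q < e" .
 have cov: "AE x in M. \<exists>q<(2::nat)^r. \<exists>i<N. x \<in> (s ^^ i) ` Y q"
 proof -
  let ?K = "{..<2^r :: nat} \<times> {..<N}"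
  let ?F = "\<lambda>(q, i). (s ^^ i) ` Y q"
  have "disjoint_family_on ?F ?K"
   unfolding disjoint_family_on_def
  proof (intro ballI impI)
   fix u u' assume u: "u \<in> ?K" "u' \<in> ?K" "u ~= u'"
   obtain q i where qi: "u = (q, i)" by (cases u)
   obtain q' i' where qi': "u' = (q', i')" by (cases u')
   have h: "q < (2::nat)^r" "i < N" "q' < (2::nat)^r" "i' < N" "q = q' --> i ~= i'"
    using u unfolding qi qi' by auto
   have False if "x \<in> Y q" "y \<in> Y q'" "(s ^^ i) x = (s ^^ i') y" for x y
   proof -
    have ii: "i = i'" using state_inj[OF S, of x y i i'] that Yq(2) h by blast
    hence "x = y" using that mpaD(2)[OF sm] by (metis injD)
    moreover have "q ~= q'" using ii h by blast
    ultimately show False using Y(2) that h unfolding disjoint_family_on_def by blast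
   qed
   thus "?F u \<inter> ?F u' = {}" unfolding qi qi' by auto
  qed
  hence "prob (\<Union>p\<in>?K. ?F p) = (\<Sum>p\<in>?K. prob (?F p))"
   using sYs by (intro finite_measure_finite_Union) auto
  also have "... = (\<Sum>p\<in>?K. t)" using Yq prob_image[OF sm Yq(1)] by (intro sum.cong) auto
  also have "... = 1" using N0 by (simp add: t_def)
  finally have "prob (\<Union>p\<in>?K. ?F p) = 1" .
  moreover have "(\<Union>p\<in>?K. ?F p) \<in> sets M" using sYs by (intro sets.finite_UN) auto
  ultimately have "AE x in M. x \<in> (\<Union>p\<in>?K. ?F p)" by (subst prob_eq_1[symmetric]) auto
  thus ?thesis by eventually_elim auto
 qed
 have "AE x in M. \<forall>q. \<forall>i. q < (2::nat)^r --> i < N --> (x \<in> (s ^^ i) ` Y q \<longleftrightarrow> x \<in> (s' ^^ jj q i) ` B')"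
  using jj(2) unfolding AE_all_countable aeq_def by auto
 with cov have "AE x in M. x \<notin> Q --> (x \<in> D \<longleftrightarrow> (\<exists>j\<in>I. x \<in> (s' ^^ j) ` B'))"
 proof eventually_elim
  case (elim x)
  show ?case
  proof
   assume "x \<notin> Q"
   obtain q i where q: "q < 2^r" "i < N" "x \<in> (s ^^ i) ` Y q" using elim(1) by blast
   hence "q \<notin> bad" using \<open>x \<notin> Q\<close> by (auto simp: Q_def)
   then obtain T where T: "T \<subseteq> {..<N}" "Y q \<subseteq> A T" using q by (auto simp: bad_def)
   show "x \<in> D \<longleftrightarrow> (\<exists>j\<in>I. x \<in> (s' ^^ j) ` B')"
   proof
    assume xD: "x \<in> D"
    obtain y where y: "y \<in> Y q" "x = (s ^^ i) y" using q by blast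
    hence iT: "i \<in> T" using T(2) xD q(2) by (auto simp: A_def)
    have "(s ^^ i) ` Y q \<subseteq> D" using T(2) iT by (auto simp: A_def)
    hence "jj q i \<in> I" using q by (auto simp: I_def)
    thus "\<exists>j\<in>I. x \<in> (s' ^^ j) ` B'" using elim(2) q by blast
   next
    assume "\<exists>j\<in>I. x \<in> (s' ^^ j) ` B'"
    then obtain q' i' where "q' < 2^r" "i' < N" "(s ^^ i') ` Y q' \<subseteq> D" "x \<in> (s' ^^ jj q' i') ` B'"
     by (auto simp: I_def)
    thus "x \<in> D" using elim(2) by blast
   qed
  qed
 qed
 moreover have "I \<subseteq> {..<N * 2 ^ r}" using jj(1) by (auto simp: I_def)
 ultimately show ?thesis using r(1) B'(1,2) Qs Qe by blast
qed

text \<open>Decoding \<open>m\<close> as a pair lets every \<open>U k\<close> occur at infinitely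
  many stages, so that it is approximated with errors tending to 0. The growth factor
  \<open>c m\<close> is reached because \<open>r \<ge> c m\<close> implies
  \<open>2 ^ r \<ge> c m\<close>.\<close>

lemma tower_seq:
 fixes c :: "nat => nat"
 shows "\<exists>B s N. (\<forall>m. state (B m) (s m) (N m)) \<and> (\<forall>m. ext (B m) (s m) (B (Suc m)) (s (Suc m))) \<and>
  (\<forall>m. N m dvd N (Suc m) \<and> c m * N m \<le> N (Suc m)) \<and>
  (\<forall>m. \<exists>I\<subseteq>{..<N (Suc m)}. \<exists>Q\<in>sets M. prob Q < 1 / Suc m \<and>
    (AE x in M. x \<notin> Q --> (x \<in> U (fst (prod_decode m)) \<longleftrightarrow> (\<exists>j\<in>I. x \<in> (s (Suc m) ^^ j) ` B (Suc m)))))"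
proof -
 define P where "P = (\<lambda>(m::nat) (B, s, N). state B s N)"
 define R where "R = (\<lambda>m (B, s, N) (B', s', N'). ext B s B' s' \<and> N dvd N' \<and> c m * N \<le> N' \<and>
   (\<exists>I\<subseteq>{..<N'}. \<exists>Q\<in>sets M. prob Q < 1 / Suc m \<and>
    (AE x in M. x \<notin> Q --> (x \<in> U (fst (prod_decode m)) \<longleftrightarrow> (\<exists>j\<in>I. x \<in> (s' ^^ j) ` B')))))"
 have "\<exists>f. \<forall>n. P n (f n) \<and> R n (f n) (f (Suc n))"
 proof (rule dependent_nat_choice)
  have "P 0 (space M, id, 1)" by (auto simp: P_def state_def fullg_id prob_space)
  thus "\<exists>x. P 0 x" by blast
  fix x n assume "P n x"
  then obtain B s N where x: "x = (B, s, N)" "state B s N" by (cases x) (auto simp: P_def)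
  obtain r B' s' I Q where h: "c n \<le> r" "state B' s' (N * 2 ^ r)" "ext B s B' s'" "I\<subseteq>{..<N * 2 ^ r}"
   "Q\<in>sets M" "prob Q < 1 / Suc n"
   "AE x in M. x \<notin> Q --> (x \<in> U (fst (prod_decode n)) \<longleftrightarrow> (\<exists>j\<in>I. x \<in> (s' ^^ j) ` B'))"
   using approx[OF x(2) U_sets[of "fst (prod_decode n)"], of "1 / Suc n" "c n"] by auto
  have "c n < 2 ^ r" using h(1) less_exp[of r] by linarith
  hence "c n * N \<le> N * 2 ^ r" by simp
  hence "P (Suc n) (B', s', N * 2 ^ r) \<and> R n x (B', s', N * 2 ^ r)"
   unfolding P_def R_def x(1) using h by auto
  thus "\<exists>y. P (Suc n) y \<and> R n x y" by blast
 qed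
 then obtain f where f: "\<And>n. P n (f n)" "\<And>n. R n (f n) (f (Suc n))" by blast
 show ?thesis
  by (rule exI[of _ "\<lambda>n. fst (f n)"], rule exI[of _ "\<lambda>n. fst (snd (f n))"], rule exI[of _ "\<lambda>n. snd (snd (f n))"])
   (use f in \<open>auto simp: P_def R_def split_beta\<close>)
qed

end

section \<open>The limit of the towers\<close>

context gam
begin

text \<open>\<open>\<kappa> m\<close> is the level in the \<open>m\<close>-th tower; the last clause says that the levels generate the \<open>\<sigma>\<close>-algebra.\<close>

definition odometer :: "('a => 'a) => (nat => nat) => (nat => 'a => nat) => 'a set => bool" where
 "odometer \<sigma> N \<kappa> X \<longleftrightarrow> \<sigma> \<in> fullg \<and> X \<in> sets M \<and> prob X = 1 \<and> (\<forall>x. \<sigma> x \<in> X \<longleftrightarrow> x \<in> X) \<and>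
   (\<forall>m. 0 < N m \<and> N m dvd N (Suc m)) \<and>
   (\<forall>m. \<forall>x\<in>X. \<kappa> m x < N m \<and> \<kappa> m (\<sigma> x) = Suc (\<kappa> m x) mod N m \<and> \<kappa> (Suc m) x mod N m = \<kappa> m x) \<and>
   (\<forall>m i. {x\<in>X. \<kappa> m x = i} \<in> sets M) \<and> (\<forall>m. \<forall>i<N m. prob {x\<in>X. \<kappa> m x = i} = 1 / N m) \<and>
   (\<forall>A\<in>sets M. \<forall>e>0. \<exists>m I. \<exists>Q\<in>sets M. prob Q < e \<and> (\<forall>x\<in>X - Q. x \<in> A \<longleftrightarrow> \<kappa> m x \<in> I))"

text \<open>If \<open>s x\<close> lies in \<open>B\<close> but \<open>s' x\<close> does not, then
  the value \<open>s' x\<close> is also taken by \<open>s'\<close> at its preimage under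
  \<open>s\<close>, against injectivity.\<close>

lemma ext_iff:
 assumes "s \<in> mpa" "s' \<in> mpa" "ext B s B' s'"
 shows "s' x \<in> B \<longleftrightarrow> s x \<in> B"
proof
 assume "s' x \<in> B"
 thus "s x \<in> B" using assms(3) by (auto simp: ext_def)
next
 assume sx: "s x \<in> B"
 show "s' x \<in> B"
 proof (rule ccontr)
  assume n: "s' x \<notin> B"
  define z where "z = inv s (s' x)"
  have z: "s z = s' x" using assms(1) by (simp add: z_def)
  hence "s' z = s' x" using assms(3) n by (auto simp: ext_def)
  hence "z = x" using mpaD(2)[OF assms(2)] by (metis injD)
  thus False using z n sx by simp
 qed
qed

text \<open>The bases have measure at most \<open>2 ^ -m\<close>, so almost every point eventually
  has a fixed image under the tower maps; \<open>\<sigma>\<close> is this limit, and it climbs all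
  towers at once.\<close>

lemma odometer_exists:
 fixes c :: "nat => nat"
 assumes c: "\<And>m. c m \<ge> 2"
 shows "\<exists>\<sigma> N \<kappa> X. odometer \<sigma> N \<kappa> X \<and> (\<forall>m. c m * N m \<le> N (Suc m))"
proof -
 obtain B s N where S: "\<And>m. state (B m) (s m) (N m)"
  and ex1: "\<And>m. ext (B m) (s m) (B (Suc m)) (s (Suc m))"
  and Nd: "\<And>m. N m dvd N (Suc m)" and Nc: "\<And>m. c m * N m \<le> N (Suc m)"
  and ap: "\<And>m. \<exists>I\<subseteq>{..<N (Suc m)}. \<exists>Q\<in>sets M. prob Q < 1 / Suc m \<and>
    (AE x in M. x \<notin> Q --> (x \<in> U (fst (prod_decode m)) \<longleftrightarrow> (\<exists>j\<in>I. x \<in> (s (Suc m) ^^ j) ` B (Suc m))))"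
  using tower_seq[of c] by blast
 have N0: "N m > 0" and Bs: "B m \<in> sets M" and sf: "s m \<in> fullg" and Bp: "prob (B m) = 1 / N m"
  and sB: "x \<in> B m ==> (s m ^^ N m) x = x" for m x
  using S[of m] unfolding state_def by auto
 have sm: "s m \<in> mpa" for m using sf fullgD by blast
 have ex: "ext (B m) (s m) (B m') (s m')" if "m \<le> m'" for m m'
  using that by (induction m' rule: dec_induct) (auto intro: ext_refl ext_trans ex1)
 have Bdec: "B m' \<subseteq> B m" if "m \<le> m'" for m m' using ex[OF that] by (simp add: ext_def)
 have seq: "s m' x = s m x" if "s m x \<notin> B m" "m \<le> m'" for m m' x
  using ex[OF that(2)] that(1) by (simp add: ext_def)
 have N2: "2 ^ m \<le> N m" for m
 proof (induction m)
  case (Suc m)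
  have "2 ^ Suc m \<le> 2 * N m" using Suc by simp
  also have "... \<le> c m * N m" using c[of m] by simp
  finally show ?case using Nc[of m] by linarith
 qed (use N0[of 0] in simp)
 have small: "prob (B m) \<le> (1/2) ^ m" for m
 proof -
  have "(2::real) ^ m \<le> N m" using N2[of m] by (metis of_nat_le_iff of_nat_numeral of_nat_power)
  thus ?thesis unfolding Bp using N0[of m] by (simp add: power_divide field_simps)
 qed
 have null: "prob (\<Inter>m. D m) = 0" if "\<And>m. D m \<in> sets M" "\<And>m. prob (D m) \<le> (1/2) ^ m" for D :: "nat => 'a set"
 proof (rule ccontr)
  assume "prob (\<Inter>m. D m) ~= 0"
  hence "0 < prob (\<Inter>m. D m)" by (simp add: zero_less_measure_iff)
  then obtain m where m: "(1/2::real) ^ m < prob (\<Inter>m. D m)" using real_arch_pow_inv[of _ "1/2"] by auto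
  have "prob (\<Inter>m. D m) \<le> prob (D m)" using that(1) by (intro finite_measure_mono) auto
  thus False using that(2)[of m] m by linarith
 qed
 have AE1: "AE x in M. \<exists>m. x \<notin> B m"
 proof -
  have "AE x in M. x \<notin> (\<Inter>m. B m)" using null[of B] Bs small by (subst prob_eq_0[symmetric]) auto
  thus ?thesis by eventually_elim auto
 qed
 have AE2: "AE x in M. \<exists>m. s m x \<notin> B m"
 proof -
  have "AE x in M. x \<notin> (\<Inter>m. s m -` B m)"
   using null[of "\<lambda>m. s m -` B m"] vimage_sets[OF sm Bs] small prob_vimage[OF sm Bs]
   by (subst prob_eq_0[symmetric]) auto
  thus ?thesis by eventually_elim auto
 qed
 have AE3: "AE x in M. \<forall>m. \<exists>i<N m. x \<in> (s m ^^ i) ` B m"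
  unfolding AE_all_countable using state_cover[OF S] by blast
 \<comment> \<open>The three demands make the preimage of \<open>x\<close> eventually constant, make
   its image eventually constant, and give \<open>x\<close> a level in every tower.\<close>
 define PP where "PP x \<longleftrightarrow> (\<exists>m. x \<notin> B m) \<and> (\<exists>m. s m x \<notin> B m) \<and> (\<forall>m. \<exists>i<N m. x \<in> (s m ^^ i) ` B m)" for x
 have "AE x in M. PP x" using AE1 AE2 AE3 unfolding PP_def by eventually_elim blast
 from saturate[OF sm this] obtain Z where Z0: "Z \<in> sets M"
  and Z1: "prob Z = 1 \<and> (\<forall>x\<in>Z. PP x) \<and> (\<forall>k x. s k x \<in> Z \<longleftrightarrow> x \<in> Z)" by (rule bexE)
 have Z: "Z \<in> sets M" "prob Z = 1" "\<And>x. x \<in> Z ==> PP x" "\<And>k x. s k x \<in> Z \<longleftrightarrow> x \<in> Z"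
  using Z0 Z1 by auto
 have AEZ: "AE x in M. x \<in> Z" using Z prob_eq_1 by blast
 define \<sigma> where "\<sigma> x = (if x \<in> Z then s (LEAST m. s m x \<notin> B m) x else x)" for x
 have \<sigma>s: "\<sigma> x = s m x" if "x \<in> Z" "s m x \<notin> B m" for x m
 proof -
  let ?l = "LEAST m. s m x \<notin> B m"
  have "s ?l x \<notin> B ?l" by (rule LeastI[of "\<lambda>m. s m x \<notin> B m", OF that(2)])
  moreover have "?l \<le> m" by (rule Least_le[of "\<lambda>m. s m x \<notin> B m", OF that(2)])
  ultimately show ?thesis using seq[of ?l x m] that(1) by (simp add: \<sigma>_def)
 qed
 have ev: "\<exists>m0. \<forall>m\<ge>m0. s m x = \<sigma> x" if x: "x \<in> Z" for x
 proof -
  obtain m where m: "s m x \<notin> B m" using Z(3)[OF x] PP_def by blast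
  have "s m' x = \<sigma> x" if "m \<le> m'" for m' using \<sigma>s[OF x m] seq[OF m that] by simp
  thus ?thesis by blast
 qed
 have \<sigma>Z: "\<sigma> x \<in> Z \<longleftrightarrow> x \<in> Z" for x using Z(4) by (simp add: \<sigma>_def)
 have \<sigma>m: "\<sigma> \<in> mpa"
 proof (rule mpa_piecewise_nat)
  let ?C = "\<lambda>i. case i of 0 => space M - Z | Suc m => Z - s m -` B m"
  let ?g = "\<lambda>i. case i of 0 => id | Suc m => s m"
  show "?C i \<in> sets M" for i using Z(1) vimage_sets[OF sm Bs] by (auto split: nat.split)
  show "?g i \<in> mpa" for i using sm by (auto split: nat.split)
  show "\<sigma> x = ?g i x" if "x \<in> ?C i" for i x using that \<sigma>s by (auto split: nat.splits simp: \<sigma>_def)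
  show "space M \<subseteq> (\<Union>i. ?C i)"
  proof
   fix x assume x: "x \<in> space M"
   show "x \<in> (\<Union>i. ?C i)"
   proof (cases "x \<in> Z")
    case True
    then obtain m where m: "s m x \<notin> B m" using Z(3)[OF True] PP_def by blast
    hence "x \<in> ?C (Suc m)" using True by simp
    thus ?thesis by blast
   next
    case False
    hence "x \<in> ?C 0" using x by simp
    thus ?thesis by blast
   qed
  qed
  have "Z \<subseteq> space M" using Z(1) sets.sets_into_space by blast
  thus "\<sigma> x = x" if "x \<notin> space M" for x using that by (auto simp: \<sigma>_def)
  show "bij \<sigma>"
  proof (rule bijI)
   show "inj \<sigma>"
   proof (rule injI)
    fix x y assume eq: "\<sigma> x = \<sigma> y"
    show "x = y"
    proof (cases "x \<in> Z")
     case True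
     hence yZ: "y \<in> Z" using eq \<sigma>Z by metis
     obtain m1 m2 where m: "\<forall>m\<ge>m1. s m x = \<sigma> x" "\<forall>m\<ge>m2. s m y = \<sigma> y"
      using ev[OF True] ev[OF yZ] by blast
     hence "s (max m1 m2) x = s (max m1 m2) y" using eq by simp
     thus ?thesis using mpaD(2)[OF sm] by (metis injD)
    next
     case False
     hence "y \<notin> Z" using eq \<sigma>Z by metis
     thus ?thesis using False eq by (simp add: \<sigma>_def)
    qed
   qed
   have "\<exists>x. \<sigma> x = y" for y
   proof (cases "y \<in> Z")
    case True
    \<comment> \<open>Outside \<open>B m\<close> the preimage is already decided by
      \<open>s m\<close>.\<close>
    then obtain m where m: "y \<notin> B m" using Z(3)[OF True] PP_def by blast
    define x where "x = inv (s m) y"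
    have sx: "s m x = y" using sm by (simp add: x_def)
    hence "x \<in> Z" using True Z(4) by metis
    hence "\<sigma> x = y" using \<sigma>s[of x m] sx m by simp
    thus ?thesis by blast
   next
    case False thus ?thesis by (intro exI[of _ y]) (simp add: \<sigma>_def)
   qed
   thus "surj \<sigma>" unfolding surj_def by metis
  qed
 qed
 have \<sigma>f: "\<sigma> \<in> fullg"
 proof -
  have "AE x in M. \<forall>m. orb x (s m x)" unfolding AE_all_countable using fullgD(2)[OF sf] by blast
  hence "AE x in M. orb x (\<sigma> x)" by eventually_elim (simp add: \<sigma>_def)
  thus ?thesis using \<sigma>m by (simp add: fullg_def)
 qed
 define \<kappa> where "\<kappa> m x = (SOME i. i < N m \<and> x \<in> (s m ^^ i) ` B m)" for m x
 have \<kappa>: "\<kappa> m x < N m" "x \<in> (s m ^^ \<kappa> m x) ` B m" if x: "x \<in> Z" for m x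
 proof -
  have "\<exists>i. i < N m \<and> x \<in> (s m ^^ i) ` B m" using Z(3)[OF x] PP_def by blast
  from someI_ex[OF this] have "\<kappa> m x < N m \<and> x \<in> (s m ^^ \<kappa> m x) ` B m" unfolding \<kappa>_def .
  thus "\<kappa> m x < N m" "x \<in> (s m ^^ \<kappa> m x) ` B m" by auto
 qed
 have \<kappa>u: "\<kappa> m x = i" if h: "x \<in> Z" "i < N m" "x \<in> (s m ^^ i) ` B m" for m x i
 proof -
  obtain b where b: "b \<in> B m" "x = (s m ^^ \<kappa> m x) b" using \<kappa>(2)[OF h(1), of m] by (rule imageE)
  obtain b' where b': "b' \<in> B m" "x = (s m ^^ i) b'" using h(3) by (rule imageE)
  have "(s m ^^ \<kappa> m x) b = (s m ^^ i) b'" using b(2) b'(2) by metis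
  thus ?thesis by (rule state_inj[OF S b(1) b'(1) \<kappa>(1)[OF h(1)] h(2)])
 qed
 have \<kappa>0: "\<kappa> m x = 0" if "x \<in> Z" "x \<in> B m" for m x
  using \<kappa>u[OF that(1) N0] that(2) by simp
 have \<kappa>B: "x \<in> B m" if "x \<in> Z" "\<kappa> m x = 0" for m x
  using \<kappa>(2)[OF that(1), of m] that(2) by simp
 have \<kappa>s: "\<kappa> m (s m x) = Suc (\<kappa> m x) mod N m" if x: "x \<in> Z" for m x
 proof -
  obtain b where b: "b \<in> B m" "x = (s m ^^ \<kappa> m x) b" using \<kappa>(2)[OF x, of m] by blast
  hence sx: "s m x = (s m ^^ Suc (\<kappa> m x)) b" by simp
  have sZ: "s m x \<in> Z" using Z(4) x by simp
  show ?thesis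
  proof (cases "Suc (\<kappa> m x) < N m")
   case True
   hence "\<kappa> m (s m x) = Suc (\<kappa> m x)" using \<kappa>u[OF sZ True] sx b(1) by blast
   thus ?thesis using True by simp
  next
   case False
   hence e: "Suc (\<kappa> m x) = N m" using \<kappa>(1)[OF x, of m] by simp
   hence "s m x \<in> B m" using sx sB[OF b(1)] b(1) by simp
   thus ?thesis using \<kappa>0[OF sZ] e by simp
  qed
 qed
 \<comment> \<open>A later map agrees with \<open>s m\<close> unless \<open>s m\<close> returns to
   the base \<open>B m\<close>; then both return there, possibly to different points, and both
   images have level 0.\<close>
 have \<kappa>s': "\<kappa> m (s m' x) = Suc (\<kappa> m x) mod N m" if x: "x \<in> Z" and m: "m \<le> m'" for m m' x
 proof (cases "s m x \<in> B m")
  case False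
  thus ?thesis using seq[OF False m] \<kappa>s[OF x] by simp
 next
  case True
  hence "s m' x \<in> B m" using ext_iff[OF sm sm ex[OF m]] by blast
  hence "\<kappa> m (s m' x) = 0" using \<kappa>0 Z(4) x by blast
  moreover have "\<kappa> m (s m x) = 0" using \<kappa>0 Z(4) x True by blast
  ultimately show ?thesis using \<kappa>s[OF x, of m] by simp
 qed
 have \<kappa>\<sigma>: "\<kappa> m (\<sigma> x) = Suc (\<kappa> m x) mod N m" if x: "x \<in> Z" for m x
 proof -
  obtain m0 where "\<forall>m\<ge>m0. s m x = \<sigma> x" using ev[OF x] by blast
  hence "s (max m0 m) x = \<sigma> x" by simp
  thus ?thesis using \<kappa>s'[OF x, of m "max m0 m"] by simp
 qed
 \<comment> \<open>Walking backwards along \<open>\<sigma>\<close> to level 0 of the larger tower,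
   where its base is contained in that of the smaller one.\<close>
 have coh: "\<kappa> (Suc m) x mod N m = \<kappa> m x" if x: "x \<in> Z" for m x
 proof -
  have "i mod N m = \<kappa> m x" if "x \<in> Z" "\<kappa> (Suc m) x = i" for i x
   using that
  proof (induction i arbitrary: x)
   case 0
   hence "x \<in> B m" using \<kappa>B Bdec[of m "Suc m"] by auto
   thus ?case using \<kappa>0 0 by simp
  next
   case (Suc i)
   define y where "y = inv \<sigma> x"
   have y: "\<sigma> y = x" using \<sigma>m by (simp add: y_def)
   hence yZ: "y \<in> Z" using Suc \<sigma>Z by metis
   have "Suc (\<kappa> (Suc m) y) mod N (Suc m) = Suc i" using \<kappa>\<sigma>[OF yZ, of "Suc m"] y Suc by simp
   hence "\<kappa> (Suc m) y = i" using \<kappa>(1)[OF yZ, of "Suc m"] by (auto simp: mod_Suc split: if_splits)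
   hence "i mod N m = \<kappa> m y" using Suc.IH yZ by blast
   hence "Suc i mod N m = Suc (\<kappa> m y) mod N m" by (metis mod_Suc_eq)
   thus ?case using \<kappa>\<sigma>[OF yZ, of m] y by simp
  qed
  thus ?thesis using x by blast
 qed
 have \<kappa>set: "{x \<in> Z. \<kappa> m x = i} = Z \<inter> (s m ^^ i) ` B m" if "i < N m" for m i
  using \<kappa>(2) \<kappa>u[OF _ that] by auto
 have imB: "(s m ^^ i) ` B m \<in> sets M" for m i using image_sets[OF funpow_mpa[OF sm] Bs] .
 have \<kappa>sets: "{x \<in> Z. \<kappa> m x = i} \<in> sets M" for m i
 proof (cases "i < N m")
  case True thus ?thesis using \<kappa>set[OF True] imB Z(1) by auto
 next
  case False
  hence "{x \<in> Z. \<kappa> m x = i} = {}" using \<kappa>(1) by auto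
  thus ?thesis by (metis sets.empty_sets)
 qed
 have \<kappa>p: "prob {x \<in> Z. \<kappa> m x = i} = 1 / N m" if i: "i < N m" for m i
 proof -
  have "prob (Z \<inter> (s m ^^ i) ` B m) = prob ((s m ^^ i) ` B m)"
   using AEZ imB Z(1) by (intro measure_eq_AE) auto
  thus ?thesis using prob_image[OF funpow_mpa[OF sm] Bs, of i m m] Bp \<kappa>set[OF i] by simp
 qed
 have dv: "N m dvd N m'" if "m \<le> m'" for m m'
  using that by (induction m' rule: dec_induct) (auto intro: dvd_trans[OF _ Nd])
 have coh': "\<kappa> m' x mod N m = \<kappa> m x" if x: "x \<in> Z" and m: "m \<le> m'" for m m' x
  using m
 proof (induction m' rule: dec_induct)
  case base show ?case using \<kappa>(1)[OF x] by simp
 next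
  case (step n)
  have "\<kappa> (Suc n) x mod N m = (\<kappa> (Suc n) x mod N n) mod N m" using dv[OF step(1)] by (simp add: mod_mod_cancel)
  thus ?case using coh[OF x] step by simp
 qed
 \<comment> \<open>Approximation by all sufficiently late towers, and not just by one, so that two
   sets can be treated at a common \<open>m\<close>.\<close>
 define apr where "apr A \<longleftrightarrow> (\<forall>e>0. \<exists>m0. \<forall>m\<ge>m0. \<exists>I. \<exists>Q\<in>sets M. prob Q < e \<and> (\<forall>x\<in>Z - Q. x \<in> A \<longleftrightarrow> \<kappa> m x \<in> I))" for A
 have aprI: "apr A" if h: "\<And>e. e > 0 ==> \<exists>m I. \<exists>Q\<in>sets M. prob Q < e \<and> (\<forall>x\<in>Z - Q. x \<in> A \<longleftrightarrow> \<kappa> m x \<in> I)" for A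
  unfolding apr_def
 proof (intro allI impI)
  fix e :: real assume "e > 0"
  then obtain m0 I Q where mI: "Q \<in> sets M" "prob Q < e" "\<forall>x\<in>Z - Q. x \<in> A \<longleftrightarrow> \<kappa> m0 x \<in> I" using h by blast
  have "\<exists>I. \<exists>Q\<in>sets M. prob Q < e \<and> (\<forall>x\<in>Z - Q. x \<in> A \<longleftrightarrow> \<kappa> m x \<in> I)" if "m0 \<le> m" for m
   using mI coh'[OF _ that] by (intro exI[of _ "{i. i mod N m0 \<in> I}"] bexI[of _ Q]) auto
  thus "\<exists>m0. \<forall>m\<ge>m0. \<exists>I. \<exists>Q\<in>sets M. prob Q < e \<and> (\<forall>x\<in>Z - Q. x \<in> A \<longleftrightarrow> \<kappa> m x \<in> I)" by blast
 qed
 have aprU: "apr (A \<union> A')" if A: "apr A" "apr A'" for A A'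
 proof (rule aprI)
  fix e :: real assume e: "e > 0"
  hence e2: "e / 2 > 0" by simp
  obtain m1 m2 where m12: "\<forall>m\<ge>m1. \<exists>I. \<exists>Q\<in>sets M. prob Q < e/2 \<and> (\<forall>x\<in>Z - Q. x \<in> A \<longleftrightarrow> \<kappa> m x \<in> I)"
   "\<forall>m\<ge>m2. \<exists>I. \<exists>Q\<in>sets M. prob Q < e/2 \<and> (\<forall>x\<in>Z - Q. x \<in> A' \<longleftrightarrow> \<kappa> m x \<in> I)"
   using A[unfolded apr_def, THEN spec, THEN mp, OF e2] by blast
  let ?m = "max m1 m2"
  obtain I Q where I: "Q \<in> sets M" "prob Q < e/2" "\<forall>x\<in>Z - Q. x \<in> A \<longleftrightarrow> \<kappa> ?m x \<in> I"
   using m12(1) by (metis max.cobounded1)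
  obtain I' Q' where I': "Q' \<in> sets M" "prob Q' < e/2" "\<forall>x\<in>Z - Q'. x \<in> A' \<longleftrightarrow> \<kappa> ?m x \<in> I'"
   using m12(2) by (metis max.cobounded2)
  have "prob (Q \<union> Q') < e" using measure_Un_le[OF I(1) I'(1)] I(2) I'(2) by linarith
  thus "\<exists>m I. \<exists>Q\<in>sets M. prob Q < e \<and> (\<forall>x\<in>Z - Q. x \<in> A \<union> A' \<longleftrightarrow> \<kappa> m x \<in> I)"
   using I I' by (intro exI[of _ ?m] exI[of _ "I \<union> I'"] bexI[of _ "Q \<union> Q'"]) auto
 qed
 have apr0: "apr {}" by (rule aprI) (auto intro!: exI[of _ "{}"] bexI[of _ "{}"])
 have apr: "apr A" if "A \<in> sigma_sets (space M) (range U)" for A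
  using that
 proof (induction A)
  case (Basic A)
  then obtain k where A: "A = U k" by blast
  show ?case
  proof (rule aprI)
   fix e :: real assume "e > 0"
   then obtain j :: nat where j: "1 / Suc j < e" using nat_approx_posE by blast
   \<comment> \<open>A stage devoted to \<open>U k\<close> that is late enough for the error
     \<open>1 / Suc m\<close> to be below \<open>e\<close>.\<close>
   define m where "m = prod_encode (k, j)"
   have "j \<le> m" unfolding m_def by (rule le_prod_encode_2)
   hence le: "1 / Suc m \<le> 1 / Suc j" by (simp add: field_simps)
   have km: "fst (prod_decode m) = k" by (simp add: m_def)
   obtain I Q where I: "I \<subseteq> {..<N (Suc m)}" "Q \<in> sets M" "prob Q < 1 / Suc m"
    "AE x in M. x \<notin> Q --> (x \<in> U k \<longleftrightarrow> (\<exists>j\<in>I. x \<in> (s (Suc m) ^^ j) ` B (Suc m)))"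
    using ap[of m] unfolding km by blast
   obtain Nn where Nn: "{x\<in>space M. \<not> (x \<notin> Q --> (x \<in> U k \<longleftrightarrow> (\<exists>j\<in>I. x \<in> (s (Suc m) ^^ j) ` B (Suc m))))} \<subseteq> Nn"
    "emeasure M Nn = 0" "Nn \<in> sets M" by (rule AE_E[OF I(4)])
   have "prob (Q \<union> Nn) \<le> prob Q + prob Nn" using I Nn by (intro measure_Un_le) auto
   also have "prob Nn = 0" using Nn by (simp add: measure_def)
   finally have "prob (Q \<union> Nn) < e" using I(3) le j by linarith
   moreover have "x \<in> U k \<longleftrightarrow> \<kappa> (Suc m) x \<in> I" if x: "x \<in> Z - (Q \<union> Nn)" for x
   proof -
    have "x \<in> space M" using x Z(1) sets.sets_into_space by blast
    hence "x \<in> U k \<longleftrightarrow> (\<exists>j\<in>I. x \<in> (s (Suc m) ^^ j) ` B (Suc m))" using x Nn(1) by blast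
    also have "... \<longleftrightarrow> \<kappa> (Suc m) x \<in> I"
    proof
     assume "\<exists>j\<in>I. x \<in> (s (Suc m) ^^ j) ` B (Suc m)"
     then obtain j where j: "j \<in> I" "x \<in> (s (Suc m) ^^ j) ` B (Suc m)" by blast
     have "j < N (Suc m)" using I(1) j(1) by auto
     hence "\<kappa> (Suc m) x = j" using x by (intro \<kappa>u j(2)) auto
     thus "\<kappa> (Suc m) x \<in> I" using j(1) by simp
    next
     assume "\<kappa> (Suc m) x \<in> I"
     thus "\<exists>j\<in>I. x \<in> (s (Suc m) ^^ j) ` B (Suc m)" using \<kappa>(2) x by blast
    qed
    finally show ?thesis .
   qed
   ultimately show "\<exists>m I. \<exists>Q\<in>sets M. prob Q < e \<and> (\<forall>x\<in>Z - Q. x \<in> A \<longleftrightarrow> \<kappa> m x \<in> I)"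
    unfolding A using I(2) Nn(3) by (intro exI[of _ "Suc m"] exI[of _ I] bexI[of _ "Q \<union> Nn"]) auto
  qed
 next
  case Empty show ?case by (rule apr0)
 next
  case (Compl A)
  show ?case
  proof (rule aprI)
   fix e :: real assume "e > 0"
   then obtain m where "\<exists>I. \<exists>Q\<in>sets M. prob Q < e \<and> (\<forall>x\<in>Z - Q. x \<in> A \<longleftrightarrow> \<kappa> m x \<in> I)"
    using Compl.IH unfolding apr_def by blast
   then obtain I Q where I: "Q \<in> sets M" "prob Q < e" "\<forall>x\<in>Z - Q. x \<in> A \<longleftrightarrow> \<kappa> m x \<in> I" by blast
   have "Z \<subseteq> space M" using Z(1) sets.sets_into_space by blast
   thus "\<exists>m I. \<exists>Q\<in>sets M. prob Q < e \<and> (\<forall>x\<in>Z - Q. x \<in> space M - A \<longleftrightarrow> \<kappa> m x \<in> I)"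
    using I by (intro exI[of _ m] exI[of _ "- I"] bexI[of _ Q]) auto
  qed
 next
  case (Union A)
  have As: "A i \<in> sets M" for i using Union.hyps sets_eq by simp
  have fin: "apr (\<Union>i<n. A i)" for n
  proof (induction n)
   case (Suc n)
   have "(\<Union>i<Suc n. A i) = (\<Union>i<n. A i) \<union> A n" by (auto simp: less_Suc_eq)
   thus ?case using aprU[OF Suc Union.IH] by simp
  qed (simp add: apr0)
  show ?case
  proof (rule aprI)
   fix e :: real assume e: "e > 0"
   let ?T = "\<lambda>n. (\<Union>i. A i) - (\<Union>i<n. A i)"
   have "decseq ?T" by (rule decseq_SucI) auto
   hence "(\<lambda>n. prob (?T n)) \<longlonglongrightarrow> prob (\<Inter>n. ?T n)" using As by (intro finite_Lim_measure_decseq) auto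
   moreover have "(\<Inter>n. ?T n) = {}" by auto
   ultimately have "(\<lambda>n. prob (?T n)) \<longlonglongrightarrow> 0" by (simp only: measure_empty)
   hence "\<forall>\<^sub>F n in sequentially. prob (?T n) < e / 2" using e by (intro order_tendstoD) auto
   then obtain n where n: "prob (?T n) < e / 2" by (auto simp: eventually_sequentially)
   have e2: "e / 2 > 0" using e by simp
   obtain m0 where m0: "\<forall>m\<ge>m0. \<exists>I. \<exists>Q\<in>sets M. prob Q < e/2 \<and> (\<forall>x\<in>Z - Q. x \<in> (\<Union>i<n. A i) \<longleftrightarrow> \<kappa> m x \<in> I)"
    using fin[of n, unfolded apr_def, THEN spec, THEN mp, OF e2] by (rule exE)
   define m where "m = m0"
   have "\<exists>I. \<exists>Q\<in>sets M. prob Q < e/2 \<and> (\<forall>x\<in>Z - Q. x \<in> (\<Union>i<n. A i) \<longleftrightarrow> \<kappa> m x \<in> I)"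
    using m0[THEN spec, of m] by (simp add: m_def)
   then obtain I Q where I: "Q \<in> sets M" "prob Q < e/2" "\<forall>x\<in>Z - Q. x \<in> (\<Union>i<n. A i) \<longleftrightarrow> \<kappa> m x \<in> I" by blast
   have T: "?T n \<in> sets M" using As by auto
   have "prob (Q \<union> ?T n) < e" using measure_Un_le[OF I(1) T] I(2) n by linarith
   thus "\<exists>m I. \<exists>Q\<in>sets M. prob Q < e \<and> (\<forall>x\<in>Z - Q. x \<in> (\<Union>i. A i) \<longleftrightarrow> \<kappa> m x \<in> I)"
    using I T by (intro exI[of _ m] exI[of _ I] bexI[of _ "Q \<union> ?T n"]) auto
  qed
 qed
 have "odometer \<sigma> N \<kappa> Z"
  unfolding odometer_def
 proof (intro conjI allI ballI impI)
  fix A e assume "A \<in> sets M" "(0::real) < e"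
  hence "apr A" using apr sets_eq by simp
  thus "\<exists>m I. \<exists>Q\<in>sets M. prob Q < e \<and> (\<forall>x\<in>Z - Q. x \<in> A \<longleftrightarrow> \<kappa> m x \<in> I)"
   using \<open>0 < e\<close> unfolding apr_def by blast
 qed (use \<sigma>f Z(1,2) \<sigma>Z N0 Nd \<kappa>(1) \<kappa>\<sigma> coh \<kappa>sets \<kappa>p in auto)
 thus ?thesis using Nc by blast
qed

end

section \<open>Permutation groups closed under shifts\<close>

text \<open>The conjugate of \<open>p\<close> by the translation by \<open>d\<close>, continued by
  the identity on the first \<open>d\<close> numbers.\<close>

definition shn :: "nat => (nat => nat) => nat => nat" where
 "shn d p i = (if i < d then i else p (i - d) + d)"

lemma shn_0 [simp]: "shn 0 p = p"
 by (auto simp: shn_def)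

lemma shn_shn: "shn a (shn b p) = shn (a + b) p"
 by (auto simp: shn_def fun_eq_iff)

lemma shn_permutes:
 assumes "p permutes {..<k}" shows "shn d p permutes {..<k + d}"
proof (rule bij_imp_permutes)
 have inj: "inj p" using permutes_inj[OF assms] .
 have "bij (shn d p)"
 proof (rule bijI)
  show "inj (shn d p)"
  proof (rule injI)
   fix x y assume eq: "shn d p x = shn d p y"
   show "x = y"
   proof (cases "x < d \<or> y < d")
    case True
    thus ?thesis using eq by (cases "x < d"; cases "y < d") (simp_all add: shn_def)
   next
    case False
    hence "p (x - d) = p (y - d)" using eq by (simp add: shn_def)
    hence "x - d = y - d" using inj by (metis injD)
    thus ?thesis using False by arith
   qed
  qed
  have "\<exists>x. shn d p x = y" for y
  proof (cases "y < d")
   case True thus ?thesis by (intro exI[of _ y]) (simp add: shn_def)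
  next
   case False
   obtain z where "p z = y - d" using permutes_surj[OF assms] by (metis surjD)
   thus ?thesis using False by (intro exI[of _ "z + d"]) (simp add: shn_def)
  qed
  thus "surj (shn d p)" unfolding surj_def by metis
 qed
 moreover show out: "shn d p x = x" if "x \<notin> {..<k + d}" for x
  using permutes_not_in[OF assms, of "x - d"] that by (auto simp: shn_def)
 ultimately show "bij_betw (shn d p) {..<k + d} {..<k + d}"
 proof -
  have "shn d p x < k + d" if "x < k + d" for x
  proof (cases "x < d")
   case False
   hence "x - d < k" using that by auto
   hence "p (x - d) < k" using permutes_in_image[OF assms, of "x - d"] by auto
   thus ?thesis using False by (simp add: shn_def)
  qed (use that in \<open>simp add: shn_def\<close>)
  hence "shn d p ` {..<k + d} \<subseteq> {..<k + d}" by auto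
  moreover have "inj_on (shn d p) {..<k + d}" using \<open>bij (shn d p)\<close> by (meson bij_is_inj inj_on_subset subset_UNIV)
  ultimately show ?thesis by (simp add: bij_betw_def endo_inj_surj)
 qed
qed

text \<open>For \<open>p\<close> injective on \<open>{..q}\<close> this is the cycle through
  \<open>p 0\<close>, ..., \<open>p q\<close>. Its length is \<open>Suc q\<close>, and this is the
  number that will be prime.\<close>

definition cyc :: "(nat => nat) => nat => nat => nat" where
 "cyc p q i = (if i \<in> p ` {..q} then p (Suc (the_inv_into {..q} p i) mod Suc q) else i)"

lemma cyc_apply: "inj_on p {..q} ==> k \<le> q ==> cyc p q (p k) = p (Suc k mod Suc q)"
 by (simp add: cyc_def the_inv_into_f_f)

lemma cyc_out: "i \<notin> p ` {..q} ==> cyc p q i = i"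
 by (simp add: cyc_def)

lemma cyc_funpow:
 assumes "inj_on p {..q}" "k \<le> q" shows "(cyc p q ^^ j) (p k) = p ((k + j) mod Suc q)"
proof (induction j)
 case (Suc j)
 have "(k + j) mod Suc q \<le> q" by (metis less_Suc_eq_le mod_less_divisor zero_less_Suc)
 thus ?case using Suc cyc_apply[OF assms(1)] by (simp add: mod_Suc_eq)
qed (use assms in simp)

lemma cyc_order:
 assumes "inj_on p {..q}" shows "cyc p q ^^ Suc q = id"
proof
 fix i show "(cyc p q ^^ Suc q) i = id i"
 proof (cases "i \<in> p ` {..q}")
  case True
  then obtain k where k: "k \<le> q" "i = p k" by auto
  have "(k + Suc q) mod Suc q = k" using k(1) by (metis less_Suc_eq_le mod_add_self2 mod_less)
  thus ?thesis using cyc_funpow[OF assms k(1), of "Suc q"] k(2) by (metis id_apply)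
 next
  case False
  have "(cyc p q ^^ j) i = i" for j by (induction j) (simp_all add: cyc_out[OF False])
  thus ?thesis by (metis id_apply)
 qed
qed

lemma cyc_permutes:
 assumes "inj_on p {..q}" "p ` {..q} \<subseteq> S" shows "cyc p q permutes S"
proof -
 have "cyc p q o (cyc p q ^^ q) = id" "(cyc p q ^^ q) o cyc p q = id"
  using cyc_order[OF assms(1)] by (simp_all add: funpow_swap1 fun_eq_iff)
 hence "bij (cyc p q)" by (metis o_bij)
 moreover have "cyc p q x = x" if "x \<notin> S" for x using that assms(2) by (intro cyc_out) auto
 ultimately show ?thesis unfolding permutes_def by (metis bij_pointE)
qed

text \<open>If two supports share only \<open>c\<close>, then \<open>f c\<close> and
  \<open>g c\<close> are each moved by one of the maps alone. The commutator cancels everywhere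
  except at these two points and \<open>c\<close>.\<close>

lemma commutator_3cycle:
 fixes f g :: "'b => 'b"
 assumes f: "bij f" and g: "bij g" and one: "\<And>x. f x ~= x ==> g x ~= x ==> x = c"
  and fc: "f c ~= c" and gc: "g c ~= c"
 defines "h \<equiv> f o g o inv f o inv g"
 shows "h (f c) = g c" "h (g c) = c" "h c = f c" "\<And>x. x ~= f c ==> x ~= g c ==> x ~= c ==> h x = x"
proof -
 have fi: "f (inv f x) = x" "inv f (f x) = x" and gi: "g (inv g x) = x" "inv g (g x) = x" for x
  using f g by (simp_all add: bij_is_surj surj_f_inv_f bij_is_inj)
 have ffix: "inv f x = x \<longleftrightarrow> f x = x" for x using fi by metis
 have gfix: "inv g x = x \<longleftrightarrow> g x = x" for x using gi by metis
 have a: "f (f c) ~= f c" using fc fi by metis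
 have b: "g (g c) ~= g c" using gc gi by metis
 have ga: "g (f c) = f c" using one[of "f c"] a fc by blast
 have fb: "f (g c) = g c" using one[of "g c"] b gc by blast
 have "inv g (f c) = f c" using ga gfix by blast
 thus "h (f c) = g c" by (simp add: h_def fi fb)
 have "h (g c) = f (g (inv f c))" by (simp add: h_def gi)
 moreover have "f (inv f c) ~= inv f c" using fc fi by metis
 moreover have "inv f c ~= c" using fc ffix by blast
 ultimately show "h (g c) = c" using one[of "inv f c"] fi by metis
 have "g (inv g c) ~= inv g c" using gc gi by metis
 moreover have "inv g c ~= c" using gc gfix by blast
 ultimately have "f (inv g c) = inv g c" using one[of "inv g c"] by blast
 hence "inv f (inv g c) = inv g c" using ffix by blast
 thus "h c = f c" by (simp add: h_def gi)
 fix x assume x: "x ~= f c" "x ~= g c" "x ~= c"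
 show "h x = x"
 proof (cases "g x = x")
  case True
  hence gx: "inv g x = x" using gfix by blast
  show ?thesis
  proof (cases "f x = x")
   case True
   hence "inv f x = x" using ffix by blast
   thus ?thesis using gx \<open>g x = x\<close> True by (simp add: h_def)
  next
   case False
   hence "f (inv f x) ~= inv f x" using fi by metis
   moreover have "inv f x ~= c" using x(1) fi by metis
   ultimately have "g (inv f x) = inv f x" using one by blast
   thus ?thesis using gx by (simp add: h_def fi)
  qed
 next
  case False
  hence fx: "f x = x" using one x by blast
  have "g (inv g x) ~= inv g x" using False gi by metis
  moreover have "inv g x ~= c" using x(2) gi by metis
  ultimately have "f (inv g x) = inv g x" using one by blast
  hence "inv f (inv g x) = inv g x" using ffix by blast
  thus ?thesis using fx by (simp add: h_def gi)
 qed
qed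

definition tt :: "nat => nat => nat" where
 "tt i = Transposition.transpose i (Suc i)"

text \<open>For \<open>I\<close> without consecutive elements this is the product of the disjoint
  transpositions \<open>tt i\<close> with \<open>i\<close> in \<open>I\<close>.\<close>

definition TT :: "nat set => nat => nat" where
 "TT I x = (if x \<in> I then Suc x else if x > 0 \<and> x - 1 \<in> I then x - 1 else x)"

text \<open>\<open>H\<close> stands for the permutations of the levels of one tower that a closed
  group realises. Conjugation by the odometer shifts them, as long as the top level is fixed and
  nothing wraps around.\<close>

locale shift_group =
 fixes H :: "(nat => nat) set" and N :: nat
 assumes H_bij: "\<And>p. p \<in> H ==> bij p"
  and H_id: "id \<in> H"
  and H_comp: "\<And>p r. p \<in> H ==> r \<in> H ==> p o r \<in> H"
  and H_inv: "\<And>p. p \<in> H ==> inv p \<in> H"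
  and H_shift: "\<And>p. p permutes {..<N - 1} ==> shn 1 p \<in> H \<longleftrightarrow> p \<in> H"
begin

lemma H_shn:
 assumes "p permutes {..<k}" "k + d \<le> N" shows "shn d p \<in> H \<longleftrightarrow> p \<in> H"
 using assms(2)
proof (induction d)
 case (Suc d)
 have "shn d p permutes {..<k + d}" using shn_permutes assms(1) by blast
 hence "shn d p permutes {..<N - 1}" by (rule permutes_subset) (use Suc in auto)
 hence "shn 1 (shn d p) \<in> H \<longleftrightarrow> shn d p \<in> H" by (rule H_shift)
 thus ?case using Suc by (simp add: shn_shn)
qed simp

text \<open>The given cycle and a translate of it yield a 3-cycle; this one and its translate by 1
  yield a 3-cycle on \<open>{0, 1, 2}\<close>, which is a product of adjacent transpositions.
  Translates of that one multiply up to all \<open>tt i o tt j\<close>. The bound on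
  \<open>N\<close> is the room for the translates.\<close>

lemma tt_mem:
 assumes n: "n \<ge> 1" and q: "q \<ge> 2" and N: "2 * q * n + 4 \<le> N"
  and p: "p = (\<lambda>k. if k = 0 then q * n + 1 else (q + 1 - k) * n)" and w: "cyc p q \<in> H"
  and ij: "i < j" "Suc j < N"
 shows "tt i o tt j \<in> H"
proof -
 have qn: "(q - 1) * n + n = q * n" using q by (metis Suc_diff_1 add.commute less_le_trans mult_Suc pos2)
 have pk: "p k \<ge> n \<and> p k \<le> q * n" if "0 < k" "k \<le> q" for k
 proof -
  have "1 \<le> q + 1 - k" "q + 1 - k \<le> q" using that by auto
  hence "1 * n \<le> (q + 1 - k) * n" "(q + 1 - k) * n \<le> q * n" by (intro mult_right_mono; simp)+
  thus ?thesis using that p by simp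
 qed
 have injp: "inj_on p {..q}"
 proof (rule inj_onI)
  fix k l assume h: "k \<in> {..q}" "l \<in> {..q}" "p k = p l"
  show "k = l"
  proof (cases "k = 0 \<or> l = 0")
   case True
   have p0': "p 0 = q * n + 1" by (simp add: p)
   show ?thesis
   proof (rule ccontr)
    assume "k ~= l"
    then consider "k = 0" "0 < l" | "l = 0" "0 < k" using True by auto
    thus False
    proof cases
     case 1 thus ?thesis using h p0' pk[of l] by simp
    next
     case 2 thus ?thesis using h p0' pk[of k] by simp
    qed
   qed
  next
   case False
   hence "(q + 1 - k) * n = (q + 1 - l) * n" using h(3) p by simp
   hence "q + 1 - k = q + 1 - l" using n by simp
   thus ?thesis using h by auto
  qed
 qed
 have rng: "n \<le> x \<and> x \<le> q * n + 1" if x: "x \<in> p ` {..q}" for x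
 proof -
  obtain k where k: "k \<le> q" "x = p k" using x by auto
  show ?thesis
  proof (cases "k = 0")
   case True thus ?thesis using k(2) p qn by simp
  next
   case False thus ?thesis using k pk[of k] by simp
  qed
 qed
 define f where "f = cyc p q"
 define c where "c = q * n + 1"
 \<comment> \<open>The support of the cycle runs from \<open>n\<close> to \<open>c\<close>. A
   translation by \<open>d = c - n\<close> puts the lowest point of the translate exactly on the
   highest point of the original.\<close>
 define d where "d = (q - 1) * n + 1"
 have d2: "d \<ge> 2"
 proof -
  have "1 * 1 \<le> (q - 1) * n" using q n by (intro mult_mono) auto
  thus ?thesis by (simp add: d_def)
 qed
 have cd: "c = d + n" using qn by (simp add: c_def d_def)
 have fperm: "f permutes {..<c + 1}" unfolding f_def
  using rng by (intro cyc_permutes[OF injp]) (auto simp: c_def less_Suc_eq_le)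
 have Ncd: "c + d + 3 \<le> N" using N qn n by (simp add: c_def d_def)
 define g where "g = shn d f"
 have fH: "f \<in> H" using w by (simp add: f_def)
 have gH: "g \<in> H" unfolding g_def using H_shn[OF fperm, of d] Ncd fH by simp
 have p0: "p 0 = c" "p 1 = c - 1" "p q = n" using p q by (auto simp: c_def)
 have fc: "f c = c - 1" using cyc_apply[OF injp, of 0] q p0 by (simp add: f_def)
 have fn: "f n = c" using cyc_apply[OF injp, of q] q p0 by (simp add: f_def)
 have gc: "g c = c + d" using cd fn by (simp add: g_def shn_def)
 have one: "x = c" if "f x ~= x" "g x ~= x" for x
 proof -
  have 1: "x \<le> c" using that(1) cyc_out[of x p q] rng[of x] by (auto simp: f_def c_def)
  have "x \<ge> d \<and> f (x - d) ~= x - d" using that(2) by (auto simp: g_def shn_def split: if_splits)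
  hence "x \<ge> d" "x - d \<ge> n" using cyc_out[of "x - d" p q] rng[of "x - d"] by (auto simp: f_def)
  thus ?thesis using 1 cd by simp
 qed
 define h where "h = f o g o inv f o inv g"
 have hH: "h \<in> H" unfolding h_def by (intro H_comp H_inv fH gH)
 have c1: "c \<ge> 1" by (simp add: c_def)
 note h3 = commutator_3cycle[OF H_bij[OF fH] H_bij[OF gH] one]
 have h: "h (c - 1) = c + d" "h (c + d) = c" "h c = c - 1"
  "\<And>x. x ~= c - 1 ==> x ~= c + d ==> x ~= c ==> h x = x"
  using h3 fc gc c1 d2 unfolding h_def by auto
 \<comment> \<open>The 3-cycle \<open>h\<close> moved down by \<open>c - 1\<close>, so that two of
   its points become 0 and 1.\<close>
 define h0 :: "nat => nat" where "h0 x = (if x = 0 then d + 1 else if x = d + 1 then 1 else if x = 1 then 0 else x)" for x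
 have hh0: "h = shn (c - 1) h0"
 proof
  fix x
  show "h x = shn (c - 1) h0 x"
  proof -
   consider "x = c - 1" | "x = c" | "x = c + d" | "x ~= c - 1" "x ~= c" "x ~= c + d" by blast
   thus ?thesis
   proof cases
    case 1
    hence "shn (c - 1) h0 x = c + d" using c1 by (simp add: shn_def h0_def)
    thus ?thesis using h(1) 1 by simp
   next
    case 2
    hence "shn (c - 1) h0 x = c - 1" using c1 d2 by (simp add: shn_def h0_def)
    thus ?thesis using h(3) 2 by simp
   next
    case 3
    hence "x - (c - 1) = d + 1" "\<not> x < c - 1" using c1 by auto
    hence "shn (c - 1) h0 x = c" using c1 by (simp add: shn_def h0_def)
    thus ?thesis using h(2) 3 by simp
   next
    case 4
    hence "h0 (x - (c - 1)) = x - (c - 1)" if "\<not> x < c - 1"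
     using that c1 unfolding h0_def by (metis (no_types, opaque_lifting) add.commute add_diff_inverse_nat add.assoc add_0 le_add_diff_inverse2)
    hence "shn (c - 1) h0 x = x" by (auto simp: shn_def)
    thus ?thesis using h(4)[of x] 4 by simp
   qed
  qed
 qed
 have h0p: "h0 permutes {..<d + 2}"
  unfolding permutes_def
 proof (intro conjI allI impI)
  fix y
  have a: "h0 (if y = d + 1 then 0 else if y = 1 then d + 1 else if y = 0 then 1 else y) = y"
   using d2 by (auto simp: h0_def)
  show "\<exists>!x. h0 x = y"
   by (rule ex1I, rule a) (use d2 in \<open>auto simp: h0_def split: if_splits\<close>)
 qed (auto simp: h0_def)
 have h0H: "h0 \<in> H" using H_shn[OF h0p, of "c - 1"] hH hh0 Ncd c1 by simp
 define h1 where "h1 = shn 1 h0"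
 have h1H: "h1 \<in> H" using H_shn[OF h0p, of 1] h0H Ncd by (simp add: h1_def)
 have h1: "h1 2 = 1" "h1 1 = d + 2" "h1 (d + 2) = 2" using d2 by (auto simp: h1_def shn_def h0_def)
 have h1o: "h1 x = x" if "x ~= 1" "x ~= 2" "x ~= d + 2" for x using that by (auto simp: h1_def shn_def h0_def)
 have invh1: "inv h1 (h1 x) = x" for x using bij_is_inj[OF H_bij[OF h1H]] by (rule inv_f_f)
 have ih1: "inv h1 1 = 2" "\<And>x. x ~= 1 ==> x ~= 2 ==> x ~= d + 2 ==> inv h1 x = x"
 proof -
  show "inv h1 1 = 2" using invh1[of 2] h1(1) by simp
  show "inv h1 x = x" if "x ~= 1" "x ~= 2" "x ~= d + 2" for x using invh1[of x] h1o[OF that] by simp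
 qed
 \<comment> \<open>The supports of \<open>h0\<close> and \<open>h1\<close> meet only in 1. The
   inverse of \<open>h1\<close> is taken because it sends 1 to 2, whereas \<open>h1\<close> sends it
   to the distant \<open>d + 2\<close>.\<close>
 define z where "z = h0 o inv h1 o inv h0 o inv (inv h1)"
 have zH: "z \<in> H" unfolding z_def by (intro H_comp H_inv h0H h1H)
 have one': "x = 1" if "h0 x ~= x" "inv h1 x ~= x" for x
 proof -
  have "x = 0 \<or> x = 1 \<or> x = d + 1" using that(1) by (auto simp: h0_def split: if_splits)
  moreover have "x = 1 \<or> x = 2 \<or> x = d + 2" using that(2) ih1(2) by blast
  ultimately show ?thesis using d2 by auto
 qed
 note z3 = commutator_3cycle[OF H_bij[OF h0H] H_bij[OF H_inv[OF h1H]] one']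
 have h01: "h0 1 = 0" using d2 by (simp add: h0_def)
 have z: "z 0 = 2" "z 2 = 1" "z 1 = 0" "\<And>x. x ~= 0 ==> x ~= 2 ==> x ~= 1 ==> z x = x"
  using z3 h01 ih1(1) unfolding z_def by auto
 have zt: "shn k z = tt (Suc k) o tt k" for k
 proof
  fix x
  show "shn k z x = (tt (Suc k) o tt k) x"
  proof (cases "x = k \<or> x = k + 1 \<or> x = k + 2")
   case True
   thus ?thesis using z by (auto simp: shn_def tt_def Transposition.transpose_def)
  next
   case False
   hence "x < k \<or> z (x - k) = x - k" using z(4)[of "x - k"] by (cases "x < k") auto
   thus ?thesis using False by (auto simp: shn_def tt_def Transposition.transpose_def)
  qed
 qed
 have z0: "z = tt 1 o tt 0" using zt[of 0] by simp
 have tperm: "tt k permutes {..<l}" if "Suc k < l" for k l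
  unfolding tt_def using that by (intro permutes_swap_id) auto
 have zperm: "z permutes {..<3}" unfolding z0 by (intro permutes_compose tperm) auto
 have adj: "tt (Suc k) o tt k \<in> H" if "k + 2 < N" for k
  using H_shn[OF zperm, of k] zH that zt[of k] by simp
 have tinv: "tt k o tt k = id" for k by (auto simp: tt_def fun_eq_iff)
 have adj': "tt k o tt (Suc k) \<in> H" if "k + 2 < N" for k
 proof -
  have "inv (tt (Suc k) o tt k) = tt k o tt (Suc k)"
   by (rule inv_unique_comp) (auto simp: tt_def fun_eq_iff)
  thus ?thesis using H_inv[OF adj[OF that]] by simp
 qed
 show ?thesis using ij
 proof (induction j)
  case (Suc j)
  show ?case
  proof (cases "i = j")
   case True
   have "j + 2 < N" using Suc.prems by simp
   thus ?thesis unfolding True by (rule adj')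
  next
   case False
   hence ij: "tt i o tt j \<in> H" using Suc.prems by (intro Suc.IH) simp_all
   have jj: "tt j o tt (Suc j) \<in> H" using Suc.prems by (intro adj') simp
   have "(tt i o tt j) o (tt j o tt (Suc j)) \<in> H" by (rule H_comp[OF ij jj])
   moreover have "(tt i o tt j) o (tt j o tt (Suc j)) = tt i o tt (Suc j)"
    using tinv[of j] by (metis comp_assoc comp_id)
   ultimately show ?thesis by (simp only:)
  qed
 qed simp
qed

text \<open>Only products of two transpositions are at hand, hence the even cardinality; they are
  multiplied pair by pair.\<close>

lemma TT_mem:
 assumes t: "\<And>i j. i < j ==> Suc j < N ==> tt i o tt j \<in> H"
  and I: "finite I" "card I = 2 * k" "\<And>i. i \<in> I ==> Suc i < N" "\<And>i. i \<in> I ==> Suc i \<notin> I"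
 shows "TT I \<in> H"
 using I
proof (induction k arbitrary: I)
 case 0
 hence "TT I = id" by (auto simp: TT_def)
 thus ?case using H_id by (simp only:)
next
 case (Suc k)
 then obtain i where i: "i \<in> I" by (metis card.empty ex_in_conv mult_is_0 nat.distinct(1) zero_neq_numeral)
 have "card (I - {i}) = 2 * k + 1" using i Suc.prems by simp
 then obtain j where j: "j \<in> I - {i}" by (metis card.empty ex_in_conv add_is_0 one_neq_zero)
 define a where "a = min i j"
 define b where "b = max i j"
 have ab: "a \<in> I" "b \<in> I" "a < b" using i j by (auto simp: a_def b_def min_def max_def)
 let ?J = "I - {a, b}"
 have "card ?J = 2 * k" using ab Suc.prems(1,2) by (simp add: card_Diff_subset)
 hence "TT ?J \<in> H" using Suc.IH[of ?J] Suc.prems by auto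
 moreover have "tt a o tt b \<in> H" using t[OF ab(3)] Suc.prems(3)[OF ab(2)] by simp
 ultimately have "TT ?J o (tt a o tt b) \<in> H" by (rule H_comp)
 moreover have "TT ?J o (tt a o tt b) = TT I"
 proof
  fix x
  have na: "Suc a \<notin> I" "Suc b \<notin> I" using Suc.prems(4) ab by auto
  have pa: "0 < a ==> a - 1 \<notin> I" "0 < b ==> b - 1 \<notin> I"
   using Suc.prems(4)[of "a - 1"] Suc.prems(4)[of "b - 1"] ab by auto
  have "Suc a ~= b" using na ab by auto
  consider "x = a" | "x = b" | "x = Suc a" | "x = Suc b" | "x \<notin> {a, b, Suc a, Suc b}" by blast
  thus "(TT ?J o (tt a o tt b)) x = TT I x"
  proof cases
   case 1
   thus ?thesis using ab na pa \<open>Suc a ~= b\<close> by (auto simp: TT_def tt_def Transposition.transpose_def)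
  next
   case 2
   thus ?thesis using ab na pa \<open>Suc a ~= b\<close> by (auto simp: TT_def tt_def Transposition.transpose_def)
  next
   case 3
   thus ?thesis using ab na pa \<open>Suc a ~= b\<close> by (auto simp: TT_def tt_def Transposition.transpose_def)
  next
   case 4
   thus ?thesis using ab na pa \<open>Suc a ~= b\<close> by (auto simp: TT_def tt_def Transposition.transpose_def)
  next
   case 5
   hence "x ~= 0 ==> x - 1 ~= a \<and> x - 1 ~= b" by auto
   thus ?thesis using 5 by (auto simp: TT_def tt_def Transposition.transpose_def)
  qed
 qed
 ultimately show ?case by simp
qed

end

section \<open>Odometers and cycles along their levels\<close>

definition zp :: "('b => 'b) => int => 'b => 'b" where
 "zp f k = (if k \<ge> 0 then f ^^ nat k else inv f ^^ nat (- k))"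

lemma zp_0 [simp]: "zp f 0 x = x" and zp_1 [simp]: "zp f 1 x = f x" and zp_m1 [simp]: "zp f (- 1) x = inv f x"
 by (simp_all add: zp_def)

lemma zp_plus1:
 assumes "bij f" shows "zp f (k + 1) x = f (zp f k x)"
proof (cases "k \<ge> 0")
 case True
 hence "nat (k + 1) = Suc (nat k)" by simp
 thus ?thesis using True by (simp add: zp_def)
next
 case False
 then obtain j where j: "nat (- k) = Suc j" by (metis Suc_diff_1 neg_0_less_iff_less not_le zero_less_nat_eq)
 have "f (inv f z) = z" for z using assms by (simp add: bij_is_surj surj_f_inv_f)
 hence "f (zp f k x) = (inv f ^^ j) x" using False j by (simp add: zp_def)
 moreover have "zp f (k + 1) x = (inv f ^^ j) x"
 proof (cases "k = -1")
  case True thus ?thesis using j by (simp add: zp_def)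
 next
  case False
  hence "k + 1 < 0" "nat (- (k + 1)) = j" using \<open>\<not> k \<ge> 0\<close> j by auto
  thus ?thesis by (simp add: zp_def)
 qed
 ultimately show ?thesis by simp
qed

lemma zp_minus1:
 assumes "bij f" shows "zp f (k - 1) x = inv f (zp f k x)"
 using zp_plus1[OF assms, of "k - 1" x] assms by (simp add: bij_is_inj inv_f_f)

lemma zp_add:
 assumes "bij f" shows "zp f (a + b) x = zp f a (zp f b x)"
proof (induction a rule: int_induct[where k = 0])
 case (step1 i)
 have "zp f (i + 1 + b) x = zp f ((i + b) + 1) x" by (simp add: algebra_simps)
 thus ?case using step1 zp_plus1[OF assms] by simp
next
 case (step2 i)
 have "zp f (i - 1 + b) x = zp f ((i + b) - 1) x" by (simp add: algebra_simps)
 thus ?case using step2 zp_minus1[OF assms] by simp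
qed simp

lemma (in gam) fullg_zp:
 assumes "f \<in> fullg" shows "zp f k \<in> fullg"
 unfolding zp_def using fullg_funpow assms fullg_inv by auto

text \<open>The index shift in \<open>growth\<close> is due to \<open>w m\<close>, whose cycle has
  \<open>Suc (q m)\<close> points and uses steps of size \<open>N (Suc m)\<close> inside tower
  \<open>Suc (Suc m)\<close>. Distinct prime lengths allow a power of \<open>v\<close> to isolate
  one cycle.\<close>

locale odo = gam M U gs for M :: "'a measure" and U gs +
 fixes \<sigma> :: "'a => 'a" and N :: "nat => nat" and \<kappa> :: "nat => 'a => nat" and X :: "'a set"
  and q :: "nat => nat"
 assumes od: "odometer \<sigma> N \<kappa> X"
  and growth: "\<And>m. (2 * q (m - 1) + 4) * N m \<le> N (Suc m)"
  and q2: "\<And>m. q m \<ge> 2" and q_prime: "\<And>m. prime (Suc (q m))" and q_inj: "\<And>m m'. q m = q m' ==> m = m'"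
begin

lemma sf: "\<sigma> \<in> fullg" and sm: "\<sigma> \<in> mpa" and sbij: "bij \<sigma>" and Xs: "X \<in> sets M" and Xp: "prob X = 1"
 and sX: "\<sigma> x \<in> X \<longleftrightarrow> x \<in> X"
 using od mpaD(1) fullgD(1) unfolding odometer_def by auto

lemma N0: "N m > 0" and Ndvd1: "N m dvd N (Suc m)"
 using od unfolding odometer_def by auto

lemma k_lt: "x \<in> X ==> \<kappa> m x < N m" and k_s: "x \<in> X ==> \<kappa> m (\<sigma> x) = Suc (\<kappa> m x) mod N m"
 and coh1: "x \<in> X ==> \<kappa> (Suc m) x mod N m = \<kappa> m x"
 and k_sets: "{x\<in>X. \<kappa> m x = i} \<in> sets M"
 and k_prob: "i < N m ==> prob {x\<in>X. \<kappa> m x = i} = 1 / N m"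
 using od unfolding odometer_def by auto

lemma apx: "A \<in> sets M ==> e > 0 ==> \<exists>m I. \<exists>Q\<in>sets M. prob Q < e \<and> (\<forall>x\<in>X - Q. x \<in> A \<longleftrightarrow> \<kappa> m x \<in> I)"
 using od unfolding odometer_def by blast

lemma Ndvd: "m \<le> m' ==> N m dvd N m'"
 by (induction m' rule: dec_induct) (auto intro: dvd_trans[OF _ Ndvd1])

lemma coh:
 assumes x: "x \<in> X" and m: "m \<le> m'" shows "\<kappa> m' x mod N m = \<kappa> m x"
 using m
proof (induction m' rule: dec_induct)
 case base show ?case using k_lt[OF x] by simp
next
 case (step n)
 have "\<kappa> (Suc n) x mod N m = (\<kappa> (Suc n) x mod N n) mod N m" using Ndvd[OF step(1)] by (simp add: mod_mod_cancel)
 thus ?case using coh1[OF x] step by simp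
qed

lemma N_grow: "2 * N m \<le> N (Suc m)"
proof -
 have "2 * N m \<le> (2 * q (m - 1) + 4) * N m" by (intro mult_right_mono) auto
 thus ?thesis using growth[of m] by linarith
qed

lemma N_pow: "2 ^ m \<le> N m"
proof (induction m)
 case (Suc m)
 thus ?case using N_grow[of m] by simp
qed (use N0[of 0] in simp)

lemma N_small:
 assumes "e > 0" shows "\<exists>m0. \<forall>m\<ge>m0. 1 / real (N m) < e"
proof -
 obtain m0 where m0: "(1/2::real) ^ m0 < e" using real_arch_pow_inv[OF assms, of "1/2"] by auto
 have "1 / real (N m) < e" if "m0 \<le> m" for m
 proof -
  have "(2::real) ^ m \<le> N m" using N_pow[of m] by (metis of_nat_le_iff of_nat_numeral of_nat_power)
  hence "1 / real (N m) \<le> 1 / 2 ^ m" using N0[of m] by (intro divide_left_mono) auto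
  also have "... = (1/2) ^ m" by (simp add: power_divide)
  also have "... \<le> (1/2) ^ m0" using that by (intro power_decreasing) auto
  finally show ?thesis using m0 by linarith
 qed
 thus ?thesis by blast
qed

lemma AE_X: "AE x in M. x \<in> X"
 using prob_eq_1[OF Xs] Xp by blast

lemma isX: "inv \<sigma> x \<in> X \<longleftrightarrow> x \<in> X"
 using sX[of "inv \<sigma> x"] sm by simp

lemma zpX: "zp \<sigma> k x \<in> X \<longleftrightarrow> x \<in> X"
proof (induction k rule: int_induct[where k = 0])
 case (step1 i) thus ?case using zp_plus1[OF sbij] sX by simp
next
 case (step2 i) thus ?case using zp_minus1[OF sbij] isX by simp
qed simp

lemma zpm: "zp \<sigma> k \<in> mpa"
 using fullg_zp[OF sf] fullgD by blast

lemma k_zp: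
 assumes x: "x \<in> X" shows "int (\<kappa> m (zp \<sigma> d x)) = (int (\<kappa> m x) + d) mod int (N m)"
proof (induction d rule: int_induct[where k = 0])
 case base
 show ?case using k_lt[OF x, of m] by simp
next
 case (step1 i)
 have z: "zp \<sigma> i x \<in> X" using zpX x by simp
 have "int (\<kappa> m (zp \<sigma> (i + 1) x)) = (int (\<kappa> m (zp \<sigma> i x)) + 1) mod int (N m)"
  using k_s[OF z, of m] zp_plus1[OF sbij, of i x] by (simp add: zmod_int add.commute)
 thus ?case using step1 by (simp add: mod_simps algebra_simps)
next
 case (step2 i)
 have z: "zp \<sigma> (i - 1) x \<in> X" using zpX x by simp
 have "zp \<sigma> i x = \<sigma> (zp \<sigma> (i - 1) x)" using zp_plus1[OF sbij, of "i - 1" x] by simp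
 hence "int (\<kappa> m (zp \<sigma> i x)) = (int (\<kappa> m (zp \<sigma> (i - 1) x)) + 1) mod int (N m)"
  using k_s[OF z, of m] by (simp add: zmod_int add.commute)
 hence "(int (\<kappa> m (zp \<sigma> i x)) - 1) mod int (N m) = int (\<kappa> m (zp \<sigma> (i - 1) x)) mod int (N m)"
  by (simp add: mod_simps)
 also have "... = int (\<kappa> m (zp \<sigma> (i - 1) x))" using k_lt[OF z, of m] by simp
 finally show ?case using step2 by (simp add: mod_simps algebra_simps)
qed

text \<open>A point at level \<open>i\<close> of tower \<open>m\<close> is moved along its
  \<open>\<sigma>\<close>-orbit to level \<open>p i\<close> of the same column, which represents
  permutations of the levels in the full group.\<close>

definition act :: "nat => (nat => nat) => 'a => 'a" where
 "act m p x = (if x \<in> X then zp \<sigma> (int (p (\<kappa> m x)) - int (\<kappa> m x)) x else x)"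

lemma act_X: "act m p x \<in> X \<longleftrightarrow> x \<in> X"
 by (simp add: act_def zpX)

lemma act_k:
 assumes "p permutes {..<N m}" "x \<in> X" shows "\<kappa> m (act m p x) = p (\<kappa> m x)"
proof -
 have "p (\<kappa> m x) < N m" using permutes_in_image[OF assms(1), of "\<kappa> m x"] k_lt[OF assms(2)] by simp
 thus ?thesis using k_zp[OF assms(2), of m "int (p (\<kappa> m x)) - int (\<kappa> m x)"] assms(2) by (simp add: act_def)
qed

lemma act_comp:
 assumes "p permutes {..<N m}" "r permutes {..<N m}" shows "act m (p o r) = act m p o act m r"
proof
 fix x show "act m (p o r) x = (act m p o act m r) x"
 proof (cases "x \<in> X")
  case True
  have "(act m p o act m r) x = zp \<sigma> (int (p (r (\<kappa> m x))) - int (r (\<kappa> m x))) (zp \<sigma> (int (r (\<kappa> m x)) - int (\<kappa> m x)) x)"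
   using act_k[OF assms(2) True] act_X[of m r x] True by (simp add: act_def)
  also have "... = act m (p o r) x" using True by (simp add: zp_add[OF sbij, symmetric] act_def)
  finally show ?thesis by simp
 qed (simp add: act_def)
qed

lemma act_id: "act m id = id"
 by (auto simp: act_def)

lemma act_inv:
 assumes "p permutes {..<N m}" shows "act m (inv p) o act m p = id" "act m p o act m (inv p) = id"
 using act_comp[OF permutes_inv[OF assms] assms] act_comp[OF assms permutes_inv[OF assms]]
  permutes_inv_o[OF assms] by (simp_all add: act_id)

lemma act_bij:
 assumes "p permutes {..<N m}" shows "bij (act m p)"
 using o_bij act_inv[OF assms] by metis

lemma act_inv_eq:
 assumes "p permutes {..<N m}" shows "inv (act m p) = act m (inv p)"
 using act_inv[OF assms] by (intro inv_unique_comp) auto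

lemma act_full:
 assumes p: "p permutes {..<N m}" shows "act m p \<in> fullg"
proof -
 have m: "act m p \<in> mpa"
 proof (rule mpa_piecewise)
  let ?C = "\<lambda>o'. case o' of None => space M - X | Some i => {x \<in> X. \<kappa> m x = i}"
  let ?g = "\<lambda>o'. case o' of None => id | Some i => zp \<sigma> (int (p i) - int i)"
  show "bij (act m p)" by (rule act_bij[OF p])
  show "?C i \<in> sets M" for i using k_sets Xs by (auto split: option.split)
  show "?g i \<in> mpa" for i using zpm by (auto split: option.split)
  show "act m p x = ?g i x" if "x \<in> ?C i" for i x using that by (auto split: option.splits simp: act_def)
  show "act m p x = x" if "x \<notin> space M" for x using that Xs sets.sets_into_space by (auto simp: act_def)
  show "space M \<subseteq> (\<Union>i. ?C i)"
  proof
   fix x assume "x \<in> space M"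
   hence "x \<in> ?C (if x \<in> X then Some (\<kappa> m x) else None)" by simp
   thus "x \<in> (\<Union>i. ?C i)" by blast
  qed
 qed
 have "AE x in M. \<forall>k. orb x (zp \<sigma> k x)" unfolding AE_all_countable using fullgD(2)[OF fullg_zp[OF sf]] by blast
 hence "AE x in M. orb x (act m p x)" by eventually_elim (simp add: act_def)
 thus ?thesis using m by (simp add: fullg_def)
qed

lemma act_mpa: "p permutes {..<N m} ==> act m p \<in> mpa"
 using act_full fullgD by blast

lemma act_funpow:
 assumes "p permutes {..<N m}" shows "act m (p ^^ k) = act m p ^^ k \<and> (p ^^ k) permutes {..<N m}"
proof (induction k)
 case (Suc k)
 have "(p o p ^^ k) permutes {..<N m}" using Suc permutes_compose[OF _ assms] by blast
 moreover have "act m (p o p ^^ k) = act m p o act m p ^^ k" using act_comp[OF assms] Suc by metis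
 ultimately show ?case by (simp only: funpow.simps)
qed (simp only: funpow.simps act_id permutes_id)

text \<open>Since \<open>p\<close> fixes the top level, conjugation by \<open>\<sigma>\<close> only
  raises levels by one and never passes from the top to the base.\<close>

lemma act_shift:
 assumes p: "p permutes {..<N m - 1}" shows "act m (shn 1 p) = \<sigma> o act m p o inv \<sigma>"
proof
 fix y show "act m (shn 1 p) y = (\<sigma> o act m p o inv \<sigma>) y"
 proof (cases "y \<in> X")
  case True
  define x where "x = inv \<sigma> y"
  have y: "y = \<sigma> x" using sm by (simp add: x_def)
  have x: "x \<in> X" using True isX by (simp add: x_def)
  have ky: "\<kappa> m y = Suc (\<kappa> m x) mod N m" using k_s[OF x] y by simp
  show ?thesis
  proof (cases "Suc (\<kappa> m x) = N m")
   case True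
   hence "p (\<kappa> m x) = \<kappa> m x" using permutes_not_in[OF p] by auto
   moreover have "\<kappa> m y = 0" using ky True by simp
   ultimately have "act m p x = x" "act m (shn 1 p) y = y" using x \<open>y \<in> X\<close> by (simp_all add: act_def shn_def)
   moreover have "(\<sigma> o act m p o inv \<sigma>) y = \<sigma> (act m p x)" unfolding x_def by simp
   ultimately show ?thesis using y by metis
  next
   case False
   hence ky': "\<kappa> m y = Suc (\<kappa> m x)" using ky k_lt[OF x, of m] by simp
   have "act m (shn 1 p) y = zp \<sigma> (int (p (\<kappa> m x)) - int (\<kappa> m x)) (zp \<sigma> 1 x)"
    using \<open>y \<in> X\<close> ky' y by (simp add: act_def shn_def)
   also have "... = zp \<sigma> 1 (zp \<sigma> (int (p (\<kappa> m x)) - int (\<kappa> m x)) x)"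
    using zp_add[OF sbij] by (metis add.commute)
   also have "... = \<sigma> (act m p x)" using x by (simp add: act_def)
   finally show ?thesis by (simp add: x_def)
  qed
 next
  case False
  hence "inv \<sigma> y \<notin> X" using isX by simp
  thus ?thesis using False sm by (simp add: act_def)
 qed
qed

text \<open>This cycle and its translate by \<open>(q m - 1) * N (Suc m) + 1\<close> move exactly one common point.\<close>

definition pp :: "nat => nat => nat" where
 "pp m = (\<lambda>k. if k = 0 then q m * N (Suc m) + 1 else (q m + 1 - k) * N (Suc m))"

definition w :: "nat => 'a => 'a" where
 "w m = act (Suc (Suc m)) (cyc (pp m) (q m))"

lemma NS2: "N (Suc m) \<ge> 2"
 using N_grow[of m] N0[of m] by linarith

lemma growth': "2 * q m * N (Suc m) + 4 \<le> N (Suc (Suc m))"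
proof -
 have "2 * q m * N (Suc m) + 4 \<le> (2 * q m + 4) * N (Suc m)" using N0[of "Suc m"] by (simp add: algebra_simps)
 thus ?thesis using growth[of "Suc m"] by simp
qed

lemma pp_range:
 assumes "k \<le> q m"
 shows "pp m k mod N (Suc m) \<le> 1" "2 \<le> pp m k" "pp m k < N (Suc (Suc m))"
proof -
 have n2: "N (Suc m) \<ge> 2" by (rule NS2)
 have qn: "2 \<le> q m * N (Suc m)" using mult_le_mono[OF q2[of m] n2] by simp
 have g: "2 * (q m * N (Suc m)) + 4 \<le> N (Suc (Suc m))" using growth'[of m] by (simp add: mult.assoc)
 show "pp m k mod N (Suc m) \<le> 1"
  using n2 by (simp add: pp_def mod_Suc)
 show "2 \<le> pp m k" "pp m k < N (Suc (Suc m))"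
 proof -
  have "2 \<le> (q m + 1 - k) * N (Suc m) \<and> (q m + 1 - k) * N (Suc m) \<le> q m * N (Suc m)" if "k ~= 0"
  proof
   have "1 * 2 \<le> (q m + 1 - k) * N (Suc m)" using assms n2 by (intro mult_le_mono) auto
   thus "2 \<le> (q m + 1 - k) * N (Suc m)" by simp
   show "(q m + 1 - k) * N (Suc m) \<le> q m * N (Suc m)" using that by (intro mult_right_mono) auto
  qed
  hence b: "2 \<le> pp m k \<and> pp m k \<le> q m * N (Suc m) + 1"
  proof (cases "k = 0")
   case True
   hence "pp m k = q m * N (Suc m) + 1" by (simp add: pp_def)
   thus ?thesis using qn by linarith
  next
   case False
   hence "pp m k = (q m + 1 - k) * N (Suc m)" by (simp add: pp_def)
   thus ?thesis using \<open>k ~= 0 ==> _\<close>[OF False] by linarith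
  qed
  show "2 \<le> pp m k" using b by (rule conjunct1)
  have "q m * N (Suc m) + 1 < N (Suc (Suc m))" using g by linarith
  thus "pp m k < N (Suc (Suc m))" using b[THEN conjunct2] by (rule order_le_less_trans[rotated])
 qed
qed

lemma pp_inj: "inj_on (pp m) {..q m}"
proof (rule inj_onI)
 fix k l assume h: "k \<in> {..q m}" "l \<in> {..q m}" "pp m k = pp m l"
 have z: "pp m 0 mod N (Suc m) = 1" using NS2[of m] by (simp add: pp_def mod_Suc)
 have nz: "pp m k mod N (Suc m) = 0" if "k ~= 0" for k using that by (simp add: pp_def)
 show "k = l"
 proof (cases "k = 0 \<or> l = 0")
  case True
  thus ?thesis using h(3) z nz by (metis one_neq_zero)
 next
  case False
  hence "(q m + 1 - k) * N (Suc m) = (q m + 1 - l) * N (Suc m)" using h(3) by (simp add: pp_def)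
  hence "q m + 1 - k = q m + 1 - l" using N0[of "Suc m"] by simp
  thus ?thesis using h by auto
 qed
qed

lemma cyc_perm: "cyc (pp m) (q m) permutes {..<N (Suc (Suc m))}"
 by (rule cyc_permutes[OF pp_inj]) (use pp_range in auto)

lemma w_full: "w m \<in> fullg" and w_mpa: "w m \<in> mpa"
 unfolding w_def using act_full act_mpa cyc_perm by auto

lemma w_order: "w m ^^ Suc (q m) = id"
 unfolding w_def using act_funpow[OF cyc_perm, of m "Suc (q m)"] cyc_order[OF pp_inj, of m] by (metis act_id)

text \<open>All points of the cycle are multiples of \<open>N (Suc m)\<close>, except its start,
  which is one more. This gives the residues 0 and 1 in tower \<open>Suc m\<close>; the points
  themselves are at least 2.\<close>

lemma w_supp:
 assumes "w m x ~= x"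
 shows "x \<in> X" "\<kappa> (Suc m) x \<le> 1" "2 \<le> \<kappa> (Suc (Suc m)) x"
proof -
 show x: "x \<in> X"
 proof (rule ccontr)
  assume "x \<notin> X"
  thus False using assms by (simp add: w_def act_def)
 qed
 have "cyc (pp m) (q m) (\<kappa> (Suc (Suc m)) x) ~= \<kappa> (Suc (Suc m)) x"
  using assms x by (auto simp: w_def act_def)
 hence "\<kappa> (Suc (Suc m)) x \<in> pp m ` {..q m}" using cyc_out by metis
 then obtain k where k: "k \<le> q m" "\<kappa> (Suc (Suc m)) x = pp m k" by auto
 show "2 \<le> \<kappa> (Suc (Suc m)) x" using pp_range(2)[OF k(1)] k(2) by simp
 show "\<kappa> (Suc m) x \<le> 1" using pp_range(1)[OF k(1)] k(2) coh1[OF x, of "Suc m"] by simp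
qed

text \<open>For \<open>m < m'\<close> the support of \<open>w m'\<close> lies on the levels 0 and 1
  of tower \<open>Suc m'\<close>, hence also of tower \<open>Suc (Suc m)\<close>, and there
  \<open>w m\<close> does not move these levels.\<close>

lemma w_dsup: "dsup w"
proof -
 have "False" if h: "w m x ~= x" "w m' x ~= x" "m < m'" for m m' x
 proof -
  have x: "x \<in> X" using w_supp[OF h(1)] by blast
  have "\<kappa> (Suc (Suc m)) x = \<kappa> (Suc m') x mod N (Suc (Suc m))" using coh[OF x, of "Suc (Suc m)" "Suc m'"] h(3) by simp
  hence "\<kappa> (Suc (Suc m)) x \<le> \<kappa> (Suc m') x" by simp
  thus False using w_supp(2)[OF h(2)] w_supp(3)[OF h(1)] by linarith
 qed
 thus ?thesis unfolding dsup_def by (metis linorder_neqE_nat)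
qed

definition v :: "'a => 'a" where "v = dprod w"

lemma v_full: "v \<in> fullg"
 unfolding v_def by (rule fullg_dprod[OF w_dsup w_full])

text \<open>Powers of \<open>v\<close> with exponent 1 modulo the length of \<open>w m\<close> and 0
  modulo the other early lengths agree with \<open>w m\<close> outside the supports of the late
  cycles, whose total measure tends to 0.\<close>

lemma w_mem:
 assumes G: "clgrp G" and vG: "v \<in> G"
 shows "w m \<in> G"
proof (rule clgrpD(5)[OF G w_mpa])
 fix e :: real assume e: "e > 0"
 have vk: "v ^^ k \<in> G" for k
  by (induction k) (simp_all only: funpow.simps clgrpD(3)[OF G vG] clgrpD(2)[OF G])
 let ?T = "\<lambda>k. \<Union>i\<in>{k..}. {x. w i x ~= x}"
 have Ts: "?T k \<in> sets M" for k using supp_sets[OF w_mpa] by (intro sets.countable_UN') auto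
 have "decseq ?T" by (rule decseq_SucI) (auto dest: Suc_leD)
 hence "(\<lambda>k. prob (?T k)) \<longlonglongrightarrow> prob (\<Inter>k. ?T k)" using Ts by (intro finite_Lim_measure_decseq) auto
 moreover have "(\<Inter>k. ?T k) = {}"
 proof -
  have False if h: "\<forall>k. x \<in> ?T k" for x
  proof -
   obtain i where i: "w i x ~= x" using h by blast
   obtain j where j: "j \<ge> Suc i" "w j x ~= x" using h[THEN spec, of "Suc i"] by blast
   show False using dsupD[OF w_dsup i j(2)] j(1) by simp
  qed
  thus ?thesis by blast
 qed
 ultimately have "(\<lambda>k. prob (?T k)) \<longlonglongrightarrow> 0" by (simp only: measure_empty)
 hence "\<forall>\<^sub>F k in sequentially. prob (?T k) < e" using e by (intro order_tendstoD) auto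
 then obtain k where k: "prob (?T k) < e" by (auto simp: eventually_sequentially)
 let ?P = "\<Prod>i\<in>{..<k} - {m}. Suc (q i)"
 have "coprime ?P (Suc (q m))"
 proof (rule prod_coprime_left)
  fix i assume "i \<in> {..<k} - {m}"
  hence "Suc (q i) ~= Suc (q m)" using q_inj by auto
  thus "coprime (Suc (q i)) (Suc (q m))" using primes_coprime q_prime by blast
 qed
 from cong_solve_coprime_nat[OF this] obtain y where y: "[?P * y = Suc 0] (mod Suc (q m))" by (rule exE)
 \<comment> \<open>The Chinese remainder theorem by hand: the product of the other lengths times an
   inverse of it modulo \<open>Suc (q m)\<close>.\<close>
 define K where "K = ?P * y"
 have K1: "K mod Suc (q m) = 1"
 proof -
  have "K mod Suc (q m) = 1 mod Suc (q m)" using y by (simp add: K_def cong_def)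
  thus ?thesis using q2[of m] by simp
 qed
 have K0: "Suc (q i) dvd K" if "i < k" "i ~= m" for i
  unfolding K_def using that by (intro dvd_mult2 dvd_prodI) auto
 have "{x. w m x ~= (v ^^ K) x} \<subseteq> ?T k"
 proof
  fix x assume "x \<in> {x. w m x ~= (v ^^ K) x}"
  hence x: "w m x ~= (v ^^ K) x" by simp
  have inj: "inj (w i)" for i by (rule mpaD(2)[OF w_mpa])
  show "x \<in> ?T k"
  proof (cases "\<exists>i. w i x ~= x")
   case True
   then obtain i where i: "w i x ~= x" by blast
   have vK: "(v ^^ K) x = (w i ^^ K) x" unfolding v_def using dprod_funpow[OF w_dsup inj i] by blast
   have per: "(w i ^^ (K mod Suc (q i))) x = (w i ^^ K) x"
    by (rule funpow_mod_eq) (metis w_order id_apply)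
   have "i \<ge> k"
   proof (rule ccontr)
    assume "\<not> i \<ge> k"
    hence ik: "i < k" by simp
    show False
    proof (cases "i = m")
     case True
     thus ?thesis using x vK per K1 by simp
    next
     case False
     hence "K mod Suc (q i) = 0" using K0[OF ik] by (metis dvd_imp_mod_0)
     hence "(v ^^ K) x = x" using vK per by simp
     moreover have "w m x = x" using dsupD[OF w_dsup i] False by blast
     ultimately show False using x by simp
    qed
   qed
   thus ?thesis using i by auto
  next
   case False
   hence "v x = x" unfolding v_def using dprod_id[of w x] by blast
   hence "(v ^^ K) x = x" for K by (induction K) auto
   thus ?thesis using False x by auto
  qed
 qed
 hence "prob {x. w m x ~= (v ^^ K) x} \<le> prob (?T k)" using Ts by (intro finite_measure_mono) auto
 thus "\<exists>g\<in>G. prob {x. w m x ~= g x} < e" using k vk by (intro bexI[of _ "v ^^ K"]) auto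
qed

definition HG :: "('a => 'a) set => nat => (nat => nat) set" where
 "HG G m = {p. p permutes {..<N m} \<and> act m p \<in> G}"

text \<open>The shift condition is conjugation by \<open>\<sigma>\<close> and by its inverse, both
  of which lie in \<open>G\<close>.\<close>

lemma HG_shift_group:
 assumes G: "clgrp G" and sG: "\<sigma> \<in> G"
 shows "shift_group (HG G m) (N m)"
proof
 show "bij p" if "p \<in> HG G m" for p using that permutes_bij by (auto simp: HG_def)
 show "id \<in> HG G m" using clgrpD(2)[OF G] by (simp add: HG_def act_id permutes_id)
 show "p o r \<in> HG G m" if "p \<in> HG G m" "r \<in> HG G m" for p r
  using that act_comp[of p m r] clgrpD(3)[OF G, of "act m p" "act m r"] permutes_compose[of r _ p]
  unfolding HG_def mem_Collect_eq by metis
 show "inv p \<in> HG G m" if "p \<in> HG G m" for p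
  using that act_inv_eq[of p m] clgrpD(4)[OF G, of "act m p"] permutes_inv[of p]
  unfolding HG_def mem_Collect_eq by metis
 fix p assume p: "p permutes {..<N m - 1}"
 have N1: "N m - 1 + 1 = N m" using N0[of m] by simp
 have p1: "p permutes {..<N m}" by (rule permutes_subset[OF p]) auto
 have p2: "shn 1 p permutes {..<N m}" using shn_permutes[OF p, of 1] N1 by simp
 have a: "act m (shn 1 p) = \<sigma> o act m p o inv \<sigma>" by (rule act_shift[OF p])
 have isG: "inv \<sigma> \<in> G" using clgrpD(4)[OF G sG] .
 show "shn 1 p \<in> HG G m \<longleftrightarrow> p \<in> HG G m"
 proof
  assume "p \<in> HG G m"
  hence "act m p \<in> G" by (simp add: HG_def)
  hence "\<sigma> o act m p o inv \<sigma> \<in> G" by (intro clgrpD(3)[OF G] sG isG)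
  thus "shn 1 p \<in> HG G m" using p2 a by (simp only: HG_def mem_Collect_eq)
 next
  assume "shn 1 p \<in> HG G m"
  hence "act m (shn 1 p) \<in> G" by (simp add: HG_def)
  hence "inv \<sigma> o act m (shn 1 p) o \<sigma> \<in> G" by (intro clgrpD(3)[OF G] sG isG)
  moreover have "inv \<sigma> o act m (shn 1 p) o \<sigma> = act m p" unfolding a using sm by (auto simp: fun_eq_iff)
  ultimately show "p \<in> HG G m" using p1 by (simp only: HG_def mem_Collect_eq)
 qed
qed

lemma TT_mem_G:
 assumes G: "clgrp G" and sG: "\<sigma> \<in> G" and vG: "v \<in> G"
  and I: "finite I" "card I = 2 * k" "\<And>i. i \<in> I ==> Suc i < N (Suc (Suc m))" "\<And>i. i \<in> I ==> Suc i \<notin> I"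
 shows "TT I \<in> HG G (Suc (Suc m))"
proof -
 interpret shift_group "HG G (Suc (Suc m))" "N (Suc (Suc m))" by (rule HG_shift_group[OF G sG])
 have wH: "cyc (pp m) (q m) \<in> HG G (Suc (Suc m))"
  using cyc_perm w_mem[OF G vG, of m] by (simp add: HG_def w_def)
 have n1: "N (Suc m) \<ge> 1" using NS2[of m] by simp
 have "tt i o tt j \<in> HG G (Suc (Suc m))" if "i < j" "Suc j < N (Suc (Suc m))" for i j
  by (rule tt_mem[OF n1 q2 growth' pp_def wH that])
 thus ?thesis by (rule TT_mem) (use I in auto)
qed

end

section \<open>Goodness of the odometer and of maps along its orbits\<close>

context odo
begin

text \<open>In a fine tower, \<open>A'\<close> is nearly a union of levels, and the swap along
  \<open>\<sigma>\<close> is nearly the product of the transpositions of these levels with the next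
  ones.\<close>

lemma swp_act_close:
 assumes G: "clgrp G" and sG: "\<sigma> \<in> G" and vG: "v \<in> G"
  and A': "A' \<in> sets M" "A' \<subseteq> {x \<in> X. \<kappa> j x = a}" "A' \<inter> \<sigma> ` A' = {}" and a: "Suc a < N j" and e: "e > 0"
 shows "\<exists>g\<in>G. prob {x. swp A' \<sigma> x ~= g x} < e"
proof -
 obtain m0 I0 Q where ap: "Q \<in> sets M" "prob Q < e / 4" "\<forall>x\<in>X - Q. x \<in> A' \<longleftrightarrow> \<kappa> m0 x \<in> I0"
  using apx[OF A'(1), of "e / 4"] e by auto
 obtain m1 where m1: "\<forall>m\<ge>m1. 1 / real (N m) < e / 4" using N_small[of "e / 4"] e by auto
 \<comment> \<open>Fine enough for the approximation of \<open>A'\<close>, for the smallness of a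
   level and for tower \<open>j\<close>; the two successors give the index the form that
   \<open>TT_mem_G\<close> asks for.\<close>
 define m where "m = Suc (Suc (max m0 (max m1 j)))"
 have mm: "m0 \<le> m" "m1 \<le> m" "j \<le> m" by (auto simp: m_def)
 \<comment> \<open>All elements are congruent to \<open>a\<close> modulo \<open>N j\<close> and
   \<open>Suc a < N j\<close>, so no two are consecutive and none is the top level.\<close>
 define I where "I = {i. i < N m \<and> i mod N m0 \<in> I0 \<and> i mod N j = a}"
 have fI: "finite I" by (simp add: I_def)
 have I1: "Suc i < N m" "Suc i \<notin> I" if i: "i \<in> I" for i
 proof -
  have ij: "i < N m" "i mod N j = a" using i by (auto simp: I_def)
  have sj: "Suc i mod N j = Suc a" using ij a by (simp add: mod_Suc)
  show "Suc i \<notin> I" using sj by (auto simp: I_def)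
  have "Suc i ~= N m"
  proof
   assume "Suc i = N m"
   hence "Suc i mod N j = 0" using Ndvd[OF mm(3)] by (simp add: dvd_eq_mod_eq_0)
   thus False using sj by simp
  qed
  thus "Suc i < N m" using ij(1) by simp
 qed
 \<comment> \<open>One level is dropped if their number is odd. It is small and is charged to the
   error set \<open>W\<close>.\<close>
 obtain J k i0 where J: "J \<subseteq> I" "card J = 2 * k" "I - J \<subseteq> {i0}"
 proof (cases "even (card I)")
  case True
  thus ?thesis using that[of I "card I div 2" 0] by auto
 next
  case False
  hence "I ~= {}" by auto
  then obtain i0 where i0: "i0 \<in> I" by blast
  hence "card (I - {i0}) = 2 * (card I div 2)" using False fI by (simp add: card_Diff_singleton)
  thus ?thesis using that[of "I - {i0}" "card I div 2" i0] by auto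
 qed
 have fJ: "finite J" using J(1) fI finite_subset by blast
 have "TT J \<in> HG G m"
  unfolding m_def by (rule TT_mem_G[OF G sG vG fJ J(2)]) (use I1 J(1) in \<open>auto simp: m_def\<close>)
 hence actG: "act m (TT J) \<in> G" and perm: "TT J permutes {..<N m}" by (auto simp: HG_def)
 define S where "S = {x \<in> X. \<kappa> m x \<in> J}"
 define W where "W = Q \<union> {x \<in> X. \<kappa> m x = i0}"
 have Ws: "W \<in> sets M" using ap(1) k_sets by (auto simp: W_def)
 have kp: "prob {x \<in> X. \<kappa> m x = i0} < e / 4"
 proof (cases "i0 < N m")
  case True
  thus ?thesis using k_prob[OF True] m1 mm(2) by simp
 next
  case False
  hence "{x \<in> X. \<kappa> m x = i0} = {}" using k_lt by blast
  thus ?thesis using e by (simp only: measure_empty)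
 qed
 have Wp: "prob W < e / 2"
  using measure_Un_le[OF ap(1) k_sets[of m i0]] ap(2) kp unfolding W_def by linarith
 have diff: "x \<in> W" if x: "(x \<in> A') ~= (x \<in> S)" for x
 proof (rule ccontr)
  assume nW: "x \<notin> W"
  have xX: "x \<in> X" using x A'(2) by (auto simp: S_def)
  have e1: "x \<in> A' \<longleftrightarrow> \<kappa> m0 x \<in> I0" using ap(3) nW xX by (auto simp: W_def)
  have c0: "\<kappa> m x mod N m0 = \<kappa> m0 x" "\<kappa> m x mod N j = \<kappa> j x" using coh[OF xX] mm by auto
  show False
  proof (cases "x \<in> A'")
   case True
   hence "\<kappa> m x \<in> I" using e1 c0 k_lt[OF xX] A'(2) by (auto simp: I_def)
   moreover have "\<kappa> m x ~= i0" using nW xX by (auto simp: W_def)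
   ultimately have "\<kappa> m x \<in> J" using J(3) by blast
   thus False using x True xX by (simp add: S_def)
  next
   case False
   hence "\<kappa> m x \<in> J" using x by (simp add: S_def)
   hence "\<kappa> m0 x \<in> I0" using J(1) c0(1) by (auto simp: I_def)
   thus False using e1 False by simp
  qed
 qed
 have actS: "act m (TT J) x = \<sigma> x" if "x \<in> S" for x
  using that by (simp add: act_def S_def TT_def)
 have actS': "act m (TT J) (\<sigma> x) = x" if x: "x \<in> S" for x
 proof -
  have xX: "x \<in> X" "\<kappa> m x \<in> J" using x by (auto simp: S_def)
  have "Suc (\<kappa> m x) < N m" "Suc (\<kappa> m x) \<notin> J" using I1[of "\<kappa> m x"] J(1) xX(2) by auto
  moreover from this(1) have "\<kappa> m (\<sigma> x) = Suc (\<kappa> m x)" using k_s[OF xX(1), of m] by simp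
  ultimately show ?thesis using xX sX sm by (simp add: act_def TT_def)
 qed
 have act0: "act m (TT J) x = x" if x: "x \<notin> S" "inv \<sigma> x \<notin> S" for x
 proof (cases "x \<in> X")
  case True
  have "\<not> (\<kappa> m x > 0 \<and> \<kappa> m x - 1 \<in> J)"
  proof
   assume h: "\<kappa> m x > 0 \<and> \<kappa> m x - 1 \<in> J"
   define y where "y = inv \<sigma> x"
   have y: "y \<in> X" "\<sigma> y = x" using True isX sm by (auto simp: y_def)
   have "\<kappa> m x = Suc (\<kappa> m y) mod N m" using k_s[OF y(1), of m] y(2) by simp
   hence "\<kappa> m y = \<kappa> m x - 1" using h k_lt[OF y(1), of m] by (cases "Suc (\<kappa> m y) = N m") auto
   thus False using h x(2) y(1) by (simp add: S_def y_def)
  qed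
  thus ?thesis using True x(1) by (auto simp: act_def TT_def S_def)
 qed (simp add: act_def)
 have sub: "{x. swp A' \<sigma> x ~= act m (TT J) x} \<subseteq> W \<union> \<sigma> ` W"
 proof
  fix x assume "x \<in> {x. swp A' \<sigma> x ~= act m (TT J) x}"
  hence ne: "swp A' \<sigma> x ~= act m (TT J) x" by simp
  show "x \<in> W \<union> \<sigma> ` W"
  proof (rule ccontr)
   assume nW: "x \<notin> W \<union> \<sigma> ` W"
   define y where "y = inv \<sigma> x"
   have y: "\<sigma> y = x" using sm by (simp add: y_def)
   hence "y \<notin> W" using nW by blast
   hence yA: "y \<in> A' \<longleftrightarrow> y \<in> S" using diff by blast
   have xA: "x \<in> A' \<longleftrightarrow> x \<in> S" using diff nW by blast
   have sinj: "inj \<sigma>" by (rule mpaD(2)[OF sm])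
   consider "x \<in> A'" | "y \<in> A'" | "x \<notin> A'" "y \<notin> A'" by blast
   thus False
   proof cases
    case 1
    thus False using ne xA actS by (simp add: swp_in)
   next
    case 2
    hence "swp A' \<sigma> x = y" using swp_image[OF sinj A'(3)] y by blast
    thus False using ne 2 yA actS'[of y] y by simp
   next
    case 3
    hence "x \<notin> \<sigma> ` A'" using y sinj by (metis imageE injD)
    hence "swp A' \<sigma> x = x" using 3 by (simp add: swp_out)
    thus False using ne act0[of x] 3 xA yA by (simp add: y_def)
   qed
  qed
 qed
 have "prob {x. swp A' \<sigma> x ~= act m (TT J) x} \<le> prob (W \<union> \<sigma> ` W)"
  using sub Ws image_sets[OF sm Ws] by (intro finite_measure_mono) auto
 also have "... \<le> prob W + prob (\<sigma> ` W)" using Ws image_sets[OF sm Ws] by (intro measure_Un_le)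
 also have "... < e" using Wp prob_image[OF sm Ws] by simp
 finally show ?thesis using actG by blast
qed

text \<open>All levels but the top one of each tower are good. The points that are at the top of
  every tower form a null set.\<close>

lemma good_sigma:
 assumes G: "clgrp G" and sG: "\<sigma> \<in> G" and vG: "v \<in> G"
 shows "good G (space M) \<sigma>"
proof -
 define P where "P = (\<lambda>(j, a). if Suc a < N j then {x \<in> X. \<kappa> j x = a} else {})"
 show ?thesis
 proof (rule good_UN[OF G sm, where A = P])
  show "P t \<in> sets M" for t using k_sets by (auto simp: P_def split: prod.split)
  show "good G (P t) \<sigma>" for t
  proof -
   obtain j a where t: "t = (j, a)" by (cases t)
   show ?thesis
    unfolding good_def
   proof (intro ballI impI)
    fix A' assume A': "A' \<in> sets M" "A' \<subseteq> P t \<and> A' \<inter> \<sigma> ` A' = {}"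
    show "swp A' \<sigma> \<in> G"
    proof (cases "Suc a < N j")
     case True
     have s: "A' \<subseteq> {x \<in> X. \<kappa> j x = a}" using A' True by (simp add: P_def t)
     show ?thesis
      by (rule clgrpD(5)[OF G swp_mpa[OF A'(1) sm]])
        (use A' swp_act_close[OF G sG vG A'(1) s _ True] in auto)
    next
     case False
     hence "A' = {}" using A' by (simp add: P_def t)
     hence "swp A' \<sigma> = id" by (auto simp: swp_def)
     thus ?thesis using clgrpD(2)[OF G] by (simp only:)
    qed
   qed
  qed
  show "prob (space M - (\<Union>t. P t)) = 0"
  proof (rule ccontr)
   assume "prob (space M - (\<Union>t. P t)) ~= 0"
   hence "prob (space M - (\<Union>t. P t)) > 0" by (simp add: zero_less_measure_iff)
   then obtain j where j: "1 / real (N j) < prob (space M - (\<Union>t. P t))" using N_small by blast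
   have "AE x in M. x \<in> space M - (\<Union>t. P t) --> x \<in> {x \<in> X. \<kappa> j x = N j - 1}"
    using AE_X
   proof eventually_elim
    case (elim x)
    show ?case
    proof
     assume x: "x \<in> space M - (\<Union>t. P t)"
     hence "x \<notin> P (j, \<kappa> j x)" by blast
     hence "\<not> Suc (\<kappa> j x) < N j" using elim by (auto simp: P_def)
     hence "\<kappa> j x = N j - 1" using k_lt[OF elim, of j] by simp
     thus "x \<in> {x \<in> X. \<kappa> j x = N j - 1}" using elim by simp
    qed
   qed
   hence "prob (space M - (\<Union>t. P t)) \<le> prob {x \<in> X. \<kappa> j x = N j - 1}"
    using k_sets by (intro finite_measure_mono_AE) auto
   thus False using k_prob[of "N j - 1" j] N0[of j] j by simp
  qed
 qed simp
qed

lemma good_zp: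
 assumes G: "clgrp G" and gs: "good G (space M) \<sigma>"
 shows "good G (space M) (zp \<sigma> k)"
proof (induction k rule: int_induct[where k = 0])
 case base
 show ?case by (rule good_fix[OF G]) simp
next
 case (step1 i)
 have e: "zp \<sigma> (i + 1) = \<sigma> o zp \<sigma> i" using zp_plus1[OF sbij] by (auto simp: fun_eq_iff)
 have "zp \<sigma> i ` space M \<subseteq> space M" using mpa_space[OF zpm] by auto
 hence "good G (zp \<sigma> i ` space M) \<sigma>" by (rule good_subset[OF gs])
 thus ?case unfolding e by (rule good_comp[OF G zpm sm sets.top step1(2)])
next
 case (step2 i)
 have e: "zp \<sigma> (i - 1) = inv \<sigma> o zp \<sigma> i" using zp_minus1[OF sbij] by (auto simp: fun_eq_iff)
 have "zp \<sigma> i ` space M \<subseteq> \<sigma> ` space M"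
 proof
  fix y assume "y \<in> zp \<sigma> i ` space M"
  hence "y \<in> space M" using mpa_space[OF zpm] by auto
  hence "inv \<sigma> y \<in> space M" using mpa_space[OF inv_mpa[OF sm]] by simp
  thus "y \<in> \<sigma> ` space M" using mpa_inv_apply(1)[OF sm, of y] by (metis imageI)
 qed
 hence "good G (zp \<sigma> i ` space M) (inv \<sigma>)" by (rule good_subset[OF good_inv[OF sm gs]])
 thus ?case unfolding e by (rule good_comp[OF G zpm inv_mpa[OF sm] sets.top step2(2)])
qed

lemma good_pointwise:
 assumes G: "clgrp G" and gs: "good G (space M) \<sigma>" and f: "f \<in> mpa" and fz: "\<And>x. \<exists>k. f x = zp \<sigma> k x"
 shows "good G (space M) f"
proof (rule good_UN[OF G f, where A = "\<lambda>k. {x \<in> space M. f x = zp \<sigma> k x}"])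
 show "{x \<in> space M. f x = zp \<sigma> k x} \<in> sets M" for k
  using eq_sets mpaD(5) f zpm by blast
 show "good G {x \<in> space M. f x = zp \<sigma> k x} f" for k
  by (rule good_cong[OF good_subset[OF good_zp[OF G gs, of k]] zpm f]) auto
 have "space M - (\<Union>k. {x \<in> space M. f x = zp \<sigma> k x}) = {}" using fz by blast
 thus "prob (space M - (\<Union>k. {x \<in> space M. f x = zp \<sigma> k x})) = 0" by (simp only: measure_empty)
qed simp

text \<open>An invariant set meets all levels of a tower in equal measure, so it is independent of
  every union \<open>C\<close> of levels. It is also close to such a union, hence nearly independent
  of itself: its measure \<open>p\<close> satisfies \<open>p \<le> p * p\<close>.\<close>

lemma sigma_ergodic:
 assumes V: "V \<in> sets M" and inv: "\<And>x. x \<in> X ==> \<sigma> x \<in> V \<longleftrightarrow> x \<in> V"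
 shows "prob V = 0 \<or> prob V = 1"
proof -
 define VX where "VX = V \<inter> X"
 have VXs: "VX \<in> sets M" using V Xs by (simp add: VX_def)
 have pV: "prob VX = prob V" unfolding VX_def
  using AE_X V Xs by (intro measure_eq_AE) auto
 have sVX: "\<sigma> x \<in> VX \<longleftrightarrow> x \<in> VX" for x using inv[of x] sX by (auto simp: VX_def)
 have zVX: "zp \<sigma> k x \<in> VX \<longleftrightarrow> x \<in> VX" for k x
 proof (induction k rule: int_induct[where k = 0])
  case (step1 i) thus ?case using zp_plus1[OF sbij] sVX by simp
 next
  case (step2 i)
  have "inv \<sigma> y \<in> VX \<longleftrightarrow> y \<in> VX" for y using sVX[of "inv \<sigma> y"] sm by simp
  thus ?case using step2 zp_minus1[OF sbij] by simp
 qed simp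
 have piece: "prob (VX \<inter> {x \<in> X. \<kappa> m x = i}) = prob V / N m" if i: "i < N m" for m i
 proof -
  let ?K = "\<lambda>i. VX \<inter> {x \<in> X. \<kappa> m x = i}"
  have Ks: "?K i \<in> sets M" for i using VXs k_sets by auto
  have e: "prob (?K i) = prob (?K 0)" if i: "i < N m" for i
  proof -
   have "?K i = zp \<sigma> (int i) ` ?K 0"
   proof
    show "zp \<sigma> (int i) ` ?K 0 \<subseteq> ?K i"
    proof
     fix y assume "y \<in> zp \<sigma> (int i) ` ?K 0"
     then obtain x where x: "x \<in> VX" "x \<in> X" "\<kappa> m x = 0" "y = zp \<sigma> (int i) x" by auto
     hence "\<kappa> m y = i" using k_zp[OF x(2), of m "int i"] i by simp
     thus "y \<in> ?K i" using x zVX zpX by simp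
    qed
    show "?K i \<subseteq> zp \<sigma> (int i) ` ?K 0"
    proof
     fix y assume y: "y \<in> ?K i"
     define x where "x = zp \<sigma> (- int i) y"
     have yx: "y = zp \<sigma> (int i) x" using zp_add[OF sbij, of "int i" "- int i" y] by (simp add: x_def)
     have "\<kappa> m x = 0" using k_zp[of y m "- int i"] y by (simp add: x_def)
     hence "x \<in> ?K 0" using y zVX zpX by (simp add: x_def)
     thus "y \<in> zp \<sigma> (int i) ` ?K 0" using yx by blast
    qed
   qed
   thus ?thesis using prob_image[OF zpm Ks[of 0]] by simp
  qed
  have "prob VX = prob (\<Union>i<N m. ?K i)"
   using k_lt by (intro arg_cong[where f = prob]) (auto simp: VX_def)
  also have "... = (\<Sum>i<N m. prob (?K i))"
   using Ks by (intro finite_measure_finite_Union) (auto simp: disjoint_family_on_def)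
  also have "... = (\<Sum>i<N m. prob (?K 0))" by (intro sum.cong refl e) simp
  also have "... = N m * prob (?K 0)" by simp
  finally have eq: "prob VX = real (N m) * prob (?K 0)" .
  have "a = b / real (N m)" if "b = real (N m) * a" for a b :: real using that N0[of m] by simp
  from this[OF eq] show ?thesis unfolding pV e[OF i] .
 qed
 have main: "prob V \<le> prob V * prob V + 2 * e" if e: "e > 0" for e
 proof -
  obtain m I Q where ap: "Q \<in> sets M" "prob Q < e" "\<forall>x\<in>X - Q. x \<in> VX \<longleftrightarrow> \<kappa> m x \<in> I"
   using apx[OF VXs e] by blast
  define J where "J = I \<inter> {..<N m}"
  have fJ: "finite J" by (simp add: J_def)
  define C where "C = (\<Union>i\<in>J. {x \<in> X. \<kappa> m x = i})"
  have Cs: "C \<in> sets M" unfolding C_def using fJ k_sets by (intro sets.finite_UN) auto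
  have CX: "x \<in> C \<longleftrightarrow> x \<in> X \<and> \<kappa> m x \<in> I" for x using k_lt by (auto simp: C_def J_def)
  have pC: "prob C = card J / N m"
  proof -
   have "prob C = (\<Sum>i\<in>J. prob {x \<in> X. \<kappa> m x = i})"
    unfolding C_def using fJ k_sets by (intro finite_measure_finite_Union) (auto simp: disjoint_family_on_def)
   also have "... = (\<Sum>i\<in>J. 1 / N m)" using k_prob by (intro sum.cong) (auto simp: J_def)
   finally show ?thesis by simp
  qed
  have "prob (VX \<inter> C) = (\<Sum>i\<in>J. prob (VX \<inter> {x \<in> X. \<kappa> m x = i}))"
  proof -
   have "VX \<inter> C = (\<Union>i\<in>J. VX \<inter> {x \<in> X. \<kappa> m x = i})" by (auto simp: C_def)
   moreover have "prob (\<Union>i\<in>J. VX \<inter> {x \<in> X. \<kappa> m x = i}) = (\<Sum>i\<in>J. prob (VX \<inter> {x \<in> X. \<kappa> m x = i}))"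
    using fJ k_sets VXs by (intro finite_measure_finite_Union) (auto simp: disjoint_family_on_def)
   ultimately show ?thesis by (simp only:)
  qed
  also have "... = (\<Sum>i\<in>J. prob V / N m)" using piece by (intro sum.cong) (auto simp: J_def)
  also have "... = prob V * prob C" by (simp add: pC)
  finally have pVC: "prob (VX \<inter> C) = prob V * prob C" .
  have "prob VX \<le> prob ((VX \<inter> C) \<union> Q)"
   using ap CX VXs Cs by (intro finite_measure_mono) (auto simp: VX_def)
  also have "... \<le> prob (VX \<inter> C) + prob Q" using VXs Cs ap(1) by (intro measure_Un_le) auto
  finally have 1: "prob V \<le> prob V * prob C + e" using pVC pV ap(2) by linarith
  have "prob C \<le> prob (VX \<union> Q)" using ap CX VXs by (intro finite_measure_mono) auto
  also have "... \<le> prob VX + prob Q" using VXs ap(1) by (intro measure_Un_le) auto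
  finally have 2: "prob C \<le> prob V + e" using pV ap(2) by linarith
  have "prob V * prob C \<le> prob V * (prob V + e)" using 2 by (intro mult_left_mono) auto
  also have "... = prob V * prob V + prob V * e" by (simp add: algebra_simps)
  also have "... \<le> prob V * prob V + 1 * e" using e by (intro add_left_mono mult_right_mono) auto
  finally show ?thesis using 1 by simp
 qed
 have "prob V \<le> prob V * prob V"
 proof (rule field_le_epsilon)
  fix e :: real assume "e > 0"
  thus "prob V \<le> prob V * prob V + e" using main[of "e / 2"] by simp
 qed
 hence "1 \<le> prob V" if "prob V ~= 0"
  using that mult_le_cancel_left_pos[of "prob V" 1 "prob V"] by (simp add: zero_less_measure_iff)
 thus ?thesis using prob_le_1[of V] by linarith
qed

text \<open>The powers of \<open>\<sigma>\<close> take the place of the words of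
  \<open>exchange_full\<close>. The resulting involution moves points along
  \<open>\<sigma>\<close>-orbits, so it is good as soon as \<open>\<sigma>\<close> is.\<close>

lemma exchange_sigma:
 assumes A: "A \<in> sets M" and B: "B \<in> sets M" and eq: "prob A = prob B"
 shows "\<exists>f\<in>mpa. (\<forall>x. f (f x) = x) \<and> (\<forall>x. f x ~= x --> x \<in> (A - B) \<union> (B - A)) \<and>
  (\<exists>A0\<in>sets M. A0 \<subseteq> A \<and> prob (A - A0) = 0 \<and> f ` A0 \<subseteq> B) \<and> (\<forall>x. \<exists>k. f x = zp \<sigma> k x)"
proof -
 let ?h = "\<lambda>k. zp \<sigma> (from_nat k)"
 have erg: "\<exists>k. prob (A \<inter> ?h k -` B) > 0" if AB: "A \<in> sets M" "B \<in> sets M" "prob A > 0" "prob B > 0" for A B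
 proof (rule ccontr)
  assume n: "\<not> (\<exists>k. prob (A \<inter> ?h k -` B) > 0)"
  have n0: "prob (A \<inter> zp \<sigma> k -` B) = 0" for k
  proof -
   have "\<not> prob (A \<inter> ?h (to_nat k) -` B) > 0" using n by blast
   thus ?thesis by (simp add: zero_less_measure_iff)
  qed
  let ?V = "\<Union>k. zp \<sigma> k -` B"
  have Vs: "?V \<in> sets M" using vimage_sets[OF zpm AB(2)] by (intro sets.countable_UN') auto
  have "prob ?V = 0 \<or> prob ?V = 1"
  proof (rule sigma_ergodic[OF Vs])
   fix x
   show "\<sigma> x \<in> ?V \<longleftrightarrow> x \<in> ?V"
   proof
    assume "\<sigma> x \<in> ?V"
    then obtain k where "zp \<sigma> k (zp \<sigma> 1 x) \<in> B" by auto
    hence "zp \<sigma> (k + 1) x \<in> B" by (simp only: zp_add[OF sbij])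
    thus "x \<in> ?V" by blast
   next
    assume "x \<in> ?V"
    then obtain k where "zp \<sigma> k x \<in> B" by auto
    hence "zp \<sigma> ((k - 1) + 1) x \<in> B" by simp
    hence "zp \<sigma> (k - 1) (zp \<sigma> 1 x) \<in> B" by (simp only: zp_add[OF sbij])
    thus "\<sigma> x \<in> ?V" by auto
   qed
  qed
  moreover have "prob B \<le> prob ?V"
  proof (rule finite_measure_mono[OF _ Vs])
   have "B \<subseteq> zp \<sigma> 0 -` B" by auto
   thus "B \<subseteq> ?V" by blast
  qed
  ultimately have "prob ?V = 1" using AB(4) by linarith
  hence AV: "AE x in M. x \<in> ?V" using prob_eq_1[OF Vs] by simp
  have "AE x in M. x \<notin> A \<inter> zp \<sigma> k -` B" for k
   using n0[of k] prob_eq_0[of "A \<inter> zp \<sigma> k -` B"] AB(1) vimage_sets[OF zpm AB(2)] by auto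
  hence "AE x in M. \<forall>k. x \<notin> A \<inter> zp \<sigma> k -` B" unfolding AE_all_countable by blast
  with AV have "AE x in M. x \<notin> A" by eventually_elim auto
  thus False using prob_eq_0[OF AB(1)] AB(3) by simp
 qed
 obtain f where f: "f \<in> mpa" and f1: "(\<forall>x. f (f x) = x) \<and> (\<forall>x. f x ~= x --> x \<in> (A - B) \<union> (B - A)) \<and>
  (\<exists>A0\<in>sets M. A0 \<subseteq> A \<and> prob (A - A0) = 0 \<and> f ` A0 \<subseteq> B) \<and>
  (\<forall>x. f x = x \<or> (\<exists>k. f x = ?h k x \<or> ?h k (f x) = x))"
  using exchange[OF zpm erg A B eq] by (rule bexE)
 have "\<exists>k. f x = zp \<sigma> k x" for x
 proof -
  consider "f x = x" | k where "f x = ?h k x" | k where "?h k (f x) = x" using f1 by blast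
  thus ?thesis
  proof cases
   case 1 hence "f x = zp \<sigma> 0 x" by simp
   thus ?thesis by blast
  next
   case 2 thus ?thesis by blast
  next
   case 3
   have "f x = zp \<sigma> (- from_nat k + from_nat k) (f x)" by simp
   also have "... = zp \<sigma> (- from_nat k) x" unfolding zp_add[OF sbij] 3 ..
   finally show ?thesis by blast
  qed
 qed
 thus ?thesis using f f1 by blast
qed

end

section \<open>The equivalence relation of a closed group\<close>

context std_prob
begin

text \<open>Good sets are closed under countable unions, so one of maximal measure exists and
  contains every other up to a null set.\<close>

lemma good_max:
 assumes G: "clgrp G" and g: "g \<in> mpa"
 shows "\<exists>A\<in>sets M. good G A g \<and> (\<forall>B\<in>sets M. good G B g --> prob (B - A) = 0)"
proof -
 define S where "S = {prob A |A. A \<in> sets M \<and> good G A g}"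
 have bdd: "bdd_above S" unfolding S_def by (rule bdd_aboveI[of _ 1]) auto
 have ne: "S ~= {}" using good_fix[OF G, of "{}" g] unfolding S_def by auto
 have "\<exists>A. A \<in> sets M \<and> good G A g \<and> Sup S - 1 / Suc n < prob A" for n
 proof -
  have "Sup S - 1 / Suc n < Sup S" by simp
  then obtain y where "y \<in> S" "Sup S - 1 / Suc n < y" using less_cSup_iff[OF ne bdd] by blast
  thus ?thesis unfolding S_def by auto
 qed
 then obtain A where A: "\<And>n. A n \<in> sets M \<and> good G (A n) g \<and> Sup S - 1 / Suc n < prob (A n)" by metis
 define B where "B = (\<Union>n. A n)"
 have Bs: "B \<in> sets M" using A by (auto simp: B_def)
 have Bg: "good G B g" by (rule good_UN_nat[OF G g, of A]) (use A Bs in \<open>auto simp: B_def\<close>)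
 have ge: "Sup S \<le> prob B"
 proof (rule field_le_epsilon)
  fix e :: real assume "e > 0"
  then obtain n where n: "1 / Suc n < e" using nat_approx_posE by blast
  have "prob (A n) \<le> prob B" using Bs A by (intro finite_measure_mono) (auto simp: B_def)
  thus "Sup S \<le> prob B + e" using A[of n] n by linarith
 qed
 have "prob (C - B) = 0" if C: "C \<in> sets M" "good G C g" for C
 proof -
  have "good G (B \<union> C) g" by (rule good_Un[OF G g Bs Bg C(2)])
  hence "prob (B \<union> C) \<in> S" using Bs C unfolding S_def by blast
  hence "prob (B \<union> C) \<le> prob B" using cSup_upper[OF _ bdd] ge by (meson order_trans)
  moreover have "prob (B \<union> C) = prob B + prob (C - B)"
   using Bs C finite_measure_Union[of B "C - B"] by (simp add: Un_Diff_cancel)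
  ultimately show ?thesis using measure_nonneg[of M "C - B"] by linarith
 qed
 thus ?thesis using Bs Bg by blast
qed

end

context gam
begin

text \<open>Two points are related if some word carries one to the other on its maximal good set.
  Inverses and products of good maps are good, which makes this almost everywhere an equivalence
  relation, and goodness of a map becomes a statement about its graph.\<close>

lemma good_relation:
 assumes G: "clgrp G"
 shows "\<exists>R. (AE x in M. R x x \<and> (\<forall>y. R x y --> R y x) \<and> (\<forall>y z. R x y --> R y z --> R x z)) \<and>
  (\<forall>f\<in>mpa. \<forall>A\<in>sets M. good G A f --> (AE x in M. orb x (f x)) --> (AE x in M. x \<in> A --> R x (f x))) \<and>
  (\<forall>f\<in>mpa. (AE x in M. R x (f x)) --> good G (space M) f)"
proof -
 obtain XX where XX: "\<And>w. XX w \<in> sets M \<and> good G (XX w) (wd w) \<and> (\<forall>B\<in>sets M. good G B (wd w) --> prob (B - XX w) = 0)"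
  using good_max[OF G wd_mpa] by metis
 have XXs: "XX w \<in> sets M" and XXg: "good G (XX w) (wd w)" for w using XX by auto
 have XXm: "AE x in M. x \<in> B --> x \<in> XX w" if B: "B \<in> sets M" "good G B (wd w)" for B w
 proof -
  have "AE x in M. x \<notin> B - XX w" using XX B prob_eq_0[of "B - XX w"] by auto
  thus ?thesis by eventually_elim auto
 qed
 define R where "R x y \<longleftrightarrow> (\<exists>w. y = wd w x \<and> x \<in> XX w)" for x y
 have "AE x in M. x \<in> XX []"
 proof -
  have "good G (space M) (wd [])" by (rule good_fix[OF G]) simp
  hence "AE x in M. x \<in> space M --> x \<in> XX []" by (intro XXm) auto
  thus ?thesis using AE_space by eventually_elim auto
 qed
 moreover have "AE x in M. \<forall>w. x \<in> XX w --> wd w x \<in> XX (rev w)"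
  unfolding AE_all_countable
 proof
  fix w
  have iw: "inv (wd w) = wd (rev w)"
   using wd_rev[of w] wd_rev[of "rev w"] by (intro inv_unique_comp) (auto simp: fun_eq_iff)
  have "good G (wd w ` XX w) (wd (rev w))" using good_inv[OF wd_mpa XXg, of w] iw by simp
  hence "AE y in M. y \<in> wd w ` XX w --> y \<in> XX (rev w)" by (intro XXm image_sets[OF wd_mpa XXs])
  hence "AE x in M. wd w x \<in> wd w ` XX w --> wd w x \<in> XX (rev w)" by (rule AE_mpa[OF wd_mpa])
  thus "AE x in M. x \<in> XX w --> wd w x \<in> XX (rev w)" by eventually_elim auto
 qed
 moreover have "AE x in M. \<forall>u w. x \<in> XX u \<and> wd u x \<in> XX w --> x \<in> XX (w @ u)"
  unfolding AE_all_countable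
 proof (intro allI)
  fix u w
  let ?A = "XX u \<inter> wd u -` XX w"
  have As: "?A \<in> sets M" using XXs vimage_sets[OF wd_mpa XXs] by auto
  have "good G ?A (wd w o wd u)"
  proof (rule good_comp[OF G wd_mpa wd_mpa As])
   show "good G ?A (wd u)" by (rule good_subset[OF XXg]) auto
   show "good G (wd u ` ?A) (wd w)" by (rule good_subset[OF XXg]) auto
  qed
  hence "good G ?A (wd (w @ u))" by (simp only: wd_append)
  from XXm[OF As this] show "AE x in M. x \<in> XX u \<and> wd u x \<in> XX w --> x \<in> XX (w @ u)"
   by eventually_elim auto
 qed
 ultimately have 1: "AE x in M. R x x \<and> (\<forall>y. R x y --> R y x) \<and> (\<forall>y z. R x y --> R y z --> R x z)"
 proof eventually_elim
  case (elim x)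
  have a: "R x x" unfolding R_def using elim(1) by (intro exI[of _ "[]"]) simp
  have b: "R y x" if xy: "R x y" for y
  proof -
   obtain w where w: "y = wd w x" "x \<in> XX w" using xy R_def by blast
   thus ?thesis unfolding R_def using elim(2) wd_rev[of w x] by (intro exI[of _ "rev w"]) auto
  qed
  have c: "R x z" if h: "R x y" "R y z" for y z
  proof -
   obtain u where u: "y = wd u x" "x \<in> XX u" using h(1) R_def by blast
   obtain w where w: "z = wd w y" "y \<in> XX w" using h(2) R_def by blast
   show ?thesis unfolding R_def using elim(3) u w by (intro exI[of _ "w @ u"]) (auto simp: wd_append)
  qed
  show ?case using a b c by blast
 qed
 have eqs: "{x \<in> space M. f x = wd w x} \<in> sets M" if "f \<in> mpa" for f w
  using eq_sets[OF mpaD(5)[OF that] mpaD(5)[OF wd_mpa]] .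
 have 2: "AE x in M. x \<in> A --> R x (f x)"
  if f: "f \<in> mpa" and A: "A \<in> sets M" and gd: "good G A f" and o: "AE x in M. orb x (f x)" for f A
 proof -
  have "AE x in M. \<forall>w. x \<in> A \<inter> {x \<in> space M. f x = wd w x} --> x \<in> XX w"
   unfolding AE_all_countable
  proof
   fix w
   show "AE x in M. x \<in> A \<inter> {x \<in> space M. f x = wd w x} --> x \<in> XX w"
   proof (rule XXm)
    show "A \<inter> {x \<in> space M. f x = wd w x} \<in> sets M" using A eqs[OF f] by auto
    show "good G (A \<inter> {x \<in> space M. f x = wd w x}) (wd w)"
     by (rule good_cong[OF good_subset[OF gd] f wd_mpa]) auto
   qed
  qed
  with o show ?thesis using AE_space
  proof eventually_elim
   case (elim x)
   thus ?case unfolding R_def orb_def by blast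
  qed
 qed
 have 3: "good G (space M) f" if f: "f \<in> mpa" and o: "AE x in M. R x (f x)" for f
 proof (rule good_UN[OF G f, where A = "\<lambda>w. XX w \<inter> {x \<in> space M. f x = wd w x}"])
  show s: "XX w \<inter> {x \<in> space M. f x = wd w x} \<in> sets M" for w using XXs eqs[OF f] by auto
  show "good G (XX w \<inter> {x \<in> space M. f x = wd w x}) f" for w
   by (rule good_cong[OF good_subset[OF XXg[of w]] wd_mpa f]) auto
  have "AE x in M. x \<notin> space M - (\<Union>w. XX w \<inter> {x \<in> space M. f x = wd w x})"
   using o AE_space by eventually_elim (auto simp: R_def)
  moreover have "space M - (\<Union>w. XX w \<inter> {x \<in> space M. f x = wd w x}) \<in> sets M"
   using s by (intro sets.Diff sets.countable_UN') auto
  ultimately show "prob (space M - (\<Union>w. XX w \<inter> {x \<in> space M. f x = wd w x})) = 0"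
   using prob_eq_0 by blast
 qed simp
 show ?thesis using 1 2 3 by (intro exI[of _ R]) blast
qed

text \<open>The slots are cut one after another; \<open>V\<close> records the part already used,
  whose measure is a partial sum, so the next slot always fits.\<close>

lemma disjoint_slots:
 assumes D: "D \<in> sets M" and b: "\<And>p::nat. b p \<ge> 0" "summable b" "suminf b \<le> prob D"
 shows "\<exists>S. (\<forall>p. S p \<in> sets M \<and> S p \<subseteq> D \<and> prob (S p) = b p) \<and> disjoint_family S"
proof -
 define PQ where "PQ = (\<lambda>n (S, V). V \<in> sets M \<and> V \<subseteq> D \<and> prob V = (\<Sum>i<n. b i) \<and> S \<in> sets M \<and> S \<subseteq> D - V \<and> prob S = b n)"
 define QQ where "QQ = (\<lambda>(S, V) (S' :: 'a set, V'). V' = V \<union> (S :: 'a set))"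
 have "\<exists>f. \<forall>n. PQ n (f n) \<and> QQ (f n) (f (Suc n))"
 proof (rule dependent_nat_choice)
  have "b 0 \<le> suminf b" using sum_le_suminf[OF b(2), of "{0}"] b(1) by auto
  then obtain S where "S \<in> sets M" "S \<subseteq> D" "prob S = b 0"
   using nonatomic_split[OF prob_space_axioms na D b(1)[of 0]] b(3) by auto
  thus "\<exists>x. PQ 0 x"
   by (intro exI[of _ "(S, {})"]) (auto simp: PQ_def)
 next
  fix x n assume x: "PQ n x"
  obtain S V where SV: "x = (S, V)" by (cases x)
  have V: "V \<in> sets M" "V \<subseteq> D" "prob V = sum b {..<n}" "S \<in> sets M" "S \<subseteq> D - V" "prob S = b n" using x by (auto simp: SV PQ_def)
  have pV: "prob (V \<union> S) = sum b {..<Suc n}" using V finite_measure_Union[of V S] by auto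
  have "sum b {..<Suc (Suc n)} \<le> suminf b" using b by (intro sum_le_suminf) auto
  hence "b (Suc n) \<le> prob (D - (V \<union> S))"
   using V D pV b(3) by (subst finite_measure_Diff) auto
  then obtain S' where "S' \<in> sets M" "S' \<subseteq> D - (V \<union> S)" "prob S' = b (Suc n)"
   using nonatomic_split[OF prob_space_axioms na _ b(1)[of "Suc n"], of "D - (V \<union> S)"] D V by auto
  thus "\<exists>y. PQ (Suc n) y \<and> QQ x y"
   using V pV by (intro exI[of _ "(S', V \<union> S)"]) (auto simp: SV PQ_def QQ_def)
 qed
 then obtain f where f: "\<And>n. PQ n (f n)" "\<And>n. QQ (f n) (f (Suc n))" by blast
 define S where "S n = fst (f n)" for n
 define V where "V n = snd (f n)" for n
 have S: "S n \<in> sets M" "S n \<subseteq> D - V n" "prob (S n) = b n" "V (Suc n) = V n \<union> S n" for n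
  using f(1)[of n] f(2)[of n] by (auto simp: S_def V_def PQ_def QQ_def split_beta)
 have mono: "V m \<subseteq> V n" if "m \<le> n" for m n using that by (induction n rule: dec_induct) (auto simp: S(4))
 have "S m \<inter> S n = {}" if "m < n" for m n
 proof -
  have "S m \<subseteq> V n" using mono[of "Suc m" n] that by (auto simp: S(4))
  thus ?thesis using S(2)[of n] by blast
 qed
 hence "disjoint_family S" unfolding disjoint_family_on_def by (metis inf_commute linorder_neqE_nat)
 thus ?thesis using S by (intro exI[of _ S]) auto
qed

end

section \<open>Isolating parts of an involution\<close>

context odo
begin

lemma fullg_pointwise: "f \<in> mpa ==> (\<And>x. \<exists>k. f x = zp \<sigma> k x) ==> f \<in> fullg"
proof -
 assume f: "f \<in> mpa" and fz: "\<And>x. \<exists>k. f x = zp \<sigma> k x"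
 have "AE x in M. \<forall>k. orb x (zp \<sigma> k x)" unfolding AE_all_countable using fullgD(2)[OF fullg_zp[OF sf]] by blast
 hence "AE x in M. orb x (f x)"
 proof eventually_elim
  case (elim x) thus ?case using fz[of x] by auto
 qed
 thus ?thesis using f by (simp add: fullg_def)
qed

text \<open>If the involution \<open>T\<close> swaps \<open>D0\<close> with a disjoint set and there is room outside, then
 conjugating \<open>T\<close> by an exchange of a small subset of \<open>D0\<close> with a subset of the room isolates
 the restriction of \<open>T\<close> to that small subset.\<close>

lemma good_of_room:
 assumes G: "clgrp G" and gs: "good G (space M) \<sigma>" and TG: "T \<in> G" and TT: "\<And>x. T (T x) = x"
  and D0: "D0 \<in> sets M" and d: "D0 \<inter> T ` D0 = {}"
  and Rm: "Rm \<in> sets M" "prob Rm > 0" "\<And>x. x \<in> Rm ==> T x = x" "Rm \<inter> D0 = {}"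
 shows "good G D0 T"
proof -
 have Tm: "T \<in> mpa" using clgrpD(1)[OF G TG] .
 have Tinj: "inj T" by (rule mpaD(2)[OF Tm])
 have small: "swp A' T \<in> G" if A': "A' \<in> sets M" "A' \<subseteq> D0" "prob A' \<le> prob Rm" for A'
 proof -
  obtain C where C: "C \<in> sets M" "C \<subseteq> Rm" "prob C = prob A'"
   using nonatomic_split[OF prob_space_axioms na Rm(1) measure_nonneg A'(3)] by blast
  obtain h where h: "h \<in> mpa" and h1: "(\<forall>x. h (h x) = x) \<and> (\<forall>x. h x ~= x --> x \<in> (A' - C) \<union> (C - A')) \<and>
   (\<exists>A0\<in>sets M. A0 \<subseteq> A' \<and> prob (A' - A0) = 0 \<and> h ` A0 \<subseteq> C) \<and> (\<forall>x. \<exists>k. h x = zp \<sigma> k x)"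
   using exchange_sigma[OF A'(1) C(1) C(3)[symmetric]] by (rule bexE)
  have hh: "h (h x) = x" for x using h1 by blast
  have hs: "x \<in> A' \<or> x \<in> C" if "h x ~= x" for x using h1 that by blast
  obtain A0 where A0: "A0 \<in> sets M" "A0 \<subseteq> A'" "prob (A' - A0) = 0" "h ` A0 \<subseteq> C" using h1 by blast
  have hG: "h \<in> G" using good_imp_mem[OF G h good_pointwise[OF G gs h]] h1 by blast
  \<comment> \<open>As \<open>T\<close> fixes \<open>C\<close>, the conjugate
    \<open>T o h o T\<close> exchanges \<open>C\<close> with the image of \<open>A'\<close> under
    \<open>T\<close>. Conjugating by \<open>h\<close> then replaces \<open>C\<close> by
    \<open>A'\<close>.\<close>
  define k where "k = h o T o h o T o h"
  have kG: "k \<in> G" unfolding k_def by (intro clgrpD(3)[OF G] hG TG)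
  \<comment> \<open>The exchange \<open>h\<close> matches \<open>A'\<close> with \<open>C\<close>
    only up to a null set; these are its unmatched points.\<close>
  define N1 where "N1 = (A' - A0) \<union> (C - h ` A0)"
  have hA0: "h ` A0 \<in> sets M" using image_sets[OF h A0(1)] .
  have dA: "A' \<inter> T ` A' = {}" using d A'(2) by blast
  have N1s: "N1 \<in> sets M" using A'(1) A0(1) C(1) hA0 by (auto simp: N1_def)
  have "prob A0 = prob A'" using A0 A'(1) by (simp add: finite_measure_Diff)
  hence "prob (C - h ` A0) = 0"
   using finite_measure_Diff[OF C(1) hA0 A0(4)] prob_image[OF h A0(1)] C(3) by simp
  hence "prob N1 = 0"
   using measure_Un_le[of "A' - A0" M "C - h ` A0"] A0 A'(1) C(1) hA0 measure_nonneg[of M N1] unfolding N1_def by auto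
  hence "AE x in M. x \<notin> N1" using N1s prob_eq_0 by blast
  hence "AE x in M. x \<notin> N1 \<and> T x \<notin> N1" using AE_mpa[OF Tm, of "\<lambda>x. x \<notin> N1"] by auto
  hence "AE x in M. swp A' T x = k x"
  proof eventually_elim
   case (elim x)
   have CR: "T c = c" "c \<notin> A'" if "c \<in> C" for c using that C(2) Rm(3,4) A'(2) by auto
   have TA: "T a \<notin> A'" "T a \<notin> C" if a: "a \<in> A'" for a
   proof -
    show "T a \<notin> A'" using dA a by blast
    show "T a \<notin> C"
    proof
     assume "T a \<in> C"
     hence "T (T a) = T a" using CR by blast
     hence "a \<in> C" using \<open>T a \<in> C\<close> TT by simp
     thus False using a CR by blast
    qed
   qed
   have hTA: "h (T a) = T a" if "a \<in> A'" for a using TA[OF that] hs by blast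
   have sw: "k (T a) = a \<and> k a = T a" if a: "a \<in> A0" for a
   proof -
    have c: "h a \<in> C" using A0(4) a by blast
    have aA: "a \<in> A'" using A0(2) a by blast
    show ?thesis using c aA CR(1)[OF c] hTA[OF aA] by (simp add: k_def hh TT)
   qed
   consider "x \<in> A'" | a where "a \<in> A'" "x = T a" | "x \<in> C" | "x \<notin> A'" "x \<notin> T ` A'" "x \<notin> C" by blast
   thus ?case
   proof cases
    case 1
    hence "x \<in> A0" using elim by (auto simp: N1_def)
    thus ?thesis using sw 1 by (simp add: swp_in)
   next
    case 2
    hence "a \<in> A0" using elim TT by (auto simp: N1_def)
    thus ?thesis using sw 2 swp_image[OF Tinj dA] by simp
   next
    case 3
    hence "x \<in> h ` A0" using elim by (auto simp: N1_def)
    then obtain a where a: "a \<in> A0" "x = h a" by blast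
    have aA: "a \<in> A'" using A0(2) a by blast
    have "k x = x" using hTA[OF aA] by (simp add: k_def a hh TT)
    moreover have "x \<notin> A'" using CR 3 by blast
    moreover have "x \<notin> T ` A'" using TA(2) 3 by blast
    ultimately show ?thesis by (simp add: swp_out)
   next
    case 4
    have hx: "h x = x" using 4 hs by blast
    have "T x \<notin> A'"
    proof
     assume "T x \<in> A'"
     hence "T (T x) \<in> T ` A'" by blast
     thus False using 4 TT by simp
    qed
    moreover have "T x \<notin> C"
    proof
     assume "T x \<in> C"
     hence "T (T x) = T x" using CR by blast
     thus False using \<open>T x \<in> C\<close> 4 TT by simp
    qed
    ultimately have "h (T x) = T x" using hs by blast
    hence "k x = x" using hx TT by (simp add: k_def)
    thus ?thesis using 4 by (simp add: swp_out)
   qed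
  qed
  thus ?thesis by (rule clgrp_AE[OF G swp_mpa[OF A'(1) Tm dA] kG])
 qed
 \<comment> \<open>Cutting \<open>D0\<close> along the levels of a fine tower gives sets no larger
   than the room, to which the conjugation applies.\<close>
 obtain m0 where "\<forall>m\<ge>m0. 1 / real (N m) < prob Rm" using N_small[OF Rm(2)] by blast
 hence m0: "1 / real (N m0) < prob Rm" by blast
 show ?thesis
 proof (rule good_UN_nat[OF G Tm, where A = "\<lambda>i. D0 \<inter> {x \<in> X. \<kappa> m0 x = i}"])
  show "D0 \<inter> {x \<in> X. \<kappa> m0 x = i} \<in> sets M" for i using D0 k_sets by auto
  show "good G (D0 \<inter> {x \<in> X. \<kappa> m0 x = i}) T" for i
   unfolding good_def
  proof (intro ballI impI)
   fix A' assume A': "A' \<in> sets M" "A' \<subseteq> D0 \<inter> {x \<in> X. \<kappa> m0 x = i} \<and> A' \<inter> T ` A' = {}"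
   have "prob A' \<le> prob {x \<in> X. \<kappa> m0 x = i}" using A' k_sets by (intro finite_measure_mono) auto
   also have "... \<le> 1 / N m0"
   proof (cases "i < N m0")
    case True thus ?thesis using k_prob by simp
   next
    case False
    hence "{x \<in> X. \<kappa> m0 x = i} = {}" using k_lt by blast
    hence "prob {x \<in> X. \<kappa> m0 x = i} = 0" by (simp only: measure_empty)
    thus ?thesis by simp
   qed
   finally show "swp A' T \<in> G" using A' m0 by (intro small) auto
  qed
  have "AE x in M. x \<notin> D0 - (\<Union>i. D0 \<inter> {x \<in> X. \<kappa> m0 x = i})" using AE_X by eventually_elim auto
  moreover have "D0 - (\<Union>i. D0 \<inter> {x \<in> X. \<kappa> m0 x = i}) \<in> sets M" using D0 k_sets by auto
  ultimately show "prob (D0 - (\<Union>i. D0 \<inter> {x \<in> X. \<kappa> m0 x = i})) = 0" using prob_eq_0 by blast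
 qed (rule D0)
qed

end

section \<open>Encoding partial maps by involutions\<close>

context odo
begin

definition xch :: "'a set => 'a set => ('a => 'a) => bool" where
 "xch A B f \<longleftrightarrow> f \<in> mpa \<and> (\<forall>x. f (f x) = x) \<and> prob (A - f -` B) = 0 \<and> (\<forall>x. \<exists>k. f x = zp \<sigma> k x)"

lemma xch_exists:
 assumes A: "A \<in> sets M" and B: "B \<in> sets M" and eq: "prob A = prob B"
 shows "\<exists>f. xch A B f"
proof -
 obtain f where f: "f \<in> mpa" and f1: "(\<forall>x. f (f x) = x) \<and> (\<forall>x. f x ~= x --> x \<in> (A - B) \<union> (B - A)) \<and>
  (\<exists>A0\<in>sets M. A0 \<subseteq> A \<and> prob (A - A0) = 0 \<and> f ` A0 \<subseteq> B) \<and> (\<forall>x. \<exists>k. f x = zp \<sigma> k x)"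
  using exchange_sigma[OF A B eq] by (rule bexE)
 obtain A0 where A0: "A0 \<in> sets M" "A0 \<subseteq> A" "prob (A - A0) = 0" "f ` A0 \<subseteq> B" using f1 by blast
 have "prob (A - f -` B) \<le> prob (A - A0)" using A0 A by (intro finite_measure_mono) auto
 hence "prob (A - f -` B) = 0" using A0(3) measure_nonneg[of M] by (metis antisym)
 thus ?thesis unfolding xch_def using f f1 by blast
qed

text \<open>Exchanges along \<open>\<sigma>\<close>-orbits move the domains into disjoint slots of
  \<open>D\<close> and the ranges into disjoint slots of \<open>D'\<close>, so one involution
  performs all the transported maps at once. Isolating a slot and undoing the exchanges, which are
  good, recovers each \<open>\<psi> p\<close>.\<close>

lemma encoding_involution:
 fixes \<psi> :: "nat => 'a => 'a" and B :: "nat => 'a set"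
 assumes B: "\<And>p. B p \<in> sets M" and psi: "\<And>p. \<psi> p \<in> fullg"
  and sm: "summable (\<lambda>p. prob (B p))" and lt: "(\<Sum>p. prob (B p)) < 1 / 2"
 shows "\<exists>T\<in>fullg. \<forall>G. clgrp G --> good G (space M) \<sigma> --> T \<in> G --> (\<forall>p. good G (B p) (\<psi> p))"
proof -
 define c where "c = (\<Sum>p. prob (B p))"
 have c: "0 \<le> c" "c < 1 / 2" using sm lt by (auto simp: c_def intro: suminf_nonneg)
 obtain D where D: "D \<in> sets M" "prob D = c"
  using nonatomic_split[OF prob_space_axioms na sets.top c(1)] c(2) by (auto simp: prob_space)
 have "prob (space M - D) = 1 - c" using D by (simp add: prob_compl)
 hence "c \<le> prob (space M - D)" using c(2) by simp
 then obtain D' where D': "D' \<in> sets M" "D' \<subseteq> space M - D" "prob D' = c"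
  using nonatomic_split[OF prob_space_axioms na sets.compl_sets[OF D(1)] c(1)] by blast
 have b0: "0 \<le> prob (B p)" for p by simp
 obtain S where S0: "(\<forall>p. S p \<in> sets M \<and> S p \<subseteq> D \<and> prob (S p) = prob (B p)) \<and> disjoint_family S"
  using disjoint_slots[OF D(1) b0 sm] D(2) unfolding c_def by auto
 obtain S' where S0': "(\<forall>p. S' p \<in> sets M \<and> S' p \<subseteq> D' \<and> prob (S' p) = prob (B p)) \<and> disjoint_family S'"
  using disjoint_slots[OF D'(1) b0 sm] D'(3) unfolding c_def by auto
 have S: "S p \<in> sets M" "S p \<subseteq> D" "prob (S p) = prob (B p)" and S': "S' p \<in> sets M" "S' p \<subseteq> D'" "prob (S' p) = prob (B p)" for p
  using S0 S0' by auto
 have psim: "\<psi> p \<in> mpa" for p using psi fullgD by blast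
 define C where "C p = \<psi> p ` B p" for p
 have C: "C p \<in> sets M" "prob (C p) = prob (B p)" for p
  using image_sets[OF psim B] prob_image[OF psim B] by (auto simp: C_def)
 define h where "h p = (SOME f. xch (B p) (S p) f)" for p
 define h' where "h' p = (SOME f. xch (C p) (S' p) f)" for p
 have h: "xch (B p) (S p) (h p)" for p
  unfolding h_def by (rule someI_ex[OF xch_exists[OF B S(1) S(3)[symmetric]]])
 have h': "xch (C p) (S' p) (h' p)" for p
  unfolding h'_def using C(2)[of p] S'(3)[of p] by (intro someI_ex[OF xch_exists[OF C(1) S'(1)]]) simp
 have hm: "h p \<in> mpa" "h p (h p x) = x" "prob (B p - h p -` S p) = 0" "\<exists>k. h p x = zp \<sigma> k x" for p x
  using h[of p] unfolding xch_def by auto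
 have hm': "h' p \<in> mpa" "h' p (h' p x) = x" "prob (C p - h' p -` S' p) = 0" "\<exists>k. h' p x = zp \<sigma> k x" for p x
  using h'[of p] unfolding xch_def by auto
 have hf: "h p \<in> fullg" "h' p \<in> fullg" for p using fullg_pointwise[OF hm(1) hm(4)] fullg_pointwise[OF hm'(1) hm'(4)] by auto
 \<comment> \<open>The points at which both exchanges reach their slots; they fill
   \<open>B p\<close> up to a null set.\<close>
 define B1 where "B1 p = B p \<inter> h p -` S p \<inter> \<psi> p -` (C p \<inter> h' p -` S' p)" for p
 have CS: "C p \<inter> h' p -` S' p \<in> sets M" for p using C(1) vimage_sets[OF hm'(1) S'(1)] by auto
 have BS: "B p \<inter> h p -` S p \<in> sets M" for p using B vimage_sets[OF hm(1) S(1)] by auto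
 have B1s: "B1 p \<in> sets M" for p using BS vimage_sets[OF psim CS] by (simp add: B1_def)
 have B1p: "prob (B p - B1 p) = 0" for p
 proof -
  have "B p - B1 p \<subseteq> (B p - h p -` S p) \<union> \<psi> p -` (C p - h' p -` S' p)" by (auto simp: B1_def C_def)
  moreover have s1: "B p - h p -` S p \<in> sets M" using B vimage_sets[OF hm(1) S(1)] by auto
  moreover have s2: "\<psi> p -` (C p - h' p -` S' p) \<in> sets M"
   using C(1) vimage_sets[OF hm'(1) S'(1)] by (intro vimage_sets[OF psim]) auto
  ultimately have "prob (B p - B1 p) \<le> prob ((B p - h p -` S p) \<union> \<psi> p -` (C p - h' p -` S' p))"
   by (intro finite_measure_mono) auto
  also have "... \<le> prob (B p - h p -` S p) + prob (\<psi> p -` (C p - h' p -` S' p))" using s1 s2 by (intro measure_Un_le)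
  also have "prob (\<psi> p -` (C p - h' p -` S' p)) = prob (C p - h' p -` S' p)"
   using C(1) vimage_sets[OF hm'(1) S'(1)] by (intro prob_vimage[OF psim]) auto
  finally show ?thesis using hm(3)[of p] hm'(3)[of p] measure_nonneg[of M "B p - B1 p"] by linarith
 qed
 define S1 where "S1 p = h p ` B1 p" for p
 \<comment> \<open>The map \<open>\<psi> p\<close> seen between the slots: out of the slot in
   \<open>D\<close>, along \<open>\<psi> p\<close>, into the slot in \<open>D'\<close>.\<close>
 define k where "k p = h' p o \<psi> p o h p" for p
 have S1s: "S1 p \<in> sets M" for p using image_sets[OF hm(1) B1s] by (simp add: S1_def)
 have kf: "k p \<in> fullg" for p unfolding k_def by (intro fullg_comp hf psi)
 have km: "k p \<in> mpa" for p using kf fullgD by blast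
 have S1S: "S1 p \<subseteq> S p" for p by (auto simp: S1_def B1_def)
 have kS: "k p ` S1 p \<subseteq> S' p" for p by (auto simp: S1_def B1_def k_def hm(2))
 have DD: "D \<inter> D' = {}" using D'(2) by blast
 have dk: "S1 p \<inter> k p ` S1 p = {}" for p using S1S[of p] kS[of p] S(2)[of p] S'(2)[of p] DD by blast
 define wv where "wv p = swp (S1 p) (k p)" for p
 have kinj: "inj (k p)" for p by (rule mpaD(2)[OF km])
 have wsupp: "x \<in> S1 p \<or> x \<in> k p ` S1 p" if "wv p x ~= x" for p x
  using that swp_out unfolding wv_def by metis
 have ds: "dsup wv"
  unfolding dsup_def
 proof (intro allI impI)
  fix p p' x assume x: "wv p x ~= x" "wv p' x ~= x"
  show "p = p'"
  proof (rule ccontr)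
   assume ne: "p ~= p'"
   have "S p \<inter> S p' = {}" "S' p \<inter> S' p' = {}" using S0 S0' ne unfolding disjoint_family_on_def by auto
   moreover have "x \<in> S p \<or> x \<in> S' p" using wsupp[OF x(1)] S1S kS by blast
   moreover have "x \<in> S p' \<or> x \<in> S' p'" using wsupp[OF x(2)] S1S kS by blast
   ultimately show False using S(2)[of p] S'(2)[of p] S(2)[of p'] S'(2)[of p'] DD by blast
  qed
 qed
 have wf: "wv p \<in> fullg" for p unfolding wv_def by (rule fullg_swp[OF S1s dk kf])
 define T where "T = dprod wv"
 have Tf: "T \<in> fullg" unfolding T_def by (rule fullg_dprod[OF ds wf])
 have Tm: "T \<in> mpa" using Tf fullgD by blast
 have Tw: "T x = wv p x" if "wv p x ~= x" for p x unfolding T_def by (rule dprod_eq[OF ds that])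
 have ww: "wv p (wv p x) = x" for p x unfolding wv_def by (rule swp_swp[OF kinj dk])
 have Tsupp: "\<exists>p. wv p x ~= x" if "T x ~= x" for x using that dprod_id[of wv x] unfolding T_def by blast
 have TT: "T (T x) = x" for x
 proof (cases "T x = x")
  case False
  then obtain p where p: "wv p x ~= x" using Tsupp by blast
  have "wv p (wv p x) ~= wv p x" using p ww[of p x] by simp
  thus ?thesis using Tw[of p "wv p x"] Tw[OF p] ww[of p x] by simp
 qed simp
 have TS: "T x = k p x" if x: "x \<in> S1 p" for p x
 proof -
  have "wv p x = k p x" using x by (simp add: wv_def swp_in)
  moreover have "k p x ~= x" using dk[of p] x by (metis IntI empty_iff imageI)
  ultimately show ?thesis using Tw[of p x] by simp
 qed
 define D0 where "D0 = (\<Union>p. S1 p)"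
 have D0s: "D0 \<in> sets M" using S1s by (auto simp: D0_def)
 have D0D: "D0 \<subseteq> D" using S1S S(2) by (auto simp: D0_def)
 have TD0: "T ` D0 \<subseteq> D'" using TS kS S'(2) by (force simp: D0_def)
 \<comment> \<open>\<open>D\<close> and \<open>D'\<close> have measure \<open>c < 1 / 2\<close>
   each, so the room outside the support of \<open>T\<close> is not null.\<close>
 define Rm where "Rm = space M - (D \<union> D')"
 have Rms: "Rm \<in> sets M" using D(1) D'(1) by (simp add: Rm_def)
 have "prob Rm = 1 - prob (D \<union> D')" unfolding Rm_def using D(1) D'(1) by (intro prob_compl) auto
 also have "prob (D \<union> D') = c + c" using finite_measure_Union[OF D(1) D'(1) DD] D(2) D'(3) by simp
 finally have Rmp: "prob Rm > 0" using c(2) by simp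
 have RmT: "T x = x" if x: "x \<in> Rm" for x
 proof (rule ccontr)
  assume "T x ~= x"
  then obtain p where "wv p x ~= x" using Tsupp by blast
  hence "x \<in> D \<union> D'" using wsupp S1S S(2) kS S'(2) by blast
  thus False using x by (simp add: Rm_def)
 qed
 have "good G (B p) (\<psi> p)" if G: "clgrp G" and gs: "good G (space M) \<sigma>" and TG: "T \<in> G" for G p
 proof -
  have "good G D0 T"
  proof (rule good_of_room[OF G gs TG TT D0s _ Rms Rmp RmT])
   show "D0 \<inter> T ` D0 = {}" using D0D TD0 DD by blast
   show "Rm \<inter> D0 = {}" using D0D by (auto simp: Rm_def)
  qed
  hence "good G (S1 p) T" by (rule good_subset) (auto simp: D0_def)
  hence gk: "good G (S1 p) (k p)" by (rule good_cong[OF _ Tm km TS])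
  have sp: "A \<subseteq> space M" if "A \<in> sets M" for A using that sets.sets_into_space by blast
  have gh: "good G (space M) (h p)" by (rule good_pointwise[OF G gs hm(1) hm(4)])
  have gh': "good G (space M) (h' p)" by (rule good_pointwise[OF G gs hm'(1) hm'(4)])
  have "good G (B1 p) (k p o h p)"
  proof (rule good_comp[OF G hm(1) km B1s])
   show "good G (B1 p) (h p)" by (rule good_subset[OF gh sp[OF B1s]])
   show "good G (h p ` B1 p) (k p)" using gk by (simp add: S1_def)
  qed
  hence "good G (B1 p) (h' p o (k p o h p))"
  proof (rule good_comp[OF G comp_mpa[OF km hm(1)] hm'(1) B1s])
   show "good G ((k p o h p) ` B1 p) (h' p)"
    by (rule good_subset[OF gh' sp[OF image_sets[OF comp_mpa[OF km hm(1)] B1s]]])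
  qed
  moreover have "h' p o (k p o h p) = \<psi> p" by (auto simp: fun_eq_iff k_def hm(2) hm'(2))
  ultimately have "good G (B1 p) (\<psi> p)" by (simp only:)
  thus ?thesis by (rule good_AE_subset[OF G psim B1s _ B B1p])
 qed
 thus ?thesis using Tf by blast
qed

text \<open>\<open>O'\<close> is to be a saturated set on which the properties of the relation hold
  without exceptions, so they may be used along the whole \<open>\<sigma>\<close>-orbit.\<close>

lemma R_zp:
 assumes refl: "\<And>y. y \<in> O' ==> R y y" and trans: "\<And>x y z. x \<in> O' ==> y \<in> O' ==> R x y ==> R y z ==> R x z"
  and sym: "\<And>x y. x \<in> O' ==> R x y ==> R y x"
  and s: "\<And>y. y \<in> O' ==> R y (\<sigma> y) \<and> \<sigma> y \<in> O' \<and> inv \<sigma> y \<in> O'" and y: "y \<in> O'"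
 shows "R y (zp \<sigma> k y) \<and> zp \<sigma> k y \<in> O'"
proof (induction k rule: int_induct[where k = 0])
 case base show ?case using refl y by simp
next
 case (step1 i)
 thus ?case using s[of "zp \<sigma> i y"] trans[OF y, of "zp \<sigma> i y"] zp_plus1[OF sbij, of i y] by simp
next
 case (step2 i)
 define z where "z = zp \<sigma> i y"
 have z: "z \<in> O'" "R y z" using step2 by (auto simp: z_def)
 have iz: "inv \<sigma> z \<in> O'" using s[OF z(1)] by blast
 have "R (inv \<sigma> z) z" using s[OF iz] sm by simp
 hence "R z (inv \<sigma> z)" by (rule sym[OF iz])
 hence "R y (inv \<sigma> z)" by (rule trans[OF y z])
 thus ?case using iz zp_minus1[OF sbij, of i y] by (simp add: z_def)
qed

end

context std_prob
begin

lemma pieces_summable: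
 fixes P :: "nat => nat => 'a set"
 assumes Ps: "\<And>i k. P i k \<in> sets M" and d: "\<And>i. disjoint_family (P i)" and sub: "\<And>i k. P i k \<subseteq> A i"
  and A: "\<And>i. A i \<in> sets M" and sm: "summable (\<lambda>i. prob (A i))"
 shows "summable (\<lambda>p. prob (P (fst (prod_decode p)) (snd (prod_decode p))))"
  "(\<Sum>p. prob (P (fst (prod_decode p)) (snd (prod_decode p)))) \<le> (\<Sum>i. prob (A i))"
proof -
 have le: "(\<Sum>p<k. prob (P (fst (prod_decode p)) (snd (prod_decode p)))) \<le> (\<Sum>i. prob (A i))" for k
 proof -
  let ?F = "prod_decode ` {..<k}"
  have "finite (fst ` ?F \<union> snd ` ?F)" by simp
  then obtain L where L0: "fst ` ?F \<union> snd ` ?F \<subseteq> {..<L}" using finite_nat_iff_bounded by metis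
  have L: "?F \<subseteq> {..<L} \<times> {..<L}"
  proof
   fix z assume "z \<in> ?F"
   hence "fst z \<in> fst ` ?F" "snd z \<in> snd ` ?F" by (rule imageI)+
   hence "fst z \<in> {..<L}" "snd z \<in> {..<L}" using L0 by auto
   thus "z \<in> {..<L} \<times> {..<L}" by (simp add: mem_Times_iff)
  qed
  have "(\<Sum>p<k. prob (P (fst (prod_decode p)) (snd (prod_decode p)))) = (\<Sum>z\<in>?F. prob (P (fst z) (snd z)))"
   by (subst sum.reindex) (auto simp: inj_on_def prod_decode_eq)
  also have "... \<le> (\<Sum>z\<in>{..<L} \<times> {..<L}. prob (P (fst z) (snd z)))" using L by (intro sum_mono2) auto
  also have "... = (\<Sum>i<L. \<Sum>k<L. prob (P i k))" by (simp add: sum.cartesian_product split_beta)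
  also have "... \<le> (\<Sum>i<L. prob (A i))"
  proof (rule sum_mono)
   fix i
   have "disjoint_family_on (P i) {..<L}" using d[of i] unfolding disjoint_family_on_def by blast
   hence "(\<Sum>k<L. prob (P i k)) = prob (\<Union>k<L. P i k)"
    using Ps by (intro finite_measure_finite_Union[symmetric]) auto
   also have "... \<le> prob (A i)" using sub[of i] A by (intro finite_measure_mono UN_least) auto
   finally show "(\<Sum>k<L. prob (P i k)) \<le> prob (A i)" .
  qed
  also have "... \<le> (\<Sum>i. prob (A i))" using sm by (intro sum_le_suminf) auto
  finally show ?thesis .
 qed
 show s: "summable (\<lambda>p. prob (P (fst (prod_decode p)) (snd (prod_decode p))))"
  using le by (intro summableI_nonneg_bounded) auto
 show "(\<Sum>p. prob (P (fst (prod_decode p)) (snd (prod_decode p)))) \<le> (\<Sum>i. prob (A i))"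
  using le s by (intro suminf_le_const) auto
qed

end

section \<open>Contraction of the generating family and the generating set\<close>

context odo
begin

text \<open>The map \<open>\<pi>\<close> contracts each point to the base \<open>B0\<close> along a
  shortest path. The edges used by these paths become trivial after contraction, the others become
  partial maps between points of \<open>B0\<close>, and \<open>\<sigma>\<close> connects each point
  to \<open>B0\<close> once more.\<close>

theorem generating_set:
 fixes As :: "nat => 'a set" and n :: nat
 assumes As: "\<And>i. As i \<in> sets M" and supp: "\<And>i x. gs i x ~= x ==> x \<in> As i \<or> gs i x \<in> As i"
  and sumA: "summable (\<lambda>i. prob (As i))" and lt: "(\<Sum>i. prob (As i)) < real n"
 shows "\<exists>S. finite S \<and> S \<subseteq> fullg \<and> card S \<le> 2 * n \<and> (\<forall>G. clgrp G --> S \<subseteq> G --> fullg \<subseteq> G)"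
proof -
 \<comment> \<open>The base must be small: the paths cover the complement of \<open>B0\<close>, and
   the measure gained by dropping their edges must exceed the amount by which the total may come
   close to \<open>n\<close>, less 1.\<close>
 obtain m0 where "\<forall>m\<ge>m0. 1 / real (N m) < real n - (\<Sum>i. prob (As i))"
  using N_small[of "real n - (\<Sum>i. prob (As i))"] lt by auto
 hence m0: "1 / real (N m0) < real n - (\<Sum>i. prob (As i))" by blast
 define B0 where "B0 = {x \<in> X. \<kappa> m0 x = 0}"
 have B0s: "B0 \<in> sets M" unfolding B0_def by (rule k_sets)
 have B0p: "prob B0 = 1 / N m0" unfolding B0_def by (rule k_prob[OF N0])
 have B0pos: "prob B0 > 0" using B0p N0[of m0] by simp
 \<comment> \<open>The points from which at most \<open>l\<close> steps lead to \<open>B0\<close>;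
   \<open>lv\<close> below is the exact number of steps and \<open>ei\<close> the first edge of a
   shortest path.\<close>
 define D where "D = rec_nat B0 (\<lambda>_ D. D \<union> (\<Union>i. gs i -` D))"
 have D: "D 0 = B0" "D (Suc l) = D l \<union> (\<Union>i. gs i -` D l)" for l by (simp_all add: D_def)
 have Ds: "D l \<in> sets M" for l
 proof (induction l)
  case (Suc l)
  thus ?case using vimage_sets[OF gs_mpa Suc] by (auto simp: D)
 qed (simp add: D B0s)
 have Dg: "gs i x \<in> D (Suc l)" if x: "x \<in> D l" for i x l
 proof -
  have "gs i (gs i x) \<in> D l" using x gs_gs by simp
  thus ?thesis by (auto simp: D)
 qed
 let ?U = "\<Union>l. D l"
 have Us: "?U \<in> sets M" using Ds by auto
 have "prob ?U = 0 \<or> prob ?U = 1"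
 proof (rule ergodic[OF Us])
  fix i x assume "x \<in> ?U"
  thus "gs i x \<in> ?U" using Dg by blast
 qed
 moreover have "prob B0 \<le> prob ?U" using Us D(1) by (intro finite_measure_mono) auto
 ultimately have "prob ?U = 1" using B0pos by linarith
 hence AEU: "AE x in M. x \<in> ?U" using prob_eq_1[OF Us] by simp
 define lv where "lv x = (LEAST l. x \<in> D l)" for x
 define ei where "ei x = (LEAST i. gs i x \<in> D (lv x - 1))" for x
 define nx where "nx x = (if lv x = 0 then x else gs (ei x) x)" for x
 define \<pi> where "\<pi> x = (nx ^^ lv x) x" for x
 have lvD: "x \<in> D (lv x)" if "x \<in> ?U" for x
 proof -
  have "\<exists>l. x \<in> D l" using that by blast
  thus ?thesis unfolding lv_def by (rule LeastI_ex)
 qed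
 have lv_le: "lv x \<le> l" if "x \<in> D l" for x l unfolding lv_def by (rule Least_le) (rule that)
 have eiD: "gs (ei x) x \<in> D (lv x - 1)" if x: "x \<in> ?U" "lv x > 0" for x
 proof -
  obtain l where l: "lv x = Suc l" using x(2) by (cases "lv x") auto
  have "x \<notin> D l" using lv_le[of x l] l by auto
  hence "\<exists>i. gs i x \<in> D l" using lvD[OF x(1)] l by (auto simp: D)
  hence "\<exists>i. gs i x \<in> D (lv x - 1)" using l by simp
  thus ?thesis unfolding ei_def by (rule LeastI_ex)
 qed
 have lv_ei: "lv (gs (ei x) x) = lv x - 1" if x: "x \<in> ?U" "lv x > 0" for x
 proof -
  have a: "lv (gs (ei x) x) \<le> lv x - 1" by (rule lv_le[OF eiD[OF x]])
  have "gs (ei x) x \<in> ?U" using eiD[OF x] by blast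
  hence "gs (ei x) (gs (ei x) x) \<in> D (Suc (lv (gs (ei x) x)))" by (intro Dg lvD)
  hence "lv x \<le> Suc (lv (gs (ei x) x))" using lv_le gs_gs by simp
  thus ?thesis using a by linarith
 qed
 have pi0: "\<pi> x = x" if "x \<in> B0" for x
 proof -
  have "lv x = 0" using lv_le[of x 0] that D(1) by simp
  thus ?thesis by (simp add: \<pi>_def)
 qed
 have pi_nx: "\<pi> x = \<pi> (gs (ei x) x)" if x: "x \<in> ?U" "lv x > 0" for x
 proof -
  obtain l where l: "lv x = Suc l" using x(2) by (cases "lv x") auto
  have "\<pi> x = (nx ^^ l) (nx x)" unfolding \<pi>_def l by (simp only: funpow_Suc_right comp_apply)
  also have "nx x = gs (ei x) x" using x(2) by (simp add: nx_def)
  finally show ?thesis using lv_ei[OF x] l by (simp add: \<pi>_def)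
 qed
 have pi_orb: "orb x (\<pi> x)" for x
 proof -
  have "orb x ((nx ^^ l) x)" for l
  proof (induction l)
   case (Suc l)
   have "orb ((nx ^^ l) x) (nx ((nx ^^ l) x))" by (simp add: nx_def)
   thus ?case using orb_trans[OF Suc] by simp
  qed simp
  thus ?thesis by (simp add: \<pi>_def)
 qed
 have lvs: "{x \<in> space M. lv x = l} \<in> sets M" for l
 proof -
  have "(\<lambda>x. LEAST l. x \<in> D l) \<in> measurable M (count_space UNIV)"
   using Ds by measurable
  hence "lv -` {l} \<inter> space M \<in> sets M" unfolding lv_def by (rule measurable_sets) simp
  thus ?thesis by (simp add: vimage_def Int_def conj_commute)
 qed
 have eis: "{x \<in> space M. lv x = l \<and> ei x = i} \<in> sets M" for l i
 proof -
  have P: "Measurable.pred M (\<lambda>x. gs j x \<in> D (l - 1))" for j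
   using measurable_sets[OF mpaD(5)[OF gs_mpa[of j]] Ds[of "l - 1"]] by (simp add: pred_def vimage_def Int_def conj_commute)
  have "(\<lambda>x. LEAST j. gs j x \<in> D (l - 1)) \<in> measurable M (count_space UNIV)"
   using P by (rule measurable_Least)
  hence "(\<lambda>x. LEAST j. gs j x \<in> D (l - 1)) -` {i} \<inter> space M \<in> sets M" by (rule measurable_sets) simp
  moreover have "{x \<in> space M. lv x = l \<and> ei x = i} = {x \<in> space M. lv x = l} \<inter> ((\<lambda>x. LEAST j. gs j x \<in> D (l - 1)) -` {i} \<inter> space M)"
   by (auto simp: ei_def)
  ultimately show ?thesis using lvs[of l] by simp
 qed
 have nxm: "nx \<in> measurable M M"
 proof (rule measurableI)
  show "nx x \<in> space M" if "x \<in> space M" for x using that mpa_space[OF gs_mpa] by (simp add: nx_def)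
  fix A assume A: "A \<in> sets M"
  have "nx -` A \<inter> space M = (A \<inter> {x \<in> space M. lv x = 0}) \<union>
    (\<Union>l. \<Union>i. gs i -` A \<inter> {x \<in> space M. lv x = Suc l \<and> ei x = i})" (is "?L = ?R")
  proof (rule Set.set_eqI)
   fix x show "x \<in> ?L \<longleftrightarrow> x \<in> ?R" by (cases "lv x") (auto simp: nx_def)
  qed
  also have "... \<in> sets M" using A lvs eis vimage_sets[OF gs_mpa A] by (intro sets.Un sets.countable_UN') auto
  finally show "nx -` A \<inter> space M \<in> sets M" .
 qed
 have nxl: "nx ^^ l \<in> measurable M M" for l
  by (induction l) (simp_all only: funpow.simps measurable_ident measurable_comp[OF _ nxm])
 have pim: "\<pi> \<in> measurable M M"
 proof (rule measurableI)
  show "\<pi> x \<in> space M" if "x \<in> space M" for x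
   unfolding \<pi>_def using measurable_space[OF nxl that] .
  fix A assume A: "A \<in> sets M"
  have "\<pi> -` A \<inter> space M = (\<Union>l. ((nx ^^ l) -` A \<inter> space M) \<inter> {x \<in> space M. lv x = l})" by (auto simp: \<pi>_def)
  also have "... \<in> sets M" using lvs measurable_sets[OF nxl A] by (intro sets.countable_UN') auto
  finally show "\<pi> -` A \<inter> space M \<in> sets M" .
 qed
 \<comment> \<open>The part of the domain on which edge \<open>i\<close> starts no path, at neither
   of its ends.\<close>
 define rm where "rm i = {x \<in> As i \<inter> ?U. \<not> (0 < lv x \<and> ei x = i) \<and> \<not> (0 < lv (gs i x) \<and> ei (gs i x) = i)}" for i
 define E where "E i = {x \<in> ?U. 0 < lv x \<and> ei x = i}" for i
 have Es: "E i \<in> sets M" for i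
 proof -
  have "E i = ?U \<inter> (\<Union>l. {x \<in> space M. lv x = Suc l \<and> ei x = i})"
  proof (rule Set.set_eqI)
   fix x
   have "x \<in> ?U ==> x \<in> space M" using Us sets.sets_into_space by blast
   thus "x \<in> E i \<longleftrightarrow> x \<in> ?U \<inter> (\<Union>l. {x \<in> space M. lv x = Suc l \<and> ei x = i})"
    by (cases "lv x") (auto simp: E_def)
  qed
  thus ?thesis using Us eis by auto
 qed
 have Ugs: "gs i x \<in> ?U \<longleftrightarrow> x \<in> ?U" for i x
 proof
  assume "gs i x \<in> ?U"
  hence "gs i (gs i x) \<in> ?U" using Dg by blast
  thus "x \<in> ?U" using gs_gs by simp
 qed (use Dg in blast)
 have rm_eq: "rm i = (As i \<inter> ?U) - E i - gs i -` E i" for i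
  using Ugs unfolding rm_def E_def by auto
 have rms: "rm i \<in> sets M" for i
  unfolding rm_eq using As Us Es vimage_sets[OF gs_mpa Es] by auto
 \<comment> \<open>A point that uses edge \<open>i\<close> either lies in \<open>As i\<close> or is
   carried there by it. The two resulting subsets of \<open>As i\<close> are disjoint from each
   other and from \<open>rm i\<close>.\<close>
 have rmle: "prob (E i) \<le> prob (As i) - prob (rm i)" for i
 proof -
  let ?F1 = "As i \<inter> E i" and ?F2 = "As i \<inter> gs i -` E i"
  have s: "?F1 \<in> sets M" "?F2 \<in> sets M" using As Es vimage_sets[OF gs_mpa Es] by auto
  \<comment> \<open>An edge cannot lower the number of steps in both directions.\<close>
  have d12: "?F1 \<inter> ?F2 = {}"
  proof -
   have False if h: "x \<in> E i" "gs i x \<in> E i" for x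
   proof -
    have "lv (gs i x) = lv x - 1" "0 < lv x" using lv_ei[of x] h(1) by (auto simp: E_def)
    moreover have "lv (gs i (gs i x)) = lv (gs i x) - 1" "0 < lv (gs i x)" using lv_ei[of "gs i x"] h(2) by (auto simp: E_def)
    ultimately show False using gs_gs by simp
   qed
   thus ?thesis by blast
  qed
  have "E i \<subseteq> ?F1 \<union> gs i ` ?F2"
  proof
   fix x assume x: "x \<in> E i"
   have "gs i x ~= x"
   proof
    assume eq: "gs i x = x"
    have "lv (gs i x) = lv x - 1" "0 < lv x" using lv_ei[of x] x by (auto simp: E_def)
    thus False using eq by simp
   qed
   hence "x \<in> As i \<or> gs i x \<in> As i" by (rule supp)
   thus "x \<in> ?F1 \<union> gs i ` ?F2"
   proof
    assume "gs i x \<in> As i"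
    hence "gs i x \<in> ?F2" using x gs_gs by simp
    hence "gs i (gs i x) \<in> gs i ` ?F2" by (rule imageI)
    thus ?thesis using gs_gs by simp
   qed (use x in simp)
  qed
  hence "prob (E i) \<le> prob (?F1 \<union> gs i ` ?F2)" using s image_sets[OF gs_mpa s(2)] by (intro finite_measure_mono) auto
  also have "... \<le> prob ?F1 + prob (gs i ` ?F2)" using s image_sets[OF gs_mpa s(2)] by (intro measure_Un_le)
  also have "prob (gs i ` ?F2) = prob ?F2" by (rule prob_image[OF gs_mpa s(2)])
  also have "prob ?F1 + prob ?F2 = prob (?F1 \<union> ?F2)" using finite_measure_Union[OF s d12] by simp
  finally have 1: "prob (E i) \<le> prob (?F1 \<union> ?F2)" .
  have d3: "rm i \<inter> (?F1 \<union> ?F2) = {}" by (auto simp: rm_eq)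
  have "prob (rm i) + prob (?F1 \<union> ?F2) = prob (rm i \<union> (?F1 \<union> ?F2))"
   using finite_measure_Union[OF rms _ d3] s by auto
  also have "... \<le> prob (As i)" using As by (intro finite_measure_mono) (auto simp: rm_eq)
  finally show ?thesis using 1 by linarith
 qed
 have rmA: "prob (rm i) \<le> prob (As i)" for i using As by (intro finite_measure_mono) (auto simp: rm_eq)
 have sumr: "summable (\<lambda>i. prob (rm i))"
  by (rule summable_comparison_test'[OF sumA, of 0]) (use rmA in auto)
 have sumE: "summable (\<lambda>i. prob (E i))"
 proof (rule summable_comparison_test'[OF sumA, of 0])
  show "norm (prob (E i)) \<le> prob (As i)" for i
   using rmle[of i] measure_nonneg[of M "rm i"] measure_nonneg[of M "E i"] unfolding real_norm_def by linarith
 qed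
 have "prob (?U - B0) = 1 - 1 / N m0"
 proof -
  have "B0 \<subseteq> ?U" using D(1) by blast
  thus ?thesis using finite_measure_Diff[OF Us B0s] \<open>prob ?U = 1\<close> B0p by simp
 qed
 also have "?U - B0 = (\<Union>i. E i)"
 proof
  show "?U - B0 \<subseteq> (\<Union>i. E i)"
  proof
   fix x assume x: "x \<in> ?U - B0"
   hence "lv x ~= 0" using lvD[of x] D(1) by (metis DiffD1 DiffD2)
   thus "x \<in> (\<Union>i. E i)" using x by (auto simp: E_def)
  qed
  show "(\<Union>i. E i) \<subseteq> ?U - B0"
  proof
   fix x assume "x \<in> (\<Union>i. E i)"
   hence "x \<in> ?U" "0 < lv x" by (auto simp: E_def)
   thus "x \<in> ?U - B0" using lv_le[of x 0] D(1) by auto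
  qed
 qed
 finally have "1 - 1 / N m0 = prob (\<Union>i. E i)" ..
 also have "... \<le> (\<Sum>i. prob (E i))" using Es sumE by (intro finite_measure_subadditive_countably) auto
 also have "... \<le> (\<Sum>i. prob (As i) - prob (rm i))" using rmle sumE sumA sumr by (intro suminf_le summable_diff) auto
 also have "... = (\<Sum>i. prob (As i)) - (\<Sum>i. prob (rm i))" using suminf_diff[OF sumA sumr] by simp
 finally have rlt: "(\<Sum>i. prob (rm i)) < real n - 1" using m0 by linarith
 have r0: "0 \<le> (\<Sum>i. prob (rm i))" by (intro suminf_nonneg sumr) simp
 have n2: "n \<ge> 2" using rlt r0 by (cases "n = 0"; cases "n = 1") auto
 \<comment> \<open>Total measure below \<open>n - 1\<close>, divided into \<open>J\<close> shares,
   gives each share less than \<open>1 / 2\<close>, as \<open>encoding_involution\<close>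
   requires.\<close>
 define J where "J = 2 * n - 2"
 have J: "J > 0" "real J = 2 * (real n - 1)" using n2 by (auto simp: J_def of_nat_diff)
 \<comment> \<open>On \<open>Q i t\<close> both ends of the edge are contracted along fixed words,
   so the contracted edge is the restriction of one element of the full group.\<close>
 define Q where "Q i t = {x \<in> rm i. \<pi> x = wd (fst t) x \<and> \<pi> (gs i x) = wd (snd t) (gs i x)}" for i and t :: "nat list \<times> nat list"
 have Qs: "Q i t \<in> sets M" for i t
 proof -
  have "{x \<in> space M. \<pi> x = wd (fst t) x} \<in> sets M" by (rule eq_sets[OF pim mpaD(5)[OF wd_mpa]])
  moreover have "{x \<in> space M. (\<pi> o gs i) x = (wd (snd t) o gs i) x} \<in> sets M"
   by (rule eq_sets[OF measurable_comp[OF mpaD(5)[OF gs_mpa] pim] measurable_comp[OF mpaD(5)[OF gs_mpa] mpaD(5)[OF wd_mpa]]])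
  moreover have "Q i t = rm i \<inter> {x \<in> space M. \<pi> x = wd (fst t) x} \<inter> {x \<in> space M. (\<pi> o gs i) x = (wd (snd t) o gs i) x}"
   using sets.sets_into_space[OF rms] unfolding Q_def by auto
  ultimately show ?thesis using rms by auto
 qed
 define Pi where "Pi i = disjointed (\<lambda>k. Q i (from_nat k))" for i
 have PiQ: "Pi i k \<subseteq> Q i (from_nat k)" for i k unfolding Pi_def by (rule disjointed_subset)
 have Pid: "disjoint_family (Pi i)" for i unfolding Pi_def by (rule disjoint_family_disjointed)
 have Pis: "Pi i k \<in> sets M" for i k
 proof -
  have "range (\<lambda>k. Q i (from_nat k)) \<subseteq> sets M" using Qs by blast
  from sets.range_disjointed_sets[OF this] show ?thesis unfolding Pi_def by blast
 qed
 have PiU: "(\<Union>k. Pi i k) = rm i" for i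
 proof -
  have "(\<Union>k. Pi i k) = (\<Union>k. Q i (from_nat k))" unfolding Pi_def by (rule UN_disjointed_eq)
  also have "... = rm i"
  proof
   show "rm i \<subseteq> (\<Union>k. Q i (from_nat k))"
   proof
    fix x assume x: "x \<in> rm i"
    obtain u where u: "\<pi> x = wd u x" using pi_orb[of x] orb_def by blast
    obtain v where v: "\<pi> (gs i x) = wd v (gs i x)" using pi_orb[of "gs i x"] orb_def by blast
    have "x \<in> Q i (from_nat (to_nat (u, v)))" using x u v by (simp add: Q_def)
    thus "x \<in> (\<Union>k. Q i (from_nat k))" by blast
   qed
  qed (auto simp: Q_def)
  finally show ?thesis .
 qed
 define ix where "ix p = fst (prod_decode p)" for p
 define tx :: "nat => nat list \<times> nat list" where "tx p = from_nat (snd (prod_decode p))" for p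
 define PP where "PP p = Pi (ix p) (snd (prod_decode p))" for p
 have PPs: "PP p \<in> sets M" for p by (simp add: PP_def Pis)
 have PPsm: "summable (\<lambda>p. prob (PP p))" and PPle: "(\<Sum>p. prob (PP p)) \<le> (\<Sum>i. prob (rm i))"
 proof -
  have Psub: "Pi i k \<subseteq> rm i" for i k using PiU by blast
  show "summable (\<lambda>p. prob (PP p))" "(\<Sum>p. prob (PP p)) \<le> (\<Sum>i. prob (rm i))"
   unfolding PP_def ix_def by (rule pieces_summable[of Pi rm, OF Pis Pid Psub rms sumr])+
 qed
 have "\<exists>Y. (\<forall>q<J. Y q \<in> sets M \<and> Y q \<subseteq> PP p \<and> prob (Y q) = prob (PP p) / J) \<and> disjoint_family_on Y {..<J}" for p
  by (rule equal_parts[OF prob_space_axioms na PPs]) (use J in auto)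
 then obtain Y where Y: "\<And>p q. q < J ==> Y p q \<in> sets M \<and> Y p q \<subseteq> PP p \<and> prob (Y p q) = prob (PP p) / J"
  and Yd: "\<And>p. disjoint_family_on (Y p) {..<J}" by metis
 \<comment> \<open>Back from \<open>\<pi> y\<close> to \<open>y\<close>, across the edge, and on to
   the contraction of the other end.\<close>
 define \<psi> where "\<psi> p = wd (snd (tx p)) o gs (ix p) o wd (rev (fst (tx p)))" for p
 have gsf: "gs i \<in> fullg" for i by (rule fullgI[OF gs_mpa]) simp
 have psi: "\<psi> p \<in> fullg" for p unfolding \<psi>_def by (intro fullg_comp fullg_wd gsf)
 have psim: "\<psi> p \<in> mpa" for p using psi fullgD by blast
 have Tex: "\<exists>T\<in>fullg. \<forall>G. clgrp G --> good G (space M) \<sigma> --> T \<in> G --> (\<forall>p. good G (wd (fst (tx p)) ` Y p q) (\<psi> p))"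
  if q: "q < J" for q
 proof (rule encoding_involution[OF _ psi])
  show "wd (fst (tx p)) ` Y p q \<in> sets M" for p using image_sets[OF wd_mpa] Y[OF q] by blast
  have e: "prob (wd (fst (tx p)) ` Y p q) = prob (PP p) / J" for p using prob_image[OF wd_mpa] Y[OF q] by metis
  show "summable (\<lambda>p. prob (wd (fst (tx p)) ` Y p q))" unfolding e by (rule summable_divide[OF PPsm])
  have "(\<Sum>p. prob (wd (fst (tx p)) ` Y p q)) = (\<Sum>p. prob (PP p)) / J" unfolding e by (rule suminf_divide[OF PPsm])
  also have "... < (real n - 1) / J" using PPle rlt J by (intro divide_strict_right_mono) auto
  also have "... = 1 / 2" using J n2 by (simp add: field_simps)
  finally show "(\<Sum>p. prob (wd (fst (tx p)) ` Y p q)) < 1 / 2" .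
 qed
 define T where "T q = (SOME T. T \<in> fullg \<and> (\<forall>G. clgrp G --> good G (space M) \<sigma> --> T \<in> G --> (\<forall>p. good G (wd (fst (tx p)) ` Y p q) (\<psi> p))))" for q
 have T: "T q \<in> fullg \<and> (\<forall>G. clgrp G --> good G (space M) \<sigma> --> T q \<in> G --> (\<forall>p. good G (wd (fst (tx p)) ` Y p q) (\<psi> p)))"
  if q: "q < J" for q
 proof -
  have "\<exists>T. T \<in> fullg \<and> (\<forall>G. clgrp G --> good G (space M) \<sigma> --> T \<in> G --> (\<forall>p. good G (wd (fst (tx p)) ` Y p q) (\<psi> p)))"
   using Tex[OF q] by (simp only: Bex_def)
  thus ?thesis unfolding T_def by (rule someI_ex)
 qed
 define S where "S = insert \<sigma> (insert v (T ` {..<J}))"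
 have Sf: "S \<subseteq> fullg" using T sf v_full by (auto simp: S_def)
 have "card (T ` {..<J}) \<le> J" using card_image_le[of "{..<J}" T] by simp
 hence "card S \<le> Suc (Suc J)"
  unfolding S_def using card_insert_le_m1 by (metis (no_types, lifting) card_insert_if finite_imageI finite_insert finite_lessThan le_SucI Suc_le_mono)
 hence Sc: "card S \<le> 2 * n" using n2 by (simp add: J_def)
 have "fullg \<subseteq> G" if G: "clgrp G" and SG: "S \<subseteq> G" for G
 proof
  fix f assume f: "f \<in> fullg"
  have fm: "f \<in> mpa" using f fullgD by blast
  have sG: "\<sigma> \<in> G" and vG: "v \<in> G" and TG: "\<And>q. q < J ==> T q \<in> G" using SG by (auto simp: S_def)
  have gs': "good G (space M) \<sigma>" by (rule good_sigma[OF G sG vG])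
  have gpsi: "good G (wd (fst (tx p)) ` PP p) (\<psi> p)" for p
  proof (rule good_UN_nat[OF G psim, where A = "\<lambda>q. if q < J then wd (fst (tx p)) ` Y p q else {}"])
   show "(if q < J then wd (fst (tx p)) ` Y p q else {}) \<in> sets M" for q using image_sets[OF wd_mpa] Y by auto
   show "good G (if q < J then wd (fst (tx p)) ` Y p q else {}) (\<psi> p)" for q
    using T[of q] G gs' TG[of q] good_fix[OF G, of "{}"] by auto
   show "wd (fst (tx p)) ` PP p \<in> sets M" using image_sets[OF wd_mpa PPs] .
   have YU: "(\<Union>q<J. Y p q) \<in> sets M" using Y by auto
   have "prob (\<Union>q<J. Y p q) = (\<Sum>q<J. prob (Y p q))" using Y Yd by (intro finite_measure_finite_Union) auto
   also have "... = (\<Sum>q<J. prob (PP p) / J)" using Y by (intro sum.cong) auto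
   also have "... = prob (PP p)" using J by simp
   finally have "prob (PP p - (\<Union>q<J. Y p q)) = 0"
    using finite_measure_Diff[OF PPs YU, of p] Y[of _ p] by (simp add: UN_subset_iff)
   hence "prob (wd (fst (tx p)) ` (PP p - (\<Union>q<J. Y p q))) = 0"
    using prob_image[OF wd_mpa sets.Diff[OF PPs YU]] by simp
   moreover have "wd (fst (tx p)) ` PP p - (\<Union>q. if q < J then wd (fst (tx p)) ` Y p q else {}) = wd (fst (tx p)) ` (PP p - (\<Union>q<J. Y p q))"
   proof -
    have "(\<Union>q. if q < J then wd (fst (tx p)) ` Y p q else {}) = wd (fst (tx p)) ` (\<Union>q<J. Y p q)"
     by (auto split: if_splits)
    thus ?thesis using image_set_diff[OF mpaD(2)[OF wd_mpa]] by metis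
   qed
   ultimately show "prob (wd (fst (tx p)) ` PP p - (\<Union>q. if q < J then wd (fst (tx p)) ` Y p q else {})) = 0" by (simp only:)
  qed
  obtain R where R1: "AE x in M. R x x \<and> (\<forall>y. R x y --> R y x) \<and> (\<forall>y z. R x y --> R y z --> R x z)"
   and R2: "\<And>f A. f \<in> mpa ==> A \<in> sets M ==> good G A f ==> AE x in M. orb x (f x) ==> AE x in M. x \<in> A --> R x (f x)"
   and R3: "\<And>f. f \<in> mpa ==> AE x in M. R x (f x) ==> good G (space M) f"
   using good_relation[OF G] by blast
  have Rs: "AE x in M. R x (\<sigma> x)"
   using R2[OF sm sets.top gs' fullgD(2)[OF sf]] AE_space by eventually_elim auto
  have Rpsi: "AE x in M. \<forall>p. x \<in> wd (fst (tx p)) ` PP p --> R x (\<psi> p x)"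
   unfolding AE_all_countable
   using R2[OF psim image_sets[OF wd_mpa PPs] gpsi fullgD(2)[OF psi]] by blast
  \<comment> \<open>Everything that will be used along orbits, collected to hold at all points of
    one saturated conull set.\<close>
  define PZ where "PZ x \<longleftrightarrow> (R x x \<and> (\<forall>y. R x y --> R y x) \<and> (\<forall>y z. R x y --> R y z --> R x z)) \<and>
   R x (\<sigma> x) \<and> (\<forall>p. x \<in> wd (fst (tx p)) ` PP p --> R x (\<psi> p x)) \<and> x \<in> X \<and> x \<in> ?U \<and> orb x (\<sigma> x) \<and> orb x (inv \<sigma> x)" for x
  have "AE x in M. PZ x"
   using R1 Rs Rpsi AE_X AEU fullgD(2)[OF sf] fullgD(2)[OF fullg_inv[OF sf]]
   unfolding PZ_def by eventually_elim (elim conjE, intro conjI; assumption)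
  from saturate[of gs, OF gs_mpa this] obtain Z where Z0: "Z \<in> sets M"
   and Z1: "prob Z = 1 \<and> (\<forall>x\<in>Z. PZ x) \<and> (\<forall>k x. gs k x \<in> Z \<longleftrightarrow> x \<in> Z)" by (rule bexE)
  have ZP: "PZ x" if "x \<in> Z" for x using Z1 that by blast
  have Zwd: "wd w x \<in> Z" if "x \<in> Z" for w x using that by (induction w) (use Z1 in auto)
  have Zorb: "y \<in> Z" if h: "x \<in> Z" "orb x y" for x y
  proof -
   obtain w where w: "y = wd w x" using h(2) orb_def by blast
   show ?thesis unfolding w by (rule Zwd[OF h(1)])
  qed
  have refl: "R x x" if "x \<in> Z" for x using ZP[OF that] unfolding PZ_def by blast
  have sym: "R y x" if "x \<in> Z" "R x y" for x y using ZP[OF that(1)] that(2) unfolding PZ_def by blast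
  have trans: "R x z" if "x \<in> Z" "R x y" "R y z" for x y z using ZP[OF that(1)] that(2,3) unfolding PZ_def by blast
  have Zs: "R y (\<sigma> y) \<and> \<sigma> y \<in> Z \<and> inv \<sigma> y \<in> Z" if y: "y \<in> Z" for y
   using ZP[OF y] Zorb[OF y] unfolding PZ_def by blast
  have piZ: "\<pi> x \<in> Z" if "x \<in> Z" for x using Zorb[OF that pi_orb] .
  \<comment> \<open>Either the edge remains and is encoded by some \<open>\<psi> p\<close>, or it
    starts a path at one of its ends and both ends have the same contraction.\<close>
  have edge0: "R (\<pi> y) (\<pi> (gs i y))" if y: "y \<in> Z" "y \<in> As i" for y i
  proof (cases "y \<in> rm i")
   case True
   then obtain k where k: "y \<in> Pi i k" using PiU by blast
   define p where "p = prod_encode (i, k)"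
   have p: "ix p = i" "PP p = Pi i k" "tx p = from_nat k" by (simp_all add: p_def ix_def PP_def tx_def)
   have yQ: "\<pi> y = wd (fst (tx p)) y" "\<pi> (gs i y) = wd (snd (tx p)) (gs i y)"
    using PiQ[of i k] k p(3) by (auto simp: Q_def)
   have "\<pi> y \<in> wd (fst (tx p)) ` PP p" using yQ(1) k p(2) by simp
   moreover have "\<psi> p (\<pi> y) = \<pi> (gs i y)" using yQ p(1) by (simp add: \<psi>_def wd_rev)
   ultimately show ?thesis using ZP[OF piZ[OF y(1)]] unfolding PZ_def by metis
  next
   case False
   have yU: "y \<in> ?U" using ZP[OF y(1)] unfolding PZ_def by blast
   have "\<pi> y = \<pi> (gs i y)"
   proof (cases "0 < lv y \<and> ei y = i")
    case True thus ?thesis using pi_nx[OF yU] by blast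
   next
    case 2: False
    hence h: "0 < lv (gs i y)" "ei (gs i y) = i" using False y(2) yU by (auto simp: rm_def)
    have "gs i y \<in> ?U" using yU Ugs by blast
    thus ?thesis using pi_nx[of "gs i y"] h gs_gs by simp
   qed
   thus ?thesis using refl[OF piZ[OF y(1)]] by simp
  qed
  have edge: "R (\<pi> y) (\<pi> (gs i y))" if y: "y \<in> Z" for y i
  proof (cases "gs i y = y")
   case True thus ?thesis using refl[OF piZ[OF y]] by simp
  next
   case False
   have gZ: "gs i y \<in> Z" using Z1 y by blast
   from supp[OF False] show ?thesis
   proof
    assume "gs i y \<in> As i"
    hence "R (\<pi> (gs i y)) (\<pi> y)" using edge0[OF gZ, of i] gs_gs by simp
    thus ?thesis by (rule sym[OF piZ[OF gZ]])
   qed (rule edge0[OF y])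
  qed
  have path: "R (\<pi> x) (\<pi> (wd w x))" if x: "x \<in> Z" for x w
  proof (induction w)
   case Nil show ?case using refl[OF piZ[OF x]] by simp
  next
   case (Cons i w)
   show ?case using trans[OF piZ[OF x] Cons edge[OF Zwd[OF x]], of i] by simp
  qed
  have base: "R (\<pi> x) y" if x: "x \<in> Z" and xy: "orb x y" for x y
  proof -
   have yZ: "y \<in> Z" using Zorb[OF x xy] .
   \<comment> \<open>The base point below \<open>y\<close> in its column: contraction fixes it and
     \<open>\<sigma>\<close> relates it to \<open>y\<close>.\<close>
   define y' where "y' = zp \<sigma> (- int (\<kappa> m0 y)) y"
   have y': "R y y' \<and> y' \<in> Z" unfolding y'_def
    by (rule R_zp[of Z R, OF refl trans sym Zs yZ]) auto
   have yX: "y \<in> X" using ZP[OF yZ] unfolding PZ_def by blast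
   have "\<kappa> m0 y' = 0" using k_zp[OF yX, of m0 "- int (\<kappa> m0 y)"] by (simp add: y'_def)
   moreover have "y' \<in> X" using yX by (simp add: y'_def zpX)
   ultimately have "y' \<in> B0" by (simp add: B0_def)
   hence py: "\<pi> y' = y'" by (rule pi0)
   have zorb: "orb y (zp \<sigma> k y)" for k
    by (rule conjunct1[OF R_zp[of Z orb]]) (use Zs ZP yZ in \<open>auto simp: PZ_def intro: orb_trans orb_sym\<close>)
   have "orb x y'" using orb_trans[OF xy zorb] by (simp add: y'_def)
   then obtain w where "y' = wd w x" using orb_def by blast
   hence "R (\<pi> x) y'" using path[OF x, of w] py by simp
   moreover have "R y' y" using y' sym[OF yZ] by blast
   ultimately show ?thesis using trans[OF piZ[OF x]] by blast
  qed
  have "AE x in M. x \<in> Z" using Z0 Z1 prob_eq_1 by blast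
  with fullgD(2)[OF f] have "AE x in M. R x (f x)"
  proof eventually_elim
   case (elim x)
   have "R (\<pi> x) x" by (rule base[OF elim(2) orb_refl])
   hence "R x (\<pi> x)" by (rule sym[OF piZ[OF elim(2)]])
   thus ?case using trans[OF elim(2)] base[OF elim(2,1)] by blast
  qed
  hence "good G (space M) f" by (rule R3[OF fm])
  thus "f \<in> G" by (rule good_imp_mem[OF G fm])
 qed
 thus ?thesis using Sf Sc by (intro exI[of _ S]) (auto simp: S_def)
qed

end

theorem (in gam) upper_bound:
 fixes As :: "nat => 'a set" and n :: nat
 assumes As: "\<And>i. As i \<in> sets M" and supp: "\<And>i x. gs i x ~= x ==> x \<in> As i \<or> gs i x \<in> As i"
  and sumA: "summable (\<lambda>i. prob (As i))" and lt: "(\<Sum>i. prob (As i)) < real n"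
 shows "\<exists>S. finite S \<and> S \<subseteq> fullg \<and> card S \<le> 2 * n \<and> (\<forall>G. clgrp G --> S \<subseteq> G --> fullg \<subseteq> G)"
proof -
 define Pr where "Pr = {p::nat. prime p \<and> p > 2}"
 have "infinite Pr"
 proof
  assume "finite Pr"
  moreover have "{p::nat. prime p} \<subseteq> Pr \<union> {..2}" by (auto simp: Pr_def)
  ultimately have "finite {p::nat. prime p}" by (meson finite_UnI finite_atMost finite_subset)
  thus False using primes_infinite by blast
 qed
 define q where "q m = enumerate Pr m - 1" for m
 have en: "enumerate Pr m \<in> Pr" for m using enumerate_in_set[OF \<open>infinite Pr\<close>] .
 have sq: "Suc (q m) = enumerate Pr m" for m using en[of m] by (auto simp: q_def Pr_def)
 have q2: "q m \<ge> 2" for m using en[of m] by (auto simp: q_def Pr_def)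
 obtain \<sigma> N \<kappa> X where o: "odometer \<sigma> N \<kappa> X" "\<forall>m. (2 * q (m - 1) + 4) * N m \<le> N (Suc m)"
  using odometer_exists[of "\<lambda>m. 2 * q (m - 1) + 4"] by auto
 interpret odo M U gs \<sigma> N \<kappa> X q
 proof
  show "m = m'" if "q m = q m'" for m m'
   using sq[of m] sq[of m'] that inj_enumerate[OF \<open>infinite Pr\<close>] by (metis injD)
  show "prime (Suc (q m))" for m using sq[of m] en[of m] by (auto simp: Pr_def)
 qed (use o q2 in auto)
 show ?thesis by (rule generating_set[OF As supp sumA lt])
qed

section \<open>Classes of automorphisms\<close>

text \<open>A countable base can be enumerated since the space is not empty; it generates the Borel
  sets, and the Hausdorff property makes it separate points.\<close>

lemma standard_borel_std_prob:
 assumes sb: "standard_borel M" and P: "prob_space M"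
 shows "\<exists>U. std_prob M U"
proof -
 interpret prob_space M by (rule P)
 obtain T where T: "completely_metrizable_space T" "second_countable T" "topspace T = space M"
  "sets M = sigma_sets (space M) {U. openin T U}"
  using sb by (auto simp: standard_borel_def)
 have H: "Hausdorff_space T"
  using T(1) by (intro metrizable_imp_Hausdorff_space completely_metrizable_imp_metrizable_space)
 obtain B where B: "countable B" "\<And>V. V \<in> B ==> openin T V"
  "\<And>U x. openin T U ==> x \<in> U ==> \<exists>V\<in>B. x \<in> V \<and> V \<subseteq> U"
  using T(2) unfolding second_countable_def by metis
 obtain x0 where "x0 \<in> space M" using not_empty by blast
 hence "x0 \<in> topspace T" by (simp add: T(3))
 hence "B ~= {}" using B(3)[OF openin_topspace] by blast
 define U where "U = from_nat_into B"
 have rU: "range U = B" unfolding U_def by (rule range_from_nat_into[OF \<open>B ~= {}\<close> B(1)])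
 have "std_prob M U"
 proof unfold_locales
  have sub: "{V. openin T V} \<subseteq> sigma_sets (space M) B"
  proof
   fix V assume "V \<in> {V. openin T V}"
   hence V: "openin T V" by simp
   have eq: "V = \<Union>{W\<in>B. W \<subseteq> V}" using B(3)[OF V] by blast
   have "\<Union>{W\<in>B. W \<subseteq> V} \<in> sigma_sets (space M) B"
   proof (rule sigma_sets_UNION)
    show "countable {W \<in> B. W \<subseteq> V}" using B(1) by (rule countable_subset[rotated]) blast
   qed (auto intro: sigma_sets.Basic)
   thus "V \<in> sigma_sets (space M) B" using eq by simp
  qed
  have "sigma_sets (space M) {U. openin T U} = sigma_sets (space M) B"
  proof (rule sigma_sets_eqI)
   show "a \<in> sigma_sets (space M) B" if "a \<in> {U. openin T U}" for a using that sub by blast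
   show "b \<in> sigma_sets (space M) {U. openin T U}" if "b \<in> B" for b
    using B(2)[OF that] by (intro sigma_sets.Basic) simp
  qed
  thus "sets M = sigma_sets (space M) (range U)" using T(4) rU by simp
 next
  fix x y assume xy: "x \<in> space M" "y \<in> space M" "x ~= y"
  then obtain V W where VW: "openin T V" "openin T W" "x \<in> V" "y \<in> W" "disjnt V W"
   using H T(3) unfolding Hausdorff_space_def by metis
  obtain V' where V': "V' \<in> B" "x \<in> V'" "V' \<subseteq> V" using B(3)[OF VW(1,3)] by blast
  obtain k where "V' = U k" using V'(1) rU by (metis imageE)
  thus "\<exists>k. x \<in> U k \<and> y \<notin> U k" using V' VW by (auto simp: disjnt_def)
 qed
 thus ?thesis by blast
qed

definition evl :: "(nat => 'a => 'a) => letter => 'a => 'a" where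
 "evl f a = (if snd a then f (fst a) else inv (f (fst a)))"

definition evw :: "(nat => 'a => 'a) => letter list => 'a => 'a" where
 "evw f w = foldr (\<lambda>a h. evl f a o h) w id"

lemma evw_simps [simp]: "evw f [] = id" "evw f (a # w) = evl f a o evw f w"
 by (simp_all add: evw_def)

lemma evw_append: "evw f (v @ w) = evw f v o evw f w"
 by (induction v) (auto simp: comp_assoc)

context std_prob
begin

lemma evl_mpa: "f (fst a) \<in> mpa ==> evl f a \<in> mpa"
 by (simp add: evl_def inv_mpa)

lemma evw_mpa: "(\<And>i. i \<in> fst ` set w ==> f i \<in> mpa) ==> evw f w \<in> mpa"
proof (induction w)
 case (Cons a w)
 have "evl f a o evw f w \<in> mpa" by (rule comp_mpa[OF evl_mpa]) (use Cons in auto)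
 thus ?case by (simp only: evw_simps)
qed simp

text \<open>The element of \<open>Aut M\<close> represented by \<open>f\<close>; restriction makes
  \<open>f\<close> extensional, as the carrier of \<open>mp_aut\<close> demands.\<close>

definition cl :: "('a => 'a) => ('a => 'a) set" where
 "cl f = null_aut M #>\<^bsub>mp_aut M\<^esub> restrict f (space M)"

lemma restrict_mp_aut:
 assumes f: "f \<in> mpa" shows "restrict f (space M) \<in> carrier (mp_aut M)"
proof -
 let ?f = "restrict f (space M)"
 note F = mpaD[OF f]
 have bb: "bij_betw ?f (space M) (space M)"
 proof (rule bij_betw_imageI)
  show "inj_on ?f (space M)" using F(2) by (auto simp: inj_on_def)
  show "?f ` space M = space M"
  proof
   show "space M \<subseteq> ?f ` space M"
   proof
    fix x assume "x \<in> space M"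
    moreover have "f (inv f x) = x" using F(3) by (simp add: surj_f_inv_f)
    moreover have "inv f x \<in> space M" using calculation mpa_space[OF f, of "inv f x"] by simp
    ultimately show "x \<in> ?f ` space M" by (metis imageI restrict_apply')
   qed
  qed (use mpa_space[OF f] in auto)
 qed
 have fm: "?f \<in> measurable M M" using F(5) by (rule measurable_cong[THEN iffD1, rotated]) simp
 have "inv_into (space M) ?f x = inv f x" if x: "x \<in> space M" for x
 proof (rule inv_into_f_eq)
  show "inj_on ?f (space M)" using bb by (simp add: bij_betw_def)
  have e: "f (inv f x) = x" using F(3) by (simp add: surj_f_inv_f)
  thus s: "inv f x \<in> space M" using x mpa_space[OF f, of "inv f x"] by simp
  show "?f (inv f x) = x" using s e by simp
 qed
 hence im: "inv_into (space M) ?f \<in> measurable M M"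
  using F(6) by (intro measurable_cong[THEN iffD1, OF _ F(6)]) simp
 have d: "distr M M ?f = M" using F(7) by (intro trans[OF distr_cong F(7)]) auto
 show ?thesis using bb fm im d by (simp add: carrier_mp_aut Bij_def borel_iso_def)
qed

lemma mp_aut_extend:
 assumes h: "h \<in> carrier (mp_aut M)"
 shows "\<exists>f\<in>mpa. restrict f (space M) = h"
proof
 define f where "f x = (if x \<in> space M then h x else x)" for x
 note H = mp_autD[OF h]
 show r: "restrict f (space M) = h" using H(6) by (auto simp: fun_eq_iff f_def extensional_def)
 have hs: "h x \<in> space M" if "x \<in> space M" for x by (rule mp_aut_space[OF h that])
 have hi: "h (inv_into (space M) h x) = x" "inv_into (space M) h x \<in> space M" if "x \<in> space M" for x
  using H(3) that by (auto simp: bij_betw_def f_inv_into_f inv_into_into)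
 have ih: "inv_into (space M) h (h x) = x" if "x \<in> space M" for x
  using H(3) that by (auto simp: bij_betw_def)
 define g where "g x = (if x \<in> space M then inv_into (space M) h x else x)" for x
 have fg: "f (g x) = x" "g (f x) = x" for x using hs hi ih by (auto simp: f_def g_def)
 have bf: "bij f" by (rule o_bij[of g]) (auto simp: fg)
 have "inv f = g" by (rule inv_equality) (simp_all only: fg)
 moreover have "g \<in> measurable M M" by (rule measurable_cong[THEN iffD1, OF _ H(4)]) (simp add: g_def)
 moreover have "f \<in> measurable M M" by (rule measurable_cong[THEN iffD1, OF _ H(2)]) (simp add: f_def)
 moreover have "distr M M f = M" by (rule trans[OF distr_cong H(5)]) (auto simp: f_def)
 ultimately show "f \<in> mpa" using bf by (simp add: mpa_def f_def)
qed

lemma cl_carrier: "f \<in> mpa ==> cl f \<in> carrier (Aut M)"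
 using restrict_mp_aut unfolding cl_def carrier_Aut by blast

lemma cl_mem: "f \<in> mpa ==> restrict f (space M) \<in> cl f"
 using restrict_mp_aut unfolding cl_def by (simp add: mem_Aut_class_iff)

lemma cl_surj: "a \<in> carrier (Aut M) ==> \<exists>f\<in>mpa. a = cl f"
proof -
 assume "a \<in> carrier (Aut M)"
 then obtain h where h: "h \<in> carrier (mp_aut M)" "a = null_aut M #>\<^bsub>mp_aut M\<^esub> h"
  unfolding carrier_Aut by blast
 obtain f where "f \<in> mpa" "restrict f (space M) = h" using mp_aut_extend[OF h(1)] by (rule bexE)
 thus ?thesis using h(2) unfolding cl_def by blast
qed

lemma cl_mult:
 assumes f: "f \<in> mpa" and g: "g \<in> mpa"
 shows "cl f \<otimes>\<^bsub>Aut M\<^esub> cl g = cl (f o g)"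
proof -
 interpret N: normal "null_aut M" "mp_aut M" by (rule normal_null_aut)
 have "restrict f (space M) \<otimes>\<^bsub>mp_aut M\<^esub> restrict g (space M) = restrict (f o g) (space M)"
  unfolding mult_mp_aut[OF restrict_mp_aut[OF f] restrict_mp_aut[OF g]]
  using mpa_space[OF g] by (auto simp: compose_def fun_eq_iff)
 thus ?thesis
  using N.rcos_sum[OF restrict_mp_aut[OF f] restrict_mp_aut[OF g]] by (simp add: cl_def Aut_def FactGroup_def)
qed

lemma cl_id: "cl id = \<one>\<^bsub>Aut M\<^esub>"
proof -
 interpret group "Aut M" by (rule group_Aut)
 have "cl id \<otimes>\<^bsub>Aut M\<^esub> cl id = cl id" using cl_mult[of id id] by simp
 thus ?thesis using cl_carrier[of id] by (metis id_mpa(1) l_cancel_one')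
qed

lemma cl_inv: "f \<in> mpa ==> m_inv (Aut M) (cl f) = cl (inv f)"
proof -
 assume f: "f \<in> mpa"
 interpret group "Aut M" by (rule group_Aut)
 have "inv f o f = id" using mpaD(2)[OF f] by simp
 hence "cl (inv f) \<otimes>\<^bsub>Aut M\<^esub> cl f = \<one>\<^bsub>Aut M\<^esub>" using cl_mult[OF inv_mpa[OF f] f] cl_id by simp
 thus ?thesis by (rule inv_equality[OF _ cl_carrier[OF f] cl_carrier[OF inv_mpa[OF f]]])
qed

lemma cl_dist:
 assumes sb: "standard_borel M" and f: "f \<in> mpa" and g: "g \<in> mpa"
 shows "Aut_dist M (cl f) (cl g) = prob {x. f x ~= g x}"
proof -
 have "{x \<in> space M. restrict f (space M) x ~= restrict g (space M) x} = {x. f x ~= g x}"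
 proof (rule Set.set_eqI)
  show "x \<in> {x \<in> space M. restrict f (space M) x ~= restrict g (space M) x} \<longleftrightarrow> x \<in> {x. f x ~= g x}" for x
   by (cases "x \<in> space M") (simp_all add: mpaD(4)[OF f] mpaD(4)[OF g])
 qed
 thus ?thesis using Aut_dist_eq[OF sb cl_carrier[OF f] cl_mem[OF f] cl_carrier[OF g] cl_mem[OF g]] by simp
qed

lemma cl_full:
 assumes f: "f \<in> mpa" shows "cl f \<in> full_group M E \<longleftrightarrow> (AE x in M. (x, f x) \<in> E)"
proof -
 have "(AE x in M. (x, restrict f (space M) x) \<in> E) \<longleftrightarrow> (AE x in M. (x, f x) \<in> E)"
  by (rule AE_cong) simp
 thus ?thesis using full_group_any_representative[OF cl_carrier[OF f] cl_mem[OF f]] by simp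
qed

lemma neq_triangle:
 assumes f: "f \<in> mpa" and g: "g \<in> mpa" and h: "h \<in> mpa"
 shows "prob {x. f x ~= h x} \<le> prob {x. f x ~= g x} + prob {x. g x ~= h x}"
proof -
 have "prob {x. f x ~= h x} \<le> prob ({x. f x ~= g x} \<union> {x. g x ~= h x})"
  using neq_mpa f g h by (intro finite_measure_mono) auto
 also have "... \<le> prob {x. f x ~= g x} + prob {x. g x ~= h x}" using neq_mpa f g h by (intro measure_Un_le)
 finally show ?thesis .
qed

lemma neq_comp:
 assumes f: "f \<in> mpa" "f' \<in> mpa" and g: "g \<in> mpa" "g' \<in> mpa"
 shows "prob {x. (f o f') x ~= (g o g') x} \<le> prob {x. f x ~= g x} + prob {x. f' x ~= g' x}"
proof -
 have s: "{x. f x ~= g x} \<in> sets M" "{x. f' x ~= g' x} \<in> sets M" using neq_mpa f g by auto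
 have "prob {x. (f o f') x ~= (g o g') x} \<le> prob (f' -` {x. f x ~= g x} \<union> {x. f' x ~= g' x})"
  using s vimage_sets[OF f(2) s(1)] by (intro finite_measure_mono) auto
 also have "... \<le> prob (f' -` {x. f x ~= g x}) + prob {x. f' x ~= g' x}" using s vimage_sets[OF f(2) s(1)] by (intro measure_Un_le)
 also have "prob (f' -` {x. f x ~= g x}) = prob {x. f x ~= g x}" by (rule prob_vimage[OF f(2) s(1)])
 finally show ?thesis .
qed

lemma neq_inv:
 assumes f: "f \<in> mpa" and g: "g \<in> mpa"
 shows "prob {x. inv f x ~= inv g x} = prob {x. f x ~= g x}"
proof -
 have "{x. inv f x ~= inv g x} = f ` {x. f x ~= g x}"
 proof (rule Set.set_eqI)
  fix x
  have x: "f (inv f x) = x" and y: "\<And>y. inv f (f y) = y" "\<And>y. inv g (g y) = y" "g (inv g x) = x"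
   using mpa_inv_apply[OF f] mpa_inv_apply[OF g] by auto
  show "x \<in> {x. inv f x ~= inv g x} \<longleftrightarrow> x \<in> f ` {x. f x ~= g x}"
  proof
   assume "x \<in> {x. inv f x ~= inv g x}"
   hence "f (inv f x) ~= g (inv f x)" using x y(2)[of "inv f x"] by auto
   thus "x \<in> f ` {x. f x ~= g x}" using x by (metis (mono_tags) imageI mem_Collect_eq)
  next
   assume "x \<in> f ` {x. f x ~= g x}"
   thus "x \<in> {x. inv f x ~= inv g x}" using y by force
  qed
 qed
 thus ?thesis using prob_image[OF f neq_mpa[OF f g]] by simp
qed

text \<open>The bijections whose classes lie in the closure of the generated subgroup form a closed
  group \<open>K\<close> in the sense of \<open>clgrp\<close>. Once it contains all of
  \<open>F\<close>, the subgroup is dense.\<close>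

lemma t_full_group_le:
 assumes sb: "standard_borel M" and E: "equiv (space M) E" and F: "F = {f\<in>mpa. AE x in M. (x, f x) \<in> E}"
  and S: "finite S" "S \<subseteq> F" "card S \<le> k" and gen: "\<And>G. clgrp G ==> S \<subseteq> G ==> F \<subseteq> G"
 shows "t_full_group M E \<le> enat k"
proof -
 let ?A = "(Aut M)\<lparr>carrier := full_group M E\<rparr>"
 interpret A: group "Aut M" by (rule group_Aut)
 note sg = subgroup_full_group[OF E]
 interpret B: group ?A by (rule A.subgroup_imp_group[OF sg])
 interpret D: Metric_space "carrier (Aut M)" "Aut_dist M" by (rule Metric_space_Aut[OF sb prob_space_axioms])
 define H where "H = generate ?A (cl ` S)"
 have Sf: "cl ` S \<subseteq> full_group M E" using S(2) cl_full by (auto simp: F)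
 have Hf: "H \<subseteq> full_group M E" unfolding H_def using B.generate_incl[of "cl ` S"] Sf by simp
 have Hmul: "a \<otimes>\<^bsub>Aut M\<^esub> b \<in> H" if "a \<in> H" "b \<in> H" for a b
  using generate.eng[of a ?A "cl ` S" b] that by (simp add: H_def)
 have Hone: "\<one>\<^bsub>Aut M\<^esub> \<in> H" using generate.one[of ?A "cl ` S"] by (simp add: H_def)
 have Hinv: "m_inv (Aut M) a \<in> H" if "a \<in> H" for a
 proof -
  have "m_inv ?A a \<in> H" using B.generate_m_inv_closed[of "cl ` S" a] Sf that by (simp add: H_def)
  thus ?thesis using A.m_inv_consistent[OF sg] Hf that by auto
 qed
 define K where "K = {f\<in>mpa. \<forall>e>0. \<exists>g\<in>mpa. cl g \<in> H \<and> prob {x. f x ~= g x} < e}"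
 have KI: "f \<in> K" if "f \<in> mpa" "cl f \<in> H" for f
  using that by (auto simp: K_def intro!: bexI[of _ f])
 have "clgrp K" unfolding clgrp_def
 proof (intro conjI ballI impI)
  show "K \<subseteq> mpa" by (auto simp: K_def)
  show "id \<in> K" by (rule KI) (simp_all only: id_mpa cl_id Hone)
 next
  fix f f' assume f: "f \<in> K" "f' \<in> K"
  have m: "f \<in> mpa" "f' \<in> mpa" using f by (auto simp: K_def)
  have "\<exists>g\<in>mpa. cl g \<in> H \<and> prob {x. (f o f') x ~= g x} < e" if e: "e > 0" for e
  proof -
   have e2: "e / 2 > 0" using e by simp
   obtain g where g: "g \<in> mpa" "cl g \<in> H" "prob {x. f x ~= g x} < e / 2" using f(1) e2 unfolding K_def by blast
   obtain g' where g': "g' \<in> mpa" "cl g' \<in> H" "prob {x. f' x ~= g' x} < e / 2" using f(2) e2 unfolding K_def by blast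
   have "prob {x. (f o f') x ~= (g o g') x} < e" using neq_comp[OF m g(1) g'(1)] g(3) g'(3) by linarith
   moreover have "cl (g o g') \<in> H" using Hmul[OF g(2) g'(2)] cl_mult[OF g(1) g'(1)] by metis
   ultimately show ?thesis using comp_mpa[OF g(1) g'(1)] by blast
  qed
  thus "f o f' \<in> K" unfolding K_def using comp_mpa[OF m] by blast
 next
  fix f assume f: "f \<in> K"
  hence m: "f \<in> mpa" by (auto simp: K_def)
  have "\<exists>g\<in>mpa. cl g \<in> H \<and> prob {x. inv f x ~= g x} < e" if e: "e > 0" for e
  proof -
   obtain g where g: "g \<in> mpa" "cl g \<in> H" "prob {x. f x ~= g x} < e" using f e unfolding K_def by blast
   have "cl (inv g) \<in> H" using Hinv[OF g(2)] cl_inv[OF g(1)] by simp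
   thus ?thesis using neq_inv[OF m g(1)] g(3) inv_mpa[OF g(1)] by metis
  qed
  thus "inv f \<in> K" unfolding K_def using inv_mpa[OF m] by blast
 next
  fix f assume f: "f \<in> mpa" "\<forall>e>0. \<exists>g\<in>K. prob {x. f x ~= g x} < e"
  have "\<exists>g\<in>mpa. cl g \<in> H \<and> prob {x. f x ~= g x} < e" if e: "e > 0" for e
  proof -
   have e2: "e / 2 > 0" using e by simp
   obtain g where g: "g \<in> K" "prob {x. f x ~= g x} < e / 2" using f(2) e2 by blast
   obtain h where h: "h \<in> mpa" "cl h \<in> H" "prob {x. g x ~= h x} < e / 2" using g(1) e2 unfolding K_def by blast
   have "g \<in> mpa" using g(1) by (simp add: K_def)
   hence "prob {x. f x ~= h x} < e" using neq_triangle[OF f(1) _ h(1), of g] g(2) h(3) by fastforce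
   thus ?thesis using h by blast
  qed
  thus "f \<in> K" using f(1) by (simp add: K_def)
 qed
 moreover have "S \<subseteq> K"
 proof
  fix s assume s: "s \<in> S"
  show "s \<in> K"
  proof (rule KI)
   show "s \<in> mpa" using s S(2) by (auto simp: F)
   show "cl s \<in> H" unfolding H_def using s by (intro generate.incl) simp
  qed
 qed
 ultimately have FK: "F \<subseteq> K" by (rule gen)
 have top: "topspace (subtopology (uniform_topology M) (full_group M E)) = full_group M E"
  by (auto simp: uniform_topology_def D.topspace_mtopology full_group_def)
 have "full_group M E \<subseteq> D.mtopology closure_of H"
 proof
  fix a assume a: "a \<in> full_group M E"
  hence ac: "a \<in> carrier (Aut M)" by (simp add: full_group_def)
  obtain f where f: "f \<in> mpa" "a = cl f" using cl_surj[OF ac] by blast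
  have "f \<in> F" using a f cl_full[OF f(1)] by (simp add: F)
  hence fK: "f \<in> K" using FK by blast
  show "a \<in> D.mtopology closure_of H"
   unfolding D.metric_closure_of
  proof (intro CollectI conjI ac allI impI)
   fix r :: real assume "r > 0"
   then obtain g where g: "g \<in> mpa" "cl g \<in> H" "prob {x. f x ~= g x} < r" using fK unfolding K_def by blast
   have "cl g \<in> D.mball a r" using cl_dist[OF sb f(1) g(1)] g(3) f(2) ac cl_carrier[OF g(1)] by simp
   thus "\<exists>y\<in>H. y \<in> D.mball a r" using g(2) by blast
  qed
 qed
 hence cl: "subtopology (uniform_topology M) (full_group M E) closure_of H = full_group M E"
  unfolding closure_of_subtopology uniform_topology_def using Hf by (simp add: Int_absorb1 Int_absorb2)
 have "t_full_group M E \<le> enat (card (cl ` S))"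
  unfolding t_full_group_def top_gen_number_def
 proof (rule Inf_lower, rule CollectI, intro exI conjI)
  show "subtopology (uniform_topology M) (full_group M E) closure_of generate ?A (cl ` S) =
    topspace (subtopology (uniform_topology M) (full_group M E))"
   unfolding top H_def[symmetric] by (rule cl)
 qed (use S(1) Sf in simp_all)
 also have "... \<le> enat k" using card_image_le[OF S(1), of cl] S(3) by simp
 finally show ?thesis .
qed

text \<open>At most \<open>n\<close> topological generators are listed as a sequence of bijections,
  and density becomes approximation by words in its first \<open>n\<close> members.\<close>

lemma t_full_group_ge:
 assumes sb: "standard_borel M" and E: "equiv (space M) E" and F: "F = {f\<in>mpa. AE x in M. (x, f x) \<in> E}"
  and no: "\<And>f :: nat => 'a => 'a. (\<And>i. f i \<in> F) ==>
   (\<And>g e. g \<in> F ==> e > 0 ==> \<exists>w. fst ` set w \<subseteq> {..<n} \<and> prob {x. g x ~= evw f w x} < e) ==> False"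
 shows "enat (n + 1) \<le> t_full_group M E"
 unfolding t_full_group_def top_gen_number_def
proof (rule Inf_greatest, elim CollectE exE conjE)
 let ?A = "(Aut M)\<lparr>carrier := full_group M E\<rparr>"
 interpret A: group "Aut M" by (rule group_Aut)
 note sg = subgroup_full_group[OF E]
 interpret D: Metric_space "carrier (Aut M)" "Aut_dist M" by (rule Metric_space_Aut[OF sb prob_space_axioms])
 fix c S assume c: "c = enat (card S)" and S: "finite S" "S \<subseteq> carrier ?A"
  and d: "subtopology (uniform_topology M) (full_group M E) closure_of generate ?A S =
    topspace (subtopology (uniform_topology M) (full_group M E))"
 show "enat (n + 1) \<le> c"
 proof (rule ccontr)
  assume "\<not> enat (n + 1) \<le> c"
  hence cn: "card S \<le> n" using c by simp
  obtain h where h: "bij_betw h {0..<card S} S" using ex_bij_betw_nat_finite[OF S(1)] by blast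
  have hS: "h i \<in> S" if "i < card S" for i using bij_betwE[OF h] that by simp
  \<comment> \<open>The identity serves as a default beyond the generators, since there may be fewer
    than \<open>n\<close> of them.\<close>
  have "\<exists>f. f \<in> F \<and> (i < card S --> cl f = h i)" for i
  proof (cases "i < card S")
   case True
   hence hf: "h i \<in> full_group M E" using hS S(2) by auto
   hence "h i \<in> carrier (Aut M)" by (simp add: full_group_def)
   then obtain f where f: "f \<in> mpa" "h i = cl f" using cl_surj by blast
   hence "f \<in> F" using hf cl_full[OF f(1)] by (simp add: F)
   thus ?thesis using f by auto
  next
   case False
   have "AE x in M. (x, id x) \<in> E"
    using E by (intro AE_I2) (auto simp: equiv_def refl_on_def)
   hence "id \<in> F" using id_mpa(1) by (simp only: F mem_Collect_eq simp_thms)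
   thus ?thesis using False by blast
  qed
  then obtain f where f: "\<And>i. f i \<in> F" "\<And>i. i < card S ==> cl (f i) = h i" by metis
  have fm: "f i \<in> mpa" for i using f(1)[of i] by (simp add: F)
  have wm: "evw f w \<in> mpa" for w by (rule evw_mpa) (rule fm)
  have gen: "\<exists>w. fst ` set w \<subseteq> {..<n} \<and> a = cl (evw f w)" if "a \<in> generate ?A S" for a
   using that
  proof induction
   case one
   have "\<one>\<^bsub>?A\<^esub> = \<one>\<^bsub>Aut M\<^esub>" by simp
   also have "... = cl (evw f [])" by (simp only: evw_simps cl_id)
   finally have "\<one>\<^bsub>?A\<^esub> = cl (evw f [])" .
   moreover have "fst ` set [] \<subseteq> {..<n}" by simp
   ultimately show ?case by blast
  next
   case (incl a)
   then obtain i where i: "i < card S" "a = h i" using h by (metis atLeastLessThan_iff bij_betw_def imageE)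
   hence "a = cl (evw f [(i, True)])" using f(2) by (simp add: evl_def)
   thus ?case using i cn by (intro exI[of _ "[(i, True)]"]) auto
  next
   case (inv a)
   then obtain i where i: "i < card S" "a = h i" using h by (metis atLeastLessThan_iff bij_betw_def imageE)
   have "m_inv ?A a = m_inv (Aut M) a" using inv S(2) by (intro A.m_inv_consistent[OF sg]) auto
   hence "m_inv ?A a = cl (inv (f i))" using i f(2) cl_inv[OF fm[of i]] by simp
   hence "m_inv ?A a = cl (evw f [(i, False)])" by (simp add: evl_def)
   thus ?case using i cn by (intro exI[of _ "[(i, False)]"]) auto
  next
   case (eng a b)
   then obtain v w where v: "fst ` set v \<subseteq> {..<n}" "a = cl (evw f v)" and w: "fst ` set w \<subseteq> {..<n}" "b = cl (evw f w)"
    by blast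
   have "a \<otimes>\<^bsub>?A\<^esub> b = cl (evw f (v @ w))" using cl_mult[OF wm wm] v w by (simp add: evw_append)
   thus ?case using v(1) w(1) by (intro exI[of _ "v @ w"]) auto
  qed
  show False
  proof (rule no[of f, OF f(1)])
   fix g e assume g: "g \<in> F" and e: "(e::real) > 0"
   have gm: "g \<in> mpa" using g by (simp add: F)
   have "cl g \<in> full_group M E" using g cl_full[OF gm] by (simp add: F)
   hence "cl g \<in> subtopology (uniform_topology M) (full_group M E) closure_of generate ?A S"
    unfolding d by (auto simp: uniform_topology_def D.topspace_mtopology full_group_def)
   hence "cl g \<in> D.mtopology closure_of generate ?A S"
    unfolding uniform_topology_def by (rule subsetD[OF closure_of_subtopology_subset])
   then obtain y where y: "y \<in> generate ?A S" "y \<in> D.mball (cl g) e" using e unfolding D.metric_closure_of by blast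
   obtain w where w: "fst ` set w \<subseteq> {..<n}" "y = cl (evw f w)" using gen[OF y(1)] by blast
   have "prob {x. g x ~= evw f w x} < e" using y(2) w(2) cl_dist[OF sb gm wm] by simp
   thus "\<exists>w. fst ` set w \<subseteq> {..<n} \<and> prob {x. g x ~= evw f w x} < e" using w(1) by blast
  qed
 qed
qed

end

section \<open>Leverage scores\<close>

text \<open>A sum over the whole type that is meaningful for finite support; it is 0 by convention
  if the support is infinite.\<close>

definition fsum :: "('i => real) => real" where
 "fsum f = sum f {a. f a ~= 0}"

definition fs :: "('i => real) => bool" where
 "fs v \<longleftrightarrow> finite {a. v a ~= 0}"

definition ip :: "('i => real) => ('i => real) => real" where
 "ip v w = fsum (\<lambda>a. v a * w a)"

definition mv :: "('p => 'q => real) => ('q => real) => 'p => real" where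
 "mv K v p = fsum (\<lambda>q. K p q * v q)"

lemma fsum_superset:
 assumes "finite A" "\<And>a. f a ~= 0 ==> a \<in> A" shows "fsum f = sum f A"
 unfolding fsum_def using assms by (intro sum.mono_neutral_left) auto

lemma fsum_reindex: "bij l ==> fsum (\<lambda>a. f (l a)) = fsum f"
proof -
 assume l: "bij l"
 have "bij_betw l {a. f (l a) ~= 0} {a. f a ~= 0}"
 proof (rule bij_betw_imageI)
  show "inj_on l {a. f (l a) ~= 0}" using l by (meson bij_def inj_on_subset subset_UNIV)
  show "l ` {a. f (l a) ~= 0} = {a. f a ~= 0}"
  proof
   show "{a. f a ~= 0} \<subseteq> l ` {a. f (l a) ~= 0}"
   proof
    fix a assume a: "a \<in> {a. f a ~= 0}"
    obtain b where "a = l b" using l by (metis bij_pointE)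
    thus "a \<in> l ` {a. f (l a) ~= 0}" using a by blast
   qed
  qed blast
 qed
 thus ?thesis unfolding fsum_def by (rule sum.reindex_bij_betw)
qed

lemma ip_sum_left:
 assumes f: "\<And>k. k \<in> A ==> fs (f k)" and A: "finite A"
 shows "ip (\<lambda>a. \<Sum>k\<in>A. f k a) w = (\<Sum>k\<in>A. ip (f k) w)"
proof -
 let ?X = "\<Union>k\<in>A. {a. f k a ~= 0}"
 have X: "finite ?X" using f A by (auto simp: fs_def)
 have "ip (\<lambda>a. \<Sum>k\<in>A. f k a) w = (\<Sum>a\<in>?X. (\<Sum>k\<in>A. f k a) * w a)"
  unfolding ip_def
 proof (rule fsum_superset[OF X])
  fix a assume "(\<Sum>k\<in>A. f k a) * w a ~= 0"
  hence "(\<Sum>k\<in>A. f k a) ~= 0" by simp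
  then obtain k where "k \<in> A" "f k a ~= 0" by (meson sum.neutral)
  thus "a \<in> ?X" by blast
 qed
 also have "... = (\<Sum>k\<in>A. \<Sum>a\<in>?X. f k a * w a)" unfolding sum_distrib_right by (rule sum.swap)
 also have "... = (\<Sum>k\<in>A. ip (f k) w)"
  unfolding ip_def by (intro sum.cong refl fsum_superset[symmetric, OF X]) auto
 finally show ?thesis .
qed

lemma ip_commute: "ip v w = ip w v"
 by (simp add: ip_def mult.commute)

lemma fs_sum: "(\<And>k. k \<in> A ==> fs (f k)) ==> finite A ==> fs (\<lambda>a. \<Sum>k\<in>A. f k a)"
proof -
 assume f: "\<And>k. k \<in> A ==> fs (f k)" and A: "finite A"
 have "{a. (\<Sum>k\<in>A. f k a) ~= 0} \<subseteq> (\<Union>k\<in>A. {a. f k a ~= 0})"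
 proof
  fix a assume "a \<in> {a. (\<Sum>k\<in>A. f k a) ~= 0}"
  then obtain k where "k \<in> A" "f k a ~= 0" by (metis (mono_tags, lifting) mem_Collect_eq sum.neutral)
  thus "a \<in> (\<Union>k\<in>A. {a. f k a ~= 0})" by blast
 qed
 thus ?thesis unfolding fs_def by (rule finite_subset) (use f A in \<open>auto simp: fs_def\<close>)
qed

lemma fs_diff: "fs v ==> fs w ==> fs (\<lambda>a. v a - c * w a)"
 unfolding fs_def by (rule finite_subset[of _ "{a. v a ~= 0} \<union> {a. w a ~= 0}"]) auto

lemma ip_diff_left:
 assumes "fs v" "fs w" shows "ip (\<lambda>a. v a - c * w a) u = ip v u - c * ip w u"
proof -
 let ?X = "{a. v a ~= 0} \<union> {a. w a ~= 0}"
 have X: "finite ?X" using assms by (auto simp: fs_def)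
 have "ip (\<lambda>a. v a - c * w a) u = (\<Sum>a\<in>?X. (v a - c * w a) * u a)"
  unfolding ip_def by (rule fsum_superset[OF X]) auto
 also have "... = (\<Sum>a\<in>?X. v a * u a) - c * (\<Sum>a\<in>?X. w a * u a)"
  by (simp add: algebra_simps sum_subtractf sum_distrib_left)
 also have "(\<Sum>a\<in>?X. v a * u a) = ip v u" unfolding ip_def by (rule fsum_superset[symmetric, OF X]) auto
 also have "(\<Sum>a\<in>?X. w a * u a) = ip w u" unfolding ip_def by (rule fsum_superset[symmetric, OF X]) auto
 finally show ?thesis .
qed

lemma ip_nonneg: "0 \<le> ip v v"
 unfolding ip_def fsum_def by (rule sum_nonneg) simp

lemma ip_point: "fs v ==> (v a)\<^sup>2 \<le> ip v v"
proof (cases "v a = 0")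
 case False
 assume "fs v"
 hence "ip v v = (\<Sum>b\<in>{a. v a ~= 0}. v b * v b)" unfolding ip_def fs_def by (intro fsum_superset) auto
 moreover have "v a * v a \<le> (\<Sum>b\<in>{a. v a ~= 0}. v b * v b)"
  using False \<open>fs v\<close> by (intro member_le_sum) (auto simp: fs_def)
 ultimately show ?thesis by (simp add: power2_eq_square)
qed (simp add: ip_nonneg)

lemma ip_CS:
 assumes "fs v" "fs w" shows "(ip v w)\<^sup>2 \<le> ip v v * ip w w"
proof -
 let ?X = "{a. v a ~= 0} \<union> {a. w a ~= 0}"
 have X: "finite ?X" using assms by (auto simp: fs_def)
 have e: "ip v w = (\<Sum>a\<in>?X. v a * w a)" "ip v v = (\<Sum>a\<in>?X. (v a)\<^sup>2)" "ip w w = (\<Sum>a\<in>?X. (w a)\<^sup>2)"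
  unfolding ip_def power2_eq_square by (rule fsum_superset[OF X]; auto)+
 show ?thesis unfolding e by (rule Cauchy_Schwarz_ineq_sum)
qed

definition dl :: "'t => 't => real" where
 "dl t s = (if s = t then 1 else 0)"

lemma fs_dl: "fs (dl t)" unfolding fs_def dl_def by simp

lemma ip_dl: "ip v (dl t) = v t"
proof -
 have "ip v (dl t) = (\<Sum>a\<in>{t}. v a * dl t a)" unfolding ip_def by (rule fsum_superset) (auto simp: dl_def split: if_splits)
 thus ?thesis by (simp add: dl_def)
qed

lemma ip_dl_dl: "ip (dl t) (dl t) = 1"
 using ip_dl[of "dl t" t] by (simp add: dl_def)

lemma mv_ip: "mv K v p = ip (K p) v"
 by (simp add: mv_def ip_def)

lemma fs_mv: "fs v ==> (\<And>q. finite {p. K p q ~= 0}) ==> fs (mv K v)"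
proof -
 assume v: "fs v" and K: "\<And>q. finite {p. K p q ~= 0}"
 have "{p. mv K v p ~= 0} \<subseteq> (\<Union>q\<in>{q. v q ~= 0}. {p. K p q ~= 0})"
 proof
  fix p assume "p \<in> {p. mv K v p ~= 0}"
  then obtain q where "K p q * v q ~= 0" unfolding mv_def fsum_def by (metis (mono_tags, lifting) mem_Collect_eq sum.neutral)
  thus "p \<in> (\<Union>q\<in>{q. v q ~= 0}. {p. K p q ~= 0})" by auto
 qed
 thus ?thesis unfolding fs_def by (rule finite_subset) (use v K in \<open>auto simp: fs_def\<close>)
qed

lemma ip_mv:
 assumes v: "fs v" and z: "fs z"
 shows "ip (mv K v) z = ip v (mv (\<lambda>q p. K p q) z)"
proof -
 let ?V = "{a. v a ~= 0}" and ?Z = "{a. z a ~= 0}"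
 have f: "finite ?V" "finite ?Z" using v z by (auto simp: fs_def)
 have "ip (mv K v) z = (\<Sum>p\<in>?Z. mv K v p * z p)" unfolding ip_def by (rule fsum_superset[OF f(2)]) auto
 also have "... = (\<Sum>p\<in>?Z. \<Sum>q\<in>?V. K p q * v q * z p)"
 proof (rule sum.cong[OF refl])
  fix p
  have "mv K v p = (\<Sum>q\<in>?V. K p q * v q)" unfolding mv_def by (rule fsum_superset[OF f(1)]) auto
  thus "mv K v p * z p = (\<Sum>q\<in>?V. K p q * v q * z p)" by (simp add: sum_distrib_right)
 qed
 also have "... = (\<Sum>q\<in>?V. \<Sum>p\<in>?Z. K p q * v q * z p)" by (rule sum.swap)
 also have "... = (\<Sum>q\<in>?V. v q * mv (\<lambda>q p. K p q) z q)"
 proof (rule sum.cong[OF refl])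
  fix q
  have "mv (\<lambda>q p. K p q) z q = (\<Sum>p\<in>?Z. K p q * z p)" unfolding mv_def by (rule fsum_superset[OF f(2)]) auto
  thus "(\<Sum>p\<in>?Z. K p q * v q * z p) = v q * mv (\<lambda>q p. K p q) z q"
   by (simp add: sum_distrib_left algebra_simps)
 qed
 also have "... = ip v (mv (\<lambda>q p. K p q) z)" unfolding ip_def by (rule fsum_superset[symmetric, OF f(1)]) auto
 finally show ?thesis .
qed

text \<open>Schur's test: Cauchy-Schwarz in each row, which has at most \<open>r\<close> entries of
  size at most \<open>c\<close>, and then a count of the at most \<open>r\<close> rows in which each
  coordinate occurs.\<close>

lemma schur_bound:
 assumes row: "\<And>p. finite {q. K p q ~= 0} \<and> card {q. K p q ~= 0} \<le> r"
  and col: "\<And>q. finite {p. K p q ~= 0} \<and> card {p. K p q ~= 0} \<le> r"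
  and c: "\<And>p q. \<bar>K p q\<bar> \<le> c" and v: "fs v"
 shows "ip (mv K v) (mv K v) \<le> (real r * c)\<^sup>2 * ip v v"
proof -
 let ?V = "{a. v a ~= 0}"
 let ?P = "\<Union>q\<in>?V. {p. K p q ~= 0}"
 have fV: "finite ?V" using v by (simp add: fs_def)
 have fP: "finite ?P" using fV col by blast
 have c0: "0 \<le> c" using c[of undefined undefined] by linarith
 have "ip (mv K v) (mv K v) = (\<Sum>p\<in>?P. (mv K v p)\<^sup>2)"
  unfolding ip_def power2_eq_square
 proof (rule fsum_superset[OF fP])
  fix p assume "mv K v p * mv K v p ~= 0"
  then obtain q where "K p q * v q ~= 0" unfolding mv_def fsum_def by (metis (mono_tags, lifting) mem_Collect_eq mult_zero_left sum.neutral)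
  thus "p \<in> ?P" by auto
 qed
 also have "... \<le> (\<Sum>p\<in>?P. \<Sum>q\<in>?V. if K p q = 0 then 0 else real r * c\<^sup>2 * (v q)\<^sup>2)"
 proof (rule sum_mono)
  fix p
  let ?Q = "{q. K p q ~= 0}"
  have Q: "finite ?Q" "card ?Q \<le> r" using row by auto
  have "mv K v p = (\<Sum>q\<in>?Q. K p q * v q)" unfolding mv_def by (rule fsum_superset[OF Q(1)]) auto
  hence "(mv K v p)\<^sup>2 \<le> (\<Sum>q\<in>?Q. (K p q)\<^sup>2) * (\<Sum>q\<in>?Q. (v q)\<^sup>2)" using Cauchy_Schwarz_ineq_sum by metis
  also have "... \<le> (real r * c\<^sup>2) * (\<Sum>q\<in>?Q. (v q)\<^sup>2)"
  proof (rule mult_right_mono)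
   have "(\<Sum>q\<in>?Q. (K p q)\<^sup>2) \<le> (\<Sum>q\<in>?Q. c\<^sup>2)"
    using c by (intro sum_mono) (metis abs_le_square_iff abs_of_nonneg c0)
   also have "... \<le> real r * c\<^sup>2" using Q(2) by (simp add: mult_right_mono)
   finally show "(\<Sum>q\<in>?Q. (K p q)\<^sup>2) \<le> real r * c\<^sup>2" .
  qed (simp add: sum_nonneg)
  also have "(\<Sum>q\<in>?Q. (v q)\<^sup>2) = (\<Sum>q\<in>?V. if K p q = 0 then 0 else (v q)\<^sup>2)"
  proof -
   have "(\<Sum>q\<in>?Q. (v q)\<^sup>2) = (\<Sum>q\<in>?Q \<inter> ?V. (v q)\<^sup>2)" using Q(1) by (intro sum.mono_neutral_right) auto
   also have "... = (\<Sum>q\<in>?Q \<inter> ?V. if K p q = 0 then 0 else (v q)\<^sup>2)" by (rule sum.cong) auto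
   also have "... = (\<Sum>q\<in>?V. if K p q = 0 then 0 else (v q)\<^sup>2)" using fV by (intro sum.mono_neutral_left) auto
   finally show ?thesis .
  qed
  also have "(real r * c\<^sup>2) * ... = (\<Sum>q\<in>?V. if K p q = 0 then 0 else real r * c\<^sup>2 * (v q)\<^sup>2)"
   unfolding sum_distrib_left by (rule sum.cong) auto
  finally show "(mv K v p)\<^sup>2 \<le> (\<Sum>q\<in>?V. if K p q = 0 then 0 else real r * c\<^sup>2 * (v q)\<^sup>2)" .
 qed
 also have "... = (\<Sum>q\<in>?V. \<Sum>p\<in>?P. if K p q = 0 then 0 else real r * c\<^sup>2 * (v q)\<^sup>2)" by (rule sum.swap)
 also have "... \<le> (\<Sum>q\<in>?V. (real r * c)\<^sup>2 * (v q)\<^sup>2)"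
 proof (rule sum_mono)
  fix q
  have "(\<Sum>p\<in>?P. if K p q = 0 then 0 else real r * c\<^sup>2 * (v q)\<^sup>2) = (\<Sum>p\<in>?P \<inter> {p. K p q ~= 0}. real r * c\<^sup>2 * (v q)\<^sup>2)"
   using fP by (simp add: sum.If_cases Collect_neg_eq)
  also have "... = real (card (?P \<inter> {p. K p q ~= 0})) * (real r * c\<^sup>2 * (v q)\<^sup>2)" by simp
  also have "... \<le> real r * (real r * c\<^sup>2 * (v q)\<^sup>2)"
  proof (rule mult_right_mono)
   have "card (?P \<inter> {p. K p q ~= 0}) \<le> card {p. K p q ~= 0}" using col by (intro card_mono) auto
   thus "real (card (?P \<inter> {p. K p q ~= 0})) \<le> real r" using col[of q] by linarith
  qed simp
  finally show "(\<Sum>p\<in>?P. if K p q = 0 then 0 else real r * c\<^sup>2 * (v q)\<^sup>2) \<le> (real r * c)\<^sup>2 * (v q)\<^sup>2"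
   by (simp add: power2_eq_square algebra_simps)
 qed
 also have "... = (real r * c)\<^sup>2 * ip v v"
 proof -
  have "ip v v = (\<Sum>q\<in>?V. (v q)\<^sup>2)" unfolding ip_def power2_eq_square by (rule fsum_superset[OF fV]) auto
  thus ?thesis by (simp add: sum_distrib_left)
 qed
 finally show ?thesis .
qed

text \<open>The operator \<open>1 - (1 / m) C\<^sup>T C\<close>, for which the powers form the
  Neumann series of the inverse of \<open>C\<^sup>T C\<close>, up to the factor
  \<open>1 / m\<close>.\<close>

definition nm :: "('g => 't => real) => real => ('t => real) => 't => real" where
 "nm C m v t = v t - (1 / m) * mv (\<lambda>t g. C g t) (mv C v) t"

text \<open>The entrywise product of \<open>C\<close> with \<open>C\<close> times the truncated
  series. Its row sums are the diagonal entries of the truncated projection onto the range of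
  \<open>C\<close>, the leverage scores. Its column sums are the diagonal entries of
  \<open>C\<^sup>T C\<close> times its approximate inverse, hence close to 1.\<close>

definition kmat :: "('g => 't => real) => real => nat => 'g => 't => real" where
 "kmat C m K g t = (\<Sum>k<K. (1 / m) * (C g t * mv C ((nm C m ^^ k) (dl t)) g))"

lemma mv_reindex: "bij \<tau> ==> mv (\<lambda>g t. C (\<sigma> g) (\<tau> t)) (\<lambda>t. v (\<tau> t)) g = mv C v (\<sigma> g)"
 unfolding mv_def using fsum_reindex[of \<tau> "\<lambda>t. C (\<sigma> g) t * v t"] by simp

text \<open>The construction refers to no order or coordinates of the index sets, so it commutes
  with relabelling; this will give equivariance.\<close>

lemma kmat_reindex:
 assumes s: "bij \<sigma>" and t: "bij \<tau>"
 shows "kmat (\<lambda>g t. C (\<sigma> g) (\<tau> t)) m K g t = kmat C m K (\<sigma> g) (\<tau> t)"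
proof -
 let ?C = "\<lambda>g t. C (\<sigma> g) (\<tau> t)"
 have step: "nm ?C m (\<lambda>t. v (\<tau> t)) = (\<lambda>t. nm C m v (\<tau> t))" for v
 proof
  fix t'
  have "mv ?C (\<lambda>t. v (\<tau> t)) = (\<lambda>g. mv C v (\<sigma> g))" by (rule ext) (rule mv_reindex[OF t])
  thus "nm ?C m (\<lambda>t. v (\<tau> t)) t' = nm C m v (\<tau> t')"
   using mv_reindex[OF s, of "\<lambda>t g. C g t" \<tau> "mv C v" t'] by (simp add: nm_def)
 qed
 have "(nm ?C m ^^ k) (dl t) = (\<lambda>s. (nm C m ^^ k) (dl (\<tau> t)) (\<tau> s))" for k
 proof (induction k)
  case 0
  show ?case using t by (auto simp: dl_def fun_eq_iff bij_def inj_eq)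
 next
  case (Suc k)
  show ?case using step[of "(nm C m ^^ k) (dl (\<tau> t))"] Suc by simp
 qed
 thus ?thesis unfolding kmat_def using mv_reindex[OF t, of C \<sigma>] by simp
qed

text \<open>The spectrum of \<open>C\<^sup>T C\<close> on vectors supported in \<open>T\<close> lies
  between \<open>1 / b\<close> and \<open>m\<close>; both bounds are stated through finitely
  supported vectors.\<close>

locale gram =
 fixes C :: "'g => 't => real" and m b :: real and T :: "'t set"
 assumes row: "\<And>g. finite {t. C g t ~= 0}" and col: "\<And>t. finite {g. C g t ~= 0}"
  and m: "m \<ge> 1" and b: "b \<ge> 1"
  and upper: "\<And>v. fs v ==> ip (mv C v) (mv C v) \<le> m * ip v v"
  and lower: "\<And>v. fs v ==> (\<And>t. v t ~= 0 ==> t \<in> T) ==> ip v v \<le> b * ip (mv C v) (mv C v)"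
  and supp: "\<And>g t. C g t ~= 0 ==> t \<in> T"
begin

abbreviation S where "S \<equiv> nm C m"

lemma fsC: "fs v ==> fs (mv C v)"
 using col by (rule fs_mv[rotated])

lemma fsN: "fs v ==> fs (mv (\<lambda>t g. C g t) (mv C v))"
 using fs_mv[OF fsC, of v "\<lambda>t g. C g t"] row by blast

lemma fsS: "fs v ==> fs (S v)"
proof -
 assume v: "fs v"
 have "S v = (\<lambda>t. v t - (1 / m) * mv (\<lambda>t g. C g t) (mv C v) t)" by (simp add: nm_def fun_eq_iff)
 thus ?thesis using fs_diff[OF v fsN[OF v], of "1 / m"] by simp
qed

lemma fsSk: "fs v ==> fs ((S ^^ k) v)"
 by (induction k) (simp_all add: fsS)

lemma S_ip: "fs v ==> fs w ==> ip (S v) w = ip v w - (1 / m) * ip (mv C v) (mv C w)"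
proof -
 assume v: "fs v" and w: "fs w"
 have "ip (S v) w = ip (\<lambda>t. v t - (1 / m) * mv (\<lambda>t g. C g t) (mv C v) t) w" by (simp add: nm_def[abs_def])
 also have "... = ip v w - (1 / m) * ip (mv (\<lambda>t g. C g t) (mv C v)) w" by (rule ip_diff_left[OF v fsN[OF v]])
 also have "ip (mv (\<lambda>t g. C g t) (mv C v)) w = ip (mv C v) (mv C w)" by (rule ip_mv[OF fsC[OF v] w])
 finally show ?thesis .
qed

lemma S_sym: "fs v ==> fs w ==> ip (S v) w = ip v (S w)"
 using S_ip[of v w] S_ip[of w v] ip_commute[of v w] ip_commute[of "mv C v" "mv C w"] ip_commute[of v "S w"] by simp

lemma Sk_sym: "fs v ==> fs w ==> ip ((S ^^ k) v) w = ip v ((S ^^ k) w)"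
proof (induction k arbitrary: w)
 case (Suc k)
 have "ip ((S ^^ Suc k) v) w = ip ((S ^^ k) v) (S w)" using S_sym[OF fsSk[OF Suc.prems(1)] Suc.prems(2)] by simp
 also have "... = ip v ((S ^^ k) (S w))" by (rule Suc.IH[OF Suc.prems(1) fsS[OF Suc.prems(2)]])
 finally show ?case by (simp add: funpow_swap1)
qed simp

text \<open>Cauchy-Schwarz and \<open>upper\<close> bound the squared length of
  \<open>C\<^sup>T C v\<close> by \<open>m\<close> times that of \<open>C v\<close>. In the
  expansion of the square this leaves one of the two negative terms intact.\<close>

lemma S_contract: "fs v ==> ip (S v) (S v) \<le> ip v v - (1 / m) * ip (mv C v) (mv C v)"
proof -
 assume v: "fs v"
 let ?n = "mv (\<lambda>t g. C g t) (mv C v)"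
 let ?a = "ip ?n ?n" and ?c = "ip (mv C v) (mv C v)"
 have e: "ip ?n w = ip (mv C v) (mv C w)" if "fs w" for w by (rule ip_mv[OF fsC[OF v] that])
 have "?a\<^sup>2 = (ip (mv C v) (mv C ?n))\<^sup>2" using e[OF fsN[OF v]] by simp
 also have "... \<le> ?c * ip (mv C ?n) (mv C ?n)" by (rule ip_CS[OF fsC[OF v] fsC[OF fsN[OF v]]])
 also have "... \<le> ?c * (m * ?a)" by (intro mult_left_mono upper fsN v ip_nonneg)
 finally have "?a * ?a \<le> (m * ?c) * ?a" by (simp add: power2_eq_square algebra_simps)
 hence a: "?a \<le> m * ?c"
  using m ip_nonneg[of ?n] ip_nonneg[of "mv C v"] by (cases "?a = 0") (auto simp: mult_le_cancel_right)
 have "ip (S v) (S v) = ip v (S v) - (1 / m) * ip (mv C v) (mv C (S v))" by (rule S_ip[OF v fsS[OF v]])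
 also have "ip v (S v) = ip v v - (1 / m) * ?c" using S_ip[OF v v] ip_commute[of v "S v"] by simp
 also have "ip (mv C v) (mv C (S v)) = ip ?n (S v)" using e[OF fsS[OF v]] by simp
 also have "... = ip (S v) ?n" by (rule ip_commute)
 also have "... = ip v ?n - (1 / m) * ?a" using S_ip[OF v fsN[OF v]] e[OF fsN[OF v]] by simp
 also have "ip v ?n = ?c" using e[OF v] ip_commute[of v ?n] by simp
 finally have eq: "ip (S v) (S v) = ip v v - (1 / m) * ?c - (1 / m) * (?c - (1 / m) * ?a)" .
 have "(1 / m) * ?a \<le> ?c" using a m by (simp add: field_simps)
 hence "0 \<le> (1 / m) * (?c - (1 / m) * ?a)" using m by simp
 thus ?thesis using eq by linarith
qed

lemma S_contract': "fs v ==> ip (S v) (S v) \<le> ip v v"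
proof -
 assume v: "fs v"
 have "0 \<le> (1 / m) * ip (mv C v) (mv C v)" using m ip_nonneg[of "mv C v"] by simp
 thus ?thesis using S_contract[OF v] by linarith
qed

lemma Sk_contract: "fs v ==> ip ((S ^^ k) v) ((S ^^ k) v) \<le> ip v v"
 by (induction k) (use S_contract' fsSk in \<open>auto intro: order_trans\<close>)

text \<open>An even power is the square of a symmetric operator. For an odd power one factor is left
  in the middle, and it is positive by \<open>upper\<close>.\<close>

lemma Sk_pos:
 assumes v: "fs v" shows "0 \<le> ip v ((S ^^ k) v)"
proof (cases "even k")
 case True
 then obtain l where l: "k = l + l" by (metis evenE mult_2)
 have "ip v ((S ^^ k) v) = ip ((S ^^ l) v) ((S ^^ l) v)"
  using Sk_sym[OF v fsSk[OF v], of l l] by (simp add: l funpow_add)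
 thus ?thesis using ip_nonneg[of "(S ^^ l) v"] by simp
next
 case False
 then obtain l where l: "k = l + Suc l" by (metis oddE mult_2 add_Suc_right Suc_eq_plus1)
 let ?x = "(S ^^ l) v"
 have x: "fs ?x" by (rule fsSk[OF v])
 have "ip v ((S ^^ k) v) = ip ?x ((S ^^ Suc l) v)"
  using Sk_sym[OF v fsSk[OF v, of "Suc l"], of l] by (simp only: l funpow_add comp_apply)
 also have "... = ip (S ?x) ?x" using ip_commute[of ?x "S ?x"] by simp
 also have "... = ip ?x ?x - (1 / m) * ip (mv C ?x) (mv C ?x)" by (rule S_ip[OF x x])
 finally have e: "ip v ((S ^^ k) v) = ip ?x ?x - (1 / m) * ip (mv C ?x) (mv C ?x)" .
 have "(1 / m) * ip (mv C ?x) (mv C ?x) \<le> ip ?x ?x" using upper[OF x] m by (simp add: field_simps)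
 thus ?thesis using e by linarith
qed

lemma C_Sk: "fs v ==> fs w ==> (1 / m) * ip (mv C v) (mv C ((S ^^ k) w)) = ip v ((S ^^ k) w) - ip v ((S ^^ Suc k) w)"
proof -
 assume v: "fs v" and w: "fs w"
 have "ip v (S ((S ^^ k) w)) = ip (S v) ((S ^^ k) w)" by (rule S_sym[OF v fsSk[OF w], symmetric])
 also have "... = ip v ((S ^^ k) w) - (1 / m) * ip (mv C v) (mv C ((S ^^ k) w))" by (rule S_ip[OF v fsSk[OF w]])
 finally show ?thesis by simp
qed

lemma Sk_supp:
 assumes v: "fs v" "\<And>t. v t ~= 0 ==> t \<in> T" shows "(S ^^ k) v t ~= 0 ==> t \<in> T"
proof (induction k arbitrary: t)
 case (Suc k)
 show ?case
 proof (rule ccontr)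
  assume t: "t \<notin> T"
  hence "C g t = 0" for g using supp by blast
  hence "mv (\<lambda>t g. C g t) (mv C ((S ^^ k) v)) t = 0" by (simp add: mv_def fsum_def)
  hence "(S ^^ Suc k) v t = (S ^^ k) v t" by (simp add: nm_def)
  thus False using Suc t by auto
 qed
qed (use v in auto)

text \<open>The powers keep the support inside \<open>T\<close>, where \<open>lower\<close> turns
  the loss in \<open>S_contract\<close> into a fixed factor.\<close>

lemma Sk_decay:
 assumes v: "fs v" "\<And>t. v t ~= 0 ==> t \<in> T"
 shows "ip ((S ^^ k) v) ((S ^^ k) v) \<le> (1 - 1 / (b * m)) ^ k * ip v v"
proof (induction k)
 case (Suc k)
 let ?x = "(S ^^ k) v"
 have x: "fs ?x" by (rule fsSk[OF v(1)])
 have bm: "1 / (b * m) \<le> 1" using b m mult_mono[of 1 b 1 m] by simp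
 have "ip ?x ?x \<le> b * ip (mv C ?x) (mv C ?x)" by (rule lower[OF x]) (rule Sk_supp[OF v])
 hence "(1 / (b * m)) * ip ?x ?x \<le> (1 / m) * ip (mv C ?x) (mv C ?x)" using b m by (simp add: field_simps)
 hence "ip (S ?x) (S ?x) \<le> (1 - 1 / (b * m)) * ip ?x ?x" using S_contract[OF x] by (simp add: algebra_simps)
 also have "... \<le> (1 - 1 / (b * m)) * ((1 - 1 / (b * m)) ^ k * ip v v)"
  using Suc bm by (intro mult_left_mono) auto
 finally show ?case by (simp add: mult.assoc)
qed simp

lemma mv_dl: "mv C (dl t) = (\<lambda>g. C g t)"
 by (simp add: mv_ip ip_dl fun_eq_iff)

text \<open>The sum telescopes because \<open>(1 / m) C\<^sup>T C\<close> times a power of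
  \<open>S\<close> is the difference of two successive powers. The even number \<open>2 * l\<close>
  of terms makes the remainder a squared length, to which the decay applies.\<close>

lemma column_sum:
 assumes t: "t \<in> T"
 shows "1 - (1 - 1 / (b * m)) ^ l \<le> fsum (\<lambda>g. kmat C m (2 * l) g t)"
proof -
 let ?x = "\<lambda>k. ip (dl t) ((S ^^ k) (dl t))"
 have fin: "finite {g. C g t ~= 0}" by (rule col)
 have "fsum (\<lambda>g. kmat C m (2 * l) g t) = (\<Sum>g\<in>{g. C g t ~= 0}. kmat C m (2 * l) g t)"
  by (rule fsum_superset[OF fin]) (auto simp: kmat_def)
 also have "... = (\<Sum>k<2*l. (1 / m) * (\<Sum>g\<in>{g. C g t ~= 0}. C g t * mv C ((S ^^ k) (dl t)) g))"
  unfolding kmat_def sum_distrib_left by (rule sum.swap)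
 also have "... = (\<Sum>k<2*l. ?x k - ?x (Suc k))"
 proof (rule sum.cong[OF refl])
  fix k
  have "(\<Sum>g\<in>{g. C g t ~= 0}. C g t * mv C ((S ^^ k) (dl t)) g) = ip (mv C (dl t)) (mv C ((S ^^ k) (dl t)))"
   unfolding mv_dl ip_def by (rule fsum_superset[symmetric, OF fin]) auto
  thus "(1 / m) * (\<Sum>g\<in>{g. C g t ~= 0}. C g t * mv C ((S ^^ k) (dl t)) g) = ?x k - ?x (Suc k)"
   using C_Sk[OF fs_dl[of t] fs_dl[of t], of k] by simp
 qed
 also have "... = ?x 0 - ?x (2 * l)" by (rule sum_lessThan_telescope')
 also have "?x 0 = 1" by (simp add: ip_dl_dl)
 also have "?x (2 * l) = ip ((S ^^ l) (dl t)) ((S ^^ l) (dl t))"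
  using Sk_sym[OF fs_dl fsSk[OF fs_dl], of l t l t] by (simp add: mult_2 funpow_add)
 finally have e: "fsum (\<lambda>g. kmat C m (2 * l) g t) = 1 - ip ((S ^^ l) (dl t)) ((S ^^ l) (dl t))" .
 have "ip ((S ^^ l) (dl t)) ((S ^^ l) (dl t)) \<le> (1 - 1 / (b * m)) ^ l * ip (dl t) (dl t)"
  by (rule Sk_decay[OF fs_dl]) (use t in \<open>auto simp: dl_def split: if_splits\<close>)
 also have "ip (dl t) (dl t) = 1" by (simp add: ip_dl_dl)
 finally show ?thesis using e by simp
qed

text \<open>The row sum \<open>q\<close> is the entry at \<open>g\<close> of a vector of squared length at most \<open>q\<close>, so \<open>q\<^sup>2 \<le> q\<close>.\<close>

lemma row_sum: "fsum (\<lambda>t. kmat C m K g t) \<le> 1"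
proof -
 let ?u = "C g"
 have u: "fs ?u" using row by (simp add: fs_def)
 define s where "s k = ip ?u ((S ^^ k) ?u)" for k
 have s0: "0 \<le> s k" for k unfolding s_def by (rule Sk_pos[OF u])
 \<comment> \<open>The factor \<open>1 / m\<close> is left out here: \<open>z\<close> is the vector
   and \<open>q\<close> the row sum, both multiplied by \<open>m\<close>, so the estimate to be
   shown is \<open>q\<^sup>2 \<le> m * q\<close>.\<close>
 define z where "z = (\<lambda>h. \<Sum>k<K. mv C ((S ^^ k) ?u) h)"
 have fz: "fs (mv C ((S ^^ k) ?u))" for k by (intro fsC fsSk u)
 define q where "q = (\<Sum>k<K. s k)"
 have fin: "finite {t. C g t ~= 0}" by (rule row)
 have "fsum (\<lambda>t. kmat C m K g t) = (\<Sum>t\<in>{t. C g t ~= 0}. kmat C m K g t)"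
  by (rule fsum_superset[OF fin]) (auto simp: kmat_def)
 also have "... = (\<Sum>k<K. (1 / m) * (\<Sum>t\<in>{t. C g t ~= 0}. C g t * mv C ((S ^^ k) (dl t)) g))"
  unfolding kmat_def sum_distrib_left by (rule sum.swap)
 also have "... = (\<Sum>k<K. (1 / m) * s k)"
 proof (rule sum.cong[OF refl])
  fix k
  have "mv C ((S ^^ k) (dl t)) g = (S ^^ k) ?u t" for t
   using Sk_sym[OF u fs_dl, of k t] by (simp add: mv_ip ip_dl)
  hence "(\<Sum>t\<in>{t. C g t ~= 0}. C g t * mv C ((S ^^ k) (dl t)) g) = (\<Sum>t\<in>{t. C g t ~= 0}. C g t * (S ^^ k) ?u t)"
   by (simp only:)
  also have "... = s k" unfolding s_def ip_def by (rule fsum_superset[symmetric, OF fin]) auto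
  finally show "(1 / m) * (\<Sum>t\<in>{t. C g t ~= 0}. C g t * mv C ((S ^^ k) (dl t)) g) = (1 / m) * s k" by simp
 qed
 finally have e: "fsum (\<lambda>t. kmat C m K g t) = q / m" by (simp add: q_def sum_divide_distrib)
 have zg: "z g = q" by (simp add: z_def q_def s_def mv_ip)
 have "ip z z = (\<Sum>k<K. ip (mv C ((S ^^ k) ?u)) z)" unfolding z_def by (rule ip_sum_left) (use fz in auto)
 also have "... = (\<Sum>k<K. \<Sum>l<K. ip (mv C ((S ^^ l) ?u)) (mv C ((S ^^ k) ?u)))"
 proof (rule sum.cong[OF refl])
  fix k
  have "ip (mv C ((S ^^ k) ?u)) z = ip z (mv C ((S ^^ k) ?u))" by (rule ip_commute)
  also have "... = (\<Sum>l<K. ip (mv C ((S ^^ l) ?u)) (mv C ((S ^^ k) ?u)))" unfolding z_def by (rule ip_sum_left) (use fz in auto)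
  finally show "ip (mv C ((S ^^ k) ?u)) z = (\<Sum>l<K. ip (mv C ((S ^^ l) ?u)) (mv C ((S ^^ k) ?u)))" .
 qed
 \<comment> \<open>The inner product depends on \<open>l + k\<close> only, so summing over
   \<open>k\<close> telescopes, and the subtracted terms are nonnegative.\<close>
 also have "... = (\<Sum>k<K. \<Sum>l<K. m * (s (l + k) - s (l + Suc k)))"
 proof (intro sum.cong refl)
  fix k l
  have "(1 / m) * ip (mv C ((S ^^ l) ?u)) (mv C ((S ^^ k) ?u)) = s (l + k) - s (l + Suc k)"
   unfolding C_Sk[OF fsSk[OF u] u] s_def funpow_add comp_apply
   by (simp only: Sk_sym[OF u fsSk[OF u]])
  thus "ip (mv C ((S ^^ l) ?u)) (mv C ((S ^^ k) ?u)) = m * (s (l + k) - s (l + Suc k))" using m by (simp add: field_simps)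
 qed
 also have "... = (\<Sum>l<K. m * (\<Sum>k<K. s (l + k) - s (l + Suc k)))"
  unfolding sum_distrib_left by (rule sum.swap)
 also have "... = (\<Sum>l<K. m * (s l - s (l + K)))"
 proof -
  have "(\<Sum>k<K. s (l + k) - s (l + Suc k)) = s l - s (l + K)" for l
   using sum_lessThan_telescope'[of "\<lambda>k. s (l + k)" K] by simp
  thus ?thesis by simp
 qed
 also have "... \<le> (\<Sum>l<K. m * s l)" using s0 m by (intro sum_mono mult_left_mono) auto
 also have "... = m * q" by (simp add: q_def sum_distrib_left)
 finally have "ip z z \<le> m * q" .
 moreover have "fs z" unfolding z_def by (rule fs_sum) (use fz in auto)
 ultimately have "q\<^sup>2 \<le> m * q" using ip_point[of z g] zg by simp
 moreover have "0 \<le> q" unfolding q_def by (rule sum_nonneg) (rule s0)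
 ultimately have "q \<le> m" using m by (cases "q = 0") (auto simp: power2_eq_square mult_le_cancel_right)
 thus ?thesis using e m by simp
qed

text \<open>A crude bound, uniform when \<open>C\<close> is bounded, which makes the entries
  integrable; \<open>1 + m\<close> comes from
  \<open>\<bar>y\<bar> \<le> 1 + y\<^sup>2\<close>.\<close>

lemma kmat_bound: "\<bar>kmat C m K g t\<bar> \<le> real K * (\<bar>C g t\<bar> * (1 + m))"
proof -
 have "\<bar>mv C ((S ^^ k) (dl t)) g\<bar> \<le> 1 + m" for k
 proof -
  let ?y = "mv C ((S ^^ k) (dl t)) g"
  have "?y\<^sup>2 \<le> ip (mv C ((S ^^ k) (dl t))) (mv C ((S ^^ k) (dl t)))" by (intro ip_point fsC fsSk fs_dl)
  also have "... \<le> m * ip ((S ^^ k) (dl t)) ((S ^^ k) (dl t))" by (intro upper fsSk fs_dl)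
  also have "... \<le> m * ip (dl t) (dl t)" using m by (intro mult_left_mono Sk_contract fs_dl) auto
  also have "... = m" by (simp add: ip_dl_dl)
  finally have "?y\<^sup>2 \<le> m" .
  moreover have "\<bar>?y\<bar> \<le> 1 + ?y\<^sup>2"
   using zero_le_power2[of "\<bar>?y\<bar> - 1"] abs_ge_zero[of ?y] by (simp add: power2_eq_square algebra_simps abs_mult_self_eq) 
  ultimately show ?thesis by linarith
 qed
 hence bd: "\<bar>(1 / m) * (C g t * mv C ((S ^^ k) (dl t)) g)\<bar> \<le> \<bar>C g t\<bar> * (1 + m)" for k
 proof -
  have "\<bar>C g t * mv C ((S ^^ k) (dl t)) g\<bar> \<le> \<bar>C g t\<bar> * (1 + m)"
   unfolding abs_mult using \<open>\<And>k. \<bar>mv C ((S ^^ k) (dl t)) g\<bar> \<le> 1 + m\<close> by (intro mult_left_mono) auto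
  moreover have "\<bar>(1 / m) * y\<bar> \<le> \<bar>y\<bar>" for y
  proof -
   have "(1 / m) * \<bar>y\<bar> \<le> 1 * \<bar>y\<bar>" using m by (intro mult_right_mono) auto
   thus ?thesis using m by (simp add: abs_mult)
  qed
  ultimately show ?thesis using order_trans by blast
 qed
 have "\<bar>kmat C m K g t\<bar> \<le> (\<Sum>k<K. \<bar>(1 / m) * (C g t * mv C ((S ^^ k) (dl t)) g)\<bar>)"
  unfolding kmat_def by (rule sum_abs)
 also have "... \<le> (\<Sum>k<K. \<bar>C g t\<bar> * (1 + m))" by (rule sum_mono) (rule bd)
 finally show ?thesis by simp
qed

end

section \<open>Chains in the Cayley tree\<close>

abbreviation mul :: "letter list => letter list => letter list" where
 "mul \<equiv> foldr cancel_cons"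

abbreviation ginv :: "letter list => letter list" where
 "ginv u \<equiv> rev (map inv_letter u)"

text \<open>\<open>Th v\<close> is the signed chain of the geodesic from the identity to \<open>v\<close> in the Cayley tree, where
 \<open>(i, w)\<close> stands for the edge from \<open>w\<close> to its left translate by the \<open>i\<close>-th generator.\<close>

definition edge :: "letter => letter list => nat \<times> letter list => real" where
 "edge a v t = (if snd a then dl (fst a, v) t else - dl (fst a, cancel_cons a v) t)"

fun Th :: "letter list => nat \<times> letter list => real" where
 "Th [] t = 0"
| "Th (a # v) t = Th v t + edge a v t"

text \<open>If the letter cancels, the path backtracks along its last edge, and the two
  contributions of that edge have opposite signs.\<close>

lemma Th_cancel: "reduced_word v ==> Th (cancel_cons a v) t = Th v t + edge a v t"
proof (cases "v ~= [] \<and> hd v = inv_letter a")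
 case True
 assume r: "reduced_word v"
 obtain v' where v: "v = inv_letter a # v'" using True by (cases v) auto
 have c: "cancel_cons a v = v'" "cancel_cons (inv_letter a) v' = v"
  using r by (auto simp: v cancel_cons_def reduced_Cons)
 have "edge a v t + edge (inv_letter a) v' t = 0"
  using c by (auto simp: edge_def inv_letter_def)
 thus ?thesis using c(1) by (simp add: v)
qed (auto simp: cancel_cons_def)

text \<open>The geodesics to \<open>mul u h\<close> and to \<open>h\<close> differ by the path that
  \<open>u\<close> spells from \<open>h\<close>. So the difference is bounded by the length of
  \<open>u\<close> and lives near \<open>h\<close>, however long \<open>h\<close> is.\<close>

lemma Th_mul:
 assumes h: "reduced_word h"
 shows "\<bar>Th (mul u h) t - Th h t\<bar> \<le> length u"
  "Th (mul u h) t - Th h t ~= 0 ==> fst t \<in> fst ` set u \<and> (\<exists>q\<le>length u. snd t = mul (drop q u) h)"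
proof (induction u)
 case (Cons a u)
 have e: "Th (mul (a # u) h) t = Th (mul u h) t + edge a (mul u h) t"
  using Th_cancel[OF reduced_foldr[OF h]] by simp
 have e1: "\<bar>edge a (mul u h) t\<bar> \<le> 1" by (simp add: edge_def dl_def)
 { case 1 show ?case using Cons.IH(1) e e1 by simp }
 { case 2
  show ?case
  proof (cases "edge a (mul u h) t = 0")
   case True
   hence "Th (mul u h) t - Th h t ~= 0" using 2 e by simp
   then obtain q where q: "fst t \<in> fst ` set u" "q \<le> length u" "snd t = mul (drop q u) h" using Cons.IH(2) by blast
   hence "snd t = mul (drop (Suc q) (a # u)) h" "Suc q \<le> length (a # u)" by auto
   thus ?thesis using q(1) by (metis image_insert insertCI list.simps(15))
  next
   case False
   hence "t = (fst a, mul u h) \<or> t = (fst a, mul (a # u) h)" by (auto simp: edge_def dl_def split: if_splits)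
   hence t: "fst t = fst a" "snd t = mul (drop 1 (a # u)) h \<or> snd t = mul (drop 0 (a # u)) h" by auto
   have "\<exists>q\<le>length (a # u). snd t = mul (drop q (a # u)) h"
    using t(2) by (metis One_nat_def Suc_le_mono le0 list.size(4) add.right_neutral add_Suc_right)
   thus ?thesis using t(1) by simp
  qed }
qed simp_all

lemma reduced_drop: "reduced_word v ==> reduced_word (drop q v)"
proof (induction v arbitrary: q)
 case (Cons a v)
 thus ?case by (cases q) (auto simp: reduced_Cons)
qed simp

lemma fsum_measurable:
 fixes f :: "'a => 'i::countable => real"
 assumes f: "\<And>a. (\<lambda>x. f x a) \<in> borel_measurable M" and fin: "\<And>x. x \<in> space M ==> finite {a. f x a ~= 0}"
 shows "(\<lambda>x. fsum (f x)) \<in> borel_measurable M"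
proof (rule borel_measurable_LIMSEQ_real)
 let ?A = "\<lambda>N. {a::'i. to_nat a < N}"
 have fA: "finite (?A N)" for N
 proof -
  have "?A N = to_nat -` {..<N}" by auto
  thus ?thesis using finite_vimageI[OF finite_lessThan inj_to_nat] by metis
 qed
 show "(\<lambda>x. \<Sum>a\<in>?A N. f x a) \<in> borel_measurable M" for N by (rule borel_measurable_sum) (rule f)
 fix x assume x: "x \<in> space M"
 obtain N0 where N0: "to_nat ` {a. f x a ~= 0} \<subseteq> {..<N0}" using finite_nat_iff_bounded fin[OF x] by (meson finite_imageI)
 have "(\<Sum>a\<in>?A N. f x a) = fsum (f x)" if "N \<ge> N0" for N
 proof (rule fsum_superset[symmetric, OF fA])
  fix a assume "f x a ~= 0"
  hence "to_nat a \<in> {..<N0}" using N0 by blast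
  thus "a \<in> ?A N" using that by simp
 qed
 thus "(\<lambda>N. \<Sum>a\<in>?A N. f x a) \<longlonglongrightarrow> fsum (f x)"
  by (intro tendsto_eventually) (auto simp: eventually_sequentially)
qed

lemma sum_list_zero: "(\<And>e. e \<in> set l ==> h e = 0) ==> sum_list (map h l) = (0 :: real)"
 by (induction l) auto

lemma fsum_sum_list_delta:
 "fsum (\<lambda>g. f g * sum_list (map (\<lambda>e. if p e = g then c e else 0) l)) = sum_list (map (\<lambda>e. c e * f (p e)) l)"
proof -
 have z: "sum_list (map (\<lambda>e. if p e = g then c e else 0) l) = 0" if "g \<notin> p ` set l" for g
  using that by (induction l) auto
 have "(\<Sum>g\<in>A. f g * sum_list (map (\<lambda>e. if p e = g then c e else 0) l)) = sum_list (map (\<lambda>e. c e * f (p e)) l)"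
  if A: "finite A" "p ` set l \<subseteq> A" for A
  using A(2)
 proof (induction l)
  case (Cons e l)
  have "(\<Sum>g\<in>A. f g * (if p e = g then c e else 0)) = (\<Sum>g\<in>A. if p e = g then f g * c e else 0)"
   by (rule sum.cong) auto
  also have "... = f (p e) * c e" using Cons.prems by (simp add: sum.delta'[OF A(1)])
  finally show ?case using Cons by (simp add: distrib_left sum.distrib mult.commute)
 qed simp
 from this[of "p ` set l"] show ?thesis
  using fsum_superset[of "p ` set l" "\<lambda>g. f g * sum_list (map (\<lambda>e. if p e = g then c e else 0) l)"] z by auto
qed

section \<open>Chains along the orbits of a free group\<close>

locale free_group_action = prob_space M for M :: "'a measure" +
 fixes n :: nat and \<phi> :: "letter list => 'a => 'a"
 assumes act: "mp_action (free_group n) M \<phi>"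
begin

abbreviation \<Gamma> :: "letter list set" where "\<Gamma> \<equiv> carrier (free_group n)"

lemma mem_G: "u \<in> \<Gamma> \<longleftrightarrow> reduced_word u \<and> fst ` set u \<subseteq> {..<n}"
 by (simp add: free_group_def)

lemma G_Nil: "[] \<in> \<Gamma>" by (simp add: mem_G)

lemma G_gen: "i < n ==> [(i, b)] \<in> \<Gamma>" by (simp add: mem_G reduced_Cons)

lemma G_mul: "u \<in> \<Gamma> ==> v \<in> \<Gamma> ==> mul u v \<in> \<Gamma>"
 using monoid.m_closed[OF group.is_monoid[OF group_free_group], of u n v] by (simp add: free_group_def)

lemma G_ginv: "u \<in> \<Gamma> ==> ginv u \<in> \<Gamma>"
 by (auto simp: mem_G reduced_inverse)

lemma G_drop: "u \<in> \<Gamma> ==> drop q u \<in> \<Gamma>"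
 using set_drop_subset[of q u] by (auto simp: mem_G reduced_drop)

lemma G_assoc: "w \<in> \<Gamma> ==> mul (mul u v) w = mul u (mul v w)"
 by (simp add: mem_G foldr_cancel_assoc)

lemma mul_Nil: "u \<in> \<Gamma> ==> mul u [] = u"
 by (simp add: mem_G foldr_cancel_Nil)

lemma mul_ginv: "mul (ginv u) u = []" "u \<in> \<Gamma> ==> mul u (ginv u) = []"
proof -
 show "mul (ginv u) u = []" for u by (rule foldr_cancel_inverse)
 from this[of "ginv u"] show "mul u (ginv u) = []" by (simp add: rev_map comp_def)
qed

lemma ginv_ginv: "ginv (ginv u) = u"
 by (simp add: rev_map comp_def)

lemma mul_cancel: "u \<in> \<Gamma> ==> v \<in> \<Gamma> ==> mul (mul v (ginv u)) u = v"
 by (simp add: G_assoc mul_ginv mul_Nil)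

lemma mul_cancel': "u \<in> \<Gamma> ==> v \<in> \<Gamma> ==> mul (mul v u) (ginv u) = v"
 by (simp add: G_assoc G_ginv mul_ginv mul_Nil)

lemma ginv_mul_cancel: "u \<in> \<Gamma> ==> v \<in> \<Gamma> ==> mul (ginv u) (mul u v) = v"
 by (simp add: G_assoc[symmetric] mul_ginv)

lemma action: "group_action (free_group n) (space M) \<phi>"
 using act by (simp add: mp_action_def)

lemma phi_space: "u \<in> \<Gamma> ==> x \<in> space M ==> \<phi> u x \<in> space M"
 by (rule group_action.element_image[OF action]) auto

lemma phi_mul: "u \<in> \<Gamma> ==> v \<in> \<Gamma> ==> x \<in> space M ==> \<phi> (mul u v) x = \<phi> u (\<phi> v x)"
 using group_action.composition_rule[OF action, of x u v] by (simp add: free_group_def)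

lemma phi_Nil: "x \<in> space M ==> \<phi> [] x = x"
 using group_action.id_eq_one[OF action] by (metis (no_types, lifting) free_group_def monoid.select_convs(2) restrict_apply')

lemma phi_measurable: "u \<in> \<Gamma> ==> \<phi> u \<in> measurable M M"
 using act by (simp add: mp_action_def)

lemma phi_integral: "u \<in> \<Gamma> ==> f \<in> borel_measurable M ==> (\<integral>x. f (\<phi> u x) \<partial>M) = (\<integral>x. (f x :: real) \<partial>M)"
 using integral_distr[OF phi_measurable, of u f] act by (simp add: mp_action_def)

definition sg :: "bool => real" where "sg s = (if s then 1 else - 1)"

text \<open>The pairing of a potential with the boundary of a chain. The triple
  \<open>(j, u, s)\<close> is an edge of the \<open>j\<close>-th partial map at the point
  \<open>\<phi> u x\<close>, with orientation \<open>s\<close>; \<open>th j\<close> names the group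
  element by which that map moves a point.\<close>

definition chain :: "(nat => 'a => letter list) => 'a => (nat \<times> letter list \<times> bool) list => (letter list => real) => real" where
 "chain th x l \<psi> = sum_list (map (\<lambda>(j, u, s). sg s * (\<psi> (mul (th j (\<phi> u x)) u) - \<psi> u)) l)"

text \<open>Quantifying over all potentials \<open>\<psi>\<close> says that the chain \<open>l\<close> has the same boundary as the edge from
 the identity to the \<open>i\<close>-th generator.\<close>

definition ok :: "(nat => 'a set) => (nat => 'a => letter list) => nat => (nat \<times> letter list \<times> bool) list => 'a => bool" where
 "ok Dm th i l x \<longleftrightarrow> (\<forall>(j, u, s)\<in>set l. \<phi> u x \<in> Dm j) \<and> (\<forall>\<psi>. chain th x l \<psi> = \<psi> [(i, True)] - \<psi> [])"

lemma vals_measurable: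
 assumes th: "\<And>j. th j \<in> measurable M (count_space UNIV)" and l: "\<And>j u s. (j, u, s) \<in> set l ==> u \<in> \<Gamma>"
 shows "(\<lambda>x. map (\<lambda>(j, u, s). th j (\<phi> u x) :: letter list) l) \<in> measurable M (count_space UNIV)"
 using l
proof (induction l)
 case (Cons e l)
 obtain j u s where e: "e = (j, u, s)" by (cases e) auto
 have u: "u \<in> \<Gamma>" using Cons.prems[of j u s] e by simp
 have 1: "(\<lambda>x. th j (\<phi> u x)) \<in> measurable M (count_space UNIV)"
  by (rule measurable_compose[OF phi_measurable[OF u] th])
 have 2: "(\<lambda>x. map (\<lambda>(j, u, s). th j (\<phi> u x)) l) \<in> measurable M (count_space UNIV)"
  by (rule Cons.IH) (use Cons.prems in auto)
 have "(\<lambda>x. th j (\<phi> u x) # map (\<lambda>(j, u, s). th j (\<phi> u x)) l) \<in> measurable M (count_space UNIV)" (is "?f \<in> _")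
  unfolding measurable_count_space_eq2_countable
 proof (intro conjI ballI)
  fix zs
  show "?f -` {zs} \<inter> space M \<in> sets M"
  proof (cases zs)
   case (Cons z zs')
   have "?f -` {zs} \<inter> space M = ((\<lambda>x. th j (\<phi> u x)) -` {z} \<inter> space M) \<inter>
     ((\<lambda>x. map (\<lambda>(j, u, s). th j (\<phi> u x)) l) -` {zs'} \<inter> space M)"
    by (auto simp: Cons)
   thus ?thesis using measurable_sets[OF 1, of "{z}"] measurable_sets[OF 2, of "{zs'}"] by simp
  qed (simp add: vimage_def)
 qed simp
 thus ?case by (simp add: e)
qed simp

lemma chain_vals:
 "chain th x l \<psi> = sum_list (map (\<lambda>((j, u, s), v). sg s * (\<psi> (mul v u) - \<psi> u)) (zip l (map (\<lambda>(j, u, s). th j (\<phi> u x)) l)))"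
 unfolding chain_def by (induction l) auto

text \<open>The chain depends on \<open>x\<close> only through finitely many values of
  \<open>th\<close>, which lie in a countable type; therefore the quantifier over all potentials
  does not spoil measurability.\<close>

lemma ok_sets:
 assumes th: "\<And>j. th j \<in> measurable M (count_space UNIV)" and l: "\<And>j u s. (j, u, s) \<in> set l ==> u \<in> \<Gamma>"
  and D: "\<And>j. Dm j \<in> sets M"
 shows "{x \<in> space M. ok Dm th i l x} \<in> sets M"
proof -
 have "{x \<in> space M. \<forall>e\<in>set l. \<phi> (fst (snd e)) x \<in> Dm (fst e)} \<in> sets M"
 proof (rule sets.sets_Collect_finite_All)
  fix e assume "e \<in> set l"
  hence "fst (snd e) \<in> \<Gamma>" using l[of "fst e" "fst (snd e)" "snd (snd e)"] by simp
  hence "\<phi> (fst (snd e)) -` Dm (fst e) \<inter> space M \<in> sets M" by (intro measurable_sets[OF phi_measurable D])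
  thus "{x \<in> space M. \<phi> (fst (snd e)) x \<in> Dm (fst e)} \<in> sets M" by (simp add: vimage_def Int_def conj_commute)
 qed simp
 moreover have "(\<lambda>x. map (\<lambda>(j, u, s). th j (\<phi> u x)) l) -` {zs. \<forall>\<psi>. sum_list (map (\<lambda>((j, u, s), v). sg s * (\<psi> (mul v u) - \<psi> u)) (zip l zs)) = \<psi> [(i, True)] - \<psi> []} \<inter> space M \<in> sets M"
  by (rule measurable_sets[OF vals_measurable[OF th l]]) simp_all
 moreover have "{x \<in> space M. ok Dm th i l x} = {x \<in> space M. \<forall>e\<in>set l. \<phi> (fst (snd e)) x \<in> Dm (fst e)} \<inter>
   ((\<lambda>x. map (\<lambda>(j, u, s). th j (\<phi> u x)) l) -` {zs. \<forall>\<psi>. sum_list (map (\<lambda>((j, u, s), v). sg s * (\<psi> (mul v u) - \<psi> u)) (zip l zs)) = \<psi> [(i, True)] - \<psi> []} \<inter> space M)"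
  unfolding ok_def chain_vals by auto
 ultimately show ?thesis by (simp only: sets.Int)
qed

end

text \<open>The bounded situation: the partial maps move by elements of the finite set
  \<open>V\<close>, and each tree edge is expressed by one of finitely many chains. This makes the
  matrices banded.\<close>

locale chain_cover = free_group_action M n \<phi> for M :: "'a measure" and n \<phi> +
 fixes k :: nat and Dm :: "nat => 'a set" and th :: "nat => 'a => letter list" and V :: "letter list set"
  and PL :: "(nat \<times> letter list \<times> bool) list list"
 assumes Dm: "\<And>j. Dm j \<in> sets M" and th: "\<And>j. th j \<in> measurable M (count_space UNIV)"
  and thV: "\<And>j x. th j x \<in> V" and V: "finite V" "V \<subseteq> \<Gamma>"
  and PL: "\<And>l j u s. l \<in> set PL ==> (j, u, s) \<in> set l ==> j < k \<and> u \<in> \<Gamma>"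
  and cover: "\<And>i x. i < n ==> x \<in> space M ==> \<exists>l\<in>set PL. ok Dm th i l x"
begin

definition ix :: "nat => 'a => nat" where
 "ix i x = (LEAST p. p < length PL \<and> ok Dm th i (PL ! p) x)"

definition sel :: "nat => 'a => (nat \<times> letter list \<times> bool) list" where
 "sel i x = PL ! ix i x"

lemma sel:
 assumes "i < n" "x \<in> space M" shows "sel i x \<in> set PL" "ok Dm th i (sel i x) x"
proof -
 have "\<exists>p. p < length PL \<and> ok Dm th i (PL ! p) x" using cover[OF assms] by (metis in_set_conv_nth)
 hence "ix i x < length PL \<and> ok Dm th i (PL ! ix i x) x" unfolding ix_def by (rule LeastI_ex)
 thus "sel i x \<in> set PL" "ok Dm th i (sel i x) x" by (auto simp: sel_def)
qed

lemma sel_measurable: "sel i \<in> measurable M (count_space UNIV)"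
proof -
 have "(\<lambda>x. LEAST p. p < length PL \<and> ok Dm th i (PL ! p) x) \<in> measurable M (count_space UNIV)"
 proof (rule measurable_Least)
  fix p
  show "Measurable.pred M (\<lambda>x. p < length PL \<and> ok Dm th i (PL ! p) x)"
  proof (cases "p < length PL")
   case True
   have "{x \<in> space M. ok Dm th i (PL ! p) x} \<in> sets M"
    by (rule ok_sets[OF th _ Dm]) (use True PL nth_mem in blast)
   thus ?thesis using True by (simp add: pred_def)
  qed simp
 qed
 hence "ix i \<in> measurable M (count_space UNIV)" unfolding ix_def[abs_def] .
 hence "(\<lambda>x. PL ! ix i x) \<in> measurable M (count_space UNIV)" by (rule measurable_compose) simp
 thus ?thesis by (simp add: sel_def[abs_def])
qed

text \<open>Column \<open>t\<close> is the chain of partial-map edges selected for the tree edge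
  \<open>t\<close>, translated to the place of \<open>t\<close>.\<close>

definition C :: "'a => nat \<times> letter list => nat \<times> letter list => real" where
 "C x g t = (if fst t < n \<and> snd t \<in> \<Gamma> then
   sum_list (map (\<lambda>e. if (fst e, mul (fst (snd e)) (snd t)) = g then sg (snd (snd e)) else 0) (sel (fst t) (\<phi> (snd t) x))) else 0)"

text \<open>Column \<open>g\<close> is the tree geodesic between the ends of the partial-map edge
  \<open>g\<close>, as a difference of two geodesics from the identity. It is the bounded left
  inverse of \<open>C\<close>.\<close>

definition B :: "'a => nat \<times> letter list => nat \<times> letter list => real" where
 "B x t g = (if fst g < k \<and> snd g \<in> \<Gamma> then Th (mul (th (fst g) (\<phi> (snd g) x)) (snd g)) t - Th (snd g) t else 0)"

definition Us :: "letter list set" where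
 "Us = (\<Union>l\<in>set PL. (\<lambda>e. fst (snd e)) ` set l)"

definition Vs :: "letter list set" where
 "Vs = (\<Union>v\<in>V. (\<lambda>q. drop q v) ` {..length v})"

definition T :: "(nat \<times> letter list) set" where
 "T = {..<n} \<times> \<Gamma>"

lemma Us: "finite Us" "Us \<subseteq> \<Gamma>"
 using PL by (auto simp: Us_def)

lemma Vs: "finite Vs" "Vs \<subseteq> \<Gamma>"
 using V G_drop by (auto simp: Vs_def)

lemma C_supp:
 assumes x: "x \<in> space M" and nz: "C x g t ~= 0"
 shows "t \<in> T" "fst g < k" "\<exists>u\<in>Us. snd g = mul u (snd t)" "snd g \<in> \<Gamma>"
  "\<exists>u s. (fst g, u, s) \<in> set (sel (fst t) (\<phi> (snd t) x)) \<and> snd g = mul u (snd t)"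
proof -
 have t: "fst t < n" "snd t \<in> \<Gamma>" using nz by (auto simp: C_def split: if_splits)
 thus "t \<in> T" by (simp add: T_def mem_Times_iff)
 let ?l = "sel (fst t) (\<phi> (snd t) x)"
 have "\<exists>e\<in>set ?l. (fst e, mul (fst (snd e)) (snd t)) = g"
 proof (rule ccontr)
  assume "\<not> ?thesis"
  hence "sum_list (map (\<lambda>e. if (fst e, mul (fst (snd e)) (snd t)) = g then sg (snd (snd e)) else 0) ?l) = 0"
   by (intro sum_list_zero) auto
  thus False using nz t by (simp add: C_def)
 qed
 then obtain e where e: "e \<in> set ?l" "(fst e, mul (fst (snd e)) (snd t)) = g" by blast
 have l: "?l \<in> set PL" by (rule sel(1)[OF t(1) phi_space[OF t(2) x]])
 have p: "fst e < k \<and> fst (snd e) \<in> \<Gamma>" using PL[OF l, of "fst e" "fst (snd e)" "snd (snd e)"] e(1) by simp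
 show "fst g < k" using p e(2) by auto
 have "fst (snd e) \<in> Us" using e(1) l by (auto simp: Us_def)
 thus "\<exists>u\<in>Us. snd g = mul u (snd t)" using e(2) by auto
 show "snd g \<in> \<Gamma>" using p e(2) G_mul[OF _ t(2)] by auto
 show "\<exists>u s. (fst g, u, s) \<in> set ?l \<and> snd g = mul u (snd t)"
  using e by (intro exI[of _ "fst (snd e)"] exI[of _ "snd (snd e)"]) auto
qed

definition len :: nat where "len = sum_list (map length PL) + (\<Sum>v\<in>V. length v)"

lemma C_bound: "x \<in> space M ==> \<bar>C x g t\<bar> \<le> real len"
proof (cases "fst t < n \<and> snd t \<in> \<Gamma>")
 case True
 assume x: "x \<in> space M"
 let ?l = "sel (fst t) (\<phi> (snd t) x)"
 have "\<bar>sum_list (map (\<lambda>e. if (fst e, mul (fst (snd e)) (snd t)) = g then sg (snd (snd e)) else 0) l)\<bar> \<le> real (length l)" for l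
  by (induction l) (auto simp: sg_def)
 hence "\<bar>C x g t\<bar> \<le> real (length ?l)" using True by (simp add: C_def)
 moreover have "length ?l \<le> sum_list (map length PL)"
  using sel(1)[of "fst t" "\<phi> (snd t) x"] True phi_space[OF _ x] by (intro member_le_sum_list) auto
 hence "length ?l \<le> len" by (simp add: len_def)
 ultimately show ?thesis by linarith
qed (auto simp: C_def)

lemma B_supp:
 assumes nz: "B x t g ~= 0"
 shows "t \<in> T" "fst g < k" "snd g \<in> \<Gamma>" "\<exists>u\<in>Vs. snd t = mul u (snd g)"
proof -
 show g: "fst g < k" "snd g \<in> \<Gamma>" using nz by (auto simp: B_def split: if_splits)
 let ?v = "th (fst g) (\<phi> (snd g) x)"
 have v: "?v \<in> V" "?v \<in> \<Gamma>" using thV V by auto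
 have "Th (mul ?v (snd g)) t - Th (snd g) t ~= 0" using nz g by (simp add: B_def)
 hence f: "fst t \<in> fst ` set ?v \<and> (\<exists>q\<le>length ?v. snd t = mul (drop q ?v) (snd g))"
  using g(2) by (intro Th_mul(2)) (auto simp: mem_G)
 thus e: "\<exists>u\<in>Vs. snd t = mul u (snd g)" using v(1) unfolding Vs_def by blast
 have "fst t < n" using f v(2) by (auto simp: mem_G)
 moreover have "snd t \<in> \<Gamma>" using e Vs(2) G_mul[OF _ g(2)] by auto
 ultimately show "t \<in> T" by (simp add: T_def mem_Times_iff)
qed

lemma B_bound: "\<bar>B x t g\<bar> \<le> real len"
proof (cases "fst g < k \<and> snd g \<in> \<Gamma>")
 case True
 let ?v = "th (fst g) (\<phi> (snd g) x)"
 have "\<bar>B x t g\<bar> \<le> real (length ?v)" using True Th_mul(1)[of "snd g" ?v t] by (simp add: B_def mem_G)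
 moreover have "length ?v \<le> (\<Sum>v\<in>V. length v)" using thV V(1) by (intro member_le_sum) auto
 hence "length ?v \<le> len" by (simp add: len_def)
 ultimately show ?thesis by linarith
qed (auto simp: B_def)

definition r :: nat where "r = (n + k) * (card Us + card Vs)"

lemma band_card:
 assumes W: "finite W" "card W \<le> card Us + card Vs" and p: "p \<le> n + k" and sub: "S \<subseteq> {..<p} \<times> f ` W"
 shows "finite S \<and> card S \<le> r"
proof
 have fin: "finite ({..<p} \<times> f ` W)" using W(1) by simp
 thus "finite S" using sub by (rule finite_subset[rotated])
 have "card S \<le> card ({..<p} \<times> f ` W)" using sub fin by (intro card_mono)
 also have "... = p * card (f ` W)" by (simp add: card_cartesian_product)
 also have "... \<le> (n + k) * (card Us + card Vs)" using p W(2) card_image_le[OF W(1), of f] by (intro mult_le_mono) auto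
 finally show "card S \<le> r" by (simp add: r_def)
qed

lemma C_col: "x \<in> space M ==> finite {g. C x g t ~= 0} \<and> card {g. C x g t ~= 0} \<le> r"
proof (rule band_card[OF Us(1), where p = k and f = "\<lambda>u. mul u (snd t)"])
 assume x: "x \<in> space M"
 show "{g. C x g t ~= 0} \<subseteq> {..<k} \<times> (\<lambda>u. mul u (snd t)) ` Us"
 proof
  fix g assume "g \<in> {g. C x g t ~= 0}"
  hence nz: "C x g t ~= 0" by simp
  show "g \<in> {..<k} \<times> (\<lambda>u. mul u (snd t)) ` Us"
   using C_supp(2,3)[OF x nz] by (auto simp: mem_Times_iff)
 qed
qed auto

lemma C_row: "x \<in> space M ==> finite {t. C x g t ~= 0} \<and> card {t. C x g t ~= 0} \<le> r"
proof (rule band_card[OF Us(1), where p = n and f = "\<lambda>u. mul (ginv u) (snd g)"])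
 assume x: "x \<in> space M"
 show "{t. C x g t ~= 0} \<subseteq> {..<n} \<times> (\<lambda>u. mul (ginv u) (snd g)) ` Us"
 proof
  fix t assume "t \<in> {t. C x g t ~= 0}"
  hence nz: "C x g t ~= 0" by simp
  obtain u where u: "u \<in> Us" "snd g = mul u (snd t)" using C_supp(3)[OF x nz] by blast
  have t: "t \<in> T" by (rule C_supp(1)[OF x nz])
  hence "snd t = mul (ginv u) (snd g)" using u Us(2) ginv_mul_cancel[of u "snd t"] by (auto simp: T_def)
  thus "t \<in> {..<n} \<times> (\<lambda>u. mul (ginv u) (snd g)) ` Us" using t u(1) by (auto simp: T_def mem_Times_iff)
 qed
qed auto

lemma B_row: "finite {g. B x t g ~= 0} \<and> card {g. B x t g ~= 0} \<le> r"
proof (rule band_card[OF Vs(1), where p = k and f = "\<lambda>u. mul (ginv u) (snd t)"])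
 show "{g. B x t g ~= 0} \<subseteq> {..<k} \<times> (\<lambda>u. mul (ginv u) (snd t)) ` Vs"
 proof
  fix g assume "g \<in> {g. B x t g ~= 0}"
  hence nz: "B x t g ~= 0" by simp
  obtain u where u: "u \<in> Vs" "snd t = mul u (snd g)" using B_supp(4)[OF nz] by blast
  hence "snd g = mul (ginv u) (snd t)" using B_supp(3)[OF nz] Vs(2) ginv_mul_cancel[of u "snd g"] by auto
  thus "g \<in> {..<k} \<times> (\<lambda>u. mul (ginv u) (snd t)) ` Vs" using B_supp(2)[OF nz] u(1) by (auto simp: mem_Times_iff)
 qed
qed auto

lemma B_col: "finite {t. B x t g ~= 0} \<and> card {t. B x t g ~= 0} \<le> r"
proof (rule band_card[OF Vs(1), where p = n and f = "\<lambda>u. mul u (snd g)"])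
 show "{t. B x t g ~= 0} \<subseteq> {..<n} \<times> (\<lambda>u. mul u (snd g)) ` Vs"
 proof
  fix t assume "t \<in> {t. B x t g ~= 0}"
  hence nz: "B x t g ~= 0" by simp
  show "t \<in> {..<n} \<times> (\<lambda>u. mul u (snd g)) ` Vs"
   using B_supp(1,4)[OF nz] by (auto simp: mem_Times_iff T_def)
 qed
qed auto

text \<open>Replacing every edge of the selected chain by a geodesic keeps the boundary, and in a
  tree a finite chain is determined by its boundary. Formally, \<open>ok\<close> is applied to a
  coordinate of \<open>Th\<close> as potential.\<close>

lemma BC:
 assumes x: "x \<in> space M" and t: "t \<in> T"
 shows "fsum (\<lambda>g. B x t' g * C x g t) = dl t t'"
proof -
 obtain i w where t': "t = (i, w)" "i < n" "w \<in> \<Gamma>" using t by (auto simp: T_def)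
 let ?y = "\<phi> w x"
 let ?l = "sel i ?y"
 let ?\<psi> = "\<lambda>v. Th (mul v w) t'"
 have y: "?y \<in> space M" by (rule phi_space[OF t'(3) x])
 have l: "?l \<in> set PL" "ok Dm th i ?l ?y" using sel[OF t'(2) y] by auto
 have "fsum (\<lambda>g. B x t' g * C x g t) = sum_list (map (\<lambda>e. sg (snd (snd e)) * B x t' (fst e, mul (fst (snd e)) w)) ?l)"
  using fsum_sum_list_delta[of "B x t'" "\<lambda>e. (fst e, mul (fst (snd e)) w)" "\<lambda>e. sg (snd (snd e))" ?l] t' by (simp add: C_def)
 also have "... = chain th ?y ?l ?\<psi>"
  unfolding chain_def
 proof (rule arg_cong[where f = sum_list], rule map_cong[OF refl])
  fix e assume "e \<in> set ?l"
  moreover obtain j u s where e: "e = (j, u, s)" by (cases e) auto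
  ultimately have ju: "j < k" "u \<in> \<Gamma>" using PL[OF l(1)] by auto
  have "B x t' (j, mul u w) = Th (mul (th j (\<phi> (mul u w) x)) (mul u w)) t' - Th (mul u w) t'"
   using ju G_mul[OF ju(2) t'(3)] by (simp add: B_def)
  also have "... = ?\<psi> (mul (th j (\<phi> u ?y)) u) - ?\<psi> u"
   using phi_mul[OF ju(2) t'(3) x] G_assoc[OF t'(3), of "th j (\<phi> u ?y)" u] by simp
  finally show "sg (snd (snd e)) * B x t' (fst e, mul (fst (snd e)) w) =
    (case e of (j, u, s) => sg s * (?\<psi> (mul (th j (\<phi> u ?y)) u) - ?\<psi> u))"
   by (simp add: e)
 qed
 also have "... = ?\<psi> [(i, True)] - ?\<psi> []" using l(2) unfolding ok_def by blast
 also have "... = edge (i, True) w t'" using Th_cancel[of w "(i, True)" t'] t'(3) by (simp add: mem_G)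
 also have "... = dl t t'" by (simp add: edge_def t')
 finally show ?thesis .
qed

definition bd :: real where "bd = (real r * real len)\<^sup>2 + 1"

text \<open>The upper bound is Schur's test for \<open>C\<close>; the lower bound is Schur's test
  for \<open>B\<close> applied to \<open>v = B C v\<close>.\<close>

lemma gram: assumes x: "x \<in> space M" shows "gram (C x) bd bd T"
proof
 show "finite {t. C x g t ~= 0}" "finite {g. C x g t ~= 0}" for g t using C_row[OF x] C_col[OF x] by auto
 show "1 \<le> bd" by (simp add: bd_def)
 show "t \<in> T" if "C x g t ~= 0" for g t by (rule C_supp(1)[OF x that])
 have le: "(real r * real len)\<^sup>2 * ip v v \<le> bd * ip v v" for v :: "nat \<times> letter list => real"
  using ip_nonneg[of v] by (simp add: bd_def distrib_right)
 show "ip (mv (C x) v) (mv (C x) v) \<le> bd * ip v v" if v: "fs v" for v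
  by (rule order_trans[OF schur_bound[OF C_row[OF x] C_col[OF x] C_bound[OF x] v] le])
 show "ip v v \<le> bd * ip (mv (C x) v) (mv (C x) v)" if v: "fs v" "\<And>t. v t ~= 0 ==> t \<in> T" for v
 proof -
  have z: "fs (mv (C x) v)" using C_col[OF x] by (intro fs_mv v(1)) auto
  have "mv (B x) (mv (C x) v) t' = v t'" for t'
  proof -
   have fB: "fs (B x t')" using B_row by (simp add: fs_def)
   have "mv (B x) (mv (C x) v) t' = ip (mv (C x) v) (B x t')" by (simp add: mv_ip ip_commute)
   also have "... = ip v (mv (\<lambda>t g. C x g t) (B x t'))" by (rule ip_mv[OF v(1) fB])
   also have "... = ip v (dl t')"
    unfolding ip_def
   proof (rule arg_cong[where f = fsum], rule ext)
    fix t
    show "v t * mv (\<lambda>t g. C x g t) (B x t') t = v t * dl t' t"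
    proof (cases "v t = 0")
     case False
     have "mv (\<lambda>t g. C x g t) (B x t') t = fsum (\<lambda>g. B x t' g * C x g t)" by (simp add: mv_def mult.commute)
     also have "... = dl t t'" by (rule BC[OF x v(2)[OF False]])
     finally show ?thesis by (simp add: dl_def)
    qed simp
   qed
   finally show ?thesis by (simp add: ip_dl)
  qed
  hence "mv (B x) (mv (C x) v) = v" by (simp add: fun_eq_iff)
  hence "ip v v \<le> (real r * real len)\<^sup>2 * ip (mv (C x) v) (mv (C x) v)"
   using schur_bound[OF B_row B_col B_bound z, of x] by simp
  also have "... \<le> bd * ip (mv (C x) v) (mv (C x) v)" by (rule le)
  finally show ?thesis .
 qed
qed

definition KK :: "nat => 'a => nat \<times> letter list => nat \<times> letter list => real" where
 "KK l x = kmat (C x) bd l"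

lemma KK_C: "KK l x g t ~= 0 ==> C x g t ~= 0"
 by (auto simp: KK_def kmat_def)

text \<open>Right translation of the group coordinate, continued by the identity on words outside
  the group to be a bijection of the whole type.\<close>

definition \<tau> :: "letter list => nat \<times> letter list => nat \<times> letter list" where
 "\<tau> g a = (fst a, if snd a \<in> \<Gamma> then mul (snd a) g else snd a)"

lemma bij_tau: "g \<in> \<Gamma> ==> bij (\<tau> g)"
proof (rule o_bij[of "\<tau> (ginv g)"])
 assume g: "g \<in> \<Gamma>"
 show "\<tau> (ginv g) o \<tau> g = id" "\<tau> g o \<tau> (ginv g) = id"
  using g G_mul G_ginv mul_cancel mul_cancel' by (auto simp: \<tau>_def fun_eq_iff)
qed

text \<open>The chain selected for the edge at \<open>w\<close> depends only on the point
  \<open>\<phi> w x\<close>; replacing \<open>x\<close> by a translate therefore only relabels the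
  places.\<close>

lemma C_equivariant:
 assumes g: "g \<in> \<Gamma>" and x: "x \<in> space M"
 shows "C (\<phi> g x) a t = C x (\<tau> g a) (\<tau> g t)"
proof (cases "fst t < n \<and> snd t \<in> \<Gamma>")
 case True
 let ?l = "sel (fst t) (\<phi> (snd t) (\<phi> g x))"
 have e: "\<phi> (mul (snd t) g) x = \<phi> (snd t) (\<phi> g x)" using phi_mul True g x by blast
 have l: "?l \<in> set PL" using True by (intro sel(1) phi_space x g) auto
 have "((fst e, mul (fst (snd e)) (snd t)) = a) = ((fst e, mul (fst (snd e)) (mul (snd t) g)) = \<tau> g a)" if "e \<in> set ?l" for e
 proof -
  have u: "fst (snd e) \<in> \<Gamma>" using PL[OF l, of "fst e" "fst (snd e)" "snd (snd e)"] that by simp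
  have m: "mul (fst (snd e)) (snd t) \<in> \<Gamma>" using G_mul[OF u] True by blast
  have "mul (fst (snd e)) (mul (snd t) g) = mul (mul (fst (snd e)) (snd t)) g" using G_assoc[OF g] by simp
  hence "(fst e, mul (fst (snd e)) (mul (snd t) g)) = \<tau> g (fst e, mul (fst (snd e)) (snd t))" using m by (simp add: \<tau>_def)
  thus ?thesis using bij_tau[OF g] by (simp add: bij_def inj_eq)
 qed
 hence "map (\<lambda>e. if (fst e, mul (fst (snd e)) (snd t)) = a then sg (snd (snd e)) else 0) ?l =
   map (\<lambda>e. if (fst e, mul (fst (snd e)) (mul (snd t) g)) = \<tau> g a then sg (snd (snd e)) else 0) ?l"
  by (intro map_cong refl if_cong) auto
 from arg_cong[where f = sum_list, OF this] show ?thesis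
  using True e G_mul[OF _ g, of "snd t"] by (simp add: C_def \<tau>_def[of g t])
qed (auto simp: C_def \<tau>_def)

lemma KK_equivariant:
 assumes g: "g \<in> \<Gamma>" and x: "x \<in> space M"
 shows "KK l (\<phi> g x) a t = KK l x (\<tau> g a) (\<tau> g t)"
proof -
 have "C (\<phi> g x) = (\<lambda>a t. C x (\<tau> g a) (\<tau> g t))" using C_equivariant[OF assms] by (simp add: fun_eq_iff)
 thus ?thesis unfolding KK_def using kmat_reindex[OF bij_tau[OF g] bij_tau[OF g], of "C x" bd l a t] by simp
qed

lemma C_measurable: "(\<lambda>x. C x g t) \<in> borel_measurable M"
proof (cases "fst t < n \<and> snd t \<in> \<Gamma>")
 case True
 have "(\<lambda>x. sel (fst t) (\<phi> (snd t) x)) \<in> measurable M (count_space UNIV)"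
  using True by (intro measurable_compose[OF phi_measurable sel_measurable]) auto
 hence "(\<lambda>x. sum_list (map (\<lambda>e. if (fst e, mul (fst (snd e)) (snd t)) = g then sg (snd (snd e)) else 0) (sel (fst t) (\<phi> (snd t) x)))) \<in> borel_measurable M"
  by (rule measurable_compose) simp
 thus ?thesis using True by (simp add: C_def)
qed (auto simp: C_def)

lemma mv_measurable:
 assumes v: "\<And>t. (\<lambda>x. v x t) \<in> borel_measurable M" and K: "\<And>g t. (\<lambda>x. K x g t) \<in> borel_measurable M"
  and f: "\<And>x. x \<in> space M ==> fs (v x)"
 shows "(\<lambda>x. mv (K x) (v x :: nat \<times> letter list => real) g) \<in> borel_measurable M"
 unfolding mv_def
proof (rule fsum_measurable)
 show "(\<lambda>x. K x g t * v x t) \<in> borel_measurable M" for t using K v by (rule borel_measurable_times)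
 show "finite {t. K x g t * v x t ~= 0}" if "x \<in> space M" for x
  using f[OF that] unfolding fs_def by (rule finite_subset[rotated]) auto
qed

lemma nm_measurable: "(\<lambda>x. (nm (C x) bd ^^ l) (dl t) s) \<in> borel_measurable M"
proof (induction l arbitrary: s)
 case (Suc l)
 have f: "fs ((nm (C x) bd ^^ l) (dl t))" if "x \<in> space M" for x
  using gram.fsSk[OF gram[OF that] fs_dl] .
 have c: "(\<lambda>x. mv (C x) ((nm (C x) bd ^^ l) (dl t)) g) \<in> borel_measurable M" for g
  by (rule mv_measurable[OF Suc C_measurable f])
 have "(\<lambda>x. mv (\<lambda>t g. C x g t) (mv (C x) ((nm (C x) bd ^^ l) (dl t))) s) \<in> borel_measurable M"
  by (rule mv_measurable[OF c C_measurable]) (rule gram.fsC[OF gram f])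
 hence "(\<lambda>x. (nm (C x) bd ^^ l) (dl t) s - (1 / bd) * mv (\<lambda>t g. C x g t) (mv (C x) ((nm (C x) bd ^^ l) (dl t))) s) \<in> borel_measurable M"
  using Suc by measurable
 moreover have "(nm (C x) bd ^^ Suc l) (dl t) s =
   (nm (C x) bd ^^ l) (dl t) s - (1 / bd) * mv (\<lambda>t g. C x g t) (mv (C x) ((nm (C x) bd ^^ l) (dl t))) s" for x
  by (simp only: funpow.simps comp_apply nm_def[of _ _ "(nm (C x) bd ^^ l) (dl t)"])
 ultimately show ?case by (simp only:)
qed simp

lemma KK_integrable: "integrable M (\<lambda>x. KK l x g t)"
proof (rule integrable_const_bound[where B = "real l * (real len * (1 + bd))"])
 show "AE x in M. norm (KK l x g t) \<le> real l * (real len * (1 + bd))"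
 proof (rule AE_I2)
  fix x assume x: "x \<in> space M"
  have "\<bar>KK l x g t\<bar> \<le> real l * (\<bar>C x g t\<bar> * (1 + bd))" unfolding KK_def by (rule gram.kmat_bound[OF gram[OF x]])
  also have "... \<le> real l * (real len * (1 + bd))"
   using C_bound[OF x, of g t] by (intro mult_left_mono mult_right_mono) (auto simp: bd_def)
  finally show "norm (KK l x g t) \<le> real l * (real len * (1 + bd))" by simp
 qed
 have "(\<lambda>x. mv (C x) ((nm (C x) bd ^^ l) (dl t)) g) \<in> borel_measurable M" for l
  by (rule mv_measurable[OF nm_measurable C_measurable]) (rule gram.fsSk[OF gram fs_dl])
 thus "(\<lambda>x. KK l x g t) \<in> borel_measurable M"
  unfolding KK_def kmat_def using C_measurable[of g t] by measurable
qed

text \<open>Mass transport: the \<open>n\<close> columns at the identity have sums close to 1, and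
  by equivariance and invariance of the measure their integrals equal those of the rows at the
  identity, which are at most 1 and vanish off the domains.\<close>

theorem bounded_inequality: "real n \<le> (\<Sum>j<k. prob (Dm j))"
proof -
 define \<rho> where "\<rho> = 1 - 1 / (bd * bd)"
 have bd1: "bd \<ge> 1" by (simp add: bd_def)
 have "0 < 1 / (bd * bd)" "1 / (bd * bd) \<le> 1" using bd1 mult_mono[of 1 bd 1 bd] by auto
 hence rho: "0 \<le> \<rho>" "\<rho> < 1" by (auto simp: \<rho>_def)
 have main: "real n * (1 - \<rho> ^ l) \<le> (\<Sum>j<k. prob (Dm j))" for l
 proof -
  let ?K = "KK (2 * l)"
  have col: "1 - \<rho> ^ l \<le> (\<Sum>j<k. \<Sum>h\<in>Us. ?K x (j, h) (i, []))" if x: "x \<in> space M" and i: "i < n" for x i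
  proof -
   have "(i, []) \<in> T" using i G_Nil by (simp add: T_def)
   hence "1 - \<rho> ^ l \<le> fsum (\<lambda>g. ?K x g (i, []))" unfolding KK_def \<rho>_def by (rule gram.column_sum[OF gram[OF x]])
   also have "... = (\<Sum>g\<in>{..<k} \<times> Us. ?K x g (i, []))"
   proof (rule fsum_superset)
    fix g assume "?K x g (i, []) ~= 0"
    hence c: "C x g (i, []) ~= 0" by (rule KK_C)
    obtain u where u: "u \<in> Us" "snd g = mul u (snd (i, []))" using C_supp(3)[OF x c] by blast
    hence "snd g = u" using mul_Nil Us(2) by auto
    thus "g \<in> {..<k} \<times> Us" using u(1) C_supp(2)[OF x c] by (simp add: mem_Times_iff)
   qed (use Us in simp)
   also have "... = (\<Sum>j<k. \<Sum>h\<in>Us. ?K x (j, h) (i, []))" by (simp add: sum.cartesian_product split_beta)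
   finally show ?thesis .
  qed
  have row: "(\<Sum>i<n. \<Sum>h\<in>Us. ?K x (j, []) (i, ginv h)) \<le> indicator (Dm j) x" if x: "x \<in> space M" for x j
  proof -
   have "(\<Sum>i<n. \<Sum>h\<in>Us. ?K x (j, []) (i, ginv h)) = (\<Sum>t\<in>{..<n} \<times> Us. ?K x (j, []) (fst t, ginv (snd t)))"
    by (simp add: sum.cartesian_product split_beta)
   also have "... = (\<Sum>t\<in>(\<lambda>t. (fst t, ginv (snd t))) ` ({..<n} \<times> Us). ?K x (j, []) t)"
   proof (rule sum.reindex_cong[symmetric, OF _ refl])
    show "inj_on (\<lambda>t. (fst t, ginv (snd t))) ({..<n} \<times> Us)"
    proof (rule inj_onI)
     fix s t assume "(fst s, ginv (snd s)) = (fst t, ginv (snd t))"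
     hence h: "fst s = fst t" "ginv (snd s) = ginv (snd t)" by (simp_all only: prod.inject)
     from arg_cong[where f = "\<lambda>u. ginv u", OF h(2)] have "snd s = snd t" unfolding ginv_ginv .
     with h(1) show "s = t" by (rule prod_eqI)
    qed
   qed simp
   also have "... = fsum (\<lambda>t. ?K x (j, []) t)"
   proof (rule fsum_superset[symmetric])
    fix t assume "?K x (j, []) t ~= 0"
    hence c: "C x (j, []) t ~= 0" by (rule KK_C)
    obtain u where u: "u \<in> Us" "[] = mul u (snd t)" using C_supp(3)[OF x c] by auto
    have t: "t \<in> T" by (rule C_supp(1)[OF x c])
    have uG: "u \<in> \<Gamma>" using u(1) Us(2) by blast
    have tG: "snd t \<in> \<Gamma>" using t by (auto simp: T_def)
    have "snd t = ginv u" using ginv_mul_cancel[OF uG tG] u(2) mul_Nil[OF G_ginv[OF uG]] by simp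
    hence "t = (fst t, ginv u)" by (simp add: prod_eq_iff)
    thus "t \<in> (\<lambda>t. (fst t, ginv (snd t))) ` ({..<n} \<times> Us)" using u(1) t
     by (intro image_eqI[of _ _ "(fst t, u)"]) (auto simp: T_def)
   qed (use Us in simp)
   also have "... \<le> indicator (Dm j) x"
   proof (cases "x \<in> Dm j")
    case True
    thus ?thesis unfolding KK_def using gram.row_sum[OF gram[OF x], of "2 * l" "(j, [])"] by simp
   next
    case False
    have "?K x (j, []) t = 0" for t
    proof (rule ccontr)
     assume "?K x (j, []) t ~= 0"
     hence c: "C x (j, []) t ~= 0" by (rule KK_C)
     have t: "fst t < n" "snd t \<in> \<Gamma>" using C_supp(1)[OF x c] by (auto simp: T_def)
     obtain u s where u: "(j, u, s) \<in> set (sel (fst t) (\<phi> (snd t) x))" "[] = mul u (snd t)" using C_supp(5)[OF x c] by auto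
     have y: "\<phi> (snd t) x \<in> space M" by (rule phi_space[OF t(2) x])
     have uG: "u \<in> \<Gamma>" using PL[OF sel(1)[OF t(1) y] u(1)] by simp
     have "\<phi> u (\<phi> (snd t) x) \<in> Dm j" using sel(2)[OF t(1) y] u(1) unfolding ok_def by auto
     hence "x \<in> Dm j" using phi_mul[OF uG t(2) x] u(2) phi_Nil[OF x] by simp
     thus False using False by blast
    qed
    thus ?thesis using False by (simp add: fsum_def)
   qed
   finally show ?thesis .
  qed
  \<comment> \<open>Translating by \<open>h\<close> turns the entry between place \<open>h\<close>
    and the identity into the entry between the identity and the inverse of
    \<open>h\<close>.\<close>
  have move: "(\<integral>x. ?K x (j, h) (i, []) \<partial>M) = (\<integral>x. ?K x (j, []) (i, ginv h) \<partial>M)" if h: "h \<in> Us" for i j h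
  proof -
   have hG: "h \<in> \<Gamma>" using h Us(2) by blast
   have t: "\<tau> h (j, []) = (j, h)" "\<tau> h (i, ginv h) = (i, [])" using G_Nil G_ginv[OF hG] mul_ginv(1)[of h] by (auto simp: \<tau>_def)
   have "(\<integral>x. ?K x (j, h) (i, []) \<partial>M) = (\<integral>x. ?K (\<phi> h x) (j, []) (i, ginv h) \<partial>M)"
    using KK_equivariant[OF hG, of _ "2 * l" "(j, [])" "(i, ginv h)"] t by (intro Bochner_Integration.integral_cong) auto
   also have "... = (\<integral>x. ?K x (j, []) (i, ginv h) \<partial>M)"
    by (rule phi_integral[OF hG borel_measurable_integrable[OF KK_integrable]])
   finally show ?thesis .
  qed
  have "real n * (1 - \<rho> ^ l) = (\<Sum>i<n. (\<integral>x. 1 - \<rho> ^ l \<partial>M))" by (simp add: prob_space)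
  also have "... \<le> (\<Sum>i<n. (\<integral>x. (\<Sum>j<k. \<Sum>h\<in>Us. ?K x (j, h) (i, [])) \<partial>M))"
   by (intro sum_mono integral_mono Bochner_Integration.integrable_sum KK_integrable col) auto
  also have "... = (\<Sum>i<n. \<Sum>j<k. \<Sum>h\<in>Us. (\<integral>x. ?K x (j, h) (i, []) \<partial>M))"
   by (simp add: Bochner_Integration.integral_sum KK_integrable)
  also have "... = (\<Sum>i<n. \<Sum>j<k. \<Sum>h\<in>Us. (\<integral>x. ?K x (j, []) (i, ginv h) \<partial>M))"
   by (intro sum.cong refl move)
  also have "... = (\<Sum>j<k. \<Sum>i<n. \<Sum>h\<in>Us. (\<integral>x. ?K x (j, []) (i, ginv h) \<partial>M))" by (rule sum.swap)
  also have "... = (\<Sum>j<k. (\<integral>x. (\<Sum>i<n. \<Sum>h\<in>Us. ?K x (j, []) (i, ginv h)) \<partial>M))"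
   by (simp add: Bochner_Integration.integral_sum KK_integrable)
  also have "... \<le> (\<Sum>j<k. (\<integral>x. indicator (Dm j) x \<partial>M))"
   by (intro sum_mono integral_mono Bochner_Integration.integrable_sum KK_integrable row) (use Dm in \<open>auto simp: emeasure_eq_measure\<close>)
  also have "... = (\<Sum>j<k. prob (Dm j))" using Dm sets.sets_into_space by (intro sum.cong refl) (simp add: Int_absorb1)
  finally show ?thesis .
 qed
 have "(\<lambda>l. real n * (1 - \<rho> ^ l)) \<longlonglongrightarrow> real n * (1 - 0)"
  using rho by (intro tendsto_intros LIMSEQ_realpow_zero)
 hence "real n * (1 - 0) \<le> (\<Sum>j<k. prob (Dm j))" by (rule LIMSEQ_le_const2) (use main in blast)
 thus ?thesis by simp
qed

end

section \<open>Cost\<close>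

text \<open>The analogue of \<open>swp\<close> for a map that is injective only on \<open>A\<close>,
  as partial isomorphisms are.\<close>

definition pswp :: "'a set => ('a => 'a) => 'a => 'a" where
 "pswp A g x = (if x \<in> A then g x else if x \<in> g ` A then inv_into A g x else x)"

lemma pswp_pswp:
 assumes "inj_on g A" "A \<inter> g ` A = {}" shows "pswp A g (pswp A g x) = x"
proof -
 consider "x \<in> A" | "x \<in> g ` A" "x \<notin> A" | "x \<notin> A" "x \<notin> g ` A" by blast
 thus ?thesis
 proof cases
  case 1
  hence "g x \<notin> A" using assms(2) by blast
  thus ?thesis using 1 assms(1) by (simp add: pswp_def)
 next
  case 2
  thus ?thesis by (simp add: pswp_def inv_into_into f_inv_into_f)
 qed (simp add: pswp_def)
qed

lemma borel_iso_restrict: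
 assumes A: "A \<in> sets M" and B: "\<theta> ` A \<in> sets M"
  and iso: "borel_iso (restrict_space M A) (restrict_space M (\<theta> ` A)) \<theta>"
 shows "inj_on \<theta> A" "\<And>C. C \<in> sets M ==> {x \<in> A. \<theta> x \<in> C} \<in> sets M"
  "\<And>C. C \<in> sets M ==> C \<subseteq> A ==> \<theta> ` C \<in> sets M"
proof -
 have sp: "space (restrict_space M A) = A" "space (restrict_space M (\<theta> ` A)) = \<theta> ` A"
  using A B sets.sets_into_space by (auto simp: space_restrict_space)
 have si: "X \<in> sets (restrict_space M Y) \<longleftrightarrow> X \<subseteq> Y \<and> X \<in> sets M" if "Y \<in> sets M" for X Y
  using that by (intro sets_restrict_space_iff) auto
 note I = iso[unfolded borel_iso_def sp]
 show inj: "inj_on \<theta> A" using I by (simp add: bij_betw_def)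
 show "{x \<in> A. \<theta> x \<in> C} \<in> sets M" if C: "C \<in> sets M" for C
 proof -
  have "C \<inter> \<theta> ` A \<in> sets (restrict_space M (\<theta> ` A))" using si[OF B] C B by blast
  hence "\<theta> -` (C \<inter> \<theta> ` A) \<inter> space (restrict_space M A) \<in> sets (restrict_space M A)"
   using I measurable_sets by blast
  moreover have "\<theta> -` (C \<inter> \<theta> ` A) \<inter> space (restrict_space M A) = {x \<in> A. \<theta> x \<in> C}" using sp by blast
  ultimately show ?thesis using si[OF A] by simp
 qed
 show "\<theta> ` C \<in> sets M" if C: "C \<in> sets M" "C \<subseteq> A" for C
 proof -
  have "C \<in> sets (restrict_space M A)" using si[OF A] C by blast
  hence "inv_into A \<theta> -` C \<inter> space (restrict_space M (\<theta> ` A)) \<in> sets (restrict_space M (\<theta> ` A))"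
   using I measurable_sets by blast
  moreover have "inv_into A \<theta> -` C \<inter> space (restrict_space M (\<theta> ` A)) = \<theta> ` C"
   unfolding sp using C(2) inj by (auto simp: inv_into_f_f subset_iff)
  ultimately show ?thesis using si[OF B] by simp
 qed
qed

text \<open>The involution is a Borel automorphism with graph in \<open>E\<close>, so the hypothesis
  on \<open>E\<close> makes it preserve the measure; in this way the measure enters for partial
  isomorphisms.\<close>

lemma (in std_prob) pswp_mpa:
 assumes E: "equiv (space M) E" and mp: "measure_preserving_rel M E"
  and A: "A \<in> sets M" and B: "\<theta> ` A \<in> sets M"
  and iso: "borel_iso (restrict_space M A) (restrict_space M (\<theta> ` A)) \<theta>"
  and AE: "\<And>x. x \<in> A ==> (x, \<theta> x) \<in> E"
  and P: "P \<in> sets M" "P \<subseteq> A" "P \<inter> \<theta> ` P = {}"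
 shows "pswp P \<theta> \<in> mpa" "x \<in> space M ==> (x, pswp P \<theta> x) \<in> E"
proof -
 note I = borel_iso_restrict[OF A B iso]
 have inj: "inj_on \<theta> P" using I(1) P(2) by (rule inj_on_subset)
 let ?f = "pswp P \<theta>"
 have ff: "?f (?f x) = x" for x by (rule pswp_pswp[OF inj P(3)])
 have E1: "E \<subseteq> space M \<times> space M" "sym E" using E by (auto simp: equiv_def)
 have rE: "(x, x) \<in> E" if "x \<in> space M" for x using E that by (auto simp: equiv_def refl_on_def)
 have "\<theta> ` P \<subseteq> \<theta> ` A" using P(2) by (rule image_mono)
 hence AX2: "\<theta> ` P \<subseteq> space M" using sets.sets_into_space[OF B] by (rule order_trans)
 note AX = sets.sets_into_space[OF P(1)] AX2
 show fE: "(x, ?f x) \<in> E" if x: "x \<in> space M" for x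
 proof -
  consider "x \<in> P" | "x \<in> \<theta> ` P" "x \<notin> P" | "x \<notin> P" "x \<notin> \<theta> ` P" by blast
  thus ?thesis
  proof cases
   case 1
   thus ?thesis using AE P(2) by (auto simp: pswp_def)
  next
   case 2
   then obtain y where y: "y \<in> P" "x = \<theta> y" by blast
   hence "?f x = y" using 2 inj by (simp add: pswp_def)
   thus ?thesis using AE[of y] y P(2) E1(2) by (auto dest: symD)
  next
   case 3
   thus ?thesis using rE[OF x] by (simp add: pswp_def)
  qed
 qed
 have fs: "?f x \<in> space M" if "x \<in> space M" for x using fE[OF that] E1(1) by blast
 have fo: "?f x = x" if "x \<notin> space M" for x using that AX by (auto simp: pswp_def)
 have bij: "bij ?f" by (rule o_bij[of ?f]) (auto simp: ff)
 have inv: "inv ?f = ?f" by (rule inv_equality) (simp_all only: ff)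
 have fm: "?f \<in> measurable M M"
 proof (rule measurableI)
  fix C assume C: "C \<in> sets M"
  have "?f -` C \<inter> space M = (P \<inter> {x \<in> A. \<theta> x \<in> C}) \<union> \<theta> ` (P \<inter> C) \<union> (C - P - \<theta> ` P)" (is "?L = ?R")
  proof (rule Set.set_eqI)
   fix x
   consider "x \<in> P" | "x \<in> \<theta> ` P" "x \<notin> P" | "x \<notin> P" "x \<notin> \<theta> ` P" by blast
   thus "x \<in> ?L \<longleftrightarrow> x \<in> ?R"
   proof cases
    case 1
    thus ?thesis using P AX by (auto simp: pswp_def)
   next
    case 2
    then obtain y where y: "y \<in> P" "x = \<theta> y" by blast
    hence "?f x = y" using 2 inj by (simp add: pswp_def)
    moreover have "x \<in> \<theta> ` (P \<inter> C) \<longleftrightarrow> y \<in> C" using y inj by (auto dest: inj_onD)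
    ultimately show ?thesis using 2 AX by auto
   next
    case 3
    thus ?thesis using C sets.sets_into_space by (auto simp: pswp_def)
   qed
  qed
  moreover have "P \<inter> {x \<in> A. \<theta> x \<in> C} \<in> sets M" using P(1) I(2)[OF C] by (rule sets.Int)
  moreover have "\<theta> ` (P \<inter> C) \<in> sets M" using P C by (intro I(3)) auto
  moreover have "\<theta> ` P \<in> sets M" using P by (intro I(3))
  ultimately show "?f -` C \<inter> space M \<in> sets M" using C P(1) by simp
 qed (rule fs)
 have "inj_on ?f (space M)" using bij by (meson bij_def inj_on_subset subset_UNIV)
 hence "inv_into (space M) ?f x = ?f x" if "x \<in> space M" for x
  by (rule inv_into_f_eq) (use that fs ff in auto)
 hence im: "inv_into (space M) ?f \<in> measurable M M"
  by (intro measurable_cong[THEN iffD1, OF _ fm]) simp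
 have "bij_betw ?f (space M) (space M)"
  by (rule bij_betw_byWitness[of _ ?f]) (use ff fs in auto)
 hence "borel_iso M M ?f" using fm im by (simp add: borel_iso_def)
 hence "distr M M ?f = M" using mp fE unfolding measure_preserving_rel_def by blast
 thus "?f \<in> mpa" unfolding mpa_def using bij fo fm inv by simp
qed

lemma smallest_equiv_subset: "equiv X R ==> G \<subseteq> R ==> smallest_equiv X G \<subseteq> R"
 unfolding smallest_equiv_def by blast

text \<open>A family that witnesses the cost is cut into partial maps with disjoint domain and
  range, which does not increase the total measure, and each is extended to an involution.\<close>

theorem full_group_upper_bound:
 fixes M :: "'a measure" and E :: "('a \<times> 'a) set"
 assumes sb: "standard_borel M" and pr: "prob_space M" and na: "non_atomic M"
  and be: "borel_equiv M E"
  and mp: "measure_preserving_rel M E" and er: "ergodic_rel M E" and c: "cost M E < of_nat n"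
 shows "t_full_group M E \<le> enat (2 * n)"
proof -
 obtain A \<theta> where gf: "generating_family M E A \<theta>" and lt: "(\<Sum>i. emeasure M (A i)) < of_nat n"
  using c unfolding cost_def Inf_less_iff by blast
 obtain U where "std_prob M U" using standard_borel_std_prob[OF sb pr] by blast
 then interpret std_prob M U .
 have E: "equiv (space M) E" using be by (simp add: borel_equiv_def)
 have EX: "E \<subseteq> space M \<times> space M" using E by (auto simp: equiv_def)
 have A: "A i \<in> sets M" and B: "\<theta> i ` A i \<in> sets M"
  and iso: "borel_iso (restrict_space M (A i)) (restrict_space M (\<theta> i ` A i)) (\<theta> i)"
  and AE: "\<And>x. x \<in> A i ==> (x, \<theta> i x) \<in> E" for i
  using gf unfolding generating_family_def by auto
 let ?Gr = "\<Union>i. {(y, \<theta> i y) | y. y \<in> A i}"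
 let ?SE = "smallest_equiv (space M) ?Gr"
 have gen: "AE x in M. E `` {x} = ?SE `` {x}" using gf unfolding generating_family_def by blast
 note I = borel_iso_restrict[OF A B iso]
 \<comment> \<open>The set \<open>U k\<close> contains these points but not their images, so domain
   and image are disjoint. Only fixed points of \<open>\<theta> i\<close> are lost, and they
   generate nothing.\<close>
 define P0 where "P0 i k = (A i \<inter> U k) - {x \<in> A i. \<theta> i x \<in> U k}" for i k
 have P0s: "P0 i k \<in> sets M" for i k unfolding P0_def using A I(2)[OF U_sets] by auto
 define P where "P i = disjointed (P0 i)" for i
 have PP0: "P i k \<subseteq> P0 i k" for i k unfolding P_def by (rule disjointed_subset)
 have Ps: "P i k \<in> sets M" for i k
 proof -
  have "range (P0 i) \<subseteq> sets M" using P0s by blast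
  from sets.range_disjointed_sets[OF this] show ?thesis unfolding P_def by blast
 qed
 have Pd: "disjoint_family (P i)" for i unfolding P_def by (rule disjoint_family_disjointed)
 have PA: "P i k \<subseteq> A i" for i k using PP0[of i k] by (auto simp: P0_def)
 have Pdis: "P i k \<inter> \<theta> i ` P i k = {}" for i k using PP0[of i k] by (auto simp: P0_def)
 have PU: "x \<in> (\<Union>k. P i k)" if x: "x \<in> A i" "\<theta> i x ~= x" for x i
 proof -
  have "x \<in> space M" "\<theta> i x \<in> space M" using AE[OF x(1)] EX by auto
  then obtain k where "x \<in> U k" "\<theta> i x \<notin> U k" using sep[of x "\<theta> i x"] x(2) by auto
  hence "x \<in> (\<Union>k. P0 i k)" using x(1) by (auto simp: P0_def)
  thus ?thesis unfolding P_def by (simp only: UN_disjointed_eq)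
 qed
 define ix where "ix p = fst (prod_decode p)" for p
 define As where "As p = P (ix p) (snd (prod_decode p))" for p
 define gs where "gs p = pswp (As p) (\<theta> (ix p))" for p
 have Asp: "As p \<in> sets M" "As p \<subseteq> A (ix p)" "As p \<inter> \<theta> (ix p) ` As p = {}" for p
  unfolding As_def by (rule Ps, rule PA, rule Pdis)
 have gm: "gs p \<in> mpa" and gE: "\<And>x. x \<in> space M ==> (x, gs p x) \<in> E" for p
  unfolding gs_def by (rule pswp_mpa(1)[OF E mp A B iso AE Asp], simp, rule pswp_mpa(2)[OF E mp A B iso AE Asp])
 have gg: "gs p (gs p x) = x" for p x
  unfolding gs_def by (rule pswp_pswp[OF inj_on_subset[OF I(1) Asp(2)] Asp(3)])
 have gth: "\<exists>p. gs p x = \<theta> i x" if x: "x \<in> A i" "\<theta> i x ~= x" for x i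
 proof -
  obtain k where k: "x \<in> P i k" using PU[OF x] by blast
  have "gs (prod_encode (i, k)) x = \<theta> i x" using k by (simp add: gs_def As_def ix_def pswp_def)
  thus ?thesis by blast
 qed
 have supp: "x \<in> As p \<or> gs p x \<in> As p" if "gs p x ~= x" for p x
 proof (rule ccontr)
  assume n: "\<not> (x \<in> As p \<or> gs p x \<in> As p)"
  hence "x \<in> \<theta> (ix p) ` As p" using that by (auto simp: gs_def pswp_def split: if_splits)
  hence "gs p x \<in> As p" using n by (simp add: gs_def pswp_def inv_into_into)
  thus False using n by blast
 qed
 have fin: "(\<Sum>i. ennreal (prob (A i))) < of_nat n" using lt by (simp add: emeasure_eq_measure)
 hence "(\<Sum>i. ennreal (prob (A i))) ~= Orderings.top" by (metis not_less_iff_gr_or_eq of_nat_less_top order_less_trans)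
 hence sA: "summable (\<lambda>i. prob (A i))" by (intro summable_suminf_not_top) auto
 hence "ennreal (\<Sum>i. prob (A i)) < ennreal (real n)"
  using fin by (simp add: suminf_ennreal2 ennreal_of_nat_eq_real_of_nat)
 hence An: "(\<Sum>i. prob (A i)) < real n" by (simp add: ennreal_less_iff suminf_nonneg[OF sA])
 have sAs: "summable (\<lambda>p. prob (As p))" and "(\<Sum>p. prob (As p)) \<le> (\<Sum>i. prob (A i))"
  unfolding As_def ix_def by (rule pieces_summable[OF Ps Pd PA A sA])+
 hence Asn: "(\<Sum>p. prob (As p)) < real n" using An by linarith
 interpret gam M U gs
 proof
  show "non_atomic M" by (rule na)
  show "gs i \<in> mpa" for i by (rule gm)
  show "gs i (gs i x) = x" for i x by (rule gg)
  fix D assume D: "D \<in> sets M" and inv: "\<And>i x. x \<in> D ==> gs i x \<in> D"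
  from saturate[of gs, OF gm gen] obtain Z where Z0: "Z \<in> sets M"
   and Z1: "prob Z = 1 \<and> (\<forall>x\<in>Z. E `` {x} = ?SE `` {x}) \<and> (\<forall>k x. gs k x \<in> Z \<longleftrightarrow> x \<in> Z)" by (rule bexE)
  \<comment> \<open>Invariance under the involutions gives invariance under \<open>E\<close> only
    where the family generates the class. Hence the restriction to the saturated conull set
    \<open>Z\<close>.\<close>
  let ?D = "D \<inter> Z"
  have DZ: "gs p x \<in> ?D \<longleftrightarrow> x \<in> ?D" for p x using inv[of x p] inv[of "gs p x" p] Z1 gg[of p x] by auto
  have "?SE \<subseteq> {(x, y). x \<in> space M \<and> y \<in> space M \<and> (x \<in> ?D \<longleftrightarrow> y \<in> ?D)}"
  proof (rule smallest_equiv_subset)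
   show "equiv (space M) {(x, y). x \<in> space M \<and> y \<in> space M \<and> (x \<in> ?D \<longleftrightarrow> y \<in> ?D)}"
    by (rule equivI) (auto simp: refl_on_def sym_def trans_def)
   show "?Gr \<subseteq> {(x, y). x \<in> space M \<and> y \<in> space M \<and> (x \<in> ?D \<longleftrightarrow> y \<in> ?D)}"
   proof
    fix z assume "z \<in> ?Gr"
    then obtain i y where y: "y \<in> A i" "z = (y, \<theta> i y)" by blast
    have "y \<in> space M" "\<theta> i y \<in> space M" using AE[OF y(1)] EX by auto
    moreover have "y \<in> ?D \<longleftrightarrow> \<theta> i y \<in> ?D"
    proof (cases "\<theta> i y = y")
     case False
     then obtain p where "gs p y = \<theta> i y" using gth[OF y(1)] by blast
     thus ?thesis using DZ[of p y] by simp
    qed simp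
    ultimately show "z \<in> {(x, y). x \<in> space M \<and> y \<in> space M \<and> (x \<in> ?D \<longleftrightarrow> y \<in> ?D)}" using y(2) by blast
   qed
  qed
  hence "E `` ?D \<subseteq> ?D" using Z1 by blast
  moreover have "?D \<in> sets M" using D Z0 by auto
  ultimately have "emeasure M ?D = 0 \<or> emeasure M ?D = 1" using er unfolding ergodic_rel_def by blast
  hence "prob ?D = 0 \<or> prob ?D = 1" by (auto simp: measure_def)
  moreover have "prob ?D = prob D"
  proof -
   have "AE x in M. x \<in> Z" using Z0 Z1 prob_eq_1 by blast
   thus ?thesis by (intro measure_eq_AE) (use D Z0 in auto)
  qed
  ultimately show "prob D = 0 \<or> prob D = 1" by simp
 qed
 have wE: "(x, wd w x) \<in> E" if x: "x \<in> space M" for x w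
 proof (induction w)
  case Nil show ?case using E x by (auto simp: equiv_def refl_on_def)
 next
  case (Cons p w)
  have "(wd w x, gs p (wd w x)) \<in> E" using Cons EX by (intro gE) blast
  thus ?case using Cons E by (auto simp: equiv_def dest: transD)
 qed
 have Eo: "AE x in M. \<forall>y. (x, y) \<in> E --> orb x y"
  using gen
 proof eventually_elim
  case (elim x)
  have "?SE \<subseteq> {(x, y). x \<in> space M \<and> y \<in> space M \<and> orb x y}"
  proof (rule smallest_equiv_subset)
   show "equiv (space M) {(x, y). x \<in> space M \<and> y \<in> space M \<and> orb x y}"
    by (rule equivI) (auto simp: refl_on_def sym_def trans_def intro: orb_sym orb_trans)
   show "?Gr \<subseteq> {(x, y). x \<in> space M \<and> y \<in> space M \<and> orb x y}"
   proof
    fix z assume "z \<in> ?Gr"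
    then obtain i y where y: "y \<in> A i" "z = (y, \<theta> i y)" by blast
    have "y \<in> space M" "\<theta> i y \<in> space M" using AE[OF y(1)] EX by auto
    moreover have "orb y (\<theta> i y)"
    proof (cases "\<theta> i y = y")
     case False
     then obtain p where "gs p y = \<theta> i y" using gth[OF y(1)] by blast
     thus ?thesis using orb_gs[of y p] by simp
    qed simp
    ultimately show "z \<in> {(x, y). x \<in> space M \<and> y \<in> space M \<and> orb x y}" using y(2) by blast
   qed
  qed
  thus ?case using elim by blast
 qed
 have F: "fullg = {f\<in>mpa. AE x in M. (x, f x) \<in> E}"
 proof (rule Set.set_eqI)
  fix f
  have "(AE x in M. orb x (f x)) \<longleftrightarrow> (AE x in M. (x, f x) \<in> E)"
  proof
   assume "AE x in M. orb x (f x)"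
   thus "AE x in M. (x, f x) \<in> E"
    using AE_space by eventually_elim (use wE in \<open>auto simp: orb_def\<close>)
  next
   assume "AE x in M. (x, f x) \<in> E"
   thus "AE x in M. orb x (f x)" using Eo by eventually_elim blast
  qed
  thus "f \<in> fullg \<longleftrightarrow> f \<in> {f\<in>mpa. AE x in M. (x, f x) \<in> E}" by (simp add: fullg_def)
 qed
 have "\<exists>S. finite S \<and> S \<subseteq> fullg \<and> card S \<le> 2 * n \<and> (\<forall>G. clgrp G --> S \<subseteq> G --> fullg \<subseteq> G)"
  by (rule upper_bound[OF Asp(1) supp sAs Asn])
 then obtain S where S: "finite S" "S \<subseteq> fullg" "card S \<le> 2 * n" "\<And>G. clgrp G ==> S \<subseteq> G ==> fullg \<subseteq> G"
  by blast
 show ?thesis by (rule t_full_group_le[OF sb E F S])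
qed

section \<open>Generators of orbit relations\<close>

lemma sum_lessThan_add: "(\<Sum>j<k + n. f j) = (\<Sum>j<k. f j) + (\<Sum>i<n::nat. f (k + i) :: real)"
 by (induction n) (simp_all add: add.assoc)

text \<open>Truncation reduces to the bounded case: where a tree edge has no short chain with small
  group elements, the edge itself is added as a generator. The domains added have measure tending to
  0.\<close>

theorem (in free_group_action) chain_inequality:
 fixes k :: nat
 assumes Dm: "\<And>j. Dm j \<in> sets M" and th: "\<And>j. th j \<in> measurable M (count_space UNIV)"
  and thG: "\<And>j x. th j x \<in> \<Gamma>"
  and hyp: "AE x in M. \<forall>i<n. \<exists>l. (\<forall>(j, u, s)\<in>set l. j < k \<and> u \<in> \<Gamma>) \<and> ok Dm th i l x"
 shows "real n \<le> (\<Sum>j<k. prob (Dm j))"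
proof -
 note Dms = Dm
 define val where "val l \<longleftrightarrow> (\<forall>(j, u, s)\<in>set l. j < k \<and> u \<in> \<Gamma>)" for l :: "(nat \<times> letter list \<times> bool) list"
 define VN :: "nat => letter list set" where "VN N = from_nat ` {..<N}" for N
 define DN where "DN N j = {x \<in> Dm j. th j x \<in> VN N}" for N j
 have DNs: "DN N j \<in> sets M" for N j
 proof -
  have "DN N j = Dm j \<inter> (th j -` VN N \<inter> space M)" using sets.sets_into_space[OF Dm] by (auto simp: DN_def)
  thus ?thesis using measurable_sets[OF th, of "VN N" j] Dm by simp
 qed
 define Y where "Y N i = {x \<in> space M. \<exists>p<N. val (from_nat p) \<and> ok (DN N) th i (from_nat p) x}" for N i
 have Ys: "Y N i \<in> sets M" for N i
 proof -
  have "Y N i = (\<Union>p\<in>{p. p < N \<and> val (from_nat p)}. {x \<in> space M. ok (DN N) th i (from_nat p) x})" by (auto simp: Y_def)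
  also have "... \<in> sets M"
  proof (rule sets.finite_UN)
   fix p assume p: "p \<in> {p. p < N \<and> val (from_nat p)}"
   show "{x \<in> space M. ok (DN N) th i (from_nat p) x} \<in> sets M"
   proof (rule ok_sets[OF th _ DNs])
    fix j u s assume "(j, u, s) \<in> set (from_nat p :: (nat \<times> letter list \<times> bool) list)"
    thus "u \<in> \<Gamma>" using p by (auto simp: val_def)
   qed
  qed simp
  finally show ?thesis .
 qed
 have DNmono: "DN N j \<subseteq> DN N' j" if "N \<le> N'" for N N' j using that by (auto simp: DN_def VN_def)
 have Ymono: "Y N i \<subseteq> Y N' i" if "N \<le> N'" for N N' i
 proof
  fix x assume "x \<in> Y N i"
  then obtain p where p: "x \<in> space M" "p < N" "val (from_nat p)" "ok (DN N) th i (from_nat p) x" by (auto simp: Y_def)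
  have "ok (DN N') th i (from_nat p) x" using p(4) DNmono[OF that] unfolding ok_def by fast
  moreover have "p < N'" using p(2) that by simp
  ultimately show "x \<in> Y N' i" using p unfolding Y_def by blast
 qed
 have bound: "real n \<le> (\<Sum>j<k. prob (Dm j)) + (\<Sum>i<n. 1 - prob (Y N i))" for N
 proof -
  \<comment> \<open>Indices below \<open>k\<close> are the truncated maps, and index
    \<open>k + i\<close> is the \<open>i\<close>-th generator restricted to the points that still
    need it.\<close>
  define D' where "D' j = (if j < k then DN N j else if j < k + n then space M - Y N (j - k) else {})" for j
  define th' where "th' j x = (if j < k then (if th j x \<in> VN N then th j x else []) else if j < k + n then [(j - k, True)] else [])" for j x
  define V where "V = insert [] ((VN N \<inter> \<Gamma>) \<union> (\<lambda>i. [(i, True)]) ` {..<n})"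
  define PL where "PL = filter val (map from_nat [0..<N]) @ map (\<lambda>i. [(k + i, [], True)]) [0..<n]"
  interpret chain_cover M n \<phi> "k + n" D' th' V PL
  proof
   show "D' j \<in> sets M" for j using DNs Ys by (auto simp: D'_def)
   show "th' j \<in> measurable M (count_space UNIV)" for j
   proof -
    have "(\<lambda>v. if v \<in> VN N then v else []) \<in> measurable (count_space UNIV) (count_space UNIV)" by simp
    from measurable_compose[OF th this] have "(\<lambda>x. if th j x \<in> VN N then th j x else []) \<in> measurable M (count_space UNIV)" .
    thus ?thesis by (cases "j < k"; cases "j < k + n") (simp_all add: th'_def[abs_def])
   qed
   show "th' j x \<in> V" for j x using thG by (auto simp: th'_def V_def)
   show "finite V" by (simp add: V_def VN_def)
   show "V \<subseteq> \<Gamma>" using G_Nil G_gen by (auto simp: V_def)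
   show "j < k + n \<and> u \<in> \<Gamma>" if "l \<in> set PL" "(j, u, s) \<in> set l" for l j u s
    using that G_Nil by (force simp: PL_def val_def)
   fix i x assume i: "i < n" and x: "x \<in> space M"
   show "\<exists>l\<in>set PL. ok D' th' i l x"
   proof (cases "x \<in> Y N i")
    case True
    then obtain p where p: "p < N" "val (from_nat p)" "ok (DN N) th i (from_nat p) x" by (auto simp: Y_def)
    let ?l = "from_nat p :: (nat \<times> letter list \<times> bool) list"
    have e: "j < k" "\<phi> u x \<in> DN N j" if "(j, u, s) \<in> set ?l" for j u s
     using p(2,3) that unfolding val_def ok_def by fast+
    have "chain th' x ?l \<psi> = chain th x ?l \<psi>" for \<psi>
     unfolding chain_def
    proof (rule arg_cong[where f = sum_list], rule map_cong[OF refl])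
     fix z assume z: "z \<in> set ?l"
     obtain j u s where zz: "z = (j, u, s)" by (cases z) auto
     have "j < k" "\<phi> u x \<in> DN N j" using e z zz by auto
     hence "th' j (\<phi> u x) = th j (\<phi> u x)" by (simp add: th'_def DN_def)
     thus "(case z of (j, u, s) => sg s * (\<psi> (mul (th' j (\<phi> u x)) u) - \<psi> u)) =
       (case z of (j, u, s) => sg s * (\<psi> (mul (th j (\<phi> u x)) u) - \<psi> u))" by (simp add: zz)
    qed
    moreover have "\<forall>(j, u, s)\<in>set ?l. \<phi> u x \<in> D' j" using e by (auto simp: D'_def)
    ultimately have "ok D' th' i ?l x" using p(3) unfolding ok_def by simp
    moreover have "?l \<in> set PL" using p by (auto simp: PL_def)
    ultimately show ?thesis by blast
   next
    case False
    have "ok D' th' i [(k + i, [], True)] x"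
     using False i x phi_Nil[OF x] by (simp add: ok_def chain_def D'_def th'_def sg_def cancel_cons_def)
    moreover have "[(k + i, [], True)] \<in> set PL" using i by (auto simp: PL_def)
    ultimately show ?thesis by blast
   qed
  qed
  have "real n \<le> (\<Sum>j<k + n. prob (D' j))" by (rule bounded_inequality)
  also have "... = (\<Sum>j<k. prob (D' j)) + (\<Sum>i<n. prob (D' (k + i)))" by (rule sum_lessThan_add)
  also have "(\<Sum>j<k. prob (D' j)) \<le> (\<Sum>j<k. prob (Dm j))"
   using Dms by (intro sum_mono finite_measure_mono) (auto simp: D'_def DN_def)
  also have "(\<Sum>i<n. prob (D' (k + i))) = (\<Sum>i<n. 1 - prob (Y N i))"
   by (intro sum.cong refl) (simp add: D'_def prob_compl Ys)
  finally show ?thesis by simp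
 qed
 have lim: "(\<lambda>N. prob (Y N i)) \<longlonglongrightarrow> 1" if i: "i < n" for i
 proof -
  have "(\<lambda>N. prob (Y N i)) \<longlonglongrightarrow> prob (\<Union>N. Y N i)"
   using Ys Ymono by (intro finite_Lim_measure_incseq) (auto simp: incseq_def)
  moreover have "AE x in M. x \<in> (\<Union>N. Y N i)"
   using hyp AE_space
  proof eventually_elim
   case (elim x)
   then obtain l where l: "val l" "ok Dm th i l x" using i unfolding val_def by blast
   \<comment> \<open>Larger than the code of the chain and the codes of all group elements that
     occur in it.\<close>
   define N where "N = Suc (to_nat l + (\<Sum>e\<in>set l. Suc (to_nat (th (fst e) (\<phi> (fst (snd e)) x)))))"
   have le: "to_nat (th (fst e) (\<phi> (fst (snd e)) x)) < N" if "e \<in> set l" for e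
   proof -
    have "Suc (to_nat (th (fst e) (\<phi> (fst (snd e)) x))) \<le> (\<Sum>e\<in>set l. Suc (to_nat (th (fst e) (\<phi> (fst (snd e)) x))))"
     using that by (intro member_le_sum) auto
    thus ?thesis by (simp add: N_def)
   qed
   have "th j (\<phi> u x) \<in> VN N" if "(j, u, s) \<in> set l" for j u s
    unfolding VN_def using le[OF that] by (intro image_eqI[of _ _ "to_nat (th j (\<phi> u x))"]) auto
   hence "ok (DN N) th i l x" using l(2) unfolding ok_def DN_def by fast
   hence "x \<in> Y N i" using l(1) elim(2) unfolding Y_def
    by (intro CollectI conjI exI[of _ "to_nat l"]) (simp_all add: N_def)
   thus ?case by blast
  qed
  ultimately show ?thesis using prob_eq_1[of "\<Union>N. Y N i"] Ys by auto
 qed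
 have "(\<lambda>N. (\<Sum>j<k. prob (Dm j)) + (\<Sum>i<n. 1 - prob (Y N i))) \<longlonglongrightarrow> (\<Sum>j<k. prob (Dm j)) + (\<Sum>i<n. 1 - 1)"
  by (intro tendsto_intros lim) auto
 hence "real n \<le> (\<Sum>j<k. prob (Dm j)) + (\<Sum>i<n. 1 - 1)"
  by (rule LIMSEQ_le_const) (use bound in blast)
 thus ?thesis by simp
qed

section \<open>From connectivity to chains\<close>

definition edges :: "nat => (nat => 'a set) => (nat => 'a => 'a) => ('a \<times> 'a) set" where
 "edges k Dm f = {(z, f j z) | j z. j < k \<and> z \<in> Dm j}"

definition conn :: "nat => (nat => 'a set) => (nat => 'a => 'a) => ('a \<times> 'a) set" where
 "conn k Dm f = (edges k Dm f \<union> (edges k Dm f)\<inverse>)\<^sup>*"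

lemma conn_edge: "j < k ==> z \<in> Dm j ==> (z, f j z) \<in> conn k Dm f"
 unfolding conn_def edges_def by (rule r_into_rtrancl) blast

lemma conn_refl: "(x, x) \<in> conn k Dm f"
 by (simp add: conn_def)

lemma conn_sym: "(x, y) \<in> conn k Dm f ==> (y, x) \<in> conn k Dm f"
 unfolding conn_def by (rule symD[OF sym_rtrancl[OF sym_Un_converse]])

lemma conn_trans: "(x, y) \<in> conn k Dm f ==> (y, z) \<in> conn k Dm f ==> (x, z) \<in> conn k Dm f"
 unfolding conn_def by (rule rtrancl_trans)

locale std_action = std_prob M U + free_group_action M n \<phi> for M :: "'a measure" and U n \<phi>
begin

lemma AE_phi:
 assumes u: "u \<in> \<Gamma>" and P: "AE x in M. P x" shows "AE x in M. P (\<phi> u x)"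
proof -
 have "distr M M (\<phi> u) = M" using act u by (simp add: mp_action_def)
 hence "AE x in distr M M (\<phi> u). P x" using P by (rule ssubst)
 thus ?thesis by (rule AE_distrD[OF phi_measurable[OF u]])
qed

lemma phi_ginv: "u \<in> \<Gamma> ==> x \<in> space M ==> \<phi> (ginv u) (\<phi> u x) = x"
 using phi_mul[of "ginv u" u x] G_ginv mul_ginv(1)[of u] phi_Nil by simp

text \<open>A walk in the graph of the maps, read along the orbit, is a chain ending at some group
  element. Freeness identifies this element when the walk ends at the image of \<open>x\<close>
  under a generator.\<close>

theorem graph_inequality:
 assumes Dm: "\<And>j. Dm j \<in> sets M" and f: "\<And>j. f j \<in> mpa"
  and forb: "AE x in M. \<forall>j. \<exists>u\<in>\<Gamma>. f j x = \<phi> u x"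
  and free: "AE x in M. \<forall>u\<in>\<Gamma>. \<phi> u x = x --> u = []"
  and con: "AE x in M. \<forall>i<n. (x, \<phi> [(i, True)] x) \<in> conn k Dm f"
 shows "real n \<le> (\<Sum>j<k. prob (Dm j))"
proof -
 let ?R = "edges k Dm f \<union> (edges k Dm f)\<inverse>"
 define Q where "Q j x p \<longleftrightarrow> from_nat p \<in> \<Gamma> \<and> f j x = \<phi> (from_nat p) x" for j x and p :: nat
 \<comment> \<open>The least code makes the choice of the group element measurable;
   \<open>[]\<close> is a default value on a null set.\<close>
 define th :: "nat => 'a => letter list" where "th j x = (if \<exists>p. Q j x p then from_nat (LEAST p. Q j x p) else [])" for j x
 have Qs: "Measurable.pred M (\<lambda>x. Q j x p)" for j p
 proof (cases "from_nat p \<in> \<Gamma>")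
  case True
  have "{x \<in> space M. f j x = \<phi> (from_nat p) x} \<in> sets M" by (rule eq_sets[OF mpaD(5)[OF f] phi_measurable[OF True]])
  thus ?thesis using True by (simp add: Q_def pred_def)
 qed (simp add: Q_def)
 have thme: "th j \<in> measurable M (count_space UNIV)" for j
 proof -
  have 1: "(\<lambda>x. LEAST p. Q j x p) \<in> measurable M (count_space UNIV)" by (rule measurable_Least[OF Qs])
  have 2: "(\<lambda>x. from_nat (LEAST p. Q j x p) :: letter list) \<in> measurable M (count_space UNIV)"
   by (rule measurable_compose[OF 1]) simp
  have "Measurable.pred M (\<lambda>x. \<exists>p. Q j x p)" using Qs by measurable
  hence s: "{x \<in> space M. \<exists>p. Q j x p} \<in> sets M" by (simp add: pred_def)
  show ?thesis unfolding th_def[abs_def] by (rule measurable_If[OF 2 _ s]) simp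
 qed
 have thQ1: "from_nat (LEAST p. Q j x p) \<in> \<Gamma> \<and> f j x = \<phi> (from_nat (LEAST p. Q j x p)) x" if h: "\<exists>p. Q j x p" for j x
  using LeastI_ex[OF h] unfolding Q_def .
 have thG: "th j x \<in> \<Gamma>" for j x
 proof (cases "\<exists>p. Q j x p")
  case True
  show ?thesis unfolding th_def if_P[OF True] using thQ1[OF True] by (rule conjunct1)
 next
  case False
  show ?thesis unfolding th_def if_not_P[OF False] by (rule G_Nil)
 qed
 have thQ: "f j x = \<phi> (th j x) x" if h: "\<exists>u\<in>\<Gamma>. f j x = \<phi> u x" for j x
 proof -
  obtain u where "u \<in> \<Gamma>" "f j x = \<phi> u x" using h by blast
  hence "Q j x (to_nat u)" by (simp add: Q_def)
  hence ex: "\<exists>p. Q j x p" by blast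
  have "th j x = from_nat (LEAST p. Q j x p)" unfolding th_def by (rule if_P[OF ex])
  thus ?thesis using thQ1[OF ex] by (simp only: simp_thms)
 qed
 define P where "P x \<longleftrightarrow> x \<in> space M \<and> (\<forall>j. \<exists>u\<in>\<Gamma>. f j x = \<phi> u x) \<and> (\<forall>j. \<exists>u\<in>\<Gamma>. f j (inv (f j) x) = \<phi> u (inv (f j) x)) \<and>
   (\<forall>u\<in>\<Gamma>. \<phi> u x = x --> u = [])" for x
 have "AE x in M. \<forall>j. \<exists>u\<in>\<Gamma>. f j (inv (f j) x) = \<phi> u (inv (f j) x)"
  unfolding AE_all_countable
 proof
  fix j
  have "AE x in M. \<exists>u\<in>\<Gamma>. f j x = \<phi> u x" using forb by eventually_elim blast
  from AE_mpa[OF inv_mpa[OF f[of j]] this] show "AE x in M. \<exists>u\<in>\<Gamma>. f j (inv (f j) x) = \<phi> u (inv (f j) x)" .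
 qed
 hence AEP: "AE x in M. P x"
  using forb free AE_space unfolding P_def by eventually_elim blast
 have AEPu: "AE x in M. \<forall>u. u \<in> \<Gamma> --> P (\<phi> u x)"
  unfolding AE_all_countable
 proof
  fix u
  show "AE x in M. u \<in> \<Gamma> --> P (\<phi> u x)"
   by (cases "u \<in> \<Gamma>") (use AE_phi[OF _ AEP, of u] in auto)
 qed
 have "AE x in M. \<forall>i<n. \<exists>l. (\<forall>(j, u, s)\<in>set l. j < k \<and> u \<in> \<Gamma>) \<and> ok Dm th i l x"
  using AEPu con AE_space
 proof eventually_elim
  case (elim x)
  have x: "x \<in> space M" and Pu: "\<And>u. u \<in> \<Gamma> ==> P (\<phi> u x)" using elim by auto
  have walk: "\<exists>p\<in>\<Gamma>. z = \<phi> p x \<and> (\<exists>l. (\<forall>(j, u, s)\<in>set l. j < k \<and> u \<in> \<Gamma> \<and> \<phi> u x \<in> Dm j) \<and>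
    (\<forall>\<psi>. chain th x l \<psi> = \<psi> p - \<psi> []))" if "(x, z) \<in> ?R\<^sup>*" for z
   using that
  proof (induction rule: rtrancl_induct)
   case base
   show ?case using G_Nil phi_Nil[OF x] by (intro bexI[of _ "[]"] conjI exI[of _ "[]"]) (simp_all add: chain_def)
  next
   case (step y z)
   obtain p l where p: "p \<in> \<Gamma>" "y = \<phi> p x" and l: "\<forall>(j, u, s)\<in>set l. j < k \<and> u \<in> \<Gamma> \<and> \<phi> u x \<in> Dm j"
    and ch: "\<And>\<psi>. chain th x l \<psi> = \<psi> p - \<psi> []" using step.IH by blast
   have y: "y \<in> space M" using p phi_space[OF _ x] by blast
   from step(2) show ?case
   proof
    assume "(y, z) \<in> edges k Dm f"
    then obtain j where j: "j < k" "y \<in> Dm j" "z = f j y" by (auto simp: edges_def)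
    have "P y" using Pu p by blast
    hence e: "f j y = \<phi> (th j y) y" unfolding P_def using thQ by blast
    have z: "z = \<phi> (mul (th j y) p) x" using j(3) e p(2) phi_mul[OF thG p(1) x] by simp
    have c: "chain th x ((j, p, True) # l) \<psi> = \<psi> (mul (th j y) p) - \<psi> []" for \<psi>
     using ch[of \<psi>] p(2) by (simp add: chain_def sg_def)
    show ?thesis
     by (rule bexI[of _ "mul (th j y) p"], intro conjI exI[of _ "(j, p, True) # l"])
      (use z c l j p G_mul[OF thG p(1)] in auto)
   next
    assume "(y, z) \<in> (edges k Dm f)\<inverse>"
    then obtain j where j: "j < k" "z \<in> Dm j" "y = f j z" by (auto simp: edges_def)
    have zi: "z = inv (f j) y" using j(3) mpaD(2)[OF f] by simp
    have zs: "z \<in> space M" using j(2) sets.sets_into_space[OF Dm] by blast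
    have "P y" using Pu p by blast
    hence ex: "\<exists>u\<in>\<Gamma>. f j z = \<phi> u z" unfolding P_def zi by blast
    have e: "f j z = \<phi> (th j z) z" by (rule thQ[OF ex])
    let ?p = "mul (ginv (th j z)) p"
    have pG: "?p \<in> \<Gamma>" by (rule G_mul[OF G_ginv[OF thG] p(1)])
    have z: "z = \<phi> ?p x"
     using phi_mul[OF G_ginv[OF thG] p(1) x, of j z] p(2) j(3) e phi_ginv[OF thG zs, of j z] by simp
    have tp: "mul (th j z) ?p = p"
     using ginv_mul_cancel[of "ginv (th j z)" p] G_ginv[OF thG] p(1) by (simp only: ginv_ginv)
    have c: "chain th x ((j, ?p, False) # l) \<psi> = \<psi> ?p - \<psi> []" for \<psi>
    proof -
     have "th j (\<phi> ?p x) = th j z" using z by simp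
     thus ?thesis using ch[of \<psi>] tp by (simp add: chain_def sg_def)
    qed
    have "\<phi> ?p x \<in> Dm j" using z j(2) by simp
    thus ?thesis
     by (intro bexI[of _ ?p] conjI exI[of _ "(j, ?p, False) # l"]) (use z c l j pG in auto)
   qed
  qed
  show ?case
  proof (intro allI impI)
   fix i assume i: "i < n"
   have "(x, \<phi> [(i, True)] x) \<in> ?R\<^sup>*" using elim(2) i unfolding conn_def by blast
   from walk[OF this] obtain p l where p: "p \<in> \<Gamma>" "\<phi> [(i, True)] x = \<phi> p x"
    and l: "\<forall>(j, u, s)\<in>set l. j < k \<and> u \<in> \<Gamma> \<and> \<phi> u x \<in> Dm j" and ch: "\<And>\<psi>. chain th x l \<psi> = \<psi> p - \<psi> []" by blast
   have g: "[(i, True)] \<in> \<Gamma>" by (rule G_gen[OF i])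
   \<comment> \<open>The walk and the generator lead to the same point, so their quotient fixes
     \<open>x\<close>.\<close>
   have "\<phi> (mul (ginv p) [(i, True)]) x = x"
    using phi_mul[OF G_ginv[OF p(1)] g x] p(2) phi_ginv[OF p(1) x] by simp
   moreover have "P x" using Pu[OF G_Nil] phi_Nil[OF x] by simp
   ultimately have "mul (ginv p) [(i, True)] = []" unfolding P_def using G_mul[OF G_ginv[OF p(1)] g] by blast
   hence "p = [(i, True)]"
    using ginv_mul_cancel[of "ginv p" "[(i, True)]"] G_ginv[OF p(1)] g mul_Nil[OF p(1)] by (simp only: ginv_ginv)
   hence "ok Dm th i l x" unfolding ok_def using ch l by fast
   thus "\<exists>l. (\<forall>(j, u, s)\<in>set l. j < k \<and> u \<in> \<Gamma>) \<and> ok Dm th i l x" using l by fast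
  qed
 qed
 thus ?thesis by (rule chain_inequality[OF Dm thme thG])
qed

text \<open>The action extended by the identity off \<open>space M\<close>, as \<open>mpa\<close>
  requires.\<close>

definition ex :: "letter list => 'a => 'a" where
 "ex u x = (if x \<in> space M then \<phi> u x else x)"

lemma ex_mpa: assumes u: "u \<in> \<Gamma>" shows "ex u \<in> mpa"
proof -
 have c: "ex (ginv u) (ex u x) = x" if "u \<in> \<Gamma>" for u x
  using phi_ginv[OF that] phi_space[OF that] by (simp add: ex_def)
 have c1: "ex (ginv u) (ex u x) = x" "ex u (ex (ginv u) x) = x" for x
  using c[OF u] c[OF G_ginv[OF u], of x] by (simp_all only: ginv_ginv)
 have m: "ex u \<in> measurable M M" if "u \<in> \<Gamma>" for u
  by (rule measurable_cong[THEN iffD1, OF _ phi_measurable[OF that]]) (simp add: ex_def)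
 have "bij (ex u)" by (rule o_bij[of "ex (ginv u)"]) (auto simp: c1)
 moreover have "inv (ex u) = ex (ginv u)" by (rule inv_equality) (simp_all only: c1)
 moreover have "distr M M (ex u) = M"
 proof -
  have "distr M M (\<phi> u) = M" using act u by (simp add: mp_action_def)
  moreover have "distr M M (ex u) = distr M M (\<phi> u)" by (rule distr_cong) (auto simp: ex_def)
  ultimately show ?thesis by simp
 qed
 ultimately show ?thesis using m[OF u] m[OF G_ginv[OF u]] by (simp add: mpa_def ex_def)
qed

end

section \<open>Words with fixed points and redundant edges\<close>

lemma evw_cancel_cons:
 assumes "\<And>i. bij (f i)" shows "evw f (cancel_cons a w) x = evl f a (evw f w x)"
proof (cases "w ~= [] \<and> hd w = inv_letter a")
 case True
 then obtain v where w: "w = inv_letter a # v" by (cases w) auto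
 have "evl f a (evl f (inv_letter a) y) = y" for y
  using assms[of "fst a"] by (auto simp: evl_def inv_letter_def bij_def surj_f_inv_f)
 thus ?thesis by (simp add: w cancel_cons_def)
qed (auto simp: cancel_cons_def)

lemma evw_reduce:
 assumes "\<And>i. bij (f i)" shows "evw f (mul w []) = evw f w"
proof
 show "evw f (mul w []) x = evw f w x" for x
  by (induction w) (simp_all add: evw_cancel_cons[OF assms])
qed

lemma reduced_append: "reduced_word (u @ v) ==> reduced_word u \<and> reduced_word v"
 by (simp add: reduced_word_def successively_append_iff)

context std_prob
begin

text \<open>The set of points at which no word agrees with \<open>g\<close> is contained in every
  error set.\<close>

lemma approx_AE:
 assumes g: "g \<in> mpa" and h: "\<And>w :: 'w::countable. w \<in> W ==> h w \<in> mpa"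
  and ap: "\<And>e. e > 0 ==> \<exists>w\<in>W. prob {x. g x ~= h w x} < e"
 shows "AE x in M. \<exists>w\<in>W. g x = h w x"
proof -
 let ?N = "space M - (\<Union>w\<in>W. {x \<in> space M. g x = h w x})"
 have s: "{x \<in> space M. g x = h w x} \<in> sets M" if "w \<in> W" for w
  using that by (intro eq_sets mpaD(5) g h)
 have N: "?N \<in> sets M" using s by (intro sets.Diff sets.top sets.countable_UN') auto
 have "prob ?N \<le> 0"
 proof (rule field_le_epsilon)
  fix e :: real assume "e > 0"
  then obtain w where w: "w \<in> W" "prob {x. g x ~= h w x} < e" using ap by blast
  have "prob ?N \<le> prob {x. g x ~= h w x}" using w(1) by (intro finite_measure_mono neq_mpa g h) auto
  thus "prob ?N \<le> 0 + e" using w(2) by simp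
 qed
 hence "prob ?N = 0" using measure_nonneg[of M ?N] by linarith
 hence "AE x in M. x \<notin> ?N" using prob_eq_0[OF N] by simp
 with AE_space show ?thesis by eventually_elim auto
qed

text \<open>The set is shrunk once for each map: countably many sets disjoint from their image cover
  the moved points, so one of them meets the current set in positive measure.\<close>

lemma displace:
 assumes I: "finite I" and g: "\<And>q. q \<in> I ==> g q \<in> mpa" and X: "X \<in> sets M" "prob X > 0"
  and ne: "\<And>q. q \<in> I ==> AE x in M. x \<in> X --> g q x ~= x"
 shows "\<exists>A\<in>sets M. A \<subseteq> X \<and> prob A > 0 \<and> (\<forall>q\<in>I. A \<inter> g q ` A = {})"
 using I g ne
proof (induction I)
 case empty
 show ?case using X by blast
next
 case (insert q I)
 then obtain A where A: "A \<in> sets M" "A \<subseteq> X" "prob A > 0" "\<forall>q\<in>I. A \<inter> g q ` A = {}" by auto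
 have gq: "g q \<in> mpa" using insert.prems(1) by blast
 obtain Q :: "nat => 'a set" where Q: "\<And>i. Q i \<in> sets M" "\<And>i. Q i \<inter> g q ` Q i = {}" "{x. g q x ~= x} \<subseteq> (\<Union>i. Q i)"
  using separate[OF gq] by blast
 have "\<exists>i. prob (A \<inter> Q i) > 0"
 proof (rule ccontr)
  assume "\<not> ?thesis"
  hence z: "prob (A \<inter> Q i) = 0" for i using measure_nonneg[of M "A \<inter> Q i"] by (metis less_eq_real_def)
  have "AE x in M. \<forall>i. x \<notin> A \<inter> Q i"
   unfolding AE_all_countable using z prob_eq_0 A(1) Q(1) by blast
  moreover have "AE x in M. x \<in> X --> g q x ~= x" using insert.prems(2) by blast
  ultimately have "AE x in M. x \<notin> A" by eventually_elim (use A(2) Q(3) in auto)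
  hence "prob A = 0" using prob_eq_0[OF A(1)] by simp
  thus False using A(3) by simp
 qed
 then obtain i where i: "prob (A \<inter> Q i) > 0" by blast
 show ?case
 proof (intro bexI[of _ "A \<inter> Q i"] conjI ballI)
  fix p assume "p \<in> insert q I"
  thus "(A \<inter> Q i) \<inter> g p ` (A \<inter> Q i) = {}" using A(4) Q(2)[of i] by blast
 qed (use A Q i in auto)
qed

text \<open>A shortest word with fixed points of positive measure traces cycles with distinct vertices, so the
 first edge of the cycle is determined by its base point among all edges with the same label.\<close>

lemma removable_edges:
 assumes f: "\<And>i. f i \<in> mpa" and w0: "reduced_word w0" "w0 ~= []" "fst ` set w0 \<subseteq> {..<n}"
  and pos0: "prob {x \<in> space M. evw f w0 x = x} > 0"
 shows "\<exists>j<n. \<exists>B\<in>sets M. prob B > 0 \<and>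
  (\<forall>z\<in>B. (z, f j z) \<in> conn n (\<lambda>i. space M - (if i = j then B else {})) f)"
proof -
 define Wd where "Wd w \<longleftrightarrow> reduced_word w \<and> w ~= [] \<and> fst ` set w \<subseteq> {..<n} \<and> prob {x \<in> space M. evw f w x = x} > 0" for w
 have "Wd w0" using w0 pos0 by (simp add: Wd_def)
 from ex_has_least_nat[of Wd, OF this, of length] obtain w where w: "Wd w" and mn: "\<And>v. Wd v ==> length w \<le> length v" by blast
 have red: "reduced_word w" and ne: "w ~= []" and let_n: "fst ` set w \<subseteq> {..<n}" using w by (auto simp: Wd_def)
 let ?L = "length w"
 have L: "0 < ?L" using ne by simp
 define Fx where "Fx = {x \<in> space M. evw f w x = x}"
 have em: "evw f v \<in> mpa" for v by (rule evw_mpa) (rule f)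
 have Fxs: "Fx \<in> sets M" unfolding Fx_def by (rule eq_sets[OF mpaD(5)[OF em] measurable_ident[unfolded id_def]])
 have Fxp: "prob Fx > 0" using w by (simp add: Wd_def Fx_def)
 \<comment> \<open>The letters are applied from the right: \<open>pt ?L x\<close> is the start and
   \<open>pt 0 x\<close> the end of the walk, and \<open>w ! 0\<close> labels the last edge.\<close>
 define pt where "pt q x = evw f (drop q w) x" for q x
 have ptL: "pt ?L x = x" for x by (simp add: pt_def)
 have pt0: "pt 0 x = x" if "x \<in> Fx" for x using that by (simp add: pt_def Fx_def)
 have step: "pt q x = evl f (w ! q) (pt (Suc q) x)" if "q < ?L" for q x
  using Cons_nth_drop_Suc[OF that, symmetric] by (simp add: pt_def)
 \<comment> \<open>If the two points coincided on a set of positive measure, the letters between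
   them would form a shorter nonempty reduced word with fixed points.\<close>
 have distinct: "AE x in M. pt q x ~= pt q' x" if q: "1 \<le> q" "q < q'" "q' \<le> ?L" for q q'
 proof -
  define md where "md = take (q' - q) (drop q w)"
  have dq: "drop q w = md @ drop q' w"
   using append_take_drop_id[of "q' - q" "drop q w"] q by (simp add: md_def)
  have "w = take q w @ md @ drop q' w" using append_take_drop_id[of q w] dq by simp
  hence r: "reduced_word md" using red reduced_append by metis
  have lm: "length md = q' - q" using q by (simp add: md_def)
  have "set md \<subseteq> set w" unfolding md_def using set_take_subset set_drop_subset by fast
  hence "fst ` set md \<subseteq> {..<n}" using let_n by blast
  moreover have "\<not> Wd md" using mn[of md] lm q by auto
  moreover have "md ~= []" using lm q by auto
  ultimately have "\<not> prob {x \<in> space M. evw f md x = x} > 0" using r by (simp add: Wd_def)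
  hence "prob {x \<in> space M. evw f md x = x} = 0" using measure_nonneg by (metis less_eq_real_def)
  moreover have "{x \<in> space M. evw f md x = x} \<in> sets M" by (rule eq_sets[OF mpaD(5)[OF em] measurable_ident[unfolded id_def]])
  ultimately have "AE x in M. x \<notin> {x \<in> space M. evw f md x = x}" using prob_eq_0 by blast
  with AE_space have "AE x in M. evw f md x ~= x" by eventually_elim auto
  from AE_mpa[OF em this, of "drop q' w"] show ?thesis
   by (simp add: pt_def dq evw_append)
 qed
 obtain j b where a: "w ! 0 = (j, b)" by (cases "w ! 0") auto
 have jn: "j < n" using nth_mem[OF L] a let_n by force
 \<comment> \<open>The point at which the edge traversed at step \<open>q\<close> is based, that is
   where \<open>f\<close> and not its inverse is applied.\<close>
 define be where "be q = evw f (if snd (w ! q) then drop (Suc q) w else drop q w)" for q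
 have be: "be q x = (if snd (w ! q) then pt (Suc q) x else pt q x)" for q x by (simp add: be_def pt_def)
 have bem: "be q \<in> mpa" for q unfolding be_def by (rule em)
 \<comment> \<open>The base of the closing edge. For an inverse letter it is the end of the walk,
   written as the start \<open>x\<close>, with which it agrees on \<open>Fx\<close>, because
   \<open>distinct\<close> does not speak about index 0.\<close>
 define be0 where "be0 = evw f (if b then drop 1 w else [])"
 have be0: "be0 x = (if b then pt 1 x else x)" for x by (simp add: be0_def pt_def)
 have be0m: "be0 \<in> mpa" unfolding be0_def by (rule em)
 define I where "I = {q. 1 \<le> q \<and> q < ?L \<and> fst (w ! q) = j}"
 have nonred: "w ! 1 ~= inv_letter (w ! 0)" if h: "1 < ?L"
 proof -
  obtain a0 w1 where w1: "w = a0 # w1" using ne by (cases w) auto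
  moreover obtain a1 v where "w1 = a1 # v" using h w1 by (cases w1) auto
  ultimately show ?thesis using red by (simp add: reduced_Cons)
 qed
 \<comment> \<open>The four cases are the orientations of the two edges. Reducedness excludes an
   immediate return next to the closing edge.\<close>
 have neq: "AE x in M. x \<in> Fx --> be q x ~= be0 x" if q: "q \<in> I" for q
 proof -
  have q1: "1 \<le> q" "q < ?L" "fst (w ! q) = j" using q by (auto simp: I_def)
  have wq: "w ! q = (j, snd (w ! q))" using q1(3) by (simp add: prod_eq_iff)
  show ?thesis
  proof (cases "snd (w ! q)"; cases b)
   assume h: "snd (w ! q)" "b"
   from distinct[of 1 "Suc q"] q1 have "AE x in M. pt 1 x ~= pt (Suc q) x" by simp
   thus ?thesis by eventually_elim (use h in \<open>simp add: be be0\<close>)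
  next
   assume h: "\<not> snd (w ! q)" "\<not> b"
   from distinct[of q ?L] q1 have "AE x in M. pt q x ~= pt ?L x" by simp
   thus ?thesis by eventually_elim (use h in \<open>simp add: be be0 ptL\<close>)
  next
   assume h: "\<not> snd (w ! q)" "b"
   have "q ~= 1"
   proof
    assume "q = 1"
    hence "w ! 1 = inv_letter (w ! 0)" using wq h a by (simp add: inv_letter_def)
    thus False using nonred q1(2) \<open>q = 1\<close> by blast
   qed
   with distinct[of 1 q] q1 have "AE x in M. pt 1 x ~= pt q x" by simp
   thus ?thesis by eventually_elim (use h in \<open>simp add: be be0\<close>)
  next
   assume h: "snd (w ! q)" "\<not> b"
   show ?thesis
   proof (cases "Suc q = ?L")
    case False
    with distinct[of "Suc q" ?L] q1 have "AE x in M. pt (Suc q) x ~= pt ?L x" by simp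
    thus ?thesis by eventually_elim (use h in \<open>simp add: be be0 ptL\<close>)
   next
    case True
    have "q ~= 1"
    proof
     assume "q = 1"
     hence "w ! 1 = inv_letter (w ! 0)" using wq h a by (simp add: inv_letter_def)
     thus False using nonred q1(2) \<open>q = 1\<close> by blast
    qed
    \<comment> \<open>The walk would leave \<open>x\<close> along the very edge by which it returns,
      so its points after the first and before the last step would coincide.\<close>
    with distinct[of 1 q] q1 have "AE x in M. pt 1 x ~= pt q x" by simp
    thus ?thesis
    proof eventually_elim
     case (elim x)
     have "x \<notin> Fx"
     proof
      assume x: "x \<in> Fx"
      have "x = inv (f j) (pt 1 x)" using step[OF L, of x] pt0[OF x] a h by (simp add: evl_def)
      hence "f j x = pt 1 x" using mpa_inv_apply(1)[OF f[of j], of "pt 1 x"] by simp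
      moreover have "pt q x = f j x" using step[OF q1(2), of x] wq h True ptL by (simp add: evl_def)
      ultimately show False using elim by simp
     qed
     thus ?case by blast
    qed
   qed
  qed
 qed
 have "finite I" by (rule finite_subset[of _ "{..<?L}"]) (auto simp: I_def)
 moreover have "inv be0 o be q \<in> mpa" for q by (rule comp_mpa[OF inv_mpa[OF be0m] bem])
 moreover have "AE x in M. x \<in> Fx --> (inv be0 o be q) x ~= x" if q: "q \<in> I" for q
  using neq[OF q]
 proof eventually_elim
  case (elim x)
  have "inv be0 (be q x) = x ==> be q x = be0 x" using mpa_inv_apply(1)[OF be0m, of "be q x"] by simp
  thus ?case using elim by auto
 qed
 \<comment> \<open>Displacing \<open>A\<close> under these maps keeps every other edge of the walks
   from \<open>A\<close> based outside the image of \<open>A\<close> under \<open>be0\<close>. The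
   closing edges can then be removed for all points of \<open>A\<close> at once.\<close>
 ultimately have "\<exists>A\<in>sets M. A \<subseteq> Fx \<and> prob A > 0 \<and> (\<forall>q\<in>I. A \<inter> (inv be0 o be q) ` A = {})"
  using Fxs Fxp by (intro displace)
 then obtain A where A: "A \<in> sets M" "A \<subseteq> Fx" "prob A > 0" "\<And>q. q \<in> I ==> A \<inter> (inv be0 o be q) ` A = {}"
  by (elim bexE conjE) blast
 define B where "B = be0 ` A"
 have beB: "be q x \<notin> B" if x: "x \<in> A" and q: "q \<in> I" for x q
 proof
  assume "be q x \<in> B"
  then obtain y where y: "y \<in> A" "be q x = be0 y" by (auto simp: B_def)
  hence "(inv be0 o be q) x = y" using mpa_inv_apply(2)[OF be0m, of y] by simp
  thus False using A(4)[OF q] x y(1) by (metis IntI empty_iff imageI)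
 qed
 let ?R = "conn n (\<lambda>i. space M - (if i = j then B else {})) f"
 have edge: "(pt (Suc q) x, pt q x) \<in> ?R" if x: "x \<in> A" and q: "1 \<le> q" "q < ?L" for x q
 proof -
  obtain i c where ic: "w ! q = (i, c)" by (cases "w ! q") auto
  have i_n: "i < n" using nth_mem[OF q(2)] ic let_n by force
  have xs: "x \<in> space M" using x A(2) by (auto simp: Fx_def)
  have "be q x \<in> space M" using mpa_space[OF bem] xs by blast
  moreover have "be q x \<notin> B" if "i = j" using beB[OF x, of q] q ic that by (simp add: I_def)
  ultimately have e: "(be q x, f i (be q x)) \<in> ?R" using i_n by (intro conn_edge) auto
  show ?thesis
  proof (cases c)
   case True
   hence "be q x = pt (Suc q) x" "f i (be q x) = pt q x" using be[of q x] ic step[OF q(2), of x] by (simp_all add: evl_def)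
   thus ?thesis using e by simp
  next
   case False
   hence "be q x = pt q x" using be[of q x] ic by simp
   moreover have "f i (pt q x) = pt (Suc q) x" using step[OF q(2), of x] ic False mpa_inv_apply(1)[OF f[of i]] by (simp add: evl_def)
   ultimately have "(pt q x, pt (Suc q) x) \<in> ?R" using e by simp
   thus ?thesis by (rule conn_sym)
  qed
 qed
 have path: "(pt ?L x, pt 1 x) \<in> ?R" if x: "x \<in> A" for x
 proof -
  have "(pt ?L x, pt q x) \<in> ?R" if "1 \<le> q" "q \<le> ?L" for q
   using that(2,1)
  proof (induction q rule: inc_induct)
   case (step q)
   hence "(pt ?L x, pt (Suc q) x) \<in> ?R" "(pt (Suc q) x, pt q x) \<in> ?R" using edge[OF x, of q] by simp_all
   thus ?case by (rule conn_trans)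
  qed (rule conn_refl)
  thus ?thesis using L by (metis One_nat_def Suc_leI order_refl)
 qed
 have "(z, f j z) \<in> ?R" if z: "z \<in> B" for z
 proof -
  obtain x where x: "x \<in> A" "z = be0 x" using z by (auto simp: B_def)
  have xF: "x \<in> Fx" using x(1) A(2) by blast
  show ?thesis
  proof (cases b)
   case True
   have "z = pt 1 x" using x(2) be0 True by simp
   moreover have "f j (pt 1 x) = pt ?L x" using step[OF L, of x] pt0[OF xF] a True ptL by (simp add: evl_def)
   ultimately show ?thesis using conn_sym[OF path[OF x(1)]] by simp
  next
   case False
   have "z = pt ?L x" using x(2) be0 False ptL by simp
   moreover have "x = inv (f j) (pt 1 x)" using step[OF L, of x] pt0[OF xF] a False by (simp add: evl_def)
   hence "f j x = pt 1 x" using mpa_inv_apply(1)[OF f[of j], of "pt 1 x"] by simp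
   ultimately show ?thesis using path[OF x(1)] ptL by simp
  qed
 qed
 moreover have "B \<in> sets M" "prob B > 0" using image_sets[OF be0m A(1)] prob_image[OF be0m A(1)] A(3) by (auto simp: B_def)
 ultimately show ?thesis using jn by blast
qed

end

text \<open>The \<open>n\<close> maps connect the orbits even after removal of a redundant set of
  edges, so the domains of the rest have total measure below \<open>n\<close>, against
  \<open>graph_inequality\<close>.\<close>

theorem full_group_lower_bound:
 fixes M :: "'a measure" and E :: "('a \<times> 'a) set"
 assumes sb: "standard_borel M" and pr: "prob_space M" and na: "non_atomic M"
  and E: "equiv (space M) E" and n: "n \<ge> 1" and act: "mp_action (free_group n) M \<phi>"
  and fr: "free_action (free_group n) M \<phi>" and orb: "E = orbit_relation (free_group n) M \<phi>"
 shows "enat (n + 1) \<le> t_full_group M E"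
proof -
 obtain U where "std_prob M U" using standard_borel_std_prob[OF sb pr] by blast
 then interpret std_prob M U .
 interpret std_action M U n \<phi> by unfold_locales (rule act)
 have Eiff: "(x, y) \<in> E \<longleftrightarrow> x \<in> space M \<and> (\<exists>u\<in>\<Gamma>. y = \<phi> u x)" for x y
  by (auto simp: orb orbit_relation_def orbit_def)
 have free: "AE x in M. \<forall>u\<in>\<Gamma>. \<phi> u x = x --> u = []"
  using fr unfolding free_action_def
 proof eventually_elim
  case (elim x)
  hence "u \<in> {[]}" if "u \<in> \<Gamma>" "\<phi> u x = x" for u
   using that unfolding stabilizer_def by (auto simp: free_group_def)
  thus ?case by blast
 qed
 define F where "F = {f\<in>mpa. AE x in M. (x, f x) \<in> E}"
 have symE: "sym E" using E by (simp add: equiv_def)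
 have exF: "ex u \<in> F" if u: "u \<in> \<Gamma>" for u
  unfolding F_def using ex_mpa[OF u] u by (auto simp: Eiff ex_def)
 show ?thesis
 proof (rule t_full_group_ge[OF sb E F_def])
  fix f :: "nat => 'a => 'a"
  assume fF: "\<And>i. f i \<in> F" and dens: "\<And>g e. g \<in> F ==> e > 0 ==> \<exists>w. fst ` set w \<subseteq> {..<n} \<and> prob {x. g x ~= evw f w x} < e"
  have f: "f i \<in> mpa" for i using fF[of i] by (simp add: F_def)
  have fb: "bij (f i)" for i by (rule mpaD(1)[OF f])
  have em: "evw f v \<in> mpa" for v by (rule evw_mpa) (rule f)
  have gen: "AE x in M. \<forall>i<n. \<exists>w\<in>{w. fst ` set w \<subseteq> {..<n}}. ex [(i, True)] x = evw f w x"
   unfolding AE_all_countable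
  proof
   fix i
   show "AE x in M. i < n --> (\<exists>w\<in>{w. fst ` set w \<subseteq> {..<n}}. ex [(i, True)] x = evw f w x)"
   proof (cases "i < n")
    case True
    have "AE x in M. \<exists>w\<in>{w. fst ` set w \<subseteq> {..<n}}. ex [(i, True)] x = evw f w x"
    proof (rule approx_AE[OF ex_mpa[OF G_gen[OF True]] em])
     show "\<exists>w\<in>{w. fst ` set w \<subseteq> {..<n}}. prob {x. ex [(i, True)] x ~= evw f w x} < e" if "e > 0" for e
      using dens[OF exF[OF G_gen[OF True]] that] by blast
    qed
    thus ?thesis by eventually_elim blast
   qed simp
  qed
  have g0: "[(0, True)] \<in> \<Gamma>" using n by (intro G_gen) simp
  let ?T = "ex [(0, True)]"
  have Tm: "?T \<in> mpa" by (rule ex_mpa[OF g0])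
  have "AE x in M. x \<in> space M --> ?T x ~= x" using free
  proof eventually_elim
   case (elim x)
   hence "\<phi> [(0, True)] x ~= x" using g0 by blast
   thus ?case by (simp add: ex_def)
  qed
  hence "\<exists>A0\<in>sets M. A0 \<subseteq> space M \<and> prob A0 > 0 \<and> (\<forall>q\<in>{()}. A0 \<inter> ?T ` A0 = {})"
   using Tm by (intro displace[where g = "\<lambda>_. ?T"]) (auto simp: prob_space)
  then obtain A0 where A0: "A0 \<in> sets M" "prob A0 > 0" "A0 \<inter> ?T ` A0 = {}" by blast
  \<comment> \<open>The swap then has support \<open>2 * c \<le> 1 / 2\<close>; together with an
    error below \<open>2 * c\<close> this leaves points at which the approximating word acts as the
    identity.\<close>
  define c where "c = min (prob A0) (1 / 4)"
  have c: "0 < c" "c \<le> prob A0" "c \<le> 1 / 4" using A0(2) by (auto simp: c_def)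
  obtain A where A: "A \<in> sets M" "A \<subseteq> A0" "prob A = c"
   using nonatomic_split[OF prob_space_axioms na A0(1) less_imp_le[OF c(1)] c(2)] by blast
  have dA: "A \<inter> ?T ` A = {}" using A0(3) A(2) by blast
  let ?t = "swp A ?T"
  have tm: "?t \<in> mpa" by (rule swp_mpa[OF A(1) Tm dA])
  have Tinj: "inj ?T" by (rule mpaD(2)[OF Tm])
  have "(x, ?t x) \<in> E" if x: "x \<in> space M" for x
  proof -
   have TE: "(y, ?T y) \<in> E" if "y \<in> space M" for y using that g0 by (auto simp: Eiff ex_def)
   consider "x \<in> A" | y where "y \<in> A" "x = ?T y" | "x \<notin> A" "x \<notin> ?T ` A" by blast
   thus ?thesis
   proof cases
    case 1
    thus ?thesis using TE[OF x] by (simp add: swp_in)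
   next
    case 2
    have "(y, ?T y) \<in> E" using TE 2(1) A(1) sets.sets_into_space by blast
    thus ?thesis using 2 swp_image[OF Tinj dA 2(1)] symE by (simp add: symD)
   next
    case 3
    thus ?thesis using E x by (simp add: swp_out equiv_def refl_on_def)
   qed
  qed
  hence tF: "?t \<in> F" using tm by (auto simp: F_def)
  have supp: "{x. ?t x ~= x} = A \<union> ?T ` A"
  proof (rule Set.set_eqI)
   fix x
   consider "x \<in> A" | y where "y \<in> A" "x = ?T y" | "x \<notin> A" "x \<notin> ?T ` A" by blast
   thus "x \<in> {x. ?t x ~= x} \<longleftrightarrow> x \<in> A \<union> ?T ` A"
   proof cases
    case 1
    hence "?T x ~= x" using dA by (metis IntI empty_iff imageI)
    thus ?thesis using 1 by (simp add: swp_in)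
   next
    case 2
    hence "?t x = y" using swp_image[OF Tinj dA 2(1)] by simp
    moreover have "y ~= x" using 2 dA by (metis IntI empty_iff imageI)
    ultimately show ?thesis using 2 by auto
   next
    case 3
    thus ?thesis by (simp add: swp_out)
   qed
  qed
  have ps: "prob {x. ?t x ~= x} = 2 * c"
   unfolding supp using finite_measure_Union[OF A(1) image_sets[OF Tm A(1)] dA] prob_image[OF Tm A(1)] A(3) by simp
  have "2 * c > 0" using c by simp
  from dens[OF tF this] obtain w where w: "fst ` set w \<subseteq> {..<n}" "prob {x. ?t x ~= evw f w x} < 2 * c" by blast
  define u where "u = mul w []"
  have eu: "evw f u = evw f w" unfolding u_def by (rule evw_reduce[OF fb])
  have ru: "reduced_word u" unfolding u_def by (rule reduced_foldr) simp
  have "set u \<subseteq> set w" unfolding u_def using set_foldr_cancel[of w "[]"] by simp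
  hence lu: "fst ` set u \<subseteq> {..<n}" using w(1) by blast
  \<comment> \<open>The identity has distance exactly \<open>2 * c\<close> from the swap, so the
    approximating word cannot reduce to the empty one.\<close>
  have une: "u ~= []"
  proof
   assume "u = []"
   hence "evw f w = id" using eu by simp
   thus False using w(2) ps by simp
  qed
  have "prob {x \<in> space M. evw f u x = x} > 0"
  proof -
   have s: "{x. ?t x ~= x} \<in> sets M" "{x. ?t x ~= evw f w x} \<in> sets M" "{x \<in> space M. evw f u x = x} \<in> sets M"
    using supp_sets[OF tm] neq_mpa[OF tm em] eq_sets[OF mpaD(5)[OF em] measurable_ident[unfolded id_def]] by auto
   have "space M \<subseteq> {x. ?t x ~= x} \<union> ({x. ?t x ~= evw f w x} \<union> {x \<in> space M. evw f u x = x})" using eu by auto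
   hence "prob (space M) \<le> prob ({x. ?t x ~= x} \<union> ({x. ?t x ~= evw f w x} \<union> {x \<in> space M. evw f u x = x}))"
    using s by (intro finite_measure_mono) auto
   also have "... \<le> prob {x. ?t x ~= x} + prob ({x. ?t x ~= evw f w x} \<union> {x \<in> space M. evw f u x = x})" using s by (intro measure_Un_le) auto
   also have "prob ({x. ?t x ~= evw f w x} \<union> {x \<in> space M. evw f u x = x}) \<le> prob {x. ?t x ~= evw f w x} + prob {x \<in> space M. evw f u x = x}"
    using s by (intro measure_Un_le) auto
   finally show ?thesis using prob_space ps w(2) c(3) by simp
  qed
  from removable_edges[where f = f, OF f ru une lu this] obtain j B where j: "j < n" and B: "B \<in> sets M" "prob B > 0"
   and BR: "\<forall>z\<in>B. (z, f j z) \<in> conn n (\<lambda>i. space M - (if i = j then B else {})) f" by blast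
  \<comment> \<open>All maps keep their full domain except \<open>f j\<close>, whose edges over
    \<open>B\<close> are replaced by paths.\<close>
  define Dm where "Dm i = space M - (if i = j then B else {})" for i
  let ?R = "conn n Dm f"
  have fR: "(z, f i z) \<in> ?R" if z: "z \<in> space M" and i: "i < n" for z i
  proof (cases "z \<in> Dm i")
   case True
   thus ?thesis by (rule conn_edge[OF i])
  next
   case False
   hence "i = j" "z \<in> B" using z by (auto simp: Dm_def split: if_splits)
   thus ?thesis using BR by (simp add: Dm_def[abs_def])
  qed
  have wR: "(x, evw f w x) \<in> ?R" if x: "x \<in> space M" and w: "fst ` set w \<subseteq> {..<n}" for w x
   using w
  proof (induction w)
   case (Cons a w)
   have z: "evw f w x \<in> space M" using mpa_space[OF em] x by blast
   have i: "fst a < n" using Cons.prems by simp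
   have "(evw f w x, evl f a (evw f w x)) \<in> ?R"
   proof (cases "snd a")
    case True
    thus ?thesis using fR[OF z i] by (simp add: evl_def)
   next
    case False
    let ?z = "inv (f (fst a)) (evw f w x)"
    have "?z \<in> space M" using mpa_space[OF inv_mpa[OF f]] z by blast
    hence "(?z, f (fst a) ?z) \<in> ?R" using i by (rule fR)
    hence "(?z, evw f w x) \<in> ?R" using mpa_inv_apply(1)[OF f[of "fst a"]] by simp
    from conn_sym[OF this] show ?thesis using False by (simp add: evl_def)
   qed
   moreover have "(x, evw f w x) \<in> ?R" using Cons by simp
   ultimately show ?case unfolding evw_simps comp_apply by (blast intro: conn_trans)
  qed (simp add: conn_refl)
  have "real n \<le> (\<Sum>i<n. prob (Dm i))"
  proof (rule graph_inequality[OF _ f _ free])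
   show "Dm i \<in> sets M" for i using B(1) by (simp add: Dm_def)
   show "AE x in M. \<forall>j. \<exists>u\<in>\<Gamma>. f j x = \<phi> u x"
    unfolding AE_all_countable
   proof
    fix j
    have "AE x in M. (x, f j x) \<in> E" using fF[of j] by (simp add: F_def)
    thus "AE x in M. \<exists>u\<in>\<Gamma>. f j x = \<phi> u x" by eventually_elim (simp add: Eiff)
   qed
   show "AE x in M. \<forall>i<n. (x, \<phi> [(i, True)] x) \<in> ?R"
    using gen AE_space
   proof eventually_elim
    case (elim x)
    show ?case
    proof (intro allI impI)
     fix i assume "i < n"
     then obtain w where w: "fst ` set w \<subseteq> {..<n}" "ex [(i, True)] x = evw f w x" using elim(1) by blast
     thus "(x, \<phi> [(i, True)] x) \<in> ?R" using wR[OF elim(2) w(1)] elim(2) by (simp add: ex_def)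
    qed
   qed
  qed
  also have "(\<Sum>i<n. prob (Dm i)) = (\<Sum>i<n. 1 - (if i = j then prob B else 0))"
   using B(1) by (intro sum.cong refl) (simp add: Dm_def prob_compl prob_space)
  also have "... = real n - prob B" using j by (simp add: sum_subtractf)
  finally show False using B(2) by simp
 qed
qed

text \<open>The generators of the group, each with full domain, generate the orbit relation;
  induction on reduced words shows that every equivalence relation containing their graphs contains
  the orbits.\<close>

lemma cost_free_action:
 assumes sb: "standard_borel M" and pr: "prob_space M" and act: "mp_action (free_group n) M \<phi>"
  and orb: "E = orbit_relation (free_group n) M \<phi>" and E: "equiv (space M) E"
 shows "cost M E \<le> of_nat n"
proof -
 obtain U where "std_prob M U" using standard_borel_std_prob[OF sb pr] by blast
 then interpret std_prob M U .
 interpret std_action M U n \<phi> by unfold_locales (rule act)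
 have Eiff: "(x, y) \<in> E \<longleftrightarrow> x \<in> space M \<and> (\<exists>u\<in>\<Gamma>. y = \<phi> u x)" for x y
  by (auto simp: orb orbit_relation_def orbit_def)
 define A where "A i = (if i < n then space M else {})" for i
 define \<theta> where "\<theta> i = ex [(i, True)]" for i
 let ?Gr = "\<Union>i. {(y, \<theta> i y) | y. y \<in> A i}"
 have tm: "\<theta> i \<in> mpa" if "i < n" for i unfolding \<theta>_def by (rule ex_mpa[OF G_gen[OF that]])
 have im: "\<theta> i ` A i = A i" if "i < n" for i
 proof -
  have "\<theta> i ` space M = space M"
  proof
   show "\<theta> i ` space M \<subseteq> space M" using mpa_space[OF tm[OF that]] by blast
   show "space M \<subseteq> \<theta> i ` space M"
   proof
    fix x assume "x \<in> space M"
    moreover have "\<theta> i (inv (\<theta> i) x) = x" by (rule mpa_inv_apply(1)[OF tm[OF that]])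
    ultimately show "x \<in> \<theta> i ` space M" using mpa_space[OF tm[OF that], of "inv (\<theta> i) x"] by (metis imageI)
   qed
  qed
  thus ?thesis using that by (simp add: A_def)
 qed
 have iso: "borel_iso (restrict_space M (A i)) (restrict_space M (\<theta> i ` A i)) (\<theta> i)" for i
 proof (cases "i < n")
  case True
  have bij: "bij_betw (\<theta> i) (space M) (space M)"
   using im[OF True] True mpaD(2)[OF tm[OF True]] by (auto simp: bij_betw_def A_def intro: inj_on_subset)
  have "inv_into (space M) (\<theta> i) x = inv (\<theta> i) x" if x: "x \<in> space M" for x
  proof (rule inv_into_f_eq)
   show "inj_on (\<theta> i) (space M)" using bij by (simp add: bij_betw_def)
   have e: "\<theta> i (inv (\<theta> i) x) = x" by (rule mpa_inv_apply(1)[OF tm[OF True]])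
   thus "inv (\<theta> i) x \<in> space M" using x mpa_space[OF tm[OF True], of "inv (\<theta> i) x"] by simp
   show "\<theta> i (inv (\<theta> i) x) = x" by (rule e)
  qed
  hence "inv_into (space M) (\<theta> i) \<in> measurable M M"
   using mpaD(6)[OF tm[OF True]] by (subst measurable_cong) auto
  moreover have s: "sets (restrict_space M (space M)) = sets M"
   using sets.sets_into_space[of _ M] by (auto simp: sets_restrict_space_iff)
  ultimately show ?thesis using mpaD(5)[OF tm[OF True]] bij True im[OF True]
   by (simp add: borel_iso_def A_def measurable_cong_sets[OF s s] sets_eq_imp_space_eq[OF s])
 next
  case False
  have sp: "space (restrict_space M {}) = {}" by (simp add: space_restrict_space)
  show ?thesis using False sp by (simp add: borel_iso_def A_def measurable_def bij_betw_def)
 qed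
 have tE: "(x, \<theta> i x) \<in> E" if "x \<in> A i" for x i
  using that G_gen[of i True] by (auto simp: A_def Eiff \<theta>_def ex_def split: if_splits)
 have SE: "smallest_equiv (space M) ?Gr = E"
 proof
  show "smallest_equiv (space M) ?Gr \<subseteq> E" by (rule smallest_equiv_subset[OF E]) (use tE in auto)
  show "E \<subseteq> smallest_equiv (space M) ?Gr"
   unfolding smallest_equiv_def
  proof (intro Inter_greatest subsetI)
   fix R z assume "R \<in> {R. equiv (space M) R \<and> ?Gr \<subseteq> R}" and z: "z \<in> E"
   hence R: "equiv (space M) R" "?Gr \<subseteq> R" by auto
   have sR: "sym R" and tR: "trans R" using R(1) by (auto simp: equiv_def)
   have gR: "(y, \<phi> [(i, True)] y) \<in> R" if "i < n" "y \<in> space M" for i y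
   proof -
    have "(y, \<theta> i y) \<in> ?Gr" using that by (auto simp: A_def)
    hence "(y, \<theta> i y) \<in> R" using R(2) by blast
    thus ?thesis using that by (simp add: \<theta>_def ex_def)
   qed
   have "(x, \<phi> u x) \<in> R" if x: "x \<in> space M" and u: "u \<in> \<Gamma>" for x u
    using u
   proof (induction u)
    case Nil
    show ?case using phi_Nil[OF x] R(1) x by (simp add: equiv_def refl_on_def)
   next
    case (Cons a u)
    have uG: "u \<in> \<Gamma>" using Cons.prems by (auto simp: mem_G reduced_Cons)
    have an: "fst a < n" using Cons.prems by (auto simp: mem_G)
    have aG: "[a] \<in> \<Gamma>" using an by (simp add: mem_G reduced_Cons)
    have "mul [a] u = a # u" using Cons.prems by (auto simp: mem_G reduced_Cons cancel_cons_def)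
    hence e: "\<phi> (a # u) x = \<phi> [a] (\<phi> u x)" using phi_mul[OF aG uG x] by simp
    have y: "\<phi> u x \<in> space M" by (rule phi_space[OF uG x])
    have "(\<phi> u x, \<phi> [a] (\<phi> u x)) \<in> R"
    proof (cases "snd a")
     case True
     hence "a = (fst a, True)" by (simp add: prod_eq_iff)
     thus ?thesis using gR[OF an y] by metis
    next
     case False
     hence a: "ginv [a] = [(fst a, True)]" by (simp add: inv_letter_def)
     have "(\<phi> [a] (\<phi> u x), \<phi> [(fst a, True)] (\<phi> [a] (\<phi> u x))) \<in> R" by (rule gR[OF an phi_space[OF aG y]])
     also have "\<phi> [(fst a, True)] (\<phi> [a] (\<phi> u x)) = \<phi> u x" using phi_ginv[OF aG y] a by simp
     finally show ?thesis using sR by (simp add: symD)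
    qed
    thus ?case using Cons.IH[OF uG] e tR by (metis transD)
   qed
   moreover obtain x y where "z = (x, y)" by (cases z) auto
   ultimately show "z \<in> R" using z Eiff by auto
  qed
 qed
 have "generating_family M E A \<theta>"
  unfolding generating_family_def SE using iso tE im by (auto simp: A_def)
 hence "cost M E \<le> (\<Sum>i. emeasure M (A i))" unfolding cost_def by (intro Inf_lower) blast
 also have "... = (\<Sum>i<n. emeasure M (A i))" by (rule suminf_finite) (auto simp: A_def)
 also have "... = of_nat n" by (simp add: A_def emeasure_space_1)
 finally show ?thesis .
qed

theorem corollary3p3:
  fixes M :: "'a measure" and E :: "('a \<times> 'a) set"
  assumes "standard_borel M" and "prob_space M" and "non_atomic M"
    and "borel_equiv M E" and "countable_rel M E"
    and "measure_preserving_rel M E" and "ergodic_rel M E"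
  shows "(\<forall>n::nat. cost M E < of_nat n \<longrightarrow> t_full_group M E \<le> enat (2 * n)) \<and>
         (\<forall>n::nat. \<forall>\<phi>. n \<ge> 1 \<and> mp_action (free_group n) M \<phi> \<and>
            free_action (free_group n) M \<phi> \<and> E = orbit_relation (free_group n) M \<phi> \<longrightarrow>
            enat (n + 1) \<le> t_full_group M E \<and> t_full_group M E \<le> enat (2 * (n + 1)))"
proof -
 have E: "equiv (space M) E" using assms(4) by (simp add: borel_equiv_def)
 have up: "t_full_group M E \<le> enat (2 * n)" if "cost M E < of_nat n" for n
  by (rule full_group_upper_bound[OF assms(1,2,3,4,6,7) that])
 have lt: "of_nat n < (of_nat (n + 1) :: ennreal)" for n
  unfolding ennreal_of_nat_eq_real_of_nat by (rule ennreal_lessI) auto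
 show ?thesis
 proof (intro conjI allI impI)
  show "t_full_group M E \<le> enat (2 * n)" if "cost M E < of_nat n" for n by (rule up[OF that])
  fix n \<phi>
  assume h: "n \<ge> 1 \<and> mp_action (free_group n) M \<phi> \<and> free_action (free_group n) M \<phi> \<and>
   E = orbit_relation (free_group n) M \<phi>"
  show "enat (n + 1) \<le> t_full_group M E"
   using h by (intro full_group_lower_bound[OF assms(1,2,3) E]) auto
  have "cost M E \<le> of_nat n" using h by (intro cost_free_action[OF assms(1,2) _ _ E]) auto
  \<comment> \<open>The cost is at most \<open>n\<close>, and the strict bound asked for by the
    first part holds for \<open>n + 1\<close>.\<close>
  thus "t_full_group M E \<le> enat (2 * (n + 1))" using lt[of n] by (intro up) (rule order_le_less_trans)
 qed
qed

end
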